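(* Let $A=U_q(\mathfrak{gl}_2\oplus\mathfrak{gl}_{N_2}\oplus\cdots\oplus\mathfrak{gl}_{N_d})$ with $N_b>1$ for $2\le b\le d$, and let $V=V_1\oplus\cdots\oplus V_d$ be its vector representation of dimension $2+N_2+\cdots+N_d$. There exists a surjective algebra homomorphism $$\Phi\colon\mathrm{CTL}_{d,n}\to\operatorname{End}_A(V^{\otimes n}),$$ given by $t_i\mapsto\tau_i$, $s_i\mapsto\sigma_i$. It is an isomorphism if and only if $n\leq N_b$ for all $2\leq b\leq d$.
   Context: $q$ is an indeterminate, $\Bbbk=\mathbb{C}(q)$, $d\ge1$, $n\geq1$, and $\zeta\in\Bbbk$ is a primitive $d$-th root of unity. With $N_1=2$, $A\cong U_q(\mathfrak{gl}_{N_1})\boxtimes\cdots\boxtimes U_q(\mathfrak{gl}_{N_d})$ (componentwise structure) and $V_b$ is the vector representation of $U_q(\mathfrak{gl}_{N_b})$ of dimension $N_b$, the other tensor factors of $A$ acting on it through their counits; $A$ acts on $V^{\otimes n}$ via its comultiplication. The framed braid group $\mathcal{FB}_{d,n}$ has generators $s_1,\dots,s_{n-1},t_1,\dots,t_n$ and relations $s_is_j=s_js_i$ if $|i-j|>1$, $s_is_js_i=s_js_is_j$ if $|i-j|=1$, $t_i^d=1$, $t_it_j=t_jt_i$, $s_it_j=t_{s_i(j)}s_i$, where $s_i$ acts on indices as the transposition $(i,i+1)$. The Yokonuma–Hecke algebra $\mathrm{YH}_{d,n}$ is the quotient of $\Bbbk\mathcal{FB}_{d,n}$ by the relations $s_i^2=(q-q^{-1})E_is_i+1$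 ($1\le i\le n-1$), where $E_i=\frac1d\sum_{a=1}^dt_i^at_{i+1}^{-a}$. The complex Temperley–Lieb algebra $\mathrm{CTL}_{d,n}$ is the quotient of $\mathrm{YH}_{d,n}$ by the relation (imposed when $n>2$) $$\frac1{d^3}\sum_{a,b,c=1}^dt_1^at_2^bt_3^c\,\bigl(1-q^{-1}s_1-q^{-1}s_2+q^{-2}s_1s_2+q^{-2}s_2s_1-q^{-3}s_1s_2s_1\bigr)=0.$$ $\check R^{(b)}\in\operatorname{End}_{U_q(\mathfrak{gl}_{N_b})}(V_b\otimes V_b)$ is the action of the $R$-matrix (composed with the flip), normalized so that $(\check R^{(b)})^2=(q-q^{-1})\check R^{(b)}+1$, with eigenvalue $q$ on the $q$-symmetric square and $-q^{-1}$ on the $q$-antisymmetric square. On $V^{\otimes n}$: $\tau_i$ acts on the $i$-th factor by $v\mapsto\zeta^{b-1}v$ for $v\in V_b$; $\sigma_i$ acts on factors $i,i+1$ by $v\otimes w\mapsto w\otimes v$ if $v\in V_b,w\in V_c$, $b\neq c$, and by $\check R^{(b)}$ on $V_b\otimes V_b$. *)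

theory Defs
  imports
    "HOL-Algebra.QuotRing"
    "HOL-Algebra.Module"
    "HOL-Computational_Algebra.Fraction_Field"
    "HOL-Computational_Algebra.Polynomial"
    "HOL-Combinatorics.Transposition"
    Complex_Main
begin

type_synonym kq = "complex poly fract"

definition q :: kq where
  "q = Fraction_Field.Fract [:0, 1:] 1"

definition primitive_root_of_unity :: "nat \<Rightarrow> 'a::monoid_mult \<Rightarrow> bool" where
  "primitive_root_of_unity d z \<longleftrightarrow> z ^ d = 1 \<and> (\<forall>m. 0 < m \<and> m < d \<longrightarrow> z ^ m \<noteq> 1)"

definition delta :: "'i \<Rightarrow> 'i \<Rightarrow> kq" where
  "delta i = (\<lambda>j. if j = i then 1 else 0)"

text \<open>An algebra is a (not necessarily commutative) ring with a scalar multiplication, packed into the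
  record type of modules; scalars range over the whole type \<^typ>\<open>kq\<close>.\<close>

definition alg_hom :: "(kq, 'a) module \<Rightarrow> (kq, 'b) module \<Rightarrow> ('a \<Rightarrow> 'b) set" where
  "alg_hom A B = {h \<in> ring_hom A B. \<forall>c. \<forall>x\<in>carrier A. h (c \<odot>\<^bsub>A\<^esub> x) = c \<odot>\<^bsub>B\<^esub> h x}"

definition alg_iso :: "(kq, 'a) module \<Rightarrow> (kq, 'b) module \<Rightarrow> ('a \<Rightarrow> 'b) set" where
  "alg_iso A B = {h \<in> alg_hom A B. bij_betw h (carrier A) (carrier B)}"

definition monoid_algebra :: "'g monoid \<Rightarrow> (kq, 'g \<Rightarrow> kq) module" where
  "monoid_algebra M =
    \<lparr>carrier = {f. finite {x. f x \<noteq> 0} \<and> {x. f x \<noteq> 0} \<subseteq> carrier M},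
     monoid.mult = (\<lambda>f g z. \<Sum>x | f x \<noteq> 0. \<Sum>y | g y \<noteq> 0. if x \<otimes>\<^bsub>M\<^esub> y = z then f x * g y else 0),
     one = delta \<one>\<^bsub>M\<^esub>,
     zero = (\<lambda>_. 0),
     add = (\<lambda>f g x. f x + g x),
     module.smult = (\<lambda>c f x. c * f x)\<rparr>"

definition quot_map :: "(kq, 'a) module \<Rightarrow> 'a set \<Rightarrow> 'a \<Rightarrow> 'a set" where
  "quot_map A R x = (Idl\<^bsub>A\<^esub> R) +>\<^bsub>A\<^esub> x"

definition quot_alg :: "(kq, 'a) module \<Rightarrow> 'a set \<Rightarrow> (kq, 'a set) module" where
  "quot_alg A R = ring.extend (A Quot (Idl\<^bsub>A\<^esub> R))
     (module.fields (\<lambda>c X. \<Union>x\<in>X. quot_map A R (c \<odot>\<^bsub>A\<^esub> x)))"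

definition free_monoid :: "'g set \<Rightarrow> 'g list monoid" where
  "free_monoid X = \<lparr>carrier = lists X, monoid.mult = (@), one = []\<rparr>"

text \<open>A letter \<open>(x, True)\<close> stands for the generator \<open>x\<close>, a letter \<open>(x, False)\<close> for its inverse.
  A pair \<open>(u, v)\<close> of words in \<open>R\<close> is the relation \<open>u = v\<close>.\<close>

inductive pres_cong ::
  "'g set \<Rightarrow> (('g \<times> bool) list \<times> ('g \<times> bool) list) set \<Rightarrow>
   ('g \<times> bool) list \<Rightarrow> ('g \<times> bool) list \<Rightarrow> bool"
  for X R where
  refl: "w \<in> lists (X \<times> UNIV) \<Longrightarrow> pres_cong X R w w"
| sym: "pres_cong X R u v \<Longrightarrow> pres_cong X R v u"
| trans: "pres_cong X R u v \<Longrightarrow> pres_cong X R v w \<Longrightarrow> pres_cong X R u w"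
| append: "pres_cong X R u v \<Longrightarrow> pres_cong X R u' v' \<Longrightarrow> pres_cong X R (u @ u') (v @ v')"
| cancel: "x \<in> X \<Longrightarrow> pres_cong X R [(x, e), (x, \<not> e)] []"
| rel: "(u, v) \<in> R \<Longrightarrow> pres_cong X R u v"

definition pres_class ::
  "'g set \<Rightarrow> (('g \<times> bool) list \<times> ('g \<times> bool) list) set \<Rightarrow>
   ('g \<times> bool) list \<Rightarrow> ('g \<times> bool) list set" where
  "pres_class X R w = {v. pres_cong X R w v}"

definition presented_group ::
  "'g set \<Rightarrow> (('g \<times> bool) list \<times> ('g \<times> bool) list) set \<Rightarrow> ('g \<times> bool) list set monoid" where
  "presented_group X R =
    \<lparr>carrier = pres_class X R ` lists (X \<times> UNIV),
     monoid.mult = (\<lambda>A B. \<Union>u\<in>A. \<Union>v\<in>B. pres_class X R (u @ v)),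
     one = pres_class X R []\<rparr>"

datatype fb_gen = GenS nat | GenT nat

type_synonym fb_elt = "(fb_gen \<times> bool) list set"

abbreviation ws :: "nat \<Rightarrow> fb_gen \<times> bool" where "ws i \<equiv> (GenS i, True)"
abbreviation wt :: "nat \<Rightarrow> fb_gen \<times> bool" where "wt i \<equiv> (GenT i, True)"

definition fb_gens :: "nat \<Rightarrow> fb_gen set" where
  "fb_gens n = GenS ` {1..<n} \<union> GenT ` {1..n}"

definition fb_rels :: "nat \<Rightarrow> nat \<Rightarrow> ((fb_gen \<times> bool) list \<times> (fb_gen \<times> bool) list) set" where
  "fb_rels d n =
     {([ws i, ws j], [ws j, ws i]) | i j.
        i \<in> {1..<n} \<and> j \<in> {1..<n} \<and> \<bar>int i - int j\<bar> > 1}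
   \<union> {([ws i, ws j, ws i], [ws j, ws i, ws j]) | i j.
        i \<in> {1..<n} \<and> j \<in> {1..<n} \<and> \<bar>int i - int j\<bar> = 1}
   \<union> {(replicate d (wt i), []) | i. i \<in> {1..n}}
   \<union> {([wt i, wt j], [wt j, wt i]) | i j. i \<in> {1..n} \<and> j \<in> {1..n}}
   \<union> {([ws i, wt j], [wt (transpose i (i + 1) j), ws i]) | i j. i \<in> {1..<n} \<and> j \<in> {1..n}}"

definition FB :: "nat \<Rightarrow> nat \<Rightarrow> fb_elt monoid" where
  "FB d n = presented_group (fb_gens n) (fb_rels d n)"

definition FB_s :: "nat \<Rightarrow> nat \<Rightarrow> nat \<Rightarrow> fb_elt" where
  "FB_s d n i = pres_class (fb_gens n) (fb_rels d n) [ws i]"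

definition FB_t :: "nat \<Rightarrow> nat \<Rightarrow> nat \<Rightarrow> fb_elt" where
  "FB_t d n i = pres_class (fb_gens n) (fb_rels d n) [wt i]"

definition kFB :: "nat \<Rightarrow> nat \<Rightarrow> (kq, fb_elt \<Rightarrow> kq) module" where
  "kFB d n = monoid_algebra (FB d n)"

definition kFB_E :: "nat \<Rightarrow> nat \<Rightarrow> nat \<Rightarrow> fb_elt \<Rightarrow> kq" where
  "kFB_E d n i =
     (1 / of_nat d) \<odot>\<^bsub>kFB d n\<^esub>
     (\<Oplus>\<^bsub>kFB d n\<^esub>a\<in>{1..d}.
        delta (FB_t d n i [^]\<^bsub>FB d n\<^esub> int a \<otimes>\<^bsub>FB d n\<^esub> FB_t d n (i + 1) [^]\<^bsub>FB d n\<^esub> (- int a)))"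

definition YH_rels :: "nat \<Rightarrow> nat \<Rightarrow> (fb_elt \<Rightarrow> kq) set" where
  "YH_rels d n =
     {delta (FB_s d n i) \<otimes>\<^bsub>kFB d n\<^esub> delta (FB_s d n i) \<ominus>\<^bsub>kFB d n\<^esub>
        ((q - inverse q) \<odot>\<^bsub>kFB d n\<^esub> (kFB_E d n i \<otimes>\<^bsub>kFB d n\<^esub> delta (FB_s d n i))
           \<oplus>\<^bsub>kFB d n\<^esub> \<one>\<^bsub>kFB d n\<^esub>)
      | i. i \<in> {1..<n}}"

definition YH :: "nat \<Rightarrow> nat \<Rightarrow> (kq, (fb_elt \<Rightarrow> kq) set) module" where
  "YH d n = quot_alg (kFB d n) (YH_rels d n)"

definition YH_s :: "nat \<Rightarrow> nat \<Rightarrow> nat \<Rightarrow> (fb_elt \<Rightarrow> kq) set" where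
  "YH_s d n i = quot_map (kFB d n) (YH_rels d n) (delta (FB_s d n i))"

definition YH_t :: "nat \<Rightarrow> nat \<Rightarrow> nat \<Rightarrow> (fb_elt \<Rightarrow> kq) set" where
  "YH_t d n i = quot_map (kFB d n) (YH_rels d n) (delta (FB_t d n i))"

definition CTL_relator :: "nat \<Rightarrow> nat \<Rightarrow> (fb_elt \<Rightarrow> kq) set" where
  "CTL_relator d n =
    (let Y = YH d n; s1 = YH_s d n 1; s2 = YH_s d n 2;
         t1 = YH_t d n 1; t2 = YH_t d n 2; t3 = YH_t d n 3
     in ((1 / of_nat d ^ 3) \<odot>\<^bsub>Y\<^esub>
         (\<Oplus>\<^bsub>Y\<^esub>a\<in>{1..d}. \<Oplus>\<^bsub>Y\<^esub>b\<in>{1..d}. \<Oplus>\<^bsub>Y\<^esub>c\<in>{1..d}.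
            t1 [^]\<^bsub>Y\<^esub> a \<otimes>\<^bsub>Y\<^esub> t2 [^]\<^bsub>Y\<^esub> b \<otimes>\<^bsub>Y\<^esub> t3 [^]\<^bsub>Y\<^esub> c))
        \<otimes>\<^bsub>Y\<^esub>
        (\<one>\<^bsub>Y\<^esub> \<ominus>\<^bsub>Y\<^esub> inverse q \<odot>\<^bsub>Y\<^esub> s1 \<ominus>\<^bsub>Y\<^esub> inverse q \<odot>\<^bsub>Y\<^esub> s2
          \<oplus>\<^bsub>Y\<^esub> inverse q ^ 2 \<odot>\<^bsub>Y\<^esub> (s1 \<otimes>\<^bsub>Y\<^esub> s2) \<oplus>\<^bsub>Y\<^esub> inverse q ^ 2 \<odot>\<^bsub>Y\<^esub> (s2 \<otimes>\<^bsub>Y\<^esub> s1)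
          \<ominus>\<^bsub>Y\<^esub> inverse q ^ 3 \<odot>\<^bsub>Y\<^esub> (s1 \<otimes>\<^bsub>Y\<^esub> s2 \<otimes>\<^bsub>Y\<^esub> s1)))"

definition CTL_rels :: "nat \<Rightarrow> nat \<Rightarrow> (fb_elt \<Rightarrow> kq) set set" where
  "CTL_rels d n = (if n > 2 then {CTL_relator d n} else {})"

definition CTL :: "nat \<Rightarrow> nat \<Rightarrow> (kq, (fb_elt \<Rightarrow> kq) set set) module" where
  "CTL d n = quot_alg (YH d n) (CTL_rels d n)"

definition CTL_s :: "nat \<Rightarrow> nat \<Rightarrow> nat \<Rightarrow> (fb_elt \<Rightarrow> kq) set set" where
  "CTL_s d n i = quot_map (YH d n) (CTL_rels d n) (YH_s d n i)"

definition CTL_t :: "nat \<Rightarrow> nat \<Rightarrow> nat \<Rightarrow> (fb_elt \<Rightarrow> kq) set set" where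
  "CTL_t d n i = quot_map (YH d n) (CTL_rels d n) (YH_t d n i)"

text \<open>The generators \<open>E\<close>, \<open>F\<close>, \<open>K\<close>, \<open>K\<close> inverse; the first index is the block \<open>b\<close>, i.e. the summand
  \<open>gl\<close> of rank \<open>N b\<close>, and the second one is the position inside the block.\<close>

datatype qgen = QE nat nat | QF nat nat | QK nat nat | QKi nat nat

definition U_gens :: "nat \<Rightarrow> (nat \<Rightarrow> nat) \<Rightarrow> qgen set" where
  "U_gens d N =
     {QE b i | b i. b \<in> {1..d} \<and> i \<in> {1..<N b}} \<union> {QF b i | b i. b \<in> {1..d} \<and> i \<in> {1..<N b}}
   \<union> {QK b i | b i. b \<in> {1..d} \<and> i \<in> {1..N b}} \<union> {QKi b i | b i. b \<in> {1..d} \<and> i \<in> {1..N b}}"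

definition U_free :: "nat \<Rightarrow> (nat \<Rightarrow> nat) \<Rightarrow> (kq, qgen list \<Rightarrow> kq) module" where
  "U_free d N = monoid_algebra (free_monoid (U_gens d N))"

definition gl_weight :: "nat \<Rightarrow> nat \<Rightarrow> nat \<Rightarrow> nat \<Rightarrow> int" where
  "gl_weight b i c j =
     (if b = c \<and> i = j then 1 else if b = c \<and> i = j + 1 then -1 else 0)"

definition serre :: "(kq, qgen list \<Rightarrow> kq) module \<Rightarrow> qgen \<Rightarrow> qgen \<Rightarrow> qgen list \<Rightarrow> kq" where
  "serre A x y =
     delta [x, x, y] \<ominus>\<^bsub>A\<^esub> (q + inverse q) \<odot>\<^bsub>A\<^esub> delta [x, y, x] \<oplus>\<^bsub>A\<^esub> delta [y, x, x]"

text \<open>Words are the monomials of the free algebra, so \<open>delta [x, y]\<close> is the product of the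
  generators \<open>x\<close> and \<open>y\<close>.\<close>

definition U_rels :: "nat \<Rightarrow> (nat \<Rightarrow> nat) \<Rightarrow> (qgen list \<Rightarrow> kq) set" where
  "U_rels d N = (let A = U_free d N in
     {delta [QK b i, QKi b i] \<ominus>\<^bsub>A\<^esub> \<one>\<^bsub>A\<^esub> | b i. b \<in> {1..d} \<and> i \<in> {1..N b}}
   \<union> {delta [QKi b i, QK b i] \<ominus>\<^bsub>A\<^esub> \<one>\<^bsub>A\<^esub> | b i. b \<in> {1..d} \<and> i \<in> {1..N b}}
   \<union> {delta [QK b i, QK c j] \<ominus>\<^bsub>A\<^esub> delta [QK c j, QK b i] | b i c j.
        b \<in> {1..d} \<and> i \<in> {1..N b} \<and> c \<in> {1..d} \<and> j \<in> {1..N c}}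
   \<union> {delta [QK b i, QE c j] \<ominus>\<^bsub>A\<^esub> (q powi gl_weight b i c j) \<odot>\<^bsub>A\<^esub> delta [QE c j, QK b i] | b i c j.
        b \<in> {1..d} \<and> i \<in> {1..N b} \<and> c \<in> {1..d} \<and> j \<in> {1..<N c}}
   \<union> {delta [QK b i, QF c j] \<ominus>\<^bsub>A\<^esub> (q powi (- gl_weight b i c j)) \<odot>\<^bsub>A\<^esub> delta [QF c j, QK b i] | b i c j.
        b \<in> {1..d} \<and> i \<in> {1..N b} \<and> c \<in> {1..d} \<and> j \<in> {1..<N c}}
   \<union> {delta [QE b i, QF b i] \<ominus>\<^bsub>A\<^esub> delta [QF b i, QE b i] \<ominus>\<^bsub>A\<^esub>
        (1 / (q - inverse q)) \<odot>\<^bsub>A\<^esub> (delta [QK b i, QKi b (i + 1)] \<ominus>\<^bsub>A\<^esub> delta [QKi b i, QK b (i + 1)]) | b i.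
        b \<in> {1..d} \<and> i \<in> {1..<N b}}
   \<union> {delta [QE b i, QF c j] \<ominus>\<^bsub>A\<^esub> delta [QF c j, QE b i] | b i c j.
        b \<in> {1..d} \<and> i \<in> {1..<N b} \<and> c \<in> {1..d} \<and> j \<in> {1..<N c} \<and> (b, i) \<noteq> (c, j)}
   \<union> {delta [QE b i, QE c j] \<ominus>\<^bsub>A\<^esub> delta [QE c j, QE b i] | b i c j.
        b \<in> {1..d} \<and> i \<in> {1..<N b} \<and> c \<in> {1..d} \<and> j \<in> {1..<N c} \<and>
        (b \<noteq> c \<or> \<bar>int i - int j\<bar> > 1)}
   \<union> {delta [QF b i, QF c j] \<ominus>\<^bsub>A\<^esub> delta [QF c j, QF b i] | b i c j.
        b \<in> {1..d} \<and> i \<in> {1..<N b} \<and> c \<in> {1..d} \<and> j \<in> {1..<N c} \<and>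
        (b \<noteq> c \<or> \<bar>int i - int j\<bar> > 1)}
   \<union> {serre A (QE b i) (QE b j) | b i j.
        b \<in> {1..d} \<and> i \<in> {1..<N b} \<and> j \<in> {1..<N b} \<and> \<bar>int i - int j\<bar> = 1}
   \<union> {serre A (QF b i) (QF b j) | b i j.
        b \<in> {1..d} \<and> i \<in> {1..<N b} \<and> j \<in> {1..<N b} \<and> \<bar>int i - int j\<bar> = 1})"

text \<open>\<open>Uq d N\<close> is the quantum group of the direct sum of the Lie algebras \<open>gl\<close> of rank \<open>N b\<close>,
  \<open>b = 1, \<dots>, d\<close>; generators of different blocks commute, so it is the tensor product of the
  quantum groups of the blocks.\<close>

definition Uq :: "nat \<Rightarrow> (nat \<Rightarrow> nat) \<Rightarrow> (kq, (qgen list \<Rightarrow> kq) set) module" where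
  "Uq d N = quot_alg (U_free d N) (U_rels d N)"

primrec counit :: "qgen \<Rightarrow> kq" where
  "counit (QE b i) = 0"
| "counit (QF b i) = 0"
| "counit (QK b i) = 1"
| "counit (QKi b i) = 1"

text \<open>The comultiplication on generators, extended multiplicatively to words by \<open>word_op\<close> below.
  A list of pairs of words \<open>(u, v)\<close> stands for the sum of the tensors of \<open>u\<close> and \<open>v\<close>. With
  \<open>K = K\<^sub>i K\<^sub>i\<^sub>+\<^sub>1\<^sup>-\<^sup>1\<close> in block \<open>b\<close>: \<open>E \<mapsto> E \<otimes> K + 1 \<otimes> E\<close>, \<open>F \<mapsto> F \<otimes> 1 + K\<^sup>-\<^sup>1 \<otimes> F\<close>.\<close>

primrec comul :: "qgen \<Rightarrow> (qgen list \<times> qgen list) list" where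
  "comul (QE b i) = [([QE b i], [QK b i, QKi b (i + 1)]), ([], [QE b i])]"
| "comul (QF b i) = [([QF b i], []), ([QKi b i, QK b (i + 1)], [QF b i])]"
| "comul (QK b i) = [([QK b i], [QK b i])]"
| "comul (QKi b i) = [([QKi b i], [QKi b i])]"

text \<open>\<open>V\<close> has the basis of all \<open>(b, j)\<close> in \<open>V_basis d N\<close>, where the \<open>(b, j)\<close> with fixed \<open>b\<close> span the
  summand indexed by \<open>b\<close>. The \<open>n\<close>-th tensor power has as basis the lists of length \<open>n\<close> of basis
  vectors of \<open>V\<close> (pure tensors); an element is its coefficient function, zero off the basis.\<close>

type_synonym idx = "nat \<times> nat"
type_synonym tensor = "idx list \<Rightarrow> kq"

definition V_basis :: "nat \<Rightarrow> (nat \<Rightarrow> nat) \<Rightarrow> idx set" where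
  "V_basis d N = (SIGMA b:{1..d}. {1..N b})"

definition T_basis :: "nat \<Rightarrow> (nat \<Rightarrow> nat) \<Rightarrow> nat \<Rightarrow> idx list set" where
  "T_basis d N n = {m. length m = n \<and> set m \<subseteq> V_basis d N}"

definition T_space :: "nat \<Rightarrow> (nat \<Rightarrow> nat) \<Rightarrow> nat \<Rightarrow> tensor set" where
  "T_space d N n = {x. \<forall>m. m \<notin> T_basis d N n \<longrightarrow> x m = 0}"

definition lin_ext :: "'i set \<Rightarrow> ('i \<Rightarrow> 'j \<Rightarrow> kq) \<Rightarrow> ('i \<Rightarrow> kq) \<Rightarrow> 'j \<Rightarrow> kq" where
  "lin_ext B \<phi> x = (\<lambda>l. \<Sum>m\<in>B. x m * \<phi> m l)"

primrec V_gen_basis :: "qgen \<Rightarrow> idx \<Rightarrow> idx \<Rightarrow> kq" where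
  "V_gen_basis (QE b i) m = (if m = (b, i + 1) then delta (b, i) else (\<lambda>_. 0))"
| "V_gen_basis (QF b i) m = (if m = (b, i) then delta (b, i + 1) else (\<lambda>_. 0))"
| "V_gen_basis (QK b i) m = (\<lambda>l. (if m = (b, i) then q else 1) * delta m l)"
| "V_gen_basis (QKi b i) m = (\<lambda>l. (if m = (b, i) then inverse q else 1) * delta m l)"

definition word_op :: "('g \<Rightarrow> 'v \<Rightarrow> 'v) \<Rightarrow> 'g list \<Rightarrow> 'v \<Rightarrow> 'v" where
  "word_op \<rho> w = foldr (\<lambda>g f. \<rho> g \<circ> f) w id"

definition V_word :: "nat \<Rightarrow> (nat \<Rightarrow> nat) \<Rightarrow> qgen list \<Rightarrow> (idx \<Rightarrow> kq) \<Rightarrow> idx \<Rightarrow> kq" where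
  "V_word d N = word_op (\<lambda>g. lin_ext (V_basis d N) (V_gen_basis g))"

definition vec_tensor :: "(idx \<Rightarrow> kq) \<Rightarrow> tensor \<Rightarrow> tensor" where
  "vec_tensor v w = (\<lambda>l. case l of [] \<Rightarrow> 0 | a # l' \<Rightarrow> v a * w l')"

definition op_tensor ::
  "nat \<Rightarrow> (nat \<Rightarrow> nat) \<Rightarrow> nat \<Rightarrow> ((idx \<Rightarrow> kq) \<Rightarrow> idx \<Rightarrow> kq) \<Rightarrow> (tensor \<Rightarrow> tensor) \<Rightarrow> tensor \<Rightarrow> tensor" where
  "op_tensor d N n f g =
     lin_ext (T_basis d N (Suc n)) (\<lambda>m. vec_tensor (f (delta (hd m))) (g (delta (tl m))))"

primrec T_gen :: "nat \<Rightarrow> (nat \<Rightarrow> nat) \<Rightarrow> nat \<Rightarrow> qgen \<Rightarrow> tensor \<Rightarrow> tensor" where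
  "T_gen d N 0 = (\<lambda>g x l. counit g * x l)"
| "T_gen d N (Suc n) = (\<lambda>g x l.
     \<Sum>(u, v)\<leftarrow>comul g. op_tensor d N n (V_word d N u) (word_op (T_gen d N n) v) x l)"

definition T_free_act :: "nat \<Rightarrow> (nat \<Rightarrow> nat) \<Rightarrow> nat \<Rightarrow> (qgen list \<Rightarrow> kq) \<Rightarrow> tensor \<Rightarrow> tensor" where
  "T_free_act d N n a =
     (\<lambda>x\<in>T_space d N n. \<lambda>l. \<Sum>w | a w \<noteq> 0. a w * word_op (T_gen d N n) w x l)"

text \<open>Elements of \<open>Uq d N\<close> are cosets in the free algebra. The free action is constant on cosets, since
  the defining relations act as zero; \<open>the_elem\<close> picks the common value.\<close>

definition T_act :: "nat \<Rightarrow> (nat \<Rightarrow> nat) \<Rightarrow> nat \<Rightarrow> (qgen list \<Rightarrow> kq) set \<Rightarrow> tensor \<Rightarrow> tensor" where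
  "T_act d N n X = the_elem (T_free_act d N n ` X)"

definition T_End :: "nat \<Rightarrow> (nat \<Rightarrow> nat) \<Rightarrow> nat \<Rightarrow> (kq, tensor \<Rightarrow> tensor) module" where
  "T_End d N n = (let W = T_space d N n in
    \<lparr>carrier = {f \<in> W \<rightarrow>\<^sub>E W.
        (\<forall>x\<in>W. \<forall>y\<in>W. f (\<lambda>l. x l + y l) = (\<lambda>l. f x l + f y l)) \<and>
        (\<forall>c. \<forall>x\<in>W. f (\<lambda>l. c * x l) = (\<lambda>l. c * f x l))},
     monoid.mult = compose W,
     one = (\<lambda>x\<in>W. x),
     zero = (\<lambda>x\<in>W. \<lambda>_. 0),
     add = (\<lambda>f g. \<lambda>x\<in>W. \<lambda>l. f x l + g x l),
     module.smult = (\<lambda>c f. \<lambda>x\<in>W. \<lambda>l. c * f x l)\<rparr>)"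

definition End_Uq :: "nat \<Rightarrow> (nat \<Rightarrow> nat) \<Rightarrow> nat \<Rightarrow> (kq, tensor \<Rightarrow> tensor) module" where
  "End_Uq d N n = (T_End d N n)
     \<lparr>carrier := {f \<in> carrier (T_End d N n). \<forall>X\<in>carrier (Uq d N). \<forall>x\<in>T_space d N n.
        f (T_act d N n X x) = T_act d N n X (f x)}\<rparr>"

text \<open>Tensor factors are numbered from 1, list positions from 0.\<close>

definition tau :: "nat \<Rightarrow> (nat \<Rightarrow> nat) \<Rightarrow> nat \<Rightarrow> kq \<Rightarrow> nat \<Rightarrow> tensor \<Rightarrow> tensor" where
  "tau d N n \<zeta> i = restrict
     (lin_ext (T_basis d N n) (\<lambda>m l. \<zeta> ^ (fst (m ! (i - 1)) - 1) * delta m l))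
     (T_space d N n)"

definition swap_factors :: "nat \<Rightarrow> idx list \<Rightarrow> idx list" where
  "swap_factors i m = m[i - 1 := m ! i, i := m ! (i - 1)]"

text \<open>Inside one block this is Jimbo's R-matrix composed with the flip. For the comultiplication above
  the \<open>q\<close>-symmetric square is spanned by \<open>v\<^sub>j \<otimes> v\<^sub>j\<close> and \<open>v\<^sub>j \<otimes> v\<^sub>k + q v\<^sub>k \<otimes> v\<^sub>j\<close>, the
  \<open>q\<close>-antisymmetric square by \<open>v\<^sub>k \<otimes> v\<^sub>j - q v\<^sub>j \<otimes> v\<^sub>k\<close>, where \<open>j < k\<close>.\<close>

definition sigma_basis :: "nat \<Rightarrow> idx list \<Rightarrow> tensor" where
  "sigma_basis i m =
    (let (b, j) = m ! (i - 1); (c, k) = m ! i; m' = swap_factors i m in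
     if b \<noteq> c then delta m'
     else if j = k then (\<lambda>l. q * delta m l)
     else if j < k then delta m'
     else (\<lambda>l. delta m' l + (q - inverse q) * delta m l))"

definition sigma :: "nat \<Rightarrow> (nat \<Rightarrow> nat) \<Rightarrow> nat \<Rightarrow> nat \<Rightarrow> tensor \<Rightarrow> tensor" where
  "sigma d N n i = restrict (lin_ext (T_basis d N n) (sigma_basis i)) (T_space d N n)"

end

theory Submission
  imports Defs "HOL-Library.Function_Algebras" "HOL-Library.Multiset"
begin

text \<open>Surjectivity: enlarge all ranks by \<open>n\<close> and let \<open>v\<close> be a basis tensor with \<open>n\<close> distinct new entries.
  The raising and lowering operators carry \<open>v\<close> to every basis tensor of the small space with the same
  colour pattern. An endomorphism \<open>f\<close> of the small space transports \<open>v\<close> to a vector of the same weight;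
  that vector exists by a projection argument, since raising and lowering operators are adjoint to each
  other and the bilinear form is anisotropic over a real subfield. A vector of the weight of \<open>v\<close> is a
  combination of words in the braiding applied to \<open>v\<close>, and these words commute with the quantum group, so
  on each colour pattern \<open>f\<close> agrees with a combination of such words.

  Injectivity: modulo the relations, the group algebra is spanned by the products of a permutation braid
  and a colour idempotent, where only permutations without decreasing triples of colour \<open>1\<close> are needed. If
  \<open>n \<le> N b\<close> for all \<open>b \<ge> 2\<close>, they act on tensor space by a triangular system. If \<open>N b < n\<close>, then the
  \<open>q\<close>-antisymmetriser of colour \<open>b\<close> acts as zero, but it is nonzero in \<open>CTL\<close>, because it acts
  nontrivially for larger ranks.\<close>

text \<open>An endomorphism \<open>f\<close> is defined only on the small space, while the tensor
  \<open>v\<close> with distinct entries exists only in the enlarged one. So \<open>delta v\<close>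
  is split into a combination of words in the raising and lowering operators applied to small basis
  tensors, plus a remainder orthogonal to all vectors of its weight that arise in this way. On the
  first part \<open>f\<close> is applied to the small tensors and the words are kept; by adjointness
  no word gives the remainder a component in the small space. The real subfield is forced because
  sums of squares can vanish over \<open>kq\<close>.

  The number \<open>2\<close> enters twice. Three factors of a two-dimensional block carry no
  antisymmetric vector, so the relator acts as zero; and entries without a decreasing triple fall
  into two increasing sequences, which two basis vectors can tell apart. In the other colours no
  permutation is discarded, and separating all of them takes \<open>n\<close> different basis
  vectors, whence the bound. Inversions are counted within a colour only: a crossing of different
  colours squares to \<open>1\<close> and measures no progress.\<close>

hide_fact (open) pres_cong.refl pres_cong.sym pres_cong.trans pres_cong.append pres_cong.cancel
  pres_cong.rel

section \<open>Arithmetic of \<open>q\<close> in the field of rational functions\<close>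

lemma of_nat_kq_neq_0 [simp]: "(of_nat k :: kq) = 0 \<longleftrightarrow> k = 0"
  by (simp add: of_nat_fract Zero_fract_def eq_fract)

lemma q_power: "q ^ k = Fraction_Field.Fract ([:0, 1:] ^ k) 1"
  by (induction k) (auto simp: q_def One_fract_def)

lemma q_neq_0 [simp]: "q \<noteq> 0"
  by (simp add: q_def Zero_fract_def eq_fract)

lemma q_power_eq_1_iff: "q ^ k = 1 \<longleftrightarrow> k = 0"
proof
  assume "q ^ k = 1"
  then have "[:0, 1::complex:] ^ k = 1"
    by (simp add: q_power One_fract_def eq_fract)
  then have "degree ([:0, 1::complex:] ^ k) = 0" by simp
  then show "k = 0" by (simp add: degree_power_eq)
qed simp

lemma q_powi_eq_1_iff: "q powi k = 1 \<longleftrightarrow> k = 0"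
  by (auto simp: power_int_def q_power_eq_1_iff power_inverse)

text \<open>The variable has infinite multiplicative order, by degrees. Eigenvalues of the
  \<open>K\<close> operators therefore determine multiplicities, and so weights.\<close>

lemma q_powi_inj: "q powi a = q powi b \<longleftrightarrow> a = b"
proof
  assume "q powi a = q powi b"
  then have "q powi (a - b) = 1" by (simp add: power_int_diff)
  then show "a = b" by (simp add: q_powi_eq_1_iff)
qed simp

lemma q_power2_neq_1: "q * q \<noteq> 1"
  using q_power_eq_1_iff[of 2] by (simp add: power2_eq_square)

lemma q_diff_inverse_neq_0: "q - inverse q \<noteq> 0"
  using q_power2_neq_1 by (auto simp: field_simps)

lemma q_neq_inverse [simp]: "q \<noteq> inverse q"
  using q_diff_inverse_neq_0 by simp

lemma q_cancel [simp]: "q * (inverse q * x) = x" "inverse q * (q * x) = x"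
  by (simp_all add: mult.assoc[symmetric])

text \<open>Otherwise \<open>q ^ 4 = 1\<close>. This is what forces an antisymmetric vector to
  vanish at a tensor with two equal neighbours.\<close>

lemma q_add_inverse_neq_0: "q + inverse q \<noteq> 0"
proof
  assume "q + inverse q = 0"
  then have "q * q = - 1" by (auto simp: field_simps eq_neg_iff_add_eq_0)
  then have "q ^ 4 = 1" by (simp add: power4_eq_xxxx)
  then show False by (simp add: q_power_eq_1_iff)
qed

section \<open>The real subfield and its sums of squares\<close>

definition crp :: "real poly \<Rightarrow> complex poly" where
  "crp = map_poly complex_of_real"

lemma coeff_crp [simp]: "coeff (crp a) i = complex_of_real (coeff a i)"
  by (simp add: crp_def coeff_map_poly)

lemma crp_simps [simp]:
  "crp (a * b) = crp a * crp b" "crp (a + b) = crp a + crp b" "crp 0 = 0" "crp 1 = 1"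
  "crp (- a) = - crp a" "crp [:0, 1:] = [:0, 1:]"
  by (auto simp: poly_eq_iff coeff_mult coeff_pCons split: nat.split)

lemma crp_eq_0_iff [simp]: "crp a = 0 \<longleftrightarrow> a = 0"
  by (simp add: poly_eq_iff)

text \<open>A formally real subfield of \<^typ>\<open>kq\<close> containing \<^term>\<open>q\<close>; the raising and lowering operators
  have matrix entries in it, and there the standard bilinear form is anisotropic.\<close>

definition realq :: "kq set" where
  "realq = {Fraction_Field.Fract (crp a) (crp b) | a b. b \<noteq> 0}"

lemma realqE:
  assumes "x \<in> realq"
  obtains a b where "b \<noteq> 0" "x = Fraction_Field.Fract (crp a) (crp b)"
  using assms by (auto simp: realq_def)

lemma realqI: "b \<noteq> 0 \<Longrightarrow> Fraction_Field.Fract (crp a) (crp b) \<in> realq"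
  by (auto simp: realq_def)

lemma realq_0 [simp]: "0 \<in> realq"
  using realqI[of 1 0] by (simp add: Zero_fract_def)

lemma realq_1 [simp]: "1 \<in> realq"
  using realqI[of 1 1] by (simp add: One_fract_def)

lemma realq_q [simp]: "q \<in> realq"
  using realqI[of 1 "[:0, 1:]"] by (simp add: q_def)

lemma realq_mult [simp]:
  assumes "x \<in> realq" "y \<in> realq" shows "x * y \<in> realq"
proof -
  obtain a b c e where "b \<noteq> 0" "x = Fraction_Field.Fract (crp a) (crp b)"
    "e \<noteq> 0" "y = Fraction_Field.Fract (crp c) (crp e)"
    using assms by (metis realqE)
  then show ?thesis using realqI[of "b * e" "a * c"] by simp
qed

lemma realq_add [simp]:
  assumes "x \<in> realq" "y \<in> realq" shows "x + y \<in> realq"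
proof -
  obtain a b c e where "b \<noteq> 0" "x = Fraction_Field.Fract (crp a) (crp b)"
    "e \<noteq> 0" "y = Fraction_Field.Fract (crp c) (crp e)"
    using assms by (metis realqE)
  then show ?thesis using realqI[of "b * e" "a * e + c * b"] by simp
qed

lemma realq_inverse [simp]:
  assumes "x \<in> realq" shows "inverse x \<in> realq"
proof (cases "x = 0")
  case False
  obtain a b where ab: "b \<noteq> 0" "x = Fraction_Field.Fract (crp a) (crp b)"
    using assms by (metis realqE)
  with False have "a \<noteq> 0" by (auto simp: Zero_fract_def eq_fract)
  with ab show ?thesis using realqI[of a b] by simp
qed simp

lemma realq_uminus [simp]:
  assumes "x \<in> realq" shows "- x \<in> realq"
proof -
  obtain a b where ab: "b \<noteq> 0" "x = Fraction_Field.Fract (crp a) (crp b)"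
    using assms by (metis realqE)
  then show ?thesis using realqI[of b "- a"] by simp
qed

lemma realq_diff [simp]: "x \<in> realq \<Longrightarrow> y \<in> realq \<Longrightarrow> x - y \<in> realq"
  using realq_add[of x "- y"] by simp

lemma realq_divide [simp]: "x \<in> realq \<Longrightarrow> y \<in> realq \<Longrightarrow> x / y \<in> realq"
  by (simp add: divide_inverse)

lemma realq_sum [simp]: "(\<And>i. i \<in> I \<Longrightarrow> f i \<in> realq) \<Longrightarrow> sum f I \<in> realq"
  by (induction I rule: infinite_finite_induct) auto

text \<open>Clearing denominators is what turns a statement about sums of squares of rational
  functions into one about real polynomials.\<close>

lemma realq_common_denominator:
  assumes "finite I" "\<And>i. i \<in> I \<Longrightarrow> x i \<in> realq"
  shows "\<exists>b a. b \<noteq> 0 \<and> (\<forall>i\<in>I. x i = Fraction_Field.Fract (crp (a i)) (crp b))"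
  using assms
proof (induction I)
  case empty
  show ?case by (intro exI[of _ 1]) auto
next
  case (insert j I)
  then obtain b a where b: "b \<noteq> 0" "\<forall>i\<in>I. x i = Fraction_Field.Fract (crp (a i)) (crp b)" by auto
  obtain c e where c: "e \<noteq> 0" "x j = Fraction_Field.Fract (crp c) (crp e)"
    using insert.prems by (metis insertI1 realqE)
  show ?case
    by (rule exI[of _ "b * e"], rule exI[of _ "\<lambda>i. if i = j then c * b else a i * e"])
       (use b c insert.hyps in \<open>auto simp: eq_fract\<close>)
qed

text \<open>After clearing denominators this is a vanishing sum of squares in
  \<open>real poly\<close>, which is an ordered domain (by the sign of the leading coefficient), so
  every square is zero. Over all of \<open>kq\<close> it fails: take \<open>1\<close> and the
  imaginary unit.\<close>

lemma realq_sum_squares_eq_0: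
  assumes "finite I" "\<And>i. i \<in> I \<Longrightarrow> x i \<in> realq" "(\<Sum>i\<in>I. x i * x i) = 0" "i \<in> I"
  shows "x i = 0"
proof -
  obtain b a where b: "b \<noteq> 0" "\<forall>i\<in>I. x i = Fraction_Field.Fract (crp (a i)) (crp b)"
    using realq_common_denominator[of I x] assms(1,2) by metis
  define D where "D = Fraction_Field.Fract (crp b) 1"
  have D: "D \<noteq> 0" using b(1) by (simp add: D_def Zero_fract_def eq_fract)
  have x: "x i = Fraction_Field.Fract (crp (a i)) 1 * inverse D" if "i \<in> I" for i
    using that b by (simp add: D_def)
  have sum: "(\<Sum>i\<in>J. Fraction_Field.Fract (crp (u i)) 1) = Fraction_Field.Fract (crp (\<Sum>i\<in>J. u i)) 1"
    for u :: "'a \<Rightarrow> real poly" and J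
    by (induction J rule: infinite_finite_induct) (simp_all add: Zero_fract_def)
  have "x i * x i = Fraction_Field.Fract (crp (a i * a i)) 1 * (inverse D * inverse D)" if "i \<in> I" for i
    using x[OF that] by (simp del: inverse_fract)
  then have "(\<Sum>i\<in>I. x i * x i) = (\<Sum>i\<in>I. Fraction_Field.Fract (crp (a i * a i)) 1) * (inverse D * inverse D)"
    by (simp add: sum_distrib_right)
  then have "Fraction_Field.Fract (crp (\<Sum>i\<in>I. a i * a i)) 1 = 0"
    using assms(3) D by (simp only: sum) simp
  then have "crp (\<Sum>i\<in>I. a i * a i) = 0"
    by (simp add: Zero_fract_def eq_fract del: crp_simps(1) crp_simps(2))
  then have "(\<Sum>i\<in>I. a i * a i) = 0" by (simp del: crp_simps)
  then have "\<forall>i\<in>I. a i * a i = 0"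
    using assms(1) by (subst (asm) sum_nonneg_eq_0_iff) auto
  with assms(4) b show ?thesis by (auto simp: Zero_fract_def eq_fract)
qed

subsection \<open>Roots of unity\<close>

lemma sum_root_of_unity_powers:
  fixes z :: "'a :: field"
  assumes "z ^ d = 1" "z \<noteq> 1"
  shows "(\<Sum>a\<in>{1..d}. z ^ a) = 0"
proof -
  have "(\<Sum>a\<in>{1..d}. z ^ a) = (\<Sum>a<d. z ^ Suc a)"
    by (rule sum.reindex_bij_witness[of _ Suc "\<lambda>i. i - 1"]) auto
  also have "\<dots> = z * (\<Sum>a<d. z ^ a)"
    by (simp add: sum_distrib_left)
  also have "(\<Sum>a<d. z ^ a) = 0"
    using assms by (simp add: geometric_sum)
  finally show ?thesis by simp
qed

lemma primitive_root_power_inj: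
  fixes z :: "'a :: field"
  assumes z: "primitive_root_of_unity d z" and "i < d" "j < d" "z ^ i = z ^ j"
  shows "i = j"
proof -
  have "i' = j'" if "i' \<le> j'" "j' < d" "z ^ i' = z ^ j'" for i' j'
  proof (rule ccontr)
    assume ne: "i' \<noteq> j'"
    have "z \<noteq> 0"
    proof
      assume "z = 0"
      with z that show False by (auto simp: primitive_root_of_unity_def power_0_left split: if_splits)
    qed
    moreover have "z ^ j' = z ^ i' * z ^ (j' - i')" using that by (metis le_add_diff_inverse power_add)
    ultimately have "z ^ (j' - i') = 1" using that by simp
    with z ne that show False by (auto simp: primitive_root_of_unity_def)
  qed
  from this[of i j] this[of j i] assms show ?thesis by (cases "i \<le> j") auto
qed

lemma primitive_root_neq_0:
  fixes z :: "'a :: field"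
  assumes "primitive_root_of_unity d z" "d \<ge> 1"
  shows "z \<noteq> 0"
  using assms by (auto simp: primitive_root_of_unity_def power_0_left split: if_splits)

text \<open>Orthogonality of the characters of the cyclic group of order \<open>d\<close>. It
  evaluates the elements \<open>E_i\<close> and the colour projectors; a colour \<open>b\<close>
  enters through the exponent \<open>b - 1 < d\<close>, so different colours have different
  eigenvalues.\<close>

lemma root_average:
  fixes z w :: kq
  assumes z: "primitive_root_of_unity d z" and d: "d \<ge> 1" and ij: "i < d" "j < d"
  shows "1 / of_nat d * (\<Sum>a\<in>{1..d}. (z ^ i * inverse (z ^ j)) ^ a) = (if i = j then 1 else 0)"
proof (cases "i = j")
  case True
  with d primitive_root_neq_0[OF z d] show ?thesis by simp
next
  case False
  have "(z ^ k) ^ d = 1" for k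
    using z by (metis primitive_root_of_unity_def power_mult mult.commute power_one)
  then have "(z ^ i * inverse (z ^ j)) ^ d = 1"
    by (simp only: power_mult_distrib power_inverse) simp
  moreover have "z ^ i * inverse (z ^ j) \<noteq> 1"
  proof
    assume "z ^ i * inverse (z ^ j) = 1"
    then have "z ^ i = z ^ j" using primitive_root_neq_0[OF z d] by (simp add: divide_inverse[symmetric])
    with primitive_root_power_inj[OF z ij] False show False by simp
  qed
  ultimately have "(\<Sum>a\<in>{1..d}. (z ^ i * inverse (z ^ j)) ^ a) = 0"
    by (rule sum_root_of_unity_powers)
  then show ?thesis using False by (simp only: mult_zero_right if_False)
qed

section \<open>Algebras over \<open>kq\<close> and their homomorphisms\<close>

locale kalg = ring A for A :: "(kq, 'a) module" (structure) +
  assumes smult_closed [simp, intro]: "x \<in> carrier A \<Longrightarrow> c \<odot> x \<in> carrier A"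
    and smult_add_right: "x \<in> carrier A \<Longrightarrow> y \<in> carrier A \<Longrightarrow> c \<odot> (x \<oplus> y) = c \<odot> x \<oplus> c \<odot> y"
    and smult_add_left: "x \<in> carrier A \<Longrightarrow> (b + c) \<odot> x = b \<odot> x \<oplus> c \<odot> x"
    and smult_smult: "x \<in> carrier A \<Longrightarrow> b \<odot> (c \<odot> x) = (b * c) \<odot> x"
    and smult_one [simp]: "x \<in> carrier A \<Longrightarrow> 1 \<odot> x = x"
    and smult_mult_left: "x \<in> carrier A \<Longrightarrow> y \<in> carrier A \<Longrightarrow> (c \<odot> x) \<otimes> y = c \<odot> (x \<otimes> y)"
    and smult_mult_right: "x \<in> carrier A \<Longrightarrow> y \<in> carrier A \<Longrightarrow> x \<otimes> (c \<odot> y) = c \<odot> (x \<otimes> y)"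

lemma alg_homD:
  assumes "h \<in> alg_hom A B"
  shows "h \<in> ring_hom A B" "x \<in> carrier A \<Longrightarrow> h (c \<odot>\<^bsub>A\<^esub> x) = c \<odot>\<^bsub>B\<^esub> h x"
    "x \<in> carrier A \<Longrightarrow> h x \<in> carrier B"
    "x \<in> carrier A \<Longrightarrow> y \<in> carrier A \<Longrightarrow> h (x \<otimes>\<^bsub>A\<^esub> y) = h x \<otimes>\<^bsub>B\<^esub> h y"
    "x \<in> carrier A \<Longrightarrow> y \<in> carrier A \<Longrightarrow> h (x \<oplus>\<^bsub>A\<^esub> y) = h x \<oplus>\<^bsub>B\<^esub> h y"
    "h \<one>\<^bsub>A\<^esub> = \<one>\<^bsub>B\<^esub>"
  using assms unfolding alg_hom_def by (auto simp: ring_hom_def)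

lemma alg_homI:
  assumes "\<And>x. x \<in> carrier A \<Longrightarrow> h x \<in> carrier B"
    "\<And>x y. x \<in> carrier A \<Longrightarrow> y \<in> carrier A \<Longrightarrow> h (x \<otimes>\<^bsub>A\<^esub> y) = h x \<otimes>\<^bsub>B\<^esub> h y"
    "\<And>x y. x \<in> carrier A \<Longrightarrow> y \<in> carrier A \<Longrightarrow> h (x \<oplus>\<^bsub>A\<^esub> y) = h x \<oplus>\<^bsub>B\<^esub> h y"
    "h \<one>\<^bsub>A\<^esub> = \<one>\<^bsub>B\<^esub>"
    "\<And>c x. x \<in> carrier A \<Longrightarrow> h (c \<odot>\<^bsub>A\<^esub> x) = c \<odot>\<^bsub>B\<^esub> h x"
  shows "h \<in> alg_hom A B"
  using assms unfolding alg_hom_def ring_hom_def by auto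

lemma alg_hom_comp: "h \<in> alg_hom A B \<Longrightarrow> k \<in> alg_hom B C \<Longrightarrow> (\<lambda>x. k (h x)) \<in> alg_hom A C"
  by (rule alg_homI) (auto simp: alg_homD)

lemma alg_hom_ring_hom_ring: "kalg A \<Longrightarrow> kalg B \<Longrightarrow> h \<in> alg_hom A B \<Longrightarrow> ring_hom_ring A B h"
  by (intro ring_hom_ringI2 alg_homD(1)) (auto simp: kalg_def)

lemma alg_hom_minus:
  assumes "kalg A" "kalg B" "h \<in> alg_hom A B" "x \<in> carrier A" "y \<in> carrier A"
  shows "h (x \<ominus>\<^bsub>A\<^esub> y) = h x \<ominus>\<^bsub>B\<^esub> h y"
proof -
  interpret ring_hom_ring A B h using assms by (intro alg_hom_ring_hom_ring)
  show ?thesis using assms(4,5) by (simp add: a_minus_def)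
qed

lemma alg_hom_zero: "kalg A \<Longrightarrow> kalg B \<Longrightarrow> h \<in> alg_hom A B \<Longrightarrow> h \<zero>\<^bsub>A\<^esub> = \<zero>\<^bsub>B\<^esub>"
  using alg_hom_ring_hom_ring ring_hom_ring.homh ring_hom_zero kalg_def by metis

lemma alg_hom_finsum:
  assumes "kalg A" "kalg B" "h \<in> alg_hom A B" "f \<in> I \<rightarrow> carrier A"
  shows "h (finsum A f I) = finsum B (\<lambda>i. h (f i)) I"
proof -
  interpret ring_hom_ring A B h using assms by (intro alg_hom_ring_hom_ring)
  show ?thesis using assms(4)
  proof (induction I rule: infinite_finite_induct)
    case (insert i I)
    then have "f \<in> I \<rightarrow> carrier A" "(\<lambda>i. h (f i)) \<in> I \<rightarrow> carrier B" by (auto simp: Pi_iff)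
    with insert show ?case by (simp add: R.finsum_insert S.finsum_insert)
  qed auto
qed

subsection \<open>Quotient algebras\<close>

lemma quot_alg_simps [simp]:
  "carrier (quot_alg A R) = carrier (A Quot (Idl\<^bsub>A\<^esub> R))"
  "monoid.mult (quot_alg A R) = monoid.mult (A Quot (Idl\<^bsub>A\<^esub> R))"
  "one (quot_alg A R) = one (A Quot (Idl\<^bsub>A\<^esub> R))"
  "zero (quot_alg A R) = zero (A Quot (Idl\<^bsub>A\<^esub> R))"
  "add (quot_alg A R) = add (A Quot (Idl\<^bsub>A\<^esub> R))"
  "module.smult (quot_alg A R) = (\<lambda>c X. \<Union>x\<in>X. quot_map A R (c \<odot>\<^bsub>A\<^esub> x))"
  by (simp_all add: quot_alg_def ring.defs module.defs)

context kalg
begin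

text \<open>A scalar acts as multiplication by \<open>c \<odot> \<one>\<close>, so ring ideals are
  automatically subspaces. This makes the scalar multiplication of \<open>quot_alg\<close> well
  defined.\<close>

lemma ideal_smult_closed:
  assumes "ideal I A" "x \<in> I" shows "c \<odot> x \<in> I"
proof -
  interpret I: ideal I A by fact
  have x: "x \<in> carrier A" using assms by auto
  have "c \<odot> x = (c \<odot> \<one>) \<otimes> x" using x by (simp add: smult_mult_left)
  also have "\<dots> \<in> I" using assms(2) by (intro I.I_l_closed) auto
  finally show ?thesis .
qed

lemma kernel_ideal:
  assumes "kalg B" "h \<in> alg_hom A B"
  shows "ideal (a_kernel A B h) A"
  using alg_hom_ring_hom_ring[OF kalg_axioms assms] by (rule ring_hom_ring.kernel_is_ideal)

context
  fixes R assumes R: "R \<subseteq> carrier A"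
begin

lemma ideal_Idl: "ideal (Idl R) A"
  using R by (rule genideal_ideal)

lemma quot_map_closed: "x \<in> carrier A \<Longrightarrow> quot_map A R x \<in> carrier (quot_alg A R)"
  by (auto simp: quot_map_def FactRing_def A_RCOSETS_def')

lemma quot_carrier: "carrier (quot_alg A R) = quot_map A R ` carrier A"
  by (auto simp: quot_map_def FactRing_def A_RCOSETS_def')

lemma quot_map_add:
  "x \<in> carrier A \<Longrightarrow> y \<in> carrier A \<Longrightarrow>
    quot_map A R (x \<oplus> y) = quot_map A R x \<oplus>\<^bsub>quot_alg A R\<^esub> quot_map A R y"
  using ring_hom_add[OF ideal.rcos_ring_hom[OF ideal_Idl]] by (simp add: quot_map_def)

lemma quot_map_mult:
  "x \<in> carrier A \<Longrightarrow> y \<in> carrier A \<Longrightarrow>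
    quot_map A R (x \<otimes> y) = quot_map A R x \<otimes>\<^bsub>quot_alg A R\<^esub> quot_map A R y"
  using ring_hom_mult[OF ideal.rcos_ring_hom[OF ideal_Idl]] by (simp add: quot_map_def)

lemma quot_map_one: "quot_map A R \<one> = \<one>\<^bsub>quot_alg A R\<^esub>"
  using ring_hom_one[OF ideal.rcos_ring_hom[OF ideal_Idl]] by (simp add: quot_map_def)

lemma quot_map_eqI:
  assumes "x \<in> carrier A" "y \<in> quot_map A R x" shows "quot_map A R y = quot_map A R x"
proof -
  interpret I: ideal "Idl R" A by (rule ideal_Idl)
  show ?thesis using assms a_repr_independence[OF _ assms(1), of y "Idl R"] I.a_subgroup
    by (simp add: quot_map_def)
qed

text \<open>The union in \<open>quot_alg\<close> runs over all representatives; by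
  \<open>ideal_smult_closed\<close> they all give the same coset, so the union collapses to
  it.\<close>

lemma smult_quot_map:
  assumes "x \<in> carrier A"
  shows "c \<odot>\<^bsub>quot_alg A R\<^esub> quot_map A R x = quot_map A R (c \<odot> x)"
proof -
  interpret I: ideal "Idl R" A by (rule ideal_Idl)
  have "quot_map A R (c \<odot> y) = quot_map A R (c \<odot> x)" if "y \<in> quot_map A R x" for y
  proof -
    from that obtain i where i: "i \<in> Idl R" "y = i \<oplus> x"
      by (auto simp: quot_map_def a_r_coset_def')
    then have "c \<odot> y = c \<odot> i \<oplus> c \<odot> x" using assms I.Icarr by (simp add: smult_add_right)
    moreover have "c \<odot> i \<in> Idl R" using ideal_smult_closed[OF ideal_Idl i(1)] .
    ultimately have "c \<odot> y \<in> quot_map A R (c \<odot> x)"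
      by (auto simp: quot_map_def a_r_coset_def')
    then show ?thesis using assms by (intro quot_map_eqI) auto
  qed
  then have "(\<Union>y\<in>quot_map A R x. quot_map A R (c \<odot> y)) = (\<Union>y\<in>quot_map A R x. quot_map A R (c \<odot> x))"
    by (rule SUP_cong[OF refl])
  also have "\<dots> = quot_map A R (c \<odot> x)"
    using I.a_rcos_self[OF assms] unfolding quot_map_def by blast
  finally show ?thesis by simp
qed

lemma kalg_quot_alg: "kalg (quot_alg A R)"
proof -
  interpret I: ideal "Idl R" A by (rule ideal_Idl)
  interpret Q: ring "A Quot (Idl R)" by (rule I.quotient_is_ring)
  have "ring (quot_alg A R)"
  proof (intro ringI abelian_groupI monoidI, goal_cases)
    case (3 x y z) then show ?case by (simp add: Q.a_assoc)
  next
    case (4 x y) then show ?case by (simp add: Q.a_comm)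
  next
    case (6 x) then show ?case by (auto intro: Q.l_neg)
  next
    case (9 x y z) then show ?case by (simp add: Q.m_assoc)
  next
    case (12 x y z) then show ?case by (simp add: Q.l_distr)
  next
    case (13 x y z) then show ?case by (simp add: Q.r_distr)
  qed simp_all
  moreover have "kalg_axioms (quot_alg A R)"
  proof (unfold_locales, goal_cases)
    case (1 x c) then show ?case
      unfolding quot_carrier by (auto simp: smult_quot_map simp del: quot_alg_simps)
  next
    case (2 x y c) then show ?case
      unfolding quot_carrier
      by (auto simp: smult_quot_map smult_add_right simp flip: quot_map_add simp del: quot_alg_simps)
  next
    case (3 x b c) then show ?case
      unfolding quot_carrier
      by (auto simp: smult_quot_map smult_add_left simp flip: quot_map_add simp del: quot_alg_simps)
  next
    case (4 x b c) then show ?case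
      unfolding quot_carrier by (auto simp: smult_quot_map smult_smult simp del: quot_alg_simps)
  next
    case (5 x) then show ?case
      unfolding quot_carrier by (auto simp: smult_quot_map simp del: quot_alg_simps)
  next
    case (6 x y c) then show ?case
      unfolding quot_carrier
      by (auto simp: smult_quot_map smult_mult_left simp flip: quot_map_mult simp del: quot_alg_simps)
  next
    case (7 x y c) then show ?case
      unfolding quot_carrier
      by (auto simp: smult_quot_map smult_mult_right simp flip: quot_map_mult simp del: quot_alg_simps)
  qed
  ultimately show ?thesis by (rule kalg.intro)
qed

lemma quot_map_alg_hom: "quot_map A R \<in> alg_hom A (quot_alg A R)"
  by (intro alg_homI quot_map_closed quot_map_mult quot_map_add quot_map_one smult_quot_map[symmetric])

lemma quot_map_rel: "r \<in> R \<Longrightarrow> quot_map A R r = \<zero>\<^bsub>quot_alg A R\<^esub>"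
  using genideal_self[OF R] abelian_subgroup.a_rcos_const[of "Idl R" A r]
    abelian_subgroupI3[OF ideal.axioms(1)[OF ideal_Idl] is_abelian_group]
  by (auto simp: quot_map_def FactRing_def)

context
  fixes B :: "(kq, 'b) module" and h
  assumes B: "kalg B" and h: "h \<in> alg_hom A B" and hR: "\<And>r. r \<in> R \<Longrightarrow> h r = \<zero>\<^bsub>B\<^esub>"
begin

text \<open>A homomorphism that kills the relations kills the ideal they generate and so takes a
  single value on each coset. Hence \<open>the_elem\<close> of the image is the induced map on the
  quotient.\<close>

lemma quot_image:
  assumes "x \<in> carrier A" shows "h ` quot_map A R x = {h x}"
proof -
  interpret I: ideal "Idl R" A by (rule ideal_Idl)
  interpret B: kalg B by (rule B)
  have "Idl R \<subseteq> a_kernel A B h"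
    using R hR by (intro genideal_minimal kernel_ideal[OF B h]) (auto simp: a_kernel_def')
  then have "h (i \<oplus> x) = h x" if "i \<in> Idl R" for i
    using that assms I.Icarr[of i] h by (auto simp: a_kernel_def' alg_homD)
  moreover have "x \<in> quot_map A R x"
    using I.a_rcos_self[OF assms] unfolding quot_map_def .
  ultimately show ?thesis by (auto simp: quot_map_def a_r_coset_def')
qed

lemma quot_lift_apply: "x \<in> carrier A \<Longrightarrow> the_elem (h ` quot_map A R x) = h x"
  by (simp add: quot_image)

lemma quot_lift_alg_hom: "(\<lambda>X. the_elem (h ` X)) \<in> alg_hom (quot_alg A R) B"
proof (rule alg_homI, unfold quot_carrier, goal_cases)
  case (1 x) then show ?case using h by (auto simp: quot_lift_apply alg_homD)
next
  case (2 x y)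
  then obtain a b where "x = quot_map A R a" "y = quot_map A R b" "a \<in> carrier A" "b \<in> carrier A" by auto
  then show ?case using h
    by (simp add: quot_lift_apply alg_homD flip: quot_map_mult del: quot_alg_simps)
next
  case (3 x y)
  then obtain a b where "x = quot_map A R a" "y = quot_map A R b" "a \<in> carrier A" "b \<in> carrier A" by auto
  then show ?case using h
    by (simp add: quot_lift_apply alg_homD flip: quot_map_add del: quot_alg_simps)
next
  case 4 then show ?case using h
    by (simp add: quot_lift_apply alg_homD flip: quot_map_one del: quot_alg_simps)
next
  case (5 c x)
  then obtain a where "x = quot_map A R a" "a \<in> carrier A" by auto
  then show ?case using h
    by (simp add: quot_lift_apply alg_homD smult_quot_map del: quot_alg_simps)
qed

end
end
end

subsection \<open>Monoid algebras\<close>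

lemma monoid_algebra_simps [simp]:
  "carrier (monoid_algebra M) = {f. finite {x. f x \<noteq> 0} \<and> {x. f x \<noteq> 0} \<subseteq> carrier M}"
  "one (monoid_algebra M) = delta \<one>\<^bsub>M\<^esub>"
  "zero (monoid_algebra M) = (\<lambda>_. 0)"
  "f \<oplus>\<^bsub>monoid_algebra M\<^esub> g = (\<lambda>x. f x + g x)"
  "c \<odot>\<^bsub>monoid_algebra M\<^esub> f = (\<lambda>x. c * f x)"
  by (simp_all add: monoid_algebra_def)

lemma delta_same [simp]: "delta i i = 1" and delta_eq_0_iff [simp]: "delta i j = 0 \<longleftrightarrow> j \<noteq> i"
  by (simp_all add: delta_def)

lemma support_delta [simp]: "{x. delta i x \<noteq> 0} = {i}"
  by auto

lemma sum_delta_mult: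
  assumes "finite U" "k \<in> U" shows "(\<Sum>u\<in>U. delta k u * G u) = G k"
proof -
  have "(\<Sum>u\<in>U. delta k u * G u) = (\<Sum>u\<in>{k}. delta k u * G u)"
    using assms by (intro sum.mono_neutral_right) auto
  then show ?thesis by simp
qed

lemma monoid_algebra_mult_eq:
  assumes "finite F" "finite G" "{x. f x \<noteq> 0} \<subseteq> F" "{x. g x \<noteq> 0} \<subseteq> G"
  shows "(f \<otimes>\<^bsub>monoid_algebra M\<^esub> g) z = (\<Sum>x\<in>F. \<Sum>y\<in>G. f x * g y * delta (x \<otimes>\<^bsub>M\<^esub> y) z)"
proof -
  have "(f \<otimes>\<^bsub>monoid_algebra M\<^esub> g) z
      = (\<Sum>x | f x \<noteq> 0. \<Sum>y | g y \<noteq> 0. f x * g y * delta (x \<otimes>\<^bsub>M\<^esub> y) z)"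
    unfolding monoid_algebra_def by (auto intro!: sum.cong simp: delta_def)
  also have "\<dots> = (\<Sum>x | f x \<noteq> 0. \<Sum>y\<in>G. f x * g y * delta (x \<otimes>\<^bsub>M\<^esub> y) z)"
    using assms by (intro sum.cong refl sum.mono_neutral_left) auto
  also have "\<dots> = (\<Sum>x\<in>F. \<Sum>y\<in>G. f x * g y * delta (x \<otimes>\<^bsub>M\<^esub> y) z)"
    using assms by (intro sum.mono_neutral_left) auto
  finally show ?thesis .
qed

lemma monoid_algebra_mult_support:
  "{z. (f \<otimes>\<^bsub>monoid_algebra M\<^esub> g) z \<noteq> 0}
     \<subseteq> (\<lambda>(x, y). x \<otimes>\<^bsub>M\<^esub> y) ` ({x. f x \<noteq> 0} \<times> {x. g x \<noteq> 0})"
proof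
  fix z assume "z \<in> {z. (f \<otimes>\<^bsub>monoid_algebra M\<^esub> g) z \<noteq> 0}"
  then have "(\<Sum>x | f x \<noteq> 0. \<Sum>y | g y \<noteq> 0. if x \<otimes>\<^bsub>M\<^esub> y = z then f x * g y else 0) \<noteq> 0"
    by (simp add: monoid_algebra_def)
  from sum.not_neutral_contains_not_neutral[OF this]
  obtain x where x: "f x \<noteq> 0" "(\<Sum>y | g y \<noteq> 0. if x \<otimes>\<^bsub>M\<^esub> y = z then f x * g y else 0) \<noteq> 0"
    by auto
  obtain y where "g y \<noteq> 0" "(if x \<otimes>\<^bsub>M\<^esub> y = z then f x * g y else 0) \<noteq> 0"
    using sum.not_neutral_contains_not_neutral[OF x(2)] by auto
  then have "(x, y) \<in> {x. f x \<noteq> 0} \<times> {x. g x \<noteq> 0}" "z = x \<otimes>\<^bsub>M\<^esub> y"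
    using x(1) by (auto split: if_splits)
  then show "z \<in> (\<lambda>(x, y). x \<otimes>\<^bsub>M\<^esub> y) ` ({x. f x \<noteq> 0} \<times> {x. g x \<noteq> 0})"
    by (intro image_eqI[of _ _ "(x, y)"]) auto
qed

lemma support_finite_Un: "finite {x. f x \<noteq> 0} \<Longrightarrow> finite {x. g x \<noteq> (0::kq)} \<Longrightarrow> finite {x. f x + g x \<noteq> 0}"
  by (rule finite_subset[of _ "{x. f x \<noteq> 0} \<union> {x. g x \<noteq> 0}"]) auto

text \<open>A function \<open>G\<close> on the monoid extends to a linear functional, here evaluated
  on a product. Associativity of the monoid algebra and multiplicativity of linearly extended
  representations are both instances.\<close>

lemma monoid_algebra_linear_sum:
  fixes G :: "'g \<Rightarrow> kq"
  assumes f: "finite {x. f x \<noteq> 0}" and g: "finite {x. g x \<noteq> 0}"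
  shows "(\<Sum>u | (f \<otimes>\<^bsub>monoid_algebra M\<^esub> g) u \<noteq> 0. (f \<otimes>\<^bsub>monoid_algebra M\<^esub> g) u * G u)
    = (\<Sum>x | f x \<noteq> 0. \<Sum>y | g y \<noteq> 0. f x * g y * G (x \<otimes>\<^bsub>M\<^esub> y))"
proof -
  define U where "U = (\<lambda>(x, y). x \<otimes>\<^bsub>M\<^esub> y) ` ({x. f x \<noteq> 0} \<times> {x. g x \<noteq> 0})"
  have U: "finite U" using f g by (simp add: U_def)
  have "(\<Sum>u | (f \<otimes>\<^bsub>monoid_algebra M\<^esub> g) u \<noteq> 0. (f \<otimes>\<^bsub>monoid_algebra M\<^esub> g) u * G u)
      = (\<Sum>u\<in>U. (f \<otimes>\<^bsub>monoid_algebra M\<^esub> g) u * G u)"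
    using monoid_algebra_mult_support[where ?f = f and ?g = g] U
    by (intro sum.mono_neutral_left) (auto simp: U_def)
  also have "\<dots> = (\<Sum>u\<in>U. \<Sum>x | f x \<noteq> 0. \<Sum>y | g y \<noteq> 0. f x * g y * (delta (x \<otimes>\<^bsub>M\<^esub> y) u * G u))"
    using f g by (intro sum.cong refl) (simp only: monoid_algebra_mult_eq[OF f g subset_refl subset_refl]
        sum_distrib_right mult.assoc)
  also have "\<dots> = (\<Sum>x | f x \<noteq> 0. \<Sum>u\<in>U. \<Sum>y | g y \<noteq> 0. f x * g y * (delta (x \<otimes>\<^bsub>M\<^esub> y) u * G u))"
    by (rule sum.swap)
  also have "\<dots> = (\<Sum>x | f x \<noteq> 0. \<Sum>y | g y \<noteq> 0. \<Sum>u\<in>U. f x * g y * (delta (x \<otimes>\<^bsub>M\<^esub> y) u * G u))"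
    by (intro sum.cong refl sum.swap)
  also have "\<dots> = (\<Sum>x | f x \<noteq> 0. \<Sum>y | g y \<noteq> 0. f x * g y * G (x \<otimes>\<^bsub>M\<^esub> y))"
  proof (intro sum.cong refl)
    fix x y assume "x \<in> {x. f x \<noteq> 0}" "y \<in> {y. g y \<noteq> 0}"
    then have "x \<otimes>\<^bsub>M\<^esub> y \<in> U" by (auto simp: U_def)
    with U show "(\<Sum>u\<in>U. f x * g y * (delta (x \<otimes>\<^bsub>M\<^esub> y) u * G u)) = f x * g y * G (x \<otimes>\<^bsub>M\<^esub> y)"
      by (simp add: sum_delta_mult flip: sum_distrib_left)
  qed
  finally show ?thesis .
qed

lemma kalg_monoid_algebra:
  assumes "monoid M" shows "kalg (monoid_algebra M)"
proof -
  interpret M: monoid M by fact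
  let ?A = "monoid_algebra M"
  have closed: "f \<otimes>\<^bsub>?A\<^esub> g \<in> carrier ?A" if "f \<in> carrier ?A" "g \<in> carrier ?A" for f g
  proof -
    have "(\<lambda>(x, y). x \<otimes>\<^bsub>M\<^esub> y) ` ({x. f x \<noteq> 0} \<times> {x. g x \<noteq> 0}) \<subseteq> carrier M"
      using that by (auto simp: subset_iff)
    with monoid_algebra_mult_support[of M f g] that show ?thesis
      by (auto intro: finite_subset)
  qed
  have eq: "(f \<otimes>\<^bsub>?A\<^esub> g) z = (\<Sum>x | f x \<noteq> 0. f x * (\<Sum>y | g y \<noteq> 0. g y * delta (x \<otimes>\<^bsub>M\<^esub> y) z))"
    if "finite {x. f x \<noteq> 0}" "finite {x. g x \<noteq> 0}" for f g z
    using that by (simp add: monoid_algebra_mult_eq[OF that subset_refl subset_refl] sum_distrib_left mult.assoc)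
  have eq2: "(f \<otimes>\<^bsub>?A\<^esub> g) z = (\<Sum>y | g y \<noteq> 0. g y * (\<Sum>x | f x \<noteq> 0. f x * delta (x \<otimes>\<^bsub>M\<^esub> y) z))"
    if "finite {x. f x \<noteq> 0}" "finite {x. g x \<noteq> 0}" for f g z
    by (subst eq[OF that], subst sum_distrib_left, subst sum.swap)
       (simp add: sum_distrib_left mult_ac)
  have assoc: "(f \<otimes>\<^bsub>?A\<^esub> g) \<otimes>\<^bsub>?A\<^esub> h = f \<otimes>\<^bsub>?A\<^esub> (g \<otimes>\<^bsub>?A\<^esub> h)"
    if c: "f \<in> carrier ?A" "g \<in> carrier ?A" "h \<in> carrier ?A" for f g h
  proof
    fix z
    have fin: "finite {x. f x \<noteq> 0}" "finite {x. g x \<noteq> 0}" "finite {x. h x \<noteq> 0}"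
      "finite {x. (f \<otimes>\<^bsub>?A\<^esub> g) x \<noteq> 0}" "finite {x. (g \<otimes>\<^bsub>?A\<^esub> h) x \<noteq> 0}"
      using c closed[OF c(1,2)] closed[OF c(2,3)] by auto
    have "((f \<otimes>\<^bsub>?A\<^esub> g) \<otimes>\<^bsub>?A\<^esub> h) z = (\<Sum>x | f x \<noteq> 0. \<Sum>y | g y \<noteq> 0. f x * g y *
        (\<Sum>w | h w \<noteq> 0. h w * delta (x \<otimes>\<^bsub>M\<^esub> y \<otimes>\<^bsub>M\<^esub> w) z))"
      by (simp only: eq[OF fin(4,3)] monoid_algebra_linear_sum[OF fin(1,2)])
    also have "\<dots> = (\<Sum>x | f x \<noteq> 0. \<Sum>y | g y \<noteq> 0. \<Sum>w | h w \<noteq> 0.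
        f x * (g y * h w * delta (x \<otimes>\<^bsub>M\<^esub> (y \<otimes>\<^bsub>M\<^esub> w)) z))"
      using c by (intro sum.cong refl) (auto simp: sum_distrib_left mult_ac M.m_assoc subset_iff intro!: sum.cong)
    also have "\<dots> = (f \<otimes>\<^bsub>?A\<^esub> (g \<otimes>\<^bsub>?A\<^esub> h)) z"
      by (simp only: eq[OF fin(1,5)] monoid_algebra_linear_sum[OF fin(2,3)]) (simp add: sum_distrib_left)
    finally show "((f \<otimes>\<^bsub>?A\<^esub> g) \<otimes>\<^bsub>?A\<^esub> h) z = (f \<otimes>\<^bsub>?A\<^esub> (g \<otimes>\<^bsub>?A\<^esub> h)) z" .
  qed
  have F: "(\<Sum>x | f x \<noteq> 0. f x * G x) = (\<Sum>x\<in>U. f x * G x)" if "finite U" "{x. f x \<noteq> 0} \<subseteq> U"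
    for f G :: "'a \<Rightarrow> kq" and U
    using that by (intro sum.mono_neutral_left) auto
  \<comment> \<open>Values may cancel, so the support of a sum can be smaller than the union of the
    supports; all sums are compared on that union.\<close>
  have FU: "(\<Sum>x | f x + g x \<noteq> 0. (f x + g x) * G x)
      = (\<Sum>x | f x \<noteq> 0. f x * G x) + (\<Sum>x | g x \<noteq> 0. g x * G x)"
    if fg: "finite {x. f x \<noteq> 0}" "finite {x. g x \<noteq> 0}" for f g G :: "'a \<Rightarrow> kq"
  proof -
    let ?U = "{x. f x \<noteq> 0} \<union> {x. g x \<noteq> 0}"
    have U: "finite ?U" using fg by simp
    have "(\<Sum>x | f x + g x \<noteq> 0. (f x + g x) * G x) = (\<Sum>x\<in>?U. (f x + g x) * G x)"
      by (rule F[OF U]) auto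
    also have "\<dots> = (\<Sum>x\<in>?U. f x * G x) + (\<Sum>x\<in>?U. g x * G x)"
      by (simp add: distrib_right sum.distrib)
    also have "(\<Sum>x\<in>?U. f x * G x) = (\<Sum>x | f x \<noteq> 0. f x * G x)"
      by (rule F[OF U, symmetric]) auto
    also have "(\<Sum>x\<in>?U. g x * G x) = (\<Sum>x | g x \<noteq> 0. g x * G x)"
      by (rule F[OF U, symmetric]) auto
    finally show ?thesis .
  qed
  have add_left: "(\<lambda>x. f x + g x) \<otimes>\<^bsub>?A\<^esub> h = (\<lambda>x. (f \<otimes>\<^bsub>?A\<^esub> h) x + (g \<otimes>\<^bsub>?A\<^esub> h) x)"
    if "finite {x. f x \<noteq> 0}" "finite {x. g x \<noteq> 0}" "finite {x. h x \<noteq> 0}" for f g h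
    using that by (intro ext) (simp only: eq support_finite_Un FU)
  have add_right: "h \<otimes>\<^bsub>?A\<^esub> (\<lambda>x. f x + g x) = (\<lambda>x. (h \<otimes>\<^bsub>?A\<^esub> f) x + (h \<otimes>\<^bsub>?A\<^esub> g) x)"
    if "finite {x. f x \<noteq> 0}" "finite {x. g x \<noteq> 0}" "finite {x. h x \<noteq> 0}" for f g h
    using that by (intro ext) (simp only: eq2 support_finite_Un FU)
  have fs: "finite {x. c * f x \<noteq> 0}" if "finite {x. f x \<noteq> 0}" for c :: kq and f :: "'a \<Rightarrow> kq"
    using that by (rule rev_finite_subset) auto
  have smult_left: "(\<lambda>x. c * f x) \<otimes>\<^bsub>?A\<^esub> h = (\<lambda>x. c * (f \<otimes>\<^bsub>?A\<^esub> h) x)"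
    if "finite {x. f x \<noteq> 0}" "finite {x. h x \<noteq> 0}" for c f h
    by (rule ext, cases "c = 0")
      (use that in \<open>simp_all add: eq fs sum_distrib_left mult.assoc\<close>)
  have smult_right: "h \<otimes>\<^bsub>?A\<^esub> (\<lambda>x. c * f x) = (\<lambda>x. c * (h \<otimes>\<^bsub>?A\<^esub> f) x)"
    if "finite {x. f x \<noteq> 0}" "finite {x. h x \<noteq> 0}" for c f h
    by (rule ext, cases "c = 0")
      (use that in \<open>simp_all add: eq2 fs sum_distrib_left mult.assoc\<close>)
  have one_left: "delta \<one>\<^bsub>M\<^esub> \<otimes>\<^bsub>?A\<^esub> f = f" if "f \<in> carrier ?A" for f
  proof
    fix z
    have "(delta \<one>\<^bsub>M\<^esub> \<otimes>\<^bsub>?A\<^esub> f) z = (\<Sum>y | f y \<noteq> 0. f y * delta y z)"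
      using that by (subst eq) (auto intro!: sum.cong simp: subset_iff)
    also have "\<dots> = f z"
      using that by (auto simp: delta_def if_distrib sum.delta cong: if_cong)
    finally show "(delta \<one>\<^bsub>M\<^esub> \<otimes>\<^bsub>?A\<^esub> f) z = f z" .
  qed
  have one_right: "f \<otimes>\<^bsub>?A\<^esub> delta \<one>\<^bsub>M\<^esub> = f" if "f \<in> carrier ?A" for f
  proof
    fix z
    have "(f \<otimes>\<^bsub>?A\<^esub> delta \<one>\<^bsub>M\<^esub>) z = (\<Sum>y | f y \<noteq> 0. f y * delta y z)"
      using that by (subst eq) (auto intro!: sum.cong simp: subset_iff)
    also have "\<dots> = f z"
      using that by (auto simp: delta_def if_distrib sum.delta cong: if_cong)
    finally show "(f \<otimes>\<^bsub>?A\<^esub> delta \<one>\<^bsub>M\<^esub>) z = f z" .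
  qed
  have "ring ?A"
  proof (intro ringI abelian_groupI monoidI, goal_cases)
    case (1 x y)
    then show ?case
      by (auto intro: support_finite_Un simp: subset_iff) (metis add_0)
  next
    case (6 x) then show ?case by (intro bexI[of _ "\<lambda>z. - x z"]) auto
  next
    case (7 f g) then show ?case by (rule closed)
  next
    case (8) then show ?case by auto
  next
    case (9 f g h) then show ?case by (intro assoc)
  next
    case (10 f) then show ?case using one_left by simp
  next
    case (11 f) then show ?case using one_right by simp
  next
    case (12 x y z) then show ?case using add_left by simp
  next
    case (13 x y z) then show ?case using add_right by simp
  qed (auto simp: algebra_simps)
  moreover have "kalg_axioms ?A"
  proof (unfold_locales, goal_cases)
    case (1 x c) then show ?case by (auto intro: fs)
  next
    case (6 x y c) then show ?case using smult_left by simp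
  next
    case (7 x y c) then show ?case using smult_right by simp
  qed (auto simp: algebra_simps)
  ultimately show ?thesis by (rule kalg.intro)
qed

text \<open>The generators act on the coefficient functions of tensors of any length, by recursion on the list
  of basis indices; the ranks \<open>N b\<close> do not enter. Note that an operator reads off the
  coefficient of its result, so \<open>opE b i\<close> replaces \<open>(b, i)\<close> by \<open>(b, i + 1)\<close> in the argument.\<close>

definition wtk :: "nat \<Rightarrow> nat \<Rightarrow> idx \<Rightarrow> kq" where
  "wtk b i a = (if a = (b, i) then q else if a = (b, Suc i) then inverse q else 1)"

text \<open>The eigenvalue on the pure tensor \<open>l\<close> of \<open>K b i\<close> times the
  inverse of \<open>K b (i + 1)\<close>. It arises from the term \<open>E \<otimes> K\<close> of the
  comultiplication: when \<open>E\<close> acts on one factor, \<open>K\<close> acts on everything to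
  its right.\<close>

definition kap :: "nat \<Rightarrow> nat \<Rightarrow> idx list \<Rightarrow> kq" where
  "kap b i l = prod_list (map (wtk b i) l)"

definition wt1 :: "nat \<Rightarrow> nat \<Rightarrow> idx \<Rightarrow> kq" where
  "wt1 b i a = (if a = (b, i) then q else 1)"

definition kk :: "nat \<Rightarrow> nat \<Rightarrow> idx list \<Rightarrow> kq" where
  "kk b i l = prod_list (map (wt1 b i) l)"

fun opE :: "nat \<Rightarrow> nat \<Rightarrow> tensor \<Rightarrow> tensor" where
  "opE b i x [] = 0"
| "opE b i x (a # l) = (if a = (b, i) then kap b i l * x ((b, Suc i) # l) else 0) + opE b i (\<lambda>l'. x (a # l')) l"

fun opF :: "nat \<Rightarrow> nat \<Rightarrow> tensor \<Rightarrow> tensor" where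
  "opF b i x [] = 0"
| "opF b i x (a # l) =
     (if a = (b, Suc i) then x ((b, i) # l) else 0) + inverse (wtk b i a) * opF b i (\<lambda>l'. x (a # l')) l"

definition opK :: "nat \<Rightarrow> nat \<Rightarrow> tensor \<Rightarrow> tensor" where
  "opK b i x = (\<lambda>l. kk b i l * x l)"

definition opKi :: "nat \<Rightarrow> nat \<Rightarrow> tensor \<Rightarrow> tensor" where
  "opKi b i x = (\<lambda>l. inverse (kk b i l) * x l)"

lemma kap_simps [simp]: "kap b i [] = 1" "kap b i (a # l) = wtk b i a * kap b i l"
  by (simp_all add: kap_def)

lemma kk_simps [simp]: "kk b i [] = 1" "kk b i (a # l) = wt1 b i a * kk b i l"
  by (simp_all add: kk_def)

lemma wt_neq_0 [simp]: "wtk b i a \<noteq> 0" "wt1 b i a \<noteq> 0"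
  by (simp_all add: wtk_def wt1_def)

lemma kap_neq_0 [simp]: "kap b i l \<noteq> 0"
  by (induction l) auto

lemma kk_neq_0 [simp]: "kk b i l \<noteq> 0"
  by (induction l) auto

lemma wtk_eq: "wtk b i a = wt1 b i a * inverse (wt1 b (Suc i) a)"
  by (simp add: wtk_def wt1_def)

lemma kap_eq: "kap b i l = kk b i l * inverse (kk b (Suc i) l)"
  by (induction l) (simp_all add: wtk_eq)

lemma opE_add: "opE b i (\<lambda>l. x l + y l) l = opE b i x l + opE b i y l"
  by (induction l arbitrary: x y) (auto simp: algebra_simps)

lemma opE_scale: "opE b i (\<lambda>l. c * x l) l = c * opE b i x l"
  by (induction l arbitrary: x) (auto simp: algebra_simps)

lemma opE_diff: "opE b i (\<lambda>l. x l - y l) l = opE b i x l - opE b i y l"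
  using opE_add[of b i x "\<lambda>l. - 1 * y l" l] by (simp only: opE_scale) simp

lemma opF_add: "opF b i (\<lambda>l. x l + y l) l = opF b i x l + opF b i y l"
  by (induction l arbitrary: x y) (auto simp: algebra_simps)

lemma opF_scale: "opF b i (\<lambda>l. c * x l) l = c * opF b i x l"
  by (induction l arbitrary: x) (auto simp: algebra_simps)

lemma opF_diff: "opF b i (\<lambda>l. x l - y l) l = opF b i x l - opF b i y l"
  using opF_add[of b i x "\<lambda>l. - 1 * y l" l] by (simp only: opF_scale) simp

lemma opE_zero [simp]: "opE b i (\<lambda>l. 0) l = 0" and opF_zero [simp]: "opF b i (\<lambda>l. 0) l = 0"
  using opE_scale[of b i 0 "\<lambda>_. 0"] opF_scale[of b i 0 "\<lambda>_. 0"] by simp_all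

text \<open>A diagonal operator whose eigenvalue is multiplicative over the factors passes through
  \<open>E\<close> up to one ratio, because each term of \<open>E\<close> changes a single factor.
  The relations with \<open>K\<close> and the factors \<open>kap\<close> are instances.\<close>

lemma opE_mult:
  assumes g: "\<And>a. g a \<noteq> 0"
  shows "opE b i (\<lambda>l. prod_list (map g l) * x l) l
    = g (b, Suc i) * inverse (g (b, i)) * prod_list (map g l) * opE b i x l"
proof (induction l arbitrary: x)
  case (Cons a l)
  show ?case
    using Cons.IH[of "\<lambda>l. x (a # l)"] g[of "(b, i)"]
    by (auto simp: mult.assoc opE_scale) (simp_all add: field_simps)
qed simp

lemma opF_mult:
  assumes g: "\<And>a. g a \<noteq> 0"
  shows "opF b i (\<lambda>l. prod_list (map g l) * x l) l
    = g (b, i) * inverse (g (b, Suc i)) * prod_list (map g l) * opF b i x l"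
proof (induction l arbitrary: x)
  case (Cons a l)
  show ?case
    using Cons.IH[of "\<lambda>l. x (a # l)"] g[of "(b, Suc i)"]
    by (auto simp: mult.assoc opF_scale) (simp_all add: field_simps)
qed simp

lemmas opE_kap = opE_mult[of "wtk c j" for c j, folded kap_def, simplified]
lemmas opF_kap = opF_mult[of "wtk c j" for c j, folded kap_def, simplified]
lemmas opE_kk = opE_mult[of "wt1 c j" for c j, folded kk_def, simplified]
lemmas opF_kk = opF_mult[of "wt1 c j" for c j, folded kk_def, simplified]

lemma opK_opE: "opK b i (opE c j x) l = q powi gl_weight b i c j * opE c j (opK b i x) l"
  unfolding opK_def opE_kk by (auto simp: wt1_def gl_weight_def)

lemma opK_opF: "opK b i (opF c j x) l = q powi (- gl_weight b i c j) * opF c j (opK b i x) l"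
  unfolding opK_def opF_kk by (auto simp: wt1_def gl_weight_def)

text \<open>Induction along the comultiplication. The mixed terms cancel by \<open>opF_kap\<close>,
  and what remains is the recursion of quantum integers:
  \<open>q K - q^-1 K^-1 = (q - q^-1) K + q^-1 (K - K^-1)\<close> and its mirror image.\<close>

lemma opE_opF_commutator:
  "opE b i (opF b i x) l - opF b i (opE b i x) l
    = 1 / (q - inverse q) * ((kap b i l - inverse (kap b i l)) * x l)"
proof (induction l arbitrary: x)
  case (Cons a l)
  define h where "h = 1 / (q - inverse q)"
  have h: "h * (q - inverse q) = 1" by (simp add: h_def)
  have IH: "opE b i (opF b i y) l = opF b i (opE b i y) l + h * ((kap b i l - inverse (kap b i l)) * y l)" for y
    using Cons.IH[of y] by (simp add: h_def algebra_simps)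
  have ne: "(b, Suc i) \<noteq> (b, i)" by simp
  consider "a = (b, i)" | "a = (b, Suc i)" | "a \<noteq> (b, i)" "a \<noteq> (b, Suc i)" by blast
  then show ?case
  proof cases
    case 1
    have "h * (q * kap b i l - inverse q * inverse (kap b i l))
        = h * (q - inverse q) * kap b i l + inverse q * (h * (kap b i l - inverse (kap b i l)))"
      by (simp add: algebra_simps)
    then have e: "h * (q * kap b i l - inverse q * inverse (kap b i l))
        = kap b i l + inverse q * (h * (kap b i l - inverse (kap b i l)))"
      by (simp add: h)
    have "h * ((q * kap b i l - inverse q * inverse (kap b i l)) * x ((b, i) # l))
        = kap b i l * x ((b, i) # l) + inverse q * (h * ((kap b i l - inverse (kap b i l)) * x ((b, i) # l)))"
      by (simp only: e mult.assoc[symmetric] distrib_right)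
    with 1 show ?thesis
      by (simp add: wtk_def opE_scale opF_scale opF_add opF_kap IH flip: h_def)
         (simp add: algebra_simps)
  next
    case 2
    define Q where "Q = inverse q"
    have hi: "h * Q = q * h - 1" using h by (simp add: Q_def algebra_simps)
    have main: "h * ((Q * K - q * L) * A) = q * (h * ((K - L) * A)) - K * A" for K L A
    proof -
      have "h * ((Q * K - q * L) * A) = (h * Q) * (K * A) - q * (h * (L * A))"
        by (simp add: algebra_simps)
      also have "\<dots> = q * (h * ((K - L) * A)) - K * A"
        unfolding hi by (simp add: algebra_simps)
      finally show ?thesis .
    qed
    have lhs: "opE b i (opF b i x) (a # l) = opE b i (\<lambda>l'. x ((b, i) # l')) l
        + q * opE b i (opF b i (\<lambda>l'. x ((b, Suc i) # l'))) l"
      using 2 by (simp add: wtk_def opE_add opE_scale)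
    have rhs: "opF b i (opE b i x) (a # l) = kap b i l * x ((b, Suc i) # l) + opE b i (\<lambda>l'. x ((b, i) # l')) l
        + q * opF b i (opE b i (\<lambda>l'. x ((b, Suc i) # l'))) l"
      using 2 by (simp add: wtk_def)
    have "1 / (q - inverse q) * ((kap b i (a # l) - inverse (kap b i (a # l))) * x (a # l))
        = h * ((Q * kap b i l - q * inverse (kap b i l)) * x ((b, Suc i) # l))"
      using 2 by (simp add: wtk_def h_def Q_def)
    also note main
    finally show ?thesis
      unfolding lhs rhs IH by (simp add: distrib_left)
  next
    case 3
    then show ?thesis
      by (simp add: wtk_def IH flip: h_def)
  qed
qed simp

lemma opE_opF_commute:
  assumes "(b, i) \<noteq> (c, j)"
  shows "opE b i (opF c j x) l = opF c j (opE b i x) l"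
proof (induction l arbitrary: x)
  case (Cons a l)
  show ?case
    using assms Cons.IH
    by (cases "a = (b, i)"; cases "a = (c, Suc j)"; cases "(b, i) = (c, Suc j)")
      (auto simp: opE_add opE_scale opF_add opF_scale opF_kap wtk_def algebra_simps)
qed simp

lemma opE_opE_commute:
  assumes "b \<noteq> c \<or> \<bar>int i - int j\<bar> > 1"
  shows "opE b i (opE c j x) l = opE c j (opE b i x) l"
proof (induction l arbitrary: x)
  case (Cons a l)
  show ?case
    using assms
    by (cases "a = (b, i)"; cases "a = (c, j)")
      (auto simp: Cons.IH opE_add opE_scale opE_kap wtk_def algebra_simps)
qed simp

lemma opF_opF_commute:
  assumes "b \<noteq> c \<or> \<bar>int i - int j\<bar> > 1"
  shows "opF b i (opF c j x) l = opF c j (opF b i x) l"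
proof (induction l arbitrary: x)
  case (Cons a l)
  show ?case
    using assms
    by (cases "a = (b, Suc i)"; cases "a = (c, Suc j)")
      (auto simp: Cons.IH opF_add opF_scale opF_kap wtk_def algebra_simps)
qed simp

lemma delta_sym: "delta m l = delta l m"
  by (simp add: delta_def)

lemma delta_Cons: "delta (c # m) (a # l) = (if a = c then delta m l else 0)"
  by (simp add: delta_def)

text \<open>The matrix of \<open>E\<close> is the transpose of that of \<open>F\<close> up to a
  factor depending only on the weight of \<open>l\<close>. On weight vectors the two are thus
  adjoint, up to a scalar, for the form in which basis tensors are orthonormal.\<close>

lemma opE_delta_opF_delta: "opE b i (delta m) l = inverse q * kap b i l * opF b i (delta l) m"
proof (induction l arbitrary: m)
  case Nil
  have "(\<lambda>l'. delta [] (a # l')) = (\<lambda>l'. 0)" for a :: idx by (auto simp: delta_def)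
  then show ?case by (cases m) (simp_all add: delta_def)
next
  case (Cons a l)
  show ?case
  proof (cases m)
    case Nil
    have "(\<lambda>l'. delta [] (a # l')) = (\<lambda>l'. 0)" by (auto simp: delta_def)
    with Nil show ?thesis by (simp add: delta_def)
  next
    case m: (Cons c m')
    have s: "(\<lambda>l'. delta (c # m') (a # l')) = (if a = c then delta m' else (\<lambda>l'. 0))"
      "(\<lambda>l'. delta (a # l) (c # l')) = (if a = c then delta l else (\<lambda>l'. 0))"
      by (auto simp: delta_def fun_eq_iff)
    show ?thesis
      unfolding m opE.simps opF.simps s delta_Cons delta_sym[of m' l]
      by (cases "a = c"; cases "a = (b, i)"; cases "c = (b, Suc i)") (auto simp: Cons.IH wtk_def)
  qed
qed

subsection \<open>The braiding\<close>

text \<open>The value at a list collects the coefficients of the basis tensors that the braiding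
  sends there. Positions count from \<open>0\<close>, so \<open>sg k\<close> is \<open>sigma\<close>
  with index \<open>k + 1\<close>; lists that are too short are left alone.\<close>

fun sg :: "nat \<Rightarrow> tensor \<Rightarrow> tensor" where
  "sg 0 x (a # c # l) =
     (if fst a \<noteq> fst c then x (c # a # l)
      else if snd a = snd c then q * x (a # c # l)
      else if snd a < snd c then x (c # a # l)
      else x (c # a # l) + (q - inverse q) * x (a # c # l))"
| "sg (Suc k) x (a # l) = sg k (\<lambda>l'. x (a # l')) l"
| "sg k x l = x l"

text \<open>By the quadratic relation the inverse is \<open>sg - (q - inverse q)\<close> within a
  block and \<open>sg\<close> itself between different blocks.\<close>

fun sgi :: "nat \<Rightarrow> tensor \<Rightarrow> tensor" where
  "sgi 0 x (a # c # l) =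
     (if fst a \<noteq> fst c then x (c # a # l)
      else if snd a = snd c then inverse q * x (a # c # l)
      else if snd a < snd c then x (c # a # l) - (q - inverse q) * x (a # c # l)
      else x (c # a # l))"
| "sgi (Suc k) x (a # l) = sgi k (\<lambda>l'. x (a # l')) l"
| "sgi k x l = x l"

lemma sg_add: "sg k (\<lambda>l. x l + y l) l = sg k x l + sg k y l"
proof (induction k arbitrary: x y l)
  case 0
  show ?case by (cases l rule: remdups_adj.cases) (auto simp: algebra_simps)
next
  case (Suc k)
  then show ?case by (cases l) auto
qed

lemma sg_scale: "sg k (\<lambda>l. c * x l) l = c * sg k x l"
  by (induction k x l rule: sg.induct) (auto simp: algebra_simps)

lemma sgi_add: "sgi k (\<lambda>l. x l + y l) l = sgi k x l + sgi k y l"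
proof (induction k arbitrary: x y l)
  case 0
  show ?case by (cases l rule: remdups_adj.cases) (auto simp: algebra_simps)
next
  case (Suc k)
  then show ?case by (cases l) auto
qed

lemma sgi_scale: "sgi k (\<lambda>l. c * x l) l = c * sgi k x l"
  by (induction k x l rule: sgi.induct) (auto simp: algebra_simps)

lemma sg_zero [simp]: "sg k (\<lambda>l. 0) l = 0" and sgi_zero [simp]: "sgi k (\<lambda>l. 0) l = 0"
  using sg_scale[of k 0 "\<lambda>_. 0"] sgi_scale[of k 0 "\<lambda>_. 0"] by simp_all

lemma sg_sgi: "sg k (sgi k x) l = x l"
  by (induction k x l rule: sg.induct) (auto simp: algebra_simps prod_eq_iff)

lemma sgi_sg: "sgi k (sg k x) l = x l"
  by (induction k x l rule: sg.induct) (auto simp: algebra_simps prod_eq_iff)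

lemma sg_apply:
  "Suc k < length l \<Longrightarrow> sg k x l =
     (let a = l ! k; c = l ! Suc k; l' = l[k := c, Suc k := a] in
      if fst a \<noteq> fst c then x l'
      else if snd a = snd c then q * x l
      else if snd a < snd c then x l'
      else x l' + (q - inverse q) * x l)"
  by (induction k x l rule: sg.induct) (auto simp: Let_def)

lemma sg_quadratic:
  "Suc k < length l \<Longrightarrow> sg k (sg k x) l
    = x l + (q - inverse q) * (if fst (l ! k) = fst (l ! Suc k) then sg k x l else 0)"
  by (induction k x l rule: sg.induct) (auto simp: algebra_simps prod_eq_iff)

lemma sg_far_commute: "sg k (sg (Suc (Suc (k + j))) x) l = sg (Suc (Suc (k + j))) (sg k x) l"
proof (induction k x l rule: sg.induct)
  case (1 x a c l)
  show ?case by (simp add: sg_add sg_scale)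
next
  case (2 k x a l)
  then show ?case by simp
qed (auto simp: sg_add sg_scale)

lemma sg_braid:
  "Suc (Suc k) < length l \<Longrightarrow> sg k (sg (Suc k) (sg k x)) l = sg (Suc k) (sg k (sg (Suc k) x)) l"
proof (induction k arbitrary: x l)
  case 0
  then obtain a b c l' where l: "l = a # b # c # l'"
    by (metis Suc_less_eq length_Suc_conv less_Suc_eq_0_disj list.exhaust list.size(3) not_less_eq zero_less_Suc)
  obtain a1 a2 b1 b2 c1 c2 where "a = (a1, a2)" "b = (b1, b2)" "c = (c1, c2)" by (metis surj_pair)
  then show ?case unfolding l
    by (cases a2 b2 rule: linorder_cases; cases b2 c2 rule: linorder_cases; cases a2 c2 rule: linorder_cases)
       (auto simp: algebra_simps)
next
  case (Suc k)
  then show ?case by (cases l) auto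
qed

lemma sg_prod_list: "sg k (\<lambda>l. prod_list (map g l) * x l) l = prod_list (map g l) * sg k x l"
proof (induction k x l rule: sg.induct)
  case (2 k x a l)
  then show ?case by (simp add: mult.assoc sg_scale)
qed (auto simp: algebra_simps)

text \<open>Apart from the two exchanged factors only products such as \<open>kap\<close> occur, and
  these do not change when entries are permuted. What remains is a finite check on two
  factors.\<close>

lemma sg_opE: "sg k (opE b i x) l = opE b i (sg k x) l"
proof (induction k x l rule: sg.induct)
  case (1 x a c l)
  obtain a1 a2 c1 c2 where ac: "a = (a1, a2)" "c = (c1, c2)" by (metis surj_pair)
  show ?case unfolding ac
    by (cases "a1 = c1"; cases a2 c2 rule: linorder_cases; cases "(a1, a2) = (b, i)"; cases "(c1, c2) = (b, i)";
        cases "a2 = Suc i"; cases "c2 = Suc i")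
       (auto simp: wtk_def opE_scale opE_add opE_diff algebra_simps)
qed (auto simp: sg_add sg_scale sg_prod_list[of _ "wtk b i", folded kap_def] algebra_simps)

lemma sg_opF: "sg k (opF b i x) l = opF b i (sg k x) l"
proof (induction k x l rule: sg.induct)
  case (1 x a c l)
  obtain a1 a2 c1 c2 where ac: "a = (a1, a2)" "c = (c1, c2)" by (metis surj_pair)
  show ?case unfolding ac
    by (cases "a1 = c1"; cases a2 c2 rule: linorder_cases; cases "(a1, a2) = (b, i)"; cases "(c1, c2) = (b, i)";
        cases "a2 = Suc i"; cases "c2 = Suc i")
       (auto simp: wtk_def opF_scale opF_add opF_diff algebra_simps)
qed (auto simp: sg_add sg_scale algebra_simps)

lemma sg_opK: "sg k (opK b i x) l = opK b i (sg k x) l"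
  unfolding opK_def kk_def by (rule sg_prod_list)

lemma opE_serre:
  assumes "\<bar>int i - int j\<bar> = 1"
  shows "opE b i (opE b i (opE b j x)) l - (q + inverse q) * opE b i (opE b j (opE b i x)) l
    + opE b j (opE b i (opE b i x)) l = 0"
proof (induction l arbitrary: x)
  case (Cons a l)
  have IH: "opE b i (opE b i (opE b j y)) l
      = (q + inverse q) * opE b i (opE b j (opE b i y)) l - opE b j (opE b i (opE b i y)) l" for y
    using Cons.IH[of y] by (simp add: algebra_simps)
  consider "j = Suc i" | "i = Suc j" using assms by linarith
  then show ?case
    using IH
    by cases (cases "a = (b, i)"; cases "a = (b, j)";
        auto simp: opE_add opE_scale opE_kap wtk_def algebra_simps)+
qed simp

lemma opF_serre:
  assumes "\<bar>int i - int j\<bar> = 1"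
  shows "opF b i (opF b i (opF b j x)) l - (q + inverse q) * opF b i (opF b j (opF b i x)) l
    + opF b j (opF b i (opF b i x)) l = 0"
proof (induction l arbitrary: x)
  case (Cons a l)
  have IH: "opF b i (opF b i (opF b j y)) l
      = (q + inverse q) * opF b i (opF b j (opF b i y)) l - opF b j (opF b i (opF b i y)) l" for y
    using Cons.IH[of y] by (simp add: algebra_simps)
  consider "j = Suc i" | "i = Suc j" using assms by linarith
  then show ?case
  proof cases
    case 1
    note IH' = IH[unfolded 1]
    consider "a = (b, Suc i)" | "a = (b, i)" | "a = (b, Suc (Suc i))"
      | "a \<noteq> (b, i)" "a \<noteq> (b, Suc i)" "a \<noteq> (b, Suc (Suc i))" by blast
    then show ?thesis unfolding 1
      by cases (simp add: wtk_def opF_add opF_scale IH'; simp add: algebra_simps)+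
  next
    case 2
    note IH' = IH[unfolded 2]
    consider "a = (b, Suc j)" | "a = (b, j)" | "a = (b, Suc (Suc j))"
      | "a \<noteq> (b, j)" "a \<noteq> (b, Suc j)" "a \<noteq> (b, Suc (Suc j))" by blast
    then show ?thesis unfolding 2
      by cases (simp add: wtk_def opF_add opF_scale IH'; simp add: algebra_simps)+
  qed
qed simp

text \<open>The left side is the unnormalised \<open>q\<close>-antisymmetriser of three strands, and
  two basis vectors cannot fill three antisymmetric places. It is checked on the eight fillings.
  Here the rank \<open>2\<close> of the first block makes the Temperley-Lieb relator act as
  zero.\<close>

lemma sg_antisymmetrizer:
  assumes "length l > 2" "\<And>k. k < 3 \<Longrightarrow> fst (l ! k) = b \<and> snd (l ! k) \<in> {1, 2}"
  shows "x l - inverse q * sg 0 x l - inverse q * sg 1 x l + inverse q ^ 2 * sg 0 (sg 1 x) l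
    + inverse q ^ 2 * sg 1 (sg 0 x) l - inverse q ^ 3 * sg 0 (sg 1 (sg 0 x)) l = 0"
proof -
  obtain a c e l' where l: "l = a # c # e # l'"
    using assms(1) by (auto simp: numeral_2_eq_2 Suc_less_eq2 length_Suc_conv less_Suc_eq_le
        Suc_le_length_iff simp flip: Suc_le_eq)
  have "fst a = b" "fst c = b" "fst e = b"
    "snd a = 1 \<or> snd a = 2" "snd c = 1 \<or> snd c = 2" "snd e = 1 \<or> snd e = 2"
    using assms(2)[of 0] assms(2)[of 1] assms(2)[of 2] by (auto simp: l)
  then have "a = (b, 1) \<or> a = (b, 2)" "c = (b, 1) \<or> c = (b, 2)" "e = (b, 1) \<or> e = (b, 2)"
    by (auto simp: prod_eq_iff)
  then show ?thesis
    unfolding l by (auto simp: algebra_simps power2_eq_square power3_eq_cube)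
qed

definition ta :: "kq \<Rightarrow> nat \<Rightarrow> tensor \<Rightarrow> tensor" where
  "ta \<zeta> k x = (\<lambda>l. \<zeta> ^ (fst (l ! k) - 1) * x l)"

lemma sg_ta:
  assumes "Suc k < length l" "j < length l"
  shows "sg k (ta \<zeta> j x) l = ta \<zeta> (transpose k (Suc k) j) (sg k x) l"
  using assms
  by (cases "j = k"; cases "j = Suc k")
     (auto simp: sg_apply ta_def Let_def nth_list_update algebra_simps transpose_def)

lemma opE_ta:
  "k < length l \<Longrightarrow> opE b i (ta \<zeta> k x) l = ta \<zeta> k (opE b i x) l"
proof (induction l arbitrary: k x)
  case (Cons a l)
  show ?case
  proof (cases k)
    case 0
    then show ?thesis by (simp add: ta_def opE_scale distrib_left mult.left_commute)
  next
    case (Suc k')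
    then show ?thesis
      using Cons.IH[of k' "\<lambda>l. x (a # l)"] Cons.prems by (simp add: ta_def distrib_left mult.left_commute)
  qed
qed simp

lemma opF_ta:
  "k < length l \<Longrightarrow> opF b i (ta \<zeta> k x) l = ta \<zeta> k (opF b i x) l"
proof (induction l arbitrary: k x)
  case (Cons a l)
  show ?case
  proof (cases k)
    case 0
    then show ?thesis by (simp add: ta_def opF_scale distrib_left mult.left_commute)
  next
    case (Suc k')
    then show ?thesis
      using Cons.IH[of k' "\<lambda>l. x (a # l)"] Cons.prems by (simp add: ta_def distrib_left mult.left_commute)
  qed
qed simp

lemma opK_ta: "opK b i (ta \<zeta> k x) l = ta \<zeta> k (opK b i x) l"
  by (simp add: opK_def ta_def)

section \<open>The endomorphism algebra of tensor space\<close>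

lemma T_space_add: "x \<in> T_space d N n \<Longrightarrow> y \<in> T_space d N n \<Longrightarrow> (\<lambda>l. x l + y l) \<in> T_space d N n"
  and T_space_scale: "x \<in> T_space d N n \<Longrightarrow> (\<lambda>l. c * x l) \<in> T_space d N n"
  and T_space_uminus: "x \<in> T_space d N n \<Longrightarrow> (\<lambda>l. - x l) \<in> T_space d N n"
  and T_space_0: "(\<lambda>l. 0) \<in> T_space d N n"
  and T_space_sum: "(\<And>i. i \<in> I \<Longrightarrow> f i \<in> T_space d N n) \<Longrightarrow> (\<lambda>l. \<Sum>i\<in>I. f i l) \<in> T_space d N n"
  by (simp_all add: T_space_def)

lemma T_End_simps [simp]:
  "carrier (T_End d N n) = {f \<in> T_space d N n \<rightarrow>\<^sub>E T_space d N n.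
        (\<forall>x\<in>T_space d N n. \<forall>y\<in>T_space d N n. f (\<lambda>l. x l + y l) = (\<lambda>l. f x l + f y l)) \<and>
        (\<forall>c. \<forall>x\<in>T_space d N n. f (\<lambda>l. c * x l) = (\<lambda>l. c * f x l))}"
  "f \<otimes>\<^bsub>T_End d N n\<^esub> g = compose (T_space d N n) f g"
  "\<one>\<^bsub>T_End d N n\<^esub> = (\<lambda>x\<in>T_space d N n. x)"
  "\<zero>\<^bsub>T_End d N n\<^esub> = (\<lambda>x\<in>T_space d N n. \<lambda>_. 0)"
  "f \<oplus>\<^bsub>T_End d N n\<^esub> g = (\<lambda>x\<in>T_space d N n. \<lambda>l. f x l + g x l)"
  "c \<odot>\<^bsub>T_End d N n\<^esub> f = (\<lambda>x\<in>T_space d N n. \<lambda>l. c * f x l)"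
  by (simp_all add: T_End_def Let_def)

lemma T_End_mem:
  "f \<in> T_space d N n \<rightarrow>\<^sub>E T_space d N n \<Longrightarrow> x \<in> T_space d N n \<Longrightarrow> f x \<in> T_space d N n"
  by auto

lemma kalg_T_End: "kalg (T_End d N n)"
proof -
  note defs = T_space_add T_space_scale T_space_0 T_space_uminus T_End_mem
  have eqI: "f = g" if "f \<in> extensional W" "g \<in> extensional W" "\<And>x. x \<in> W \<Longrightarrow> f x = g x"
    for f g :: "tensor \<Rightarrow> tensor" and W
    using that by (rule extensionalityI)
  have "ring (T_End d N n)"
  proof (intro ringI abelian_groupI monoidI, goal_cases)
    case (1 f g)
    then show ?case by (auto simp: defs algebra_simps)
  next
    case 2
    show ?case by (auto simp: defs)
  next
    case (3 f g h)
    show ?case by (auto simp: fun_eq_iff restrict_def)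
  next
    case (4 f g)
    show ?case by (auto simp: fun_eq_iff restrict_def)
  next
    case (5 f)
    then show ?case by (auto intro!: eqI[where W = "T_space d N n"] simp: PiE_def)
  next
    case (6 f)
    then show ?case
      by (intro bexI[of _ "\<lambda>x\<in>T_space d N n. \<lambda>l. - f x l"]) (auto simp: defs fun_eq_iff restrict_def)
  next
    case (7 f g)
    then show ?case by (auto simp: defs compose_def)
  next
    case 8
    show ?case by (auto simp: defs)
  next
    case (9 f g h)
    then show ?case by (auto simp: fun_eq_iff compose_def defs restrict_def)
  next
    case (10 f)
    then show ?case by (auto intro!: eqI[where W = "T_space d N n"] simp: PiE_def compose_def Pi_iff)
  next
    case (11 f)
    then show ?case by (auto intro!: eqI[where W = "T_space d N n"] simp: PiE_def compose_def Pi_iff)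
  next
    case (12 f g h)
    then show ?case by (auto simp: fun_eq_iff compose_def restrict_def defs)
  next
    case (13 f g h)
    then show ?case by (auto simp: fun_eq_iff compose_def restrict_def defs)
  qed
  moreover have "kalg_axioms (T_End d N n)"
  proof (unfold_locales, goal_cases)
    case (1 f c)
    then show ?case by (auto simp: defs algebra_simps)
  next
    case (2 x y c)
    then show ?case by (auto simp: fun_eq_iff restrict_def algebra_simps)
  next
    case (3 x b c)
    then show ?case by (auto simp: fun_eq_iff restrict_def algebra_simps)
  next
    case (4 x b c)
    then show ?case by (auto simp: fun_eq_iff restrict_def algebra_simps)
  next
    case (5 f)
    then show ?case by (auto intro!: eqI[where W = "T_space d N n"] simp: PiE_def)
  next
    case (6 f g c)
    then show ?case by (auto simp: fun_eq_iff compose_def restrict_def defs)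
  next
    case (7 f g c)
    then show ?case by (auto simp: fun_eq_iff compose_def restrict_def defs)
  qed
  ultimately show ?thesis by (rule kalg.intro)
qed

lemma T_End_minus:
  assumes "f \<in> carrier (T_End d N n)" "g \<in> carrier (T_End d N n)" "x \<in> T_space d N n"
  shows "(f \<ominus>\<^bsub>T_End d N n\<^esub> g) x l = f x l - g x l"
proof -
  interpret kalg "T_End d N n" by (rule kalg_T_End)
  have "((f \<ominus>\<^bsub>T_End d N n\<^esub> g) \<oplus>\<^bsub>T_End d N n\<^esub> g) x l = f x l"
    using assms(1,2) by (simp only: a_minus_def a_assoc a_inv_closed l_neg r_zero)
  then show ?thesis using assms(3) by (simp add: algebra_simps)
qed

lemma T_End_apply_sum:
  assumes f: "f \<in> carrier (T_End d N n)" and x: "\<And>i. i \<in> I \<Longrightarrow> x i \<in> T_space d N n"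
  shows "f (\<lambda>l. \<Sum>i\<in>I. c i * x i l) = (\<lambda>l. \<Sum>i\<in>I. c i * f (x i) l)"
proof -
  have z: "f (\<lambda>l. 0) = (\<lambda>l. 0)"
  proof -
    have "f (\<lambda>l. e * y l) = (\<lambda>l. e * f y l)" if "y \<in> T_space d N n" for e y
      using f that by simp
    from this[OF T_space_0, of 0] show ?thesis by simp
  qed
  from x show ?thesis
  proof (induction I rule: infinite_finite_induct)
    case (insert i I)
    then have "f (\<lambda>l. c i * x i l + (\<Sum>i\<in>I. c i * x i l))
        = (\<lambda>l. f (\<lambda>l. c i * x i l) l + f (\<lambda>l. \<Sum>i\<in>I. c i * x i l) l)"
      using f by (simp add: T_space_scale T_space_sum)
    also have "\<dots> = (\<lambda>l. c i * f (x i) l + (\<Sum>i\<in>I. c i * f (x i) l))"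
      using f insert by simp
    finally show ?case using insert by simp
  qed (simp_all add: z)
qed

section \<open>Linear extension of monoid representations to the monoid algebra\<close>

definition rep_ext :: "nat \<Rightarrow> (nat \<Rightarrow> nat) \<Rightarrow> nat \<Rightarrow> ('g \<Rightarrow> tensor \<Rightarrow> tensor) \<Rightarrow> ('g \<Rightarrow> kq) \<Rightarrow> tensor \<Rightarrow> tensor" where
  "rep_ext d N n \<rho> a = (\<lambda>x\<in>T_space d N n. \<lambda>l. \<Sum>w | a w \<noteq> 0. a w * \<rho> w x l)"

locale tensor_rep = monoid M for M :: "'g monoid" (structure) +
  fixes d N n and \<rho> :: "'g \<Rightarrow> tensor \<Rightarrow> tensor"
  assumes rep_closed: "w \<in> carrier M \<Longrightarrow> x \<in> T_space d N n \<Longrightarrow> \<rho> w x \<in> T_space d N n"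
    and rep_add: "w \<in> carrier M \<Longrightarrow> x \<in> T_space d N n \<Longrightarrow> y \<in> T_space d N n \<Longrightarrow>
      \<rho> w (\<lambda>l. x l + y l) = (\<lambda>l. \<rho> w x l + \<rho> w y l)"
    and rep_scale: "w \<in> carrier M \<Longrightarrow> x \<in> T_space d N n \<Longrightarrow> \<rho> w (\<lambda>l. c * x l) = (\<lambda>l. c * \<rho> w x l)"
    and rep_mult: "u \<in> carrier M \<Longrightarrow> v \<in> carrier M \<Longrightarrow> x \<in> T_space d N n \<Longrightarrow> \<rho> (u \<otimes> v) x = \<rho> u (\<rho> v x)"
    and rep_one: "x \<in> T_space d N n \<Longrightarrow> \<rho> \<one> x = x"
begin

lemma rep_restrict: "w \<in> carrier M \<Longrightarrow> restrict (\<rho> w) (T_space d N n) \<in> carrier (T_End d N n)"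
  by (auto simp: rep_closed rep_add rep_scale T_space_add T_space_scale)

lemma rep_sum:
  assumes "w \<in> carrier M" "\<And>i. i \<in> I \<Longrightarrow> x i \<in> T_space d N n"
  shows "\<rho> w (\<lambda>l. \<Sum>i\<in>I. c i * x i l) = (\<lambda>l. \<Sum>i\<in>I. c i * \<rho> w (x i) l)"
  using T_End_apply_sum[OF rep_restrict, of w I x c] assms
  by (simp add: T_space_sum T_space_scale)

lemma rep_ext_closed: "a \<in> carrier (monoid_algebra M) \<Longrightarrow> x \<in> T_space d N n \<Longrightarrow>
    (\<lambda>l. \<Sum>w | a w \<noteq> 0. a w * \<rho> w x l) \<in> T_space d N n"
  by (auto intro!: T_space_sum T_space_scale rep_closed)

lemma rep_ext_alg_hom: "rep_ext d N n \<rho> \<in> alg_hom (monoid_algebra M) (T_End d N n)"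
proof (rule alg_homI, goal_cases)
  case (1 a)
  then have c: "{w. a w \<noteq> 0} \<subseteq> carrier M" by simp
  have "(\<Sum>w | a w \<noteq> 0. a w * \<rho> w (\<lambda>l. x l + y l) l)
      = (\<Sum>w | a w \<noteq> 0. a w * \<rho> w x l) + (\<Sum>w | a w \<noteq> 0. a w * \<rho> w y l)"
    if "x \<in> T_space d N n" "y \<in> T_space d N n" for x y l
    using c that by (subst sum.distrib[symmetric], intro sum.cong refl) (auto simp: rep_add distrib_left)
  moreover have "(\<Sum>w | a w \<noteq> 0. a w * \<rho> w (\<lambda>l. e * x l) l) = e * (\<Sum>w | a w \<noteq> 0. a w * \<rho> w x l)"
    if "x \<in> T_space d N n" for x l e
    using c that by (subst sum_distrib_left, intro sum.cong refl) (auto simp: rep_scale)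
  ultimately show ?case
    using rep_ext_closed[OF 1] by (auto simp: rep_ext_def T_space_add T_space_scale)
next
  case (2 a b)
  show ?case
  proof (rule extensionalityI[of _ "T_space d N n"])
    fix x assume x: "x \<in> T_space d N n"
    show "rep_ext d N n \<rho> (a \<otimes>\<^bsub>monoid_algebra M\<^esub> b) x
        = (rep_ext d N n \<rho> a \<otimes>\<^bsub>T_End d N n\<^esub> rep_ext d N n \<rho> b) x"
    proof
      fix l
      have "rep_ext d N n \<rho> (a \<otimes>\<^bsub>monoid_algebra M\<^esub> b) x l
          = (\<Sum>u | a u \<noteq> 0. \<Sum>v | b v \<noteq> 0. a u * b v * \<rho> (u \<otimes> v) x l)"
        using 2 x monoid_algebra_linear_sum[of a b M "\<lambda>w. \<rho> w x l"] by (simp add: rep_ext_def)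
      also have "\<dots> = (\<Sum>u | a u \<noteq> 0. a u * \<rho> u (\<lambda>l. \<Sum>v | b v \<noteq> 0. b v * \<rho> v x l) l)"
      proof (intro sum.cong refl)
        fix u assume "u \<in> {u. a u \<noteq> 0}"
        then have u: "u \<in> carrier M" using 2 by auto
        have v: "v \<in> carrier M" if "b v \<noteq> 0" for v using 2 that by auto
        show "(\<Sum>v | b v \<noteq> 0. a u * b v * \<rho> (u \<otimes> v) x l)
            = a u * \<rho> u (\<lambda>l. \<Sum>v | b v \<noteq> 0. b v * \<rho> v x l) l"
          by (subst rep_sum[OF u]) (use x u v in \<open>auto simp: rep_closed rep_mult sum_distrib_left mult.assoc\<close>)
      qed
      also have "\<dots> = (rep_ext d N n \<rho> a \<otimes>\<^bsub>T_End d N n\<^esub> rep_ext d N n \<rho> b) x l"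
        using x rep_ext_closed[OF 2(2) x] by (simp add: rep_ext_def compose_def)
      finally show "rep_ext d N n \<rho> (a \<otimes>\<^bsub>monoid_algebra M\<^esub> b) x l
          = (rep_ext d N n \<rho> a \<otimes>\<^bsub>T_End d N n\<^esub> rep_ext d N n \<rho> b) x l" .
    qed
  qed (simp_all add: rep_ext_def compose_def)
next
  case (3 a b)
  let ?U = "{w. a w \<noteq> 0} \<union> {w. b w \<noteq> 0}"
  have U: "finite ?U" using 3 by simp
  have s: "(\<Sum>w | e w \<noteq> 0. e w * g w) = (\<Sum>w\<in>?U. e w * g w)"
    if "{w. e w \<noteq> 0} \<subseteq> ?U" for e g :: "_ \<Rightarrow> kq"
    using that by (intro sum.mono_neutral_left U) auto
  have "(\<Sum>w | a w + b w \<noteq> 0. (a w + b w) * g w) = (\<Sum>w | a w \<noteq> 0. a w * g w) + (\<Sum>w | b w \<noteq> 0. b w * g w)"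
    for g :: "_ \<Rightarrow> kq"
    by (subst (1 2 3) s) (auto simp: sum.distrib distrib_right)
  then show ?case by (auto simp: rep_ext_def restrict_def)
next
  case 4
  show ?case by (rule extensionalityI[of _ "T_space d N n"]) (auto simp: rep_ext_def rep_one)
next
  case (5 c a)
  have "(\<Sum>w | c * a w \<noteq> 0. c * a w * g w) = c * (\<Sum>w | a w \<noteq> 0. a w * g w)" for g :: "_ \<Rightarrow> kq"
    by (cases "c = 0") (simp_all add: sum_distrib_left mult.assoc)
  then show ?case by (auto simp: rep_ext_def restrict_def simp del: mult_eq_0_iff)
qed

lemma rep_ext_delta: "x \<in> T_space d N n \<Longrightarrow> rep_ext d N n \<rho> (delta w) x = \<rho> w x"
  by (simp add: rep_ext_def)

end

subsection \<open>Action of the quantum group\<close>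

primrec gop :: "qgen \<Rightarrow> tensor \<Rightarrow> tensor" where
  "gop (QE b i) = opE b i"
| "gop (QF b i) = opF b i"
| "gop (QK b i) = opK b i"
| "gop (QKi b i) = opKi b i"

text \<open>Linearity is asked on all functions, not only on \<open>T_space\<close>, so that sums
  can be pulled through an operator without membership conditions.\<close>

definition linop :: "(tensor \<Rightarrow> tensor) \<Rightarrow> bool" where
  "linop h \<longleftrightarrow> (\<forall>x y l. h (\<lambda>l. x l + y l) l = h x l + h y l) \<and> (\<forall>c x l. h (\<lambda>l. c * x l) l = c * h x l)"

lemma linop_add: "linop h \<Longrightarrow> h (\<lambda>l. x l + y l) = (\<lambda>l. h x l + h y l)"
  and linop_scale: "linop h \<Longrightarrow> h (\<lambda>l. c * x l) = (\<lambda>l. c * h x l)"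
  by (auto simp: linop_def)

lemma linop_0: "linop h \<Longrightarrow> h (\<lambda>l. 0) = (\<lambda>l. 0)"
  using linop_scale[of h 0 "\<lambda>l. 0"] by simp

lemma linop_sum: "linop h \<Longrightarrow> h (\<lambda>l. \<Sum>i\<in>I. c i * x i l) = (\<lambda>l. \<Sum>i\<in>I. c i * h (x i) l)"
  by (induction I rule: infinite_finite_induct) (simp_all add: linop_0 linop_add[of h] linop_scale[of h])

lemma linop_comp:
  assumes h: "linop h" and k: "linop k" shows "linop (\<lambda>x. h (k x))"
  unfolding linop_def linop_add[OF k] linop_scale[OF k] linop_add[OF h] linop_scale[OF h] by simp

lemma linop_gop: "linop (gop g)"
  by (cases g) (simp_all add: linop_def opE_add opE_scale opF_add opF_scale opK_def opKi_def algebra_simps)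

lemma linop_sg: "linop (sg k)" and linop_sgi: "linop (sgi k)" and linop_ta: "linop (ta \<zeta> k)"
  by (simp_all add: linop_def sg_add sg_scale sgi_add sgi_scale ta_def algebra_simps)

lemma finite_V_basis: "finite (V_basis d N)"
  by (simp add: V_basis_def)

lemma T_basis_Suc: "T_basis d N (Suc n) = (\<lambda>(c, m). c # m) ` (V_basis d N \<times> T_basis d N n)"
proof (intro equalityI subsetI)
  fix l assume "l \<in> T_basis d N (Suc n)"
  then show "l \<in> (\<lambda>(c, m). c # m) ` (V_basis d N \<times> T_basis d N n)"
    by (cases l) (auto simp: T_basis_def image_iff)
qed (auto simp: T_basis_def)

lemma T_basis_0: "T_basis d N 0 = {[]}"
  by (auto simp: T_basis_def)

lemma finite_T_basis: "finite (T_basis d N n)"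
  by (induction n) (auto simp: T_basis_Suc T_basis_0 finite_V_basis)

lemma sum_T_basis_Suc:
  "(\<Sum>m\<in>T_basis d N (Suc n). f m) = (\<Sum>c\<in>V_basis d N. \<Sum>m\<in>T_basis d N n. f (c # m))"
proof -
  have "(\<Sum>m\<in>T_basis d N (Suc n). f m) = (\<Sum>p\<in>V_basis d N \<times> T_basis d N n. f (fst p # snd p))"
    unfolding T_basis_Suc by (subst sum.reindex) (auto simp: inj_on_def case_prod_beta)
  then show ?thesis by (simp add: sum.cartesian_product case_prod_beta)
qed

lemma T_space_expand:
  assumes "x \<in> T_space d N n" shows "x = (\<lambda>l. \<Sum>m\<in>T_basis d N n. x m * delta m l)"
proof
  fix l
  have "(\<Sum>m\<in>T_basis d N n. x m * delta m l) = (\<Sum>m\<in>T_basis d N n. delta l m * x m)"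
    by (simp add: delta_sym mult.commute)
  also have "\<dots> = x l"
  proof (cases "l \<in> T_basis d N n")
    case True
    then show ?thesis by (simp add: sum_delta_mult finite_T_basis)
  next
    case False
    then have "(\<Sum>m\<in>T_basis d N n. delta l m * x m) = 0" by (intro sum.neutral) auto
    with assms False show ?thesis by (simp add: T_space_def)
  qed
  finally show "x l = (\<Sum>m\<in>T_basis d N n. x m * delta m l)" by simp
qed

lemma T_space_slice: "x \<in> T_space d N (Suc n) \<Longrightarrow> (\<lambda>l. x (c # l)) \<in> T_space d N n"
  by (auto simp: T_space_def T_basis_def)

lemma T_space_slice_0: "x \<in> T_space d N n \<Longrightarrow> c \<notin> V_basis d N \<Longrightarrow> x (c # l) = 0"
  by (auto simp: T_space_def T_basis_def)

lemma delta_T_space: "m \<in> T_basis d N n \<Longrightarrow> delta m \<in> T_space d N n"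
  by (auto simp: T_space_def delta_def)

lemma op_tensor_Nil: "op_tensor d N n f g x [] = 0"
  by (simp add: op_tensor_def lin_ext_def vec_tensor_def)

lemma op_tensor_eq:
  assumes g: "\<And>y. y \<in> T_space d N n \<Longrightarrow> g y = h y" and h: "linop h" and x: "x \<in> T_space d N (Suc n)"
  shows "op_tensor d N n f g x (a # l) = (\<Sum>c\<in>V_basis d N. f (delta c) a * h (\<lambda>m. x (c # m)) l)"
proof -
  have "op_tensor d N n f g x (a # l)
      = (\<Sum>c\<in>V_basis d N. f (delta c) a * (\<Sum>m\<in>T_basis d N n. x (c # m) * h (delta m) l))"
    by (simp add: op_tensor_def lin_ext_def vec_tensor_def sum_T_basis_Suc g delta_T_space sum_distrib_left mult_ac)
  moreover have "(\<Sum>m\<in>T_basis d N n. x (c # m) * h (delta m) l) = h (\<lambda>m. x (c # m)) l" for c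
    using arg_cong[OF T_space_expand[OF T_space_slice[OF x, of c]], of h]
    by (simp add: linop_sum[OF h])
  ultimately show ?thesis by simp
qed

lemma V_word_Nil: "V_word d N [] v = v"
  by (simp add: V_word_def word_op_def)

lemma lin_ext_delta: "finite B \<Longrightarrow> c \<in> B \<Longrightarrow> lin_ext B \<phi> (delta c) = \<phi> c"
  by (auto simp: lin_ext_def sum_delta_mult)

lemma lin_ext_scale_delta: "finite B \<Longrightarrow> c \<in> B \<Longrightarrow> lin_ext B \<phi> (\<lambda>l. s * delta c l) = (\<lambda>l. s * \<phi> c l)"
  by (auto simp: lin_ext_def sum_delta_mult mult.assoc simp flip: sum_distrib_left)

lemma V_word_single: "c \<in> V_basis d N \<Longrightarrow> V_word d N [g] (delta c) = V_gen_basis g c"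
  by (simp add: V_word_def word_op_def lin_ext_delta finite_V_basis)

lemma sum_V_basis_delta:
  assumes "x \<in> T_space d N (Suc n)" "linop h"
  shows "(\<Sum>c\<in>V_basis d N. s c * delta c a * h (\<lambda>m. x (c # m)) l) = s a * h (\<lambda>m. x (a # m)) l"
proof -
  have "(\<Sum>c\<in>V_basis d N. s c * delta c a * h (\<lambda>m. x (c # m)) l)
      = (\<Sum>c\<in>V_basis d N. delta a c * (s c * h (\<lambda>m. x (c # m)) l))"
    by (simp add: delta_sym mult_ac)
  also have "\<dots> = s a * h (\<lambda>m. x (a # m)) l"
  proof (cases "a \<in> V_basis d N")
    case True
    then show ?thesis by (simp add: sum_delta_mult finite_V_basis)
  next
    case False
    then have "(\<lambda>m. x (a # m)) = (\<lambda>m. 0)" using T_space_slice_0[OF assms(1)] by auto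
    moreover from False have "(\<Sum>c\<in>V_basis d N. delta a c * (s c * h (\<lambda>m. x (c # m)) l)) = 0"
      by (intro sum.neutral) auto
    ultimately show ?thesis using assms(2) by (simp add: linop_0)
  qed
  finally show ?thesis .
qed

lemma gop_T_space:
  assumes "g \<in> U_gens d N" "x \<in> T_space d N n" shows "gop g x \<in> T_space d N n"
proof -
  have E: "opE b i x l = 0" if "(b, i) \<in> V_basis d N" "l \<notin> T_basis d N n" "x \<in> T_space d N n" for b i x l n
    using that
  proof (induction l arbitrary: n x)
    case (Cons a l)
    show ?case
    proof (cases n)
      case 0
      with Cons.prems have "x (c # l') = 0" for c l' by (simp add: T_space_def T_basis_0)
      then show ?thesis by simp
    next
      case (Suc n')
      show ?thesis
      proof (cases "a \<in> V_basis d N")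
        case True
        then have l: "l \<notin> T_basis d N n'" using Cons.prems Suc by (auto simp: T_basis_def)
        then have "x (c # l) = 0" for c using Cons.prems Suc by (auto simp: T_space_def T_basis_def)
        with Cons.IH[OF Cons.prems(1) l T_space_slice] Cons.prems Suc show ?thesis by auto
      next
        case False
        with Cons.prems show ?thesis by (auto simp: T_space_slice_0)
      qed
    qed
  qed simp
  have F: "opF b i x l = 0" if "(b, Suc i) \<in> V_basis d N" "l \<notin> T_basis d N n" "x \<in> T_space d N n" for b i x l n
    using that
  proof (induction l arbitrary: n x)
    case (Cons a l)
    show ?case
    proof (cases n)
      case 0
      with Cons.prems have "x (c # l') = 0" for c l' by (simp add: T_space_def T_basis_0)
      then show ?thesis by simp
    next
      case (Suc n')
      show ?thesis
      proof (cases "a \<in> V_basis d N")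
        case True
        then have l: "l \<notin> T_basis d N n'" using Cons.prems Suc by (auto simp: T_basis_def)
        then have "x (c # l) = 0" for c using Cons.prems Suc by (auto simp: T_space_def T_basis_def)
        with Cons.IH[OF Cons.prems(1) l T_space_slice] Cons.prems Suc show ?thesis by auto
      next
        case False
        with Cons.prems show ?thesis by (auto simp: T_space_slice_0)
      qed
    qed
  qed simp
  show ?thesis
    using assms E F
    by (cases g) (auto simp: U_gens_def V_basis_def T_space_def opK_def opKi_def)
qed

text \<open>The bridge from the action as defined through \<open>comul\<close> to the rank-free
  operators in which all computations take place. It needs \<open>x\<close> to be supported on the
  basis, since \<open>gop\<close> does not see the ranks.\<close>

lemma T_gen_eq:
  assumes g: "g \<in> U_gens d N" and x: "x \<in> T_space d N n"
  shows "T_gen d N n g x = gop g x"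
  using g x
proof (induction n arbitrary: g x)
  case 0
  show ?case
  proof
    fix l show "T_gen d N 0 g x l = gop g x l"
      using gop_T_space[OF 0] 0
      by (cases "l = []"; cases g) (auto simp: T_space_def T_basis_0 opK_def opKi_def)
  qed
next
  case (Suc n)
  note x = Suc.prems(2)
  have K: "word_op (T_gen d N n) [g1, g2] y = gop g1 (gop g2 y)"
    if "g1 \<in> U_gens d N" "g2 \<in> U_gens d N" "y \<in> T_space d N n" for g1 g2 y
    using that by (simp add: word_op_def Suc.IH gop_T_space)
  have S: "word_op (T_gen d N n) [g] y = gop g y" if "g \<in> U_gens d N" "y \<in> T_space d N n" for g y
    using that by (simp add: word_op_def Suc.IH)
  have I: "word_op (T_gen d N n) [] y = y" for y by (simp add: word_op_def)
  have lid: "linop (\<lambda>y. y)" by (simp add: linop_def)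
  have lin2: "linop (\<lambda>y. gop g1 (gop g2 y))" for g1 g2
    by (rule linop_comp[OF linop_gop linop_gop])
  show ?case
  proof
    fix l show "T_gen d N (Suc n) g x l = gop g x l"
    proof (cases l)
      case Nil
      then show ?thesis using x by (cases g) (auto simp: op_tensor_Nil opK_def opKi_def T_space_def T_basis_def)
    next
      case l: (Cons a l')
      show ?thesis
      proof (cases g)
        case (QE b i)
        then have mem: "QK b i \<in> U_gens d N" "QKi b (Suc i) \<in> U_gens d N" "(b, Suc i) \<in> V_basis d N" "QE b i \<in> U_gens d N"
          using Suc.prems by (auto simp: U_gens_def V_basis_def)
        have "T_gen d N (Suc n) g x l
            = (\<Sum>c\<in>V_basis d N. V_gen_basis (QE b i) c a * opK b i (opKi b (Suc i) (\<lambda>m. x (c # m))) l')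
             + (\<Sum>c\<in>V_basis d N. delta c a * opE b i (\<lambda>m. x (c # m)) l')"
          using mem op_tensor_eq[OF K lin2 x, of "QK b i" "QKi b (Suc i)"]
            op_tensor_eq[OF S linop_gop x, of "QE b i"]
          by (simp add: QE l V_word_single V_word_Nil)
        also have "(\<Sum>c\<in>V_basis d N. delta c a * opE b i (\<lambda>m. x (c # m)) l') = opE b i (\<lambda>m. x (a # m)) l'"
          using sum_V_basis_delta[OF x linop_gop, of "\<lambda>_. 1" a "QE b i" l'] by simp
        also have "(\<Sum>c\<in>V_basis d N. V_gen_basis (QE b i) c a * opK b i (opKi b (Suc i) (\<lambda>m. x (c # m))) l')
            = (\<Sum>c\<in>V_basis d N. delta (b, Suc i) c * ((if a = (b, i) then kap b i l' * x (c # l') else 0)))"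
          by (intro sum.cong refl) (auto simp: delta_def opK_def opKi_def kap_eq)
        also have "\<dots> = (if a = (b, i) then kap b i l' * x ((b, Suc i) # l') else 0)"
          using mem(3) by (subst sum_delta_mult) (auto simp: finite_V_basis)
        finally show ?thesis by (simp add: QE l)
      next
        case (QF b i)
        then have mem: "QKi b i \<in> U_gens d N" "QK b (Suc i) \<in> U_gens d N" "(b, i) \<in> V_basis d N" "QF b i \<in> U_gens d N"
          using Suc.prems by (auto simp: U_gens_def V_basis_def)
        have V2: "V_word d N [QKi b i, QK b (Suc i)] (delta c) = (\<lambda>l. inverse (wtk b i c) * delta c l)"
          if "c \<in> V_basis d N" for c
          using that by (simp add: V_word_def word_op_def lin_ext_delta lin_ext_scale_delta finite_V_basis wtk_def)
        have "T_gen d N (Suc n) g x l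
            = (\<Sum>c\<in>V_basis d N. V_gen_basis (QF b i) c a * x (c # l'))
             + (\<Sum>c\<in>V_basis d N. inverse (wtk b i c) * delta c a * opF b i (\<lambda>m. x (c # m)) l')"
          using mem op_tensor_eq[OF I lid x]
            op_tensor_eq[OF S linop_gop x, of "QF b i"]
          by (simp add: QF l V_word_single V2)
        also have "(\<Sum>c\<in>V_basis d N. inverse (wtk b i c) * delta c a * opF b i (\<lambda>m. x (c # m)) l')
            = inverse (wtk b i a) * opF b i (\<lambda>m. x (a # m)) l'"
          using sum_V_basis_delta[OF x linop_gop, of "\<lambda>c. inverse (wtk b i c)" a "QF b i" l'] by simp
        also have "(\<Sum>c\<in>V_basis d N. V_gen_basis (QF b i) c a * x (c # l'))
            = (\<Sum>c\<in>V_basis d N. delta (b, i) c * (if a = (b, Suc i) then x (c # l') else 0))"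
          by (intro sum.cong refl) (auto simp: delta_def)
        also have "\<dots> = (if a = (b, Suc i) then x ((b, i) # l') else 0)"
          using mem(3) by (subst sum_delta_mult) (auto simp: finite_V_basis)
        finally show ?thesis by (simp add: QF l)
      next
        case (QK b i)
        have "T_gen d N (Suc n) g x l
            = (\<Sum>c\<in>V_basis d N. wt1 b i c * delta c a * opK b i (\<lambda>m. x (c # m)) l')"
          using Suc.prems op_tensor_eq[OF S linop_gop x, of "QK b i"]
          by (simp add: QK l V_word_single wt1_def)
        then show ?thesis
          using sum_V_basis_delta[OF x linop_gop, of "wt1 b i" a "QK b i" l']
          by (simp add: QK l opK_def mult.assoc)
      next
        case (QKi b i)
        have "T_gen d N (Suc n) g x l
            = (\<Sum>c\<in>V_basis d N. inverse (wt1 b i c) * delta c a * opKi b i (\<lambda>m. x (c # m)) l')"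
          using Suc.prems op_tensor_eq[OF S linop_gop x, of "QKi b i"]
          by (simp add: QKi l V_word_single wt1_def) (intro sum.cong refl, auto)
        then show ?thesis
          using sum_V_basis_delta[OF x linop_gop, of "\<lambda>c. inverse (wt1 b i c)" a "QKi b i" l']
          by (simp add: QKi l opKi_def mult.assoc)
      qed
    qed
  qed
qed

lemma word_op_simps [simp]:
  "word_op \<rho> [] = id" "word_op \<rho> (g # w) = \<rho> g \<circ> word_op \<rho> w"
  by (simp_all add: word_op_def)

lemma word_op_append: "word_op \<rho> (u @ v) = word_op \<rho> u \<circ> word_op \<rho> v"
  by (induction u) auto

lemma word_op_closed:
  assumes "\<And>g x. g \<in> X \<Longrightarrow> x \<in> T_space d N n \<Longrightarrow> \<rho> g x \<in> T_space d N n"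
    and "w \<in> lists X" "x \<in> T_space d N n"
  shows "word_op \<rho> w x \<in> T_space d N n"
  using assms(2) by (induction w) (use assms(1,3) in auto)

lemma T_free_act_eq: "T_free_act d N n = rep_ext d N n (word_op (T_gen d N n))"
  by (simp add: T_free_act_def rep_ext_def fun_eq_iff)

lemma monoid_free_monoid: "monoid (free_monoid X)"
  by (rule monoidI) (auto simp: free_monoid_def)

lemma word_op_T_gen:
  "w \<in> lists (U_gens d N) \<Longrightarrow> x \<in> T_space d N n \<Longrightarrow> word_op (T_gen d N n) w x = word_op gop w x"
  by (induction w) (auto simp: T_gen_eq word_op_closed[where X = "U_gens d N"] gop_T_space)

lemma linop_word_op:
  assumes "\<And>g. linop (\<rho> g)" shows "linop (word_op \<rho> w)"
proof (induction w)
  case Nil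
  show ?case by (simp add: linop_def)
next
  case (Cons g w)
  from linop_comp[OF assms this, of g] show ?case by (simp add: comp_def)
qed

lemma tensor_rep_U: "tensor_rep (free_monoid (U_gens d N)) d N n (word_op (T_gen d N n))"
proof -
  interpret monoid "free_monoid (U_gens d N)" by (rule monoid_free_monoid)
  note lin = linop_word_op[of gop, OF linop_gop]
  show ?thesis
  proof (unfold_locales, goal_cases)
    case (1 w x)
    then show ?case
      by (auto simp: free_monoid_def word_op_T_gen intro!: word_op_closed gop_T_space)
  next
    case (2 w x y)
    then show ?case
      by (simp add: free_monoid_def word_op_T_gen T_space_add linop_add[OF lin])
  next
    case (3 w x c)
    then show ?case
      by (simp add: free_monoid_def word_op_T_gen T_space_scale linop_scale[OF lin])
  qed (simp_all add: free_monoid_def word_op_append)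
qed

lemma T_free_act_alg_hom: "T_free_act d N n \<in> alg_hom (U_free d N) (T_End d N n)"
  unfolding T_free_act_eq U_free_def by (rule tensor_rep.rep_ext_alg_hom[OF tensor_rep_U])

lemma kalg_U_free: "kalg (U_free d N)"
  unfolding U_free_def by (intro kalg_monoid_algebra monoid_free_monoid)

lemma delta_U_free: "w \<in> lists (U_gens d N) \<Longrightarrow> delta w \<in> carrier (U_free d N)"
  by (simp add: U_free_def free_monoid_def)

lemma U_gens_simps:
  "QE b i \<in> U_gens d N \<longleftrightarrow> b \<in> {1..d} \<and> i \<in> {1..<N b}"
  "QF b i \<in> U_gens d N \<longleftrightarrow> b \<in> {1..d} \<and> i \<in> {1..<N b}"
  "QK b i \<in> U_gens d N \<longleftrightarrow> b \<in> {1..d} \<and> i \<in> {1..N b}"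
  "QKi b i \<in> U_gens d N \<longleftrightarrow> b \<in> {1..d} \<and> i \<in> {1..N b}"
  by (auto simp: U_gens_def)

context
  fixes d :: nat and N :: "nat \<Rightarrow> nat" and n :: nat
begin

interpretation A: kalg "U_free d N" by (rule kalg_U_free)

lemma T_free_act_delta:
  "w \<in> lists (U_gens d N) \<Longrightarrow> x \<in> T_space d N n \<Longrightarrow> T_free_act d N n (delta w) x = word_op gop w x"
  by (simp add: T_free_act_eq tensor_rep.rep_ext_delta[OF tensor_rep_U] word_op_T_gen)

lemma T_free_act_minus:
  assumes "a \<in> carrier (U_free d N)" "b \<in> carrier (U_free d N)" "x \<in> T_space d N n"
  shows "T_free_act d N n (a \<ominus>\<^bsub>U_free d N\<^esub> b) x l = T_free_act d N n a x l - T_free_act d N n b x l"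
  using assms alg_homD(3)[OF T_free_act_alg_hom]
  by (simp add: alg_hom_minus[OF kalg_U_free kalg_T_End T_free_act_alg_hom] T_End_minus del: T_End_simps)

lemma T_free_act_add:
  assumes "a \<in> carrier (U_free d N)" "b \<in> carrier (U_free d N)" "x \<in> T_space d N n"
  shows "T_free_act d N n (a \<oplus>\<^bsub>U_free d N\<^esub> b) x l = T_free_act d N n a x l + T_free_act d N n b x l"
  using assms by (simp add: alg_homD(5)[OF T_free_act_alg_hom])

lemma T_free_act_smult:
  assumes "a \<in> carrier (U_free d N)" "x \<in> T_space d N n"
  shows "T_free_act d N n (c \<odot>\<^bsub>U_free d N\<^esub> a) x l = c * T_free_act d N n a x l"
  using assms by (simp add: alg_homD(2)[OF T_free_act_alg_hom])

lemma T_free_act_one: "x \<in> T_space d N n \<Longrightarrow> T_free_act d N n \<one>\<^bsub>U_free d N\<^esub> x = x"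
  by (simp add: alg_homD(6)[OF T_free_act_alg_hom])

lemmas T_free_act_simps = T_free_act_delta T_free_act_minus T_free_act_add T_free_act_smult T_free_act_one

text \<open>Makes the free action descend to \<open>Uq\<close>: each of the eleven families of
  defining relations is one of the operator identities established above.\<close>

lemma U_rels_vanish:
  assumes "r \<in> U_rels d N"
  shows "r \<in> carrier (U_free d N) \<and> (\<forall>x\<in>T_space d N n. \<forall>l. T_free_act d N n r x l = 0)"
  using assms unfolding U_rels_def Let_def serre_def
  apply (elim UnE CollectE exE conjE)
            subgoal for b i
              by (simp add: T_free_act_simps delta_U_free U_gens_simps opK_def opKi_def)
           subgoal for b i
             by (simp add: T_free_act_simps delta_U_free U_gens_simps opK_def opKi_def)
          subgoal for b i c j
            by (simp add: T_free_act_simps delta_U_free U_gens_simps opK_def mult.left_commute)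
         subgoal for b i c j
           by (simp add: T_free_act_simps delta_U_free U_gens_simps opK_opE)
        subgoal for b i c j
          by (simp add: T_free_act_simps delta_U_free U_gens_simps opK_opF)
       subgoal for b i
         by (simp add: T_free_act_simps delta_U_free U_gens_simps opE_opF_commutator)
            (simp add: opK_def opKi_def kap_eq algebra_simps)
      subgoal for b i c j
        by (simp add: T_free_act_simps delta_U_free U_gens_simps opE_opF_commute)
     subgoal for b i c j
       using opE_opE_commute[of b c i j]
       by (simp add: T_free_act_simps delta_U_free U_gens_simps)
    subgoal for b i c j
      using opF_opF_commute[of b c i j]
      by (simp add: T_free_act_simps delta_U_free U_gens_simps)
   subgoal for b i j
     using opE_serre[of i j b]
     by (simp add: T_free_act_simps delta_U_free U_gens_simps)
  subgoal for b i j
    using opF_serre[of i j b]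
    by (simp add: T_free_act_simps delta_U_free U_gens_simps)
  done

lemma U_rels_carrier: "U_rels d N \<subseteq> carrier (U_free d N)"
  using U_rels_vanish by blast

lemma T_act_quot_map:
  assumes "a \<in> carrier (U_free d N)"
  shows "T_act d N n (quot_map (U_free d N) (U_rels d N) a) = T_free_act d N n a"
proof -
  have "T_free_act d N n r = \<zero>\<^bsub>T_End d N n\<^esub>" if "r \<in> U_rels d N" for r
  proof (rule extensionalityI[of _ "T_space d N n"])
    show "T_free_act d N n r x = \<zero>\<^bsub>T_End d N n\<^esub> x" if "x \<in> T_space d N n" for x
      using U_rels_vanish[OF \<open>r \<in> U_rels d N\<close>] that by auto
  qed (simp_all add: T_free_act_def)
  then show ?thesis
    unfolding T_act_def
    by (intro A.quot_lift_apply[OF U_rels_carrier kalg_T_End T_free_act_alg_hom _ assms]) auto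
qed

text \<open>Generators suffice, because every coset is represented by a combination of words. Later
  arguments use the quantum group only through this criterion.\<close>

lemma End_Uq_carrier_iff:
  "f \<in> carrier (End_Uq d N n) \<longleftrightarrow>
     f \<in> carrier (T_End d N n) \<and> (\<forall>g\<in>U_gens d N. \<forall>x\<in>T_space d N n. f (gop g x) = gop g (f x))"
proof (intro iffI conjI ballI)
  assume f: "f \<in> carrier (End_Uq d N n)"
  then show "f \<in> carrier (T_End d N n)" by (simp add: End_Uq_def)
  fix g x assume g: "g \<in> U_gens d N" and x: "x \<in> T_space d N n"
  have d: "delta [g] \<in> carrier (U_free d N)" using g by (simp add: delta_U_free)
  have "quot_map (U_free d N) (U_rels d N) (delta [g]) \<in> carrier (Uq d N)"
    unfolding Uq_def by (rule A.quot_map_closed[OF U_rels_carrier d])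
  with f x have "f (T_free_act d N n (delta [g]) x) = T_free_act d N n (delta [g]) (f x)"
    by (auto simp: End_Uq_def T_act_quot_map[OF d] simp del: T_End_simps)
  moreover have "f x \<in> T_space d N n" using f x by (auto simp: End_Uq_def)
  ultimately show "f (gop g x) = gop g (f x)"
    using g x by (simp add: T_free_act_delta)
next
  assume "f \<in> carrier (T_End d N n) \<and> (\<forall>g\<in>U_gens d N. \<forall>x\<in>T_space d N n. f (gop g x) = gop g (f x))"
  then have f: "f \<in> carrier (T_End d N n)" and c: "\<And>g x. g \<in> U_gens d N \<Longrightarrow> x \<in> T_space d N n \<Longrightarrow> f (gop g x) = gop g (f x)"
    by auto
  have fW: "f x \<in> T_space d N n" if "x \<in> T_space d N n" for x using f that by auto
  have cw: "f (word_op gop w x) = word_op gop w (f x) \<and> word_op gop w x \<in> T_space d N n"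
    if "w \<in> lists (U_gens d N)" "x \<in> T_space d N n" for w x
    using that by (induction w) (simp_all add: c gop_T_space)
  have "f (T_free_act d N n a x) = T_free_act d N n a (f x)"
    if a: "a \<in> carrier (U_free d N)" and x: "x \<in> T_space d N n" for a x
  proof -
    have w: "w \<in> lists (U_gens d N)" if "a w \<noteq> 0" for w
      using a that by (auto simp: U_free_def free_monoid_def)
    have "f (\<lambda>l. \<Sum>w | a w \<noteq> 0. a w * word_op gop w x l) = (\<lambda>l. \<Sum>w | a w \<noteq> 0. a w * f (word_op gop w x) l)"
      using w x cw by (intro T_End_apply_sum[OF f]) auto
    moreover have "T_free_act d N n a y = (\<lambda>l. \<Sum>w | a w \<noteq> 0. a w * word_op gop w y l)"
      if "y \<in> T_space d N n" for y
      using that w by (auto simp: T_free_act_def word_op_T_gen intro!: ext sum.cong)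
    ultimately show ?thesis using w x cw fW by (auto intro!: ext sum.cong)
  qed
  then show "f \<in> carrier (End_Uq d N n)"
    using f by (auto simp: End_Uq_def Uq_def A.quot_carrier[OF U_rels_carrier] T_act_quot_map
        simp del: quot_alg_simps T_End_simps)
qed

end

lemma End_Uq_simps [simp]:
  "f \<otimes>\<^bsub>End_Uq d N n\<^esub> g = compose (T_space d N n) f g"
  "\<one>\<^bsub>End_Uq d N n\<^esub> = (\<lambda>x\<in>T_space d N n. x)"
  "f \<oplus>\<^bsub>End_Uq d N n\<^esub> g = (\<lambda>x\<in>T_space d N n. \<lambda>l. f x l + g x l)"
  "c \<odot>\<^bsub>End_Uq d N n\<^esub> f = (\<lambda>x\<in>T_space d N n. \<lambda>l. c * f x l)"
  by (simp_all add: End_Uq_def T_End_def Let_def)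

subsection \<open>Groups given by generators and relations\<close>

context
  fixes X :: "'g set" and R :: "(('g \<times> bool) list \<times> ('g \<times> bool) list) set"
  assumes R: "R \<subseteq> lists (X \<times> UNIV) \<times> lists (X \<times> UNIV)"
begin

lemma pres_cong_lists:
  "pres_cong X R u v \<Longrightarrow> u \<in> lists (X \<times> UNIV) \<and> v \<in> lists (X \<times> UNIV)"
  by (induction rule: pres_cong.induct) (use R in auto)

lemma pres_class_eqI: "pres_cong X R u v \<Longrightarrow> pres_class X R u = pres_class X R v"
  by (auto simp: pres_class_def intro: pres_cong.trans pres_cong.sym)

lemma mem_pres_class: "w \<in> lists (X \<times> UNIV) \<Longrightarrow> w \<in> pres_class X R w"
  by (simp add: pres_class_def pres_cong.refl)

lemma presented_group_mult:
  assumes "u \<in> lists (X \<times> UNIV)" "v \<in> lists (X \<times> UNIV)"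
  shows "pres_class X R u \<otimes>\<^bsub>presented_group X R\<^esub> pres_class X R v = pres_class X R (u @ v)"
proof -
  have "pres_class X R (u' @ v') = pres_class X R (u @ v)"
    if "u' \<in> pres_class X R u" "v' \<in> pres_class X R v" for u' v'
    using that by (intro pres_class_eqI) (auto simp: pres_class_def intro: pres_cong.append pres_cong.sym)
  then have "(\<Union>u'\<in>pres_class X R u. \<Union>v'\<in>pres_class X R v. pres_class X R (u' @ v'))
      = (\<Union>u'\<in>pres_class X R u. \<Union>v'\<in>pres_class X R v. pres_class X R (u @ v))"
    by (intro SUP_cong refl)
  also have "\<dots> = pres_class X R (u @ v)"
  proof -
    have "pres_class X R u \<noteq> {}" "pres_class X R v \<noteq> {}"
      using mem_pres_class[OF assms(1)] mem_pres_class[OF assms(2)] by blast+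
    then show ?thesis by (simp only: UN_constant if_False)
  qed
  finally show ?thesis by (simp add: presented_group_def)
qed

lemma pres_cong_inverse:
  "w \<in> lists (X \<times> UNIV) \<Longrightarrow> pres_cong X R (map (\<lambda>(x, e). (x, \<not> e)) (rev w) @ w) []"
proof (induction w)
  case Nil
  show ?case by (simp add: pres_cong.refl)
next
  case (Cons g w)
  obtain x e where g: "g = (x, e)" by (cases g)
  let ?iw = "map (\<lambda>(x, e). (x, \<not> e)) (rev w)"
  have iw: "?iw \<in> lists (X \<times> UNIV)" using Cons.prems by auto
  have "pres_cong X R [(x, \<not> e), (x, e)] []"
    using Cons.prems pres_cong.cancel[of x X R "\<not> e"] by (simp add: g)
  then have "pres_cong X R (?iw @ ([(x, \<not> e), (x, e)] @ w)) (?iw @ ([] @ w))"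
    using iw Cons.prems by (intro pres_cong.append pres_cong.refl) auto
  moreover have "pres_cong X R (?iw @ w) []" using Cons by simp
  ultimately show ?case by (auto simp: g intro: pres_cong.trans)
qed

lemma presented_group_carrier: "carrier (presented_group X R) = pres_class X R ` lists (X \<times> UNIV)"
  and presented_group_one: "\<one>\<^bsub>presented_group X R\<^esub> = pres_class X R []"
  by (simp_all add: presented_group_def)

lemma group_presented_group: "group (presented_group X R)"
proof (rule groupI, goal_cases)
  case (1 x y)
  then obtain u v where "u \<in> lists (X \<times> UNIV)" "x = pres_class X R u"
    "v \<in> lists (X \<times> UNIV)" "y = pres_class X R v" by (auto simp: presented_group_carrier)
  then show ?case by (simp only: presented_group_mult presented_group_carrier) (intro imageI, simp)
next
  case 2
  show ?case unfolding presented_group_carrier presented_group_one by (intro imageI) simp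
next
  case (3 x y z)
  then obtain u v w where "u \<in> lists (X \<times> UNIV)" "x = pres_class X R u"
    "v \<in> lists (X \<times> UNIV)" "y = pres_class X R v" "w \<in> lists (X \<times> UNIV)" "z = pres_class X R w"
    by (auto simp: presented_group_carrier)
  then show ?case by (simp add: presented_group_mult)
next
  case (4 x)
  then obtain u where "u \<in> lists (X \<times> UNIV)" "x = pres_class X R u" by (auto simp: presented_group_carrier)
  then show ?case by (simp add: presented_group_mult presented_group_one)
next
  case (5 x)
  then obtain u where u: "u \<in> lists (X \<times> UNIV)" "x = pres_class X R u" by (auto simp: presented_group_carrier)
  let ?iu = "map (\<lambda>(x, e). (x, \<not> e)) (rev u)"
  have iu: "?iu \<in> lists (X \<times> UNIV)" using u(1) by auto
  have "pres_class X R ?iu \<otimes>\<^bsub>presented_group X R\<^esub> x = pres_class X R []"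
    using presented_group_mult[OF iu u(1)] pres_class_eqI[OF pres_cong_inverse[OF u(1)]] u(2) by simp
  moreover have "pres_class X R ?iu \<in> carrier (presented_group X R)"
    unfolding presented_group_carrier using iu by (rule imageI)
  ultimately show ?case unfolding presented_group_one by blast
qed

context
  fixes d N n and \<phi> :: "'g \<times> bool \<Rightarrow> tensor \<Rightarrow> tensor"
  assumes lin: "\<And>g. linop (\<phi> g)"
    and closed: "\<And>g x. fst g \<in> X \<Longrightarrow> x \<in> T_space d N n \<Longrightarrow> \<phi> g x \<in> T_space d N n"
    and inverse: "\<And>g e x. g \<in> X \<Longrightarrow> x \<in> T_space d N n \<Longrightarrow> \<phi> (g, e) (\<phi> (g, \<not> e) x) = x"
    and rels: "\<And>u v x. (u, v) \<in> R \<Longrightarrow> x \<in> T_space d N n \<Longrightarrow> word_op \<phi> u x = word_op \<phi> v x"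
begin

lemma word_op_pres_closed:
  "w \<in> lists (X \<times> UNIV) \<Longrightarrow> x \<in> T_space d N n \<Longrightarrow> word_op \<phi> w x \<in> T_space d N n"
  by (rule word_op_closed[of "X \<times> UNIV"]) (auto simp: closed)

lemma word_op_pres_cong:
  "pres_cong X R u v \<Longrightarrow> x \<in> T_space d N n \<Longrightarrow> word_op \<phi> u x = word_op \<phi> v x"
proof (induction arbitrary: x rule: pres_cong.induct)
  case (append u v u' v')
  then show ?case
    using pres_cong_lists[OF append.hyps(2)] by (simp add: word_op_append word_op_pres_closed)
qed (auto simp: inverse rels)

text \<open>By \<open>word_op_pres_cong\<close> all words of a class act in the same way, so the
  choice made by \<open>SOME\<close> has no effect on tensors.\<close>

lemma word_op_some_pres_class:
  assumes "w \<in> lists (X \<times> UNIV)" "x \<in> T_space d N n"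
  shows "word_op \<phi> (SOME v. v \<in> pres_class X R w) x = word_op \<phi> w x"
proof -
  have "(SOME v. v \<in> pres_class X R w) \<in> pres_class X R w"
    using mem_pres_class[OF assms(1)] by (rule someI)
  then show ?thesis
    using word_op_pres_cong[of w "SOME v. v \<in> pres_class X R w" x] assms(2) by (simp add: pres_class_def)
qed

lemma tensor_rep_presented:
  "tensor_rep (presented_group X R) d N n (\<lambda>A. word_op \<phi> (SOME v. v \<in> A))"
proof -
  interpret group "presented_group X R" by (rule group_presented_group)
  note c = presented_group_carrier presented_group_one
  note l = linop_word_op[of \<phi>, OF lin]
  show ?thesis
  proof (unfold_locales, goal_cases)
    case (1 w x)
    then obtain a where a: "a \<in> lists (X \<times> UNIV)" "w = pres_class X R a" by (auto simp: c)
    with 1 show ?case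
      using word_op_some_pres_class[OF a(1), of x] word_op_pres_closed[OF a(1), of x] by simp
  next
    case (2 w x y)
    then show ?case by (simp add: linop_add[OF l])
  next
    case (3 w x c)
    then show ?case by (simp add: linop_scale[OF l])
  next
    case (4 u v x)
    then obtain a b where ab: "a \<in> lists (X \<times> UNIV)" "u = pres_class X R a"
      "b \<in> lists (X \<times> UNIV)" "v = pres_class X R b" by (auto simp: c)
    then have "a @ b \<in> lists (X \<times> UNIV)" by simp
    with ab 4 show ?case
      by (simp add: presented_group_mult word_op_some_pres_class word_op_pres_closed word_op_append)
  next
    case (5 x)
    then show ?case using word_op_some_pres_class[of "[]" x] by (simp add: c)
  qed
qed

end
end

subsection \<open>The framed braid group on tensors\<close>

fun fb_phi :: "kq \<Rightarrow> fb_gen \<times> bool \<Rightarrow> tensor \<Rightarrow> tensor" where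
  "fb_phi \<zeta> (GenS i, e) = (if e then sg (i - 1) else sgi (i - 1))"
| "fb_phi \<zeta> (GenT i, e) = ta (if e then \<zeta> else inverse \<zeta>) (i - 1)"

definition fb_rep :: "kq \<Rightarrow> fb_elt \<Rightarrow> tensor \<Rightarrow> tensor" where
  "fb_rep \<zeta> A = word_op (fb_phi \<zeta>) (SOME v. v \<in> A)"

lemma T_space_eqI:
  "x \<in> T_space d N n \<Longrightarrow> y \<in> T_space d N n \<Longrightarrow> (\<And>l. l \<in> T_basis d N n \<Longrightarrow> x l = y l) \<Longrightarrow> x = y"
  by (rule ext, case_tac "xa \<in> T_basis d N n") (simp_all add: T_space_def)

lemma T_basis_length: "l \<in> T_basis d N n \<Longrightarrow> length l = n"
  by (simp add: T_basis_def)

lemma T_basis_nth: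
  assumes "l \<in> T_basis d N n" "k < n"
  shows "fst (l ! k) \<in> {1..d} \<and> snd (l ! k) \<in> {1..N (fst (l ! k))}"
proof -
  have "l ! k \<in> V_basis d N" using assms nth_mem[of k l] by (auto simp: T_basis_def)
  then show ?thesis by (cases "l ! k") (auto simp: V_basis_def)
qed

lemma T_basis_swap:
  assumes "Suc k < length l"
  shows "l[k := l ! Suc k, Suc k := l ! k] \<in> T_basis d N n \<longleftrightarrow> l \<in> T_basis d N n"
proof -
  have "mset (l[k := l ! Suc k, Suc k := l ! k]) = mset l"
    using assms by (simp add: mset_swap)
  then have "set (l[k := l ! Suc k, Suc k := l ! k]) = set l" by (metis set_mset_mset)
  then show ?thesis by (simp add: T_basis_def)
qed

lemma sg_T_space: "x \<in> T_space d N n \<Longrightarrow> sg k x \<in> T_space d N n"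
proof -
  assume x: "x \<in> T_space d N n"
  have "sg k x l = 0" if "l \<notin> T_basis d N n" for l
  proof (cases "Suc k < length l")
    case True
    with that x show ?thesis by (simp add: sg_apply Let_def T_space_def T_basis_swap)
  next
    case False
    then have "sg k x l = x l" by (induction k x l rule: sg.induct) auto
    with that x show ?thesis by (simp add: T_space_def)
  qed
  then show ?thesis by (simp add: T_space_def)
qed

lemma sgi_apply:
  "Suc k < length l \<Longrightarrow> sgi k x l =
     (let a = l ! k; c = l ! Suc k; l' = l[k := c, Suc k := a] in
      if fst a \<noteq> fst c then x l'
      else if snd a = snd c then inverse q * x l
      else if snd a < snd c then x l' - (q - inverse q) * x l
      else x l')"
  by (induction k x l rule: sgi.induct) (auto simp: Let_def)

lemma sgi_T_space: "x \<in> T_space d N n \<Longrightarrow> sgi k x \<in> T_space d N n"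
proof -
  assume x: "x \<in> T_space d N n"
  have "sgi k x l = 0" if "l \<notin> T_basis d N n" for l
  proof (cases "Suc k < length l")
    case True
    with that x show ?thesis by (simp add: sgi_apply Let_def T_space_def T_basis_swap)
  next
    case False
    then have "sgi k x l = x l" by (induction k x l rule: sgi.induct) auto
    with that x show ?thesis by (simp add: T_space_def)
  qed
  then show ?thesis by (simp add: T_space_def)
qed

lemma ta_T_space: "x \<in> T_space d N n \<Longrightarrow> ta \<zeta> k x \<in> T_space d N n"
  by (simp add: T_space_def ta_def)

lemma fb_phi_T_space: "x \<in> T_space d N n \<Longrightarrow> fb_phi \<zeta> g x \<in> T_space d N n"
  by (cases "(\<zeta>, g)" rule: fb_phi.cases) (auto simp: sg_T_space sgi_T_space ta_T_space)

lemma linop_fb_phi: "linop (fb_phi \<zeta> g)"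
  by (cases "(\<zeta>, g)" rule: fb_phi.cases) (auto simp: linop_sg linop_sgi linop_ta)

lemma sg_gop: "sg k (gop g y) = gop g (sg k y)"
proof -
  have inv: "inverse (prod_list (map f l)) = prod_list (map (\<lambda>a. inverse (f a)) l)" for f :: "idx \<Rightarrow> kq" and l
    by (induction l) auto
  show ?thesis
    by (cases g) (simp_all add: fun_eq_iff sg_opE sg_opF sg_opK opKi_def kk_def inv sg_prod_list)
qed

lemma fb_rels_lists: "fb_rels d n \<subseteq> lists (fb_gens n \<times> UNIV) \<times> lists (fb_gens n \<times> UNIV)"
  by (auto simp: fb_rels_def fb_gens_def transpose_def)

lemma word_op_ta_replicate:
  "word_op (fb_phi \<zeta>) (replicate k (wt i)) x l = (\<zeta> ^ (fst (l ! (i - 1)) - 1)) ^ k * x l"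
  by (induction k) (simp_all add: ta_def)

text \<open>Exchanging two neighbours is an involution on lists. Hence reading off coefficients at
  \<open>l\<close>, as \<open>sg\<close> does, and mapping the basis tensor \<open>m\<close>, as
  \<open>sigma_basis\<close> does, describe the same matrix.\<close>

lemma sg_delta_sigma_basis:
  assumes "Suc k < length m" shows "sg k (delta m) l = sigma_basis (Suc k) m l"
proof -
  let ?sw = "\<lambda>m :: idx list. m[k := m ! Suc k, Suc k := m ! k]"
  have sw: "?sw (?sw l) = l" if "Suc k < length l" for l
    using that by (auto intro!: nth_equalityI simp: nth_list_update)
  obtain b j c e where bj: "m ! k = (b, j)" "m ! Suc k = (c, e)" by (metis surj_pair)
  consider "l = m" | "l = ?sw m" "l \<noteq> m" | "l \<noteq> m" "l \<noteq> ?sw m" by blast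
  then show ?thesis
  proof cases
    case 1
    have "?sw m = m \<longleftrightarrow> m ! k = m ! Suc k"
      using assms by (metis list_update_id length_list_update nth_list_update_eq nth_list_update_neq n_not_Suc_n Suc_lessD)
    then show ?thesis
      using 1 assms bj by (auto simp: sg_apply sigma_basis_def swap_factors_def Let_def delta_def)
  next
    case 2
    then have l: "Suc k < length l" "l ! k = (c, e)" "l ! Suc k = (b, j)" "?sw l = m"
      using assms bj sw[of m] by auto
    have "(c, e) \<noteq> (b, j)" using 2 bj by (metis list_update_id)
    with 2 l show ?thesis
      using bj by (auto simp: sg_apply sigma_basis_def swap_factors_def Let_def delta_def)
  next
    case 3
    have 1: "sigma_basis (Suc k) m l = 0"
      using 3 bj by (auto simp: sigma_basis_def swap_factors_def Let_def delta_def)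
    have "sg k (delta m) l = 0"
    proof (cases "Suc k < length l")
      case True
      have "?sw l \<noteq> m" using 3 sw[OF True] by auto
      with 3 True show ?thesis by (simp add: sg_apply Let_def delta_def)
    next
      case False
      then have "sg k y l = y l" for y by (induction k y l rule: sg.induct) auto
      with 3 show ?thesis by simp
    qed
    with 1 show ?thesis by simp
  qed
qed

lemma hom_T_End_closed:
  "h \<in> alg_hom A (T_End d N n) \<Longrightarrow> a \<in> carrier A \<Longrightarrow> x \<in> T_space d N n \<Longrightarrow> h a x \<in> T_space d N n"
  using alg_homD(3)[of h A "T_End d N n" a] by auto

lemma hom_T_End_minus:
  assumes "kalg A" "h \<in> alg_hom A (T_End d N n)" "a \<in> carrier A" "b \<in> carrier A" "x \<in> T_space d N n"
  shows "h (a \<ominus>\<^bsub>A\<^esub> b) x l = h a x l - h b x l"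
  using assms alg_homD(3)[OF assms(2)]
  by (simp add: alg_hom_minus[OF assms(1) kalg_T_End assms(2)] T_End_minus del: T_End_simps)

lemma hom_T_End_add:
  assumes "h \<in> alg_hom A (T_End d N n)" "a \<in> carrier A" "b \<in> carrier A" "x \<in> T_space d N n"
  shows "h (a \<oplus>\<^bsub>A\<^esub> b) x l = h a x l + h b x l"
  using assms by (simp add: alg_homD(5)[OF assms(1)])

lemma hom_T_End_smult:
  assumes "h \<in> alg_hom A (T_End d N n)" "a \<in> carrier A" "x \<in> T_space d N n"
  shows "h (c \<odot>\<^bsub>A\<^esub> a) x l = c * h a x l"
  using assms by (simp add: alg_homD(2)[OF assms(1)])

lemma hom_T_End_mult:
  assumes "h \<in> alg_hom A (T_End d N n)" "a \<in> carrier A" "b \<in> carrier A" "x \<in> T_space d N n"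
  shows "h (a \<otimes>\<^bsub>A\<^esub> b) x = h a (h b x)"
  using assms by (simp add: alg_homD(4)[OF assms(1)] compose_eq)

lemma hom_T_End_one:
  assumes "h \<in> alg_hom A (T_End d N n)" "x \<in> T_space d N n"
  shows "h \<one>\<^bsub>A\<^esub> x = x"
  using assms by (simp add: alg_homD(6)[OF assms(1)])

lemma T_End_finsum:
  assumes "finite I" "f \<in> I \<rightarrow> carrier (T_End d N n)" "x \<in> T_space d N n"
  shows "finsum (T_End d N n) f I x l = (\<Sum>i\<in>I. f i x l)"
proof -
  interpret T: kalg "T_End d N n" by (rule kalg_T_End)
  show ?thesis using assms(1,2)
  proof (induction I)
    case empty
    show ?case using assms(3) by simp
  next
    case (insert i I)
    then have "f i \<in> carrier (T_End d N n)" "f \<in> I \<rightarrow> carrier (T_End d N n)" by auto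
    with insert assms(3) show ?case by (simp add: T.finsum_insert del: T_End_simps(1))
  qed
qed

lemma hom_T_End_finsum:
  assumes "kalg A" "h \<in> alg_hom A (T_End d N n)" "finite I" "f \<in> I \<rightarrow> carrier A" "x \<in> T_space d N n"
  shows "h (finsum A f I) x l = (\<Sum>i\<in>I. h (f i) x l)"
proof -
  have "(\<lambda>i. h (f i)) \<in> I \<rightarrow> carrier (T_End d N n)"
    using assms(4) alg_homD(3)[OF assms(2)] by (auto simp del: T_End_simps)
  from T_End_finsum[OF assms(3) this assms(5)] show ?thesis
    by (simp add: alg_hom_finsum[OF assms(1) kalg_T_End assms(2,4)])
qed

section \<open>The homomorphism on the group algebra and its descent to the quotients\<close>

context
  fixes d n :: nat and N :: "nat \<Rightarrow> nat" and \<zeta> :: kq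
  assumes d: "d \<ge> 1" and \<zeta>: "primitive_root_of_unity d \<zeta>"
begin

lemma zeta_neq_0: "\<zeta> \<noteq> 0"
  using primitive_root_neq_0[OF \<zeta> d] .

lemma fb_rels_hold:
  assumes "(u, v) \<in> fb_rels d n" and x: "x \<in> T_space d N n"
  shows "word_op (fb_phi \<zeta>) u x = word_op (fb_phi \<zeta>) v x"
proof (rule T_space_eqI)
  have uv: "u \<in> lists (fb_gens n \<times> UNIV)" "v \<in> lists (fb_gens n \<times> UNIV)"
    using assms(1) fb_rels_lists by blast+
  show "word_op (fb_phi \<zeta>) u x \<in> T_space d N n" "word_op (fb_phi \<zeta>) v x \<in> T_space d N n"
    by (rule word_op_closed[of "fb_gens n \<times> UNIV"], rule fb_phi_T_space, assumption, rule uv, rule x)+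
  fix l assume "l \<in> T_basis d N n"
  then have l: "length l = n" by (simp add: T_basis_def)
  from assms(1) show "word_op (fb_phi \<zeta>) u x l = word_op (fb_phi \<zeta>) v x l"
    unfolding fb_rels_def
  proof (elim UnE CollectE exE conjE, goal_cases)
    case (1 i j)
    have far: "sg i' (sg j' x) l = sg j' (sg i' x) l" if "Suc i' < j'" for i' j'
    proof -
      have "j' = Suc (Suc (i' + (j' - Suc (Suc i'))))" using that by simp
      then obtain m where "j' = Suc (Suc (i' + m))" ..
      then show ?thesis by (simp add: sg_far_commute)
    qed
    from 1 have "Suc (i - 1) < j - 1 \<or> Suc (j - 1) < i - 1" by auto
    with 1 far[of "i - 1" "j - 1"] far[of "j - 1" "i - 1"] show ?case by auto
  next
    case (2 i j)
    then have "j - 1 = Suc (i - 1) \<and> Suc (Suc (i - 1)) < length l \<or>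
        i - 1 = Suc (j - 1) \<and> Suc (Suc (j - 1)) < length l"
      by (auto simp: l)
    with 2 sg_braid[of "i - 1" l x] sg_braid[of "j - 1" l x] show ?case by auto
  next
    case (3 i)
    have "\<zeta> ^ d = 1" using \<zeta> by (simp add: primitive_root_of_unity_def)
    then have "(\<zeta> ^ k) ^ d = 1" for k by (metis mult.commute power_mult power_one)
    with 3 show ?case by (simp add: word_op_ta_replicate)
  next
    case (4 i j)
    then show ?case by (simp add: ta_def mult.left_commute)
  next
    case (5 i j)
    then have "transpose i (i + 1) j - 1 = transpose (i - 1) (Suc (i - 1)) (j - 1)"
      by (auto simp: transpose_def)
    with 5 sg_ta[of "i - 1" l "j - 1" \<zeta> x] show ?case by (auto simp: l)
  qed
qed

lemma fb_phi_inverse: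
  "fb_phi \<zeta> (g, e) (fb_phi \<zeta> (g, \<not> e) x) = x"
  using zeta_neq_0
  by (cases g; cases e) (auto simp: fun_eq_iff sg_sgi sgi_sg ta_def power_inverse)

lemma tensor_rep_FB: "tensor_rep (FB d n) d N n (fb_rep \<zeta>)"
  unfolding FB_def fb_rep_def
  by (rule tensor_rep_presented[OF fb_rels_lists linop_fb_phi fb_phi_T_space fb_phi_inverse fb_rels_hold])

lemma fb_rep_word:
  "w \<in> lists (fb_gens n \<times> UNIV) \<Longrightarrow> x \<in> T_space d N n \<Longrightarrow>
    fb_rep \<zeta> (pres_class (fb_gens n) (fb_rels d n) w) x = word_op (fb_phi \<zeta>) w x"
  unfolding fb_rep_def
  by (rule word_op_some_pres_class[OF fb_rels_lists linop_fb_phi fb_phi_T_space fb_phi_inverse fb_rels_hold])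

interpretation rep: tensor_rep "FB d n" d N n "fb_rep \<zeta>"
  by (rule tensor_rep_FB)

lemma group_FB: "group (FB d n)"
  unfolding FB_def by (rule group_presented_group[OF fb_rels_lists])

interpretation G: group "FB d n" by (rule group_FB)

lemma FB_s_closed: "i \<in> {1..<n} \<Longrightarrow> FB_s d n i \<in> carrier (FB d n)"
  by (auto simp: FB_def FB_s_def presented_group_def fb_gens_def intro!: imageI)

lemma FB_t_closed: "i \<in> {1..n} \<Longrightarrow> FB_t d n i \<in> carrier (FB d n)"
  by (auto simp: FB_def FB_t_def presented_group_def fb_gens_def intro!: imageI)

lemma fb_rep_s: "i \<in> {1..<n} \<Longrightarrow> x \<in> T_space d N n \<Longrightarrow> fb_rep \<zeta> (FB_s d n i) x = sg (i - 1) x"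
  using fb_rep_word[of "[ws i]" x] by (simp add: FB_s_def fb_gens_def)

lemma fb_rep_t: "i \<in> {1..n} \<Longrightarrow> x \<in> T_space d N n \<Longrightarrow> fb_rep \<zeta> (FB_t d n i) x = ta \<zeta> (i - 1) x"
  using fb_rep_word[of "[wt i]" x] by (simp add: FB_t_def fb_gens_def)

lemma fb_rep_t_pow:
  assumes i: "i \<in> {1..n}" and x: "x \<in> T_space d N n"
  shows "fb_rep \<zeta> (FB_t d n i [^]\<^bsub>FB d n\<^esub> (a::nat)) x = (\<lambda>l. (\<zeta> ^ (fst (l ! (i - 1)) - 1)) ^ a * x l)"
proof (induction a)
  case 0
  show ?case using x by (simp add: rep.rep_one)
next
  case (Suc a)
  have "(\<lambda>l. (\<zeta> ^ (fst (l ! (i - 1)) - 1)) ^ a * x l) \<in> T_space d N n"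
    using x by (simp add: T_space_def)
  moreover have "fb_rep \<zeta> (FB_t d n i [^]\<^bsub>FB d n\<^esub> Suc a) x
      = fb_rep \<zeta> (FB_t d n i) (fb_rep \<zeta> (FB_t d n i [^]\<^bsub>FB d n\<^esub> a) x)"
    using x i by (simp only: rep.nat_pow_Suc2 FB_t_closed) (simp add: rep.rep_mult FB_t_closed)
  ultimately show ?case using i by (simp add: Suc fb_rep_t ta_def mult.assoc)
qed

lemma fb_rep_t_pow_neg:
  assumes i: "i \<in> {1..n}" and x: "x \<in> T_space d N n"
  shows "fb_rep \<zeta> (FB_t d n i [^]\<^bsub>FB d n\<^esub> (- int a)) x
    = (\<lambda>l. (inverse (\<zeta> ^ (fst (l ! (i - 1)) - 1))) ^ a * x l)"
proof -
  let ?g = "FB_t d n i [^]\<^bsub>FB d n\<^esub> a"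
  let ?y = "\<lambda>l. (inverse (\<zeta> ^ (fst (l ! (i - 1)) - 1))) ^ a * x l"
  have g: "?g \<in> carrier (FB d n)" using i by (simp add: FB_t_closed)
  have y: "?y \<in> T_space d N n" using x by (simp add: T_space_def)
  have gy: "fb_rep \<zeta> ?g ?y = x"
    unfolding fb_rep_t_pow[OF i y]
    by (auto simp: fun_eq_iff zeta_neq_0 power_inverse mult.assoc[symmetric] simp flip: power_mult_distrib)
  have "FB_t d n i [^]\<^bsub>FB d n\<^esub> (- int a) = inv\<^bsub>FB d n\<^esub> ?g"
    using i by (simp add: G.int_pow_neg FB_t_closed int_pow_int)
  moreover have "fb_rep \<zeta> (inv\<^bsub>FB d n\<^esub> ?g) x = ?y"
    using rep.rep_mult[of "inv\<^bsub>FB d n\<^esub> ?g" ?g ?y] g y rep.rep_one[OF y] gy by simp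
  ultimately show ?thesis by simp
qed

definition PhiFB :: "(fb_elt \<Rightarrow> kq) \<Rightarrow> tensor \<Rightarrow> tensor" where
  "PhiFB = rep_ext d N n (fb_rep \<zeta>)"

lemma PhiFB_alg_hom: "PhiFB \<in> alg_hom (kFB d n) (T_End d N n)"
  unfolding PhiFB_def kFB_def by (rule rep.rep_ext_alg_hom)

lemma PhiFB_delta: "x \<in> T_space d N n \<Longrightarrow> PhiFB (delta g) x = fb_rep \<zeta> g x"
  unfolding PhiFB_def by (rule rep.rep_ext_delta)

lemma kalg_kFB: "kalg (kFB d n)"
  unfolding kFB_def by (intro kalg_monoid_algebra) unfold_locales

interpretation A: kalg "kFB d n" by (rule kalg_kFB)
lemma delta_kFB: "g \<in> carrier (FB d n) \<Longrightarrow> delta g \<in> carrier (kFB d n)"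
  by (simp add: kFB_def)

lemma E_term_closed:
  assumes "i \<in> {1..<n}"
  shows "FB_t d n i [^]\<^bsub>FB d n\<^esub> int a \<otimes>\<^bsub>FB d n\<^esub> FB_t d n (i + 1) [^]\<^bsub>FB d n\<^esub> (- int a) \<in> carrier (FB d n)"
  using assms by (intro rep.m_closed G.int_pow_closed FB_t_closed) auto

lemma E_terms_closed:
  assumes "i \<in> {1..<n}"
  shows "(\<lambda>a. delta (FB_t d n i [^]\<^bsub>FB d n\<^esub> int a \<otimes>\<^bsub>FB d n\<^esub> FB_t d n (i + 1) [^]\<^bsub>FB d n\<^esub> (- int a)))
    \<in> I \<rightarrow> carrier (kFB d n)"
  by (intro Pi_I delta_kFB E_term_closed assms)

lemma kFB_E_closed: "i \<in> {1..<n} \<Longrightarrow> kFB_E d n i \<in> carrier (kFB d n)"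
  unfolding kFB_E_def by (intro A.smult_closed A.finsum_closed E_terms_closed)

text \<open>On a basis tensor the summands of \<open>E_i\<close> are the powers of one root of
  unity, the ratio of the eigenvalues of \<open>t_i\<close> and \<open>t_(i+1)\<close>, so
  \<open>root_average\<close> turns the mean into the indicator of equal colours.\<close>

lemma PhiFB_E:
  assumes i: "i \<in> {1..<n}" and x: "x \<in> T_space d N n" and l: "l \<in> T_basis d N n"
  shows "PhiFB (kFB_E d n i) x l = (if fst (l ! (i - 1)) = fst (l ! i) then x l else 0)"
proof -
  let ?g = "\<lambda>a. FB_t d n i [^]\<^bsub>FB d n\<^esub> int a \<otimes>\<^bsub>FB d n\<^esub> FB_t d n (i + 1) [^]\<^bsub>FB d n\<^esub> (- int a)"
  let ?z = "\<zeta> ^ (fst (l ! (i - 1)) - 1)" and ?w = "\<zeta> ^ (fst (l ! i) - 1)"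
  have c: "(\<lambda>a. delta (?g a)) \<in> {1..d} \<rightarrow> carrier (kFB d n)"
    using i by (rule E_terms_closed)
  have i': "i \<in> {1..n}" "i + 1 \<in> {1..n}" using i by auto
  have "i - 1 < n" "i < n" using i by auto
  then have f: "fst (l ! (i - 1)) \<in> {1..d}" "fst (l ! i) \<in> {1..d}" using T_basis_nth[OF l] by blast+
  have tm: "PhiFB (delta (?g a)) x l = (?z * inverse ?w) ^ a * x l" for a
  proof -
    have w: "(\<lambda>l. (inverse (\<zeta> ^ (fst (l ! i) - 1))) ^ a * x l) \<in> T_space d N n"
      using x by (simp add: T_space_def)
    have "PhiFB (delta (?g a)) x
        = fb_rep \<zeta> (FB_t d n i [^]\<^bsub>FB d n\<^esub> a) (fb_rep \<zeta> (FB_t d n (i + 1) [^]\<^bsub>FB d n\<^esub> (- int a)) x)"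
      using x i' by (subst PhiFB_delta, simp, subst rep.rep_mult) (simp_all add: FB_t_closed int_pow_int)
    also have "\<dots> = (\<lambda>l. (\<zeta> ^ (fst (l ! (i - 1)) - 1)) ^ a * (inverse (\<zeta> ^ (fst (l ! i) - 1)) ^ a * x l))"
      using fb_rep_t_pow_neg[OF i'(2) x, of a] fb_rep_t_pow[OF i'(1) w, of a] by simp
    finally show ?thesis by (simp add: power_mult_distrib mult.assoc)
  qed
  have "PhiFB (kFB_E d n i) x l = 1 / of_nat d * (\<Sum>a\<in>{1..d}. PhiFB (delta (?g a)) x l)"
    unfolding kFB_E_def
    using x c hom_T_End_finsum[OF kalg_kFB PhiFB_alg_hom _ c x]
    by (subst hom_T_End_smult[OF PhiFB_alg_hom]) auto
  also have "\<dots> = (1 / of_nat d * (\<Sum>a\<in>{1..d}. (?z * inverse ?w) ^ a)) * x l"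
    by (simp only: tm sum_distrib_right[symmetric] mult.assoc)
  also have "1 / of_nat d * (\<Sum>a\<in>{1..d}. (?z * inverse ?w) ^ a)
      = (if fst (l ! (i - 1)) - 1 = fst (l ! i) - 1 then 1 else 0)"
    using f by (intro root_average[OF \<zeta> d]) auto
  also have "fst (l ! (i - 1)) - 1 = fst (l ! i) - 1 \<longleftrightarrow> fst (l ! (i - 1)) = fst (l ! i)"
    using f by auto
  finally show ?thesis by simp
qed

lemma YH_rels_carrier: "YH_rels d n \<subseteq> carrier (kFB d n)"
  unfolding YH_rels_def
  by (auto intro!: A.minus_closed A.m_closed A.add.m_closed A.smult_closed delta_kFB FB_s_closed kFB_E_closed)

lemma PhiFB_YH_rels: "r \<in> YH_rels d n \<Longrightarrow> PhiFB r = \<zero>\<^bsub>T_End d N n\<^esub>"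
proof -
  assume "r \<in> YH_rels d n"
  then obtain i where i: "i \<in> {1..<n}" and r: "r = delta (FB_s d n i) \<otimes>\<^bsub>kFB d n\<^esub> delta (FB_s d n i) \<ominus>\<^bsub>kFB d n\<^esub>
        ((q - inverse q) \<odot>\<^bsub>kFB d n\<^esub> (kFB_E d n i \<otimes>\<^bsub>kFB d n\<^esub> delta (FB_s d n i))
           \<oplus>\<^bsub>kFB d n\<^esub> \<one>\<^bsub>kFB d n\<^esub>)"
    unfolding YH_rels_def by blast
  have c: "delta (FB_s d n i) \<in> carrier (kFB d n)" "kFB_E d n i \<in> carrier (kFB d n)"
    using i by (auto intro!: delta_kFB FB_s_closed kFB_E_closed)
  note h = PhiFB_alg_hom
  show ?thesis
  proof (rule extensionalityI[of _ "T_space d N n"])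
    fix x assume x: "x \<in> T_space d N n"
    have s: "PhiFB (delta (FB_s d n i)) y = sg (i - 1) y" if "y \<in> T_space d N n" for y
      using that i by (simp add: PhiFB_delta fb_rep_s)
    note ev = hom_T_End_minus[OF kalg_kFB h] hom_T_End_add[OF h] hom_T_End_smult[OF h]
      hom_T_End_mult[OF h] hom_T_End_one[OF h]
    have ev: "PhiFB r x l = sg (i - 1) (sg (i - 1) x) l
        - ((q - inverse q) * PhiFB (kFB_E d n i) (sg (i - 1) x) l + x l)" for l
      unfolding r using c x
      by (simp add: ev s sg_T_space)
    have "PhiFB r x = (\<lambda>l. 0)"
    proof (rule T_space_eqI)
      have "r \<in> carrier (kFB d n)" using \<open>r \<in> YH_rels d n\<close> YH_rels_carrier by blast
      from alg_homD(3)[OF h this] x show "PhiFB r x \<in> T_space d N n" by auto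
      show "(\<lambda>l. 0) \<in> T_space d N n" by (rule T_space_0)
      fix l assume l: "l \<in> T_basis d N n"
      show "PhiFB r x l = 0"
        unfolding ev PhiFB_E[OF i sg_T_space[OF x] l]
        using sg_quadratic[of "i - 1" l x] i l by (simp add: T_basis_length)
    qed
    then show "PhiFB r x = \<zero>\<^bsub>T_End d N n\<^esub> x" using x by simp
  qed (simp_all add: PhiFB_def rep_ext_def)
qed

lemma kalg_YH: "kalg (YH d n)"
  unfolding YH_def by (rule A.kalg_quot_alg[OF YH_rels_carrier])

definition PhiYH :: "(fb_elt \<Rightarrow> kq) set \<Rightarrow> tensor \<Rightarrow> tensor" where
  "PhiYH X = the_elem (PhiFB ` X)"

lemma PhiYH_alg_hom: "PhiYH \<in> alg_hom (YH d n) (T_End d N n)"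
  unfolding YH_def PhiYH_def[abs_def]
  by (rule A.quot_lift_alg_hom[OF YH_rels_carrier kalg_T_End PhiFB_alg_hom PhiFB_YH_rels])

lemma PhiYH_quot_map: "a \<in> carrier (kFB d n) \<Longrightarrow> PhiYH (quot_map (kFB d n) (YH_rels d n) a) = PhiFB a"
  unfolding PhiYH_def
  by (rule A.quot_lift_apply[OF YH_rels_carrier kalg_T_End PhiFB_alg_hom PhiFB_YH_rels])

lemma quot_map_YH_alg_hom: "quot_map (kFB d n) (YH_rels d n) \<in> alg_hom (kFB d n) (YH d n)"
  unfolding YH_def by (rule A.quot_map_alg_hom[OF YH_rels_carrier])

lemma YH_carrier: "carrier (YH d n) = quot_map (kFB d n) (YH_rels d n) ` carrier (kFB d n)"
  unfolding YH_def by (rule A.quot_carrier[OF YH_rels_carrier])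

lemma YH_s_closed: "i \<in> {1..<n} \<Longrightarrow> YH_s d n i \<in> carrier (YH d n)"
  unfolding YH_s_def by (intro alg_homD(3)[OF quot_map_YH_alg_hom] delta_kFB FB_s_closed)

lemma YH_t_closed: "i \<in> {1..n} \<Longrightarrow> YH_t d n i \<in> carrier (YH d n)"
  unfolding YH_t_def by (intro alg_homD(3)[OF quot_map_YH_alg_hom] delta_kFB FB_t_closed)

lemma PhiYH_s: "i \<in> {1..<n} \<Longrightarrow> x \<in> T_space d N n \<Longrightarrow> PhiYH (YH_s d n i) x = sg (i - 1) x"
  unfolding YH_s_def by (subst PhiYH_quot_map) (auto simp: delta_kFB FB_s_closed PhiFB_delta fb_rep_s)

lemma PhiYH_t: "i \<in> {1..n} \<Longrightarrow> x \<in> T_space d N n \<Longrightarrow> PhiYH (YH_t d n i) x = ta \<zeta> (i - 1) x"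
  unfolding YH_t_def by (subst PhiYH_quot_map) (auto simp: delta_kFB FB_t_closed PhiFB_delta fb_rep_t)

interpretation Y: kalg "YH d n" by (rule kalg_YH)

lemma PhiYH_t_pow:
  assumes "i \<in> {1..n}" "x \<in> T_space d N n"
  shows "PhiYH (YH_t d n i [^]\<^bsub>YH d n\<^esub> (a::nat)) x = (\<lambda>l. (\<zeta> ^ (fst (l ! (i - 1)) - 1)) ^ a * x l)"
  using assms(2)
proof (induction a arbitrary: x)
  case 0
  then show ?case by (simp add: hom_T_End_one[OF PhiYH_alg_hom])
next
  case (Suc a)
  have t: "YH_t d n i \<in> carrier (YH d n)" using assms(1) by (rule YH_t_closed)
  have "PhiYH (YH_t d n i [^]\<^bsub>YH d n\<^esub> Suc a) x = PhiYH (YH_t d n i [^]\<^bsub>YH d n\<^esub> a) (ta \<zeta> (i - 1) x)"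
    using t Suc.prems assms(1)
    by (simp only: Y.nat_pow_Suc) (simp add: hom_T_End_mult[OF PhiYH_alg_hom] PhiYH_t)
  then show ?case using Suc.IH[OF ta_T_space[OF Suc.prems]] by (simp add: ta_def mult_ac)
qed

lemma CTL_projector_closed:
  assumes "n > 2"
  shows "(\<lambda>c. YH_t d n 1 [^]\<^bsub>YH d n\<^esub> (a::nat) \<otimes>\<^bsub>YH d n\<^esub> YH_t d n 2 [^]\<^bsub>YH d n\<^esub> (b::nat) \<otimes>\<^bsub>YH d n\<^esub> YH_t d n 3 [^]\<^bsub>YH d n\<^esub> (c::nat))
      \<in> I \<rightarrow> carrier (YH d n)"
    and "(\<lambda>b. \<Oplus>\<^bsub>YH d n\<^esub>c\<in>{1..d}. YH_t d n 1 [^]\<^bsub>YH d n\<^esub> (a::nat) \<otimes>\<^bsub>YH d n\<^esub> YH_t d n 2 [^]\<^bsub>YH d n\<^esub> (b::nat) \<otimes>\<^bsub>YH d n\<^esub> YH_t d n 3 [^]\<^bsub>YH d n\<^esub> (c::nat))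
      \<in> I \<rightarrow> carrier (YH d n)"
    and "(\<lambda>a. \<Oplus>\<^bsub>YH d n\<^esub>b\<in>{1..d}. \<Oplus>\<^bsub>YH d n\<^esub>c\<in>{1..d}. YH_t d n 1 [^]\<^bsub>YH d n\<^esub> (a::nat) \<otimes>\<^bsub>YH d n\<^esub> YH_t d n 2 [^]\<^bsub>YH d n\<^esub> (b::nat) \<otimes>\<^bsub>YH d n\<^esub> YH_t d n 3 [^]\<^bsub>YH d n\<^esub> (c::nat))
      \<in> I \<rightarrow> carrier (YH d n)"
  using assms by (intro Pi_I Y.finsum_closed Y.m_closed Y.nat_pow_closed YH_t_closed; simp)+

lemma CTL_rels_carrier: "CTL_rels d n \<subseteq> carrier (YH d n)"
proof (cases "n > 2")
  case True
  have s: "YH_s d n 1 \<in> carrier (YH d n)" "YH_s d n 2 \<in> carrier (YH d n)"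
    using True by (auto intro!: YH_s_closed)
  have "CTL_relator d n \<in> carrier (YH d n)"
    unfolding CTL_relator_def Let_def
    by (intro Y.m_closed Y.smult_closed Y.finsum_closed CTL_projector_closed[OF True]
        Y.minus_closed Y.add.m_closed Y.one_closed s)
  then show ?thesis by (simp add: CTL_rels_def)
qed (simp add: CTL_rels_def)

text \<open>The average over the powers of the first three framings projects onto tensors that have
  colour \<open>1\<close> in the first three places, and there the other factor is zero by
  \<open>sg_antisymmetrizer\<close>.\<close>

lemma PhiYH_CTL_relator:
  assumes n: "n > 2" and N1: "N 1 = 2" and x: "x \<in> T_space d N n"
  shows "PhiYH (CTL_relator d n) x = (\<lambda>l. 0)"
proof -
  let ?Y = "YH d n"
  let ?Q = "inverse q"
  define S where "S = (\<one>\<^bsub>?Y\<^esub> \<ominus>\<^bsub>?Y\<^esub> ?Q \<odot>\<^bsub>?Y\<^esub> YH_s d n 1 \<ominus>\<^bsub>?Y\<^esub> ?Q \<odot>\<^bsub>?Y\<^esub> YH_s d n 2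
          \<oplus>\<^bsub>?Y\<^esub> ?Q ^ 2 \<odot>\<^bsub>?Y\<^esub> (YH_s d n 1 \<otimes>\<^bsub>?Y\<^esub> YH_s d n 2) \<oplus>\<^bsub>?Y\<^esub> ?Q ^ 2 \<odot>\<^bsub>?Y\<^esub> (YH_s d n 2 \<otimes>\<^bsub>?Y\<^esub> YH_s d n 1)
          \<ominus>\<^bsub>?Y\<^esub> ?Q ^ 3 \<odot>\<^bsub>?Y\<^esub> (YH_s d n 1 \<otimes>\<^bsub>?Y\<^esub> YH_s d n 2 \<otimes>\<^bsub>?Y\<^esub> YH_s d n 1))"
  define P where "P = (1 / of_nat d ^ 3) \<odot>\<^bsub>?Y\<^esub>
         (\<Oplus>\<^bsub>?Y\<^esub>a\<in>{1..d}. \<Oplus>\<^bsub>?Y\<^esub>b\<in>{1..d}. \<Oplus>\<^bsub>?Y\<^esub>c\<in>{1..d}.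
            YH_t d n 1 [^]\<^bsub>?Y\<^esub> a \<otimes>\<^bsub>?Y\<^esub> YH_t d n 2 [^]\<^bsub>?Y\<^esub> b \<otimes>\<^bsub>?Y\<^esub> YH_t d n 3 [^]\<^bsub>?Y\<^esub> c)"
  have r: "CTL_relator d n = P \<otimes>\<^bsub>?Y\<^esub> S"
    unfolding CTL_relator_def Let_def P_def S_def ..
  have s: "YH_s d n 1 \<in> carrier ?Y" "YH_s d n 2 \<in> carrier ?Y"
    using n by (auto intro!: YH_s_closed)
  have t: "YH_t d n 1 \<in> carrier ?Y" "YH_t d n 2 \<in> carrier ?Y" "YH_t d n 3 \<in> carrier ?Y"
    using n by (auto intro!: YH_t_closed)
  have Sc: "S \<in> carrier ?Y"
    unfolding S_def by (intro Y.m_closed Y.smult_closed Y.minus_closed Y.add.m_closed Y.one_closed s)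
  have Pc: "P \<in> carrier ?Y"
    unfolding P_def by (intro Y.smult_closed Y.finsum_closed CTL_projector_closed[OF n])
  note h = PhiYH_alg_hom
  note ev = hom_T_End_minus[OF kalg_YH h] hom_T_End_add[OF h] hom_T_End_smult[OF h]
      hom_T_End_mult[OF h] hom_T_End_one[OF h]
  have sx: "PhiYH (YH_s d n 1) y = sg 0 y" "PhiYH (YH_s d n 2) y = sg 1 y" if "y \<in> T_space d N n" for y
    using that n PhiYH_s[of 1 y] PhiYH_s[of 2 y] by auto
  let ?y = "PhiYH S x"
  have y: "?y \<in> T_space d N n" using hom_T_End_closed[OF h Sc x] .
  have Sx: "?y l = x l - inverse q * sg 0 x l - inverse q * sg 1 x l + inverse q ^ 2 * sg 0 (sg 1 x) l
    + inverse q ^ 2 * sg 1 (sg 0 x) l - inverse q ^ 3 * sg 0 (sg 1 (sg 0 x)) l" for l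
    unfolding S_def using s x
    by (simp add: ev sx sg_T_space del: One_nat_def)
  have "PhiYH P ?y l = 0" if l: "l \<in> T_basis d N n" for l
  proof -
    let ?z = "\<lambda>k. \<zeta> ^ (fst (l ! k) - 1)"
    have trm: "PhiYH (YH_t d n 1 [^]\<^bsub>?Y\<^esub> a \<otimes>\<^bsub>?Y\<^esub> YH_t d n 2 [^]\<^bsub>?Y\<^esub> b \<otimes>\<^bsub>?Y\<^esub> YH_t d n 3 [^]\<^bsub>?Y\<^esub> c) ?y l
        = ?z 0 ^ a * (?z 1 ^ b * (?z 2 ^ c * ?y l))" for a b c :: nat
    proof -
      have w3: "(\<lambda>l. (\<zeta> ^ (fst (l ! (3 - 1)) - 1)) ^ c * ?y l) \<in> T_space d N n"
        using y by (simp add: T_space_def)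
      have w2: "(\<lambda>l. (\<zeta> ^ (fst (l ! (2 - 1)) - 1)) ^ b * ((\<zeta> ^ (fst (l ! (3 - 1)) - 1)) ^ c * ?y l)) \<in> T_space d N n"
        using y by (simp add: T_space_def)
      have i: "1 \<in> {1..n}" "2 \<in> {1..n}" "3 \<in> {1..n}" using n by auto
      show ?thesis
        by (subst hom_T_End_mult[OF h], intro Y.m_closed Y.nat_pow_closed t, intro Y.nat_pow_closed t, rule y)
          (subst hom_T_End_mult[OF h], intro Y.nat_pow_closed t, intro Y.nat_pow_closed t,
            simp add: PhiYH_t_pow[OF i(3) y] w3[simplified],
            simp only: PhiYH_t_pow[OF i(3) y] PhiYH_t_pow[OF i(2) w3] PhiYH_t_pow[OF i(1) w2], simp)
    qed
    have "PhiYH P ?y l = 1 / of_nat d ^ 3 * (\<Sum>a\<in>{1..d}. \<Sum>b\<in>{1..d}. \<Sum>c\<in>{1..d}. ?z 0 ^ a * (?z 1 ^ b * (?z 2 ^ c * ?y l)))"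
      unfolding P_def
      by (subst hom_T_End_smult[OF h], intro Y.finsum_closed CTL_projector_closed[OF n], rule y)
        (simp only: hom_T_End_finsum[OF kalg_YH h _ CTL_projector_closed(1)[OF n] y]
          hom_T_End_finsum[OF kalg_YH h _ CTL_projector_closed(2)[OF n] y]
          hom_T_End_finsum[OF kalg_YH h _ CTL_projector_closed(3)[OF n] y] finite_atLeastAtMost trm)
    also have "\<dots> = 1 / of_nat d ^ 3 * ((\<Sum>a\<in>{1..d}. ?z 0 ^ a) * ((\<Sum>b\<in>{1..d}. ?z 1 ^ b) * ((\<Sum>c\<in>{1..d}. ?z 2 ^ c) * ?y l)))"
      by (simp only: sum_distrib_left[symmetric] sum_distrib_right[symmetric])
    also have "\<dots> = 0"
    proof (cases "\<forall>k<3. fst (l ! k) = 1")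
      case True
      have "?y l = 0"
        unfolding Sx
      proof (rule sg_antisymmetrizer[of l 1])
        show "length l > 2" using n l by (simp add: T_basis_length)
        fix k :: nat assume "k < 3"
        with True T_basis_nth[OF l, of k] n N1 show "fst (l ! k) = 1 \<and> snd (l ! k) \<in> {1, 2}"
          by force
      qed
      then show ?thesis by simp
    next
      case False
      then obtain k where k: "k < 3" "fst (l ! k) \<noteq> 1" by blast
      have b: "fst (l ! k) \<in> {1..d}" using T_basis_nth[OF l, of k] k n by simp
      have "(\<Sum>a\<in>{1..d}. ?z k ^ a) = 0"
      proof (rule sum_root_of_unity_powers)
        have "\<zeta> ^ d = 1" using \<zeta> by (simp add: primitive_root_of_unity_def)
        then show "?z k ^ d = 1" by (metis mult.commute power_mult power_one)
        show "?z k \<noteq> 1"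
        proof -
          have "fst (l ! k) - 1 < d" "fst (l ! k) - 1 \<noteq> 0" using b k by auto
          then show ?thesis using primitive_root_power_inj[OF \<zeta>, of "fst (l ! k) - 1" 0] d by auto
        qed
      qed
      moreover have "k = 0 \<or> k = 1 \<or> k = 2" using k by auto
      ultimately show ?thesis by auto
    qed
    finally show ?thesis .
  qed
  moreover have "PhiYH (CTL_relator d n) x = PhiYH P ?y"
    unfolding r using hom_T_End_mult[OF h Pc Sc x] .
  moreover have "PhiYH P ?y \<in> T_space d N n" using hom_T_End_closed[OF h Pc y] .
  ultimately show ?thesis by (intro T_space_eqI[of _ d N n]) (auto simp: T_space_0)
qed

lemma PhiFB_commute:
  assumes g: "g \<in> U_gens d N" and a: "a \<in> carrier (kFB d n)" and x: "x \<in> T_space d N n"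
  shows "PhiFB a (gop g x) = gop g (PhiFB a x)"
proof -
  note sg = sg_gop[of _ g]
  have sgi: "sgi k (gop g y) = gop g (sgi k y)" for k y
  proof -
    have "sgi k (gop g (sg k (sgi k y))) = gop g (sgi k y)"
      by (simp add: sgi_sg fun_eq_iff flip: sg)
    moreover have "sg k (sgi k y) = y" by (simp add: sg_sgi fun_eq_iff)
    ultimately show ?thesis by simp
  qed
  have ta: "ta z k (gop g y) = gop g (ta z k y)" if "k < n" "y \<in> T_space d N n" for z k y
  proof (rule T_space_eqI)
    show "ta z k (gop g y) \<in> T_space d N n" "gop g (ta z k y) \<in> T_space d N n"
      using that g by (auto intro: ta_T_space gop_T_space)
    fix l assume "l \<in> T_basis d N n"
    then have "k < length l" using that by (simp add: T_basis_length)
    then show "ta z k (gop g y) l = gop g (ta z k y) l"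
      by (cases g) (simp_all add: opE_ta opF_ta opK_ta, simp add: opKi_def ta_def)
  qed
  have letter: "fb_phi \<zeta> s (gop g y) = gop g (fb_phi \<zeta> s y)" if "fst s \<in> fb_gens n" "y \<in> T_space d N n" for s y
  proof (cases "(\<zeta>, s)" rule: fb_phi.cases)
    case (1 \<zeta>' i e)
    then show ?thesis by (auto simp: sg sgi)
  next
    case (2 \<zeta>' i e)
    then have "i - 1 < n" using that by (auto simp: fb_gens_def)
    with 2 that show ?thesis by (auto simp: ta)
  qed
  have word: "word_op (fb_phi \<zeta>) w (gop g x) = gop g (word_op (fb_phi \<zeta>) w x) \<and> word_op (fb_phi \<zeta>) w x \<in> T_space d N n"
    if "w \<in> lists (fb_gens n \<times> UNIV)" for w
    using that
  proof (induction w)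
    case (Cons s w)
    then show ?case by (cases s) (auto simp: letter fb_phi_T_space)
  qed (use x in simp)
  have rep: "fb_rep \<zeta> A (gop g x) = gop g (fb_rep \<zeta> A x)" if A: "A \<in> carrier (FB d n)" for A
  proof -
    from A obtain w where w: "w \<in> lists (fb_gens n \<times> UNIV)" "A = pres_class (fb_gens n) (fb_rels d n) w"
      unfolding FB_def presented_group_carrier[OF fb_rels_lists] by blast
    then show ?thesis
      using word[OF w(1)] gop_T_space[OF g x] x by (simp add: fb_rep_word)
  qed
  have A: "A \<in> carrier (FB d n)" if "a A \<noteq> 0" for A
    using a that by (auto simp: kFB_def)
  have "gop g (\<lambda>l. \<Sum>w | a w \<noteq> 0. a w * fb_rep \<zeta> w x l) = (\<lambda>l. \<Sum>w | a w \<noteq> 0. a w * gop g (fb_rep \<zeta> w x) l)"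
    by (rule linop_sum[OF linop_gop])
  then show ?thesis
    using x gop_T_space[OF g x] by (auto simp: PhiFB_def rep_ext_def rep A intro!: ext sum.cong)
qed

definition Phi :: "(fb_elt \<Rightarrow> kq) set set \<Rightarrow> tensor \<Rightarrow> tensor" where
  "Phi X = the_elem (PhiYH ` X)"

text \<open>Both quotient maps at once, so that later computations can take place in the group
  algebra modulo the kernel of this map.\<close>

definition CTL_map :: "(fb_elt \<Rightarrow> kq) \<Rightarrow> (fb_elt \<Rightarrow> kq) set set" where
  "CTL_map a = quot_map (YH d n) (CTL_rels d n) (quot_map (kFB d n) (YH_rels d n) a)"

lemma kalg_CTL: "kalg (CTL d n)"
  unfolding CTL_def by (rule Y.kalg_quot_alg[OF CTL_rels_carrier])

lemma CTL_map_alg_hom: "CTL_map \<in> alg_hom (kFB d n) (CTL d n)"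
  unfolding CTL_map_def[abs_def] CTL_def
  by (rule alg_hom_comp[OF quot_map_YH_alg_hom Y.quot_map_alg_hom[OF CTL_rels_carrier]])

lemma CTL_carrier: "carrier (CTL d n) = CTL_map ` carrier (kFB d n)"
  unfolding CTL_def Y.quot_carrier[OF CTL_rels_carrier] YH_carrier by (auto simp: CTL_map_def)

lemma CTL_s_eq: "CTL_s d n i = CTL_map (delta (FB_s d n i))"
  and CTL_t_eq: "CTL_t d n i = CTL_map (delta (FB_t d n i))"
  by (simp_all add: CTL_s_def CTL_t_def YH_s_def YH_t_def CTL_map_def)

context
  assumes N1: "N 1 = 2"
begin

lemma PhiYH_CTL_rels: "r \<in> CTL_rels d n \<Longrightarrow> PhiYH r = \<zero>\<^bsub>T_End d N n\<^esub>"
proof -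
  assume r: "r \<in> CTL_rels d n"
  then have n: "n > 2" and r': "r = CTL_relator d n" by (auto simp: CTL_rels_def split: if_splits)
  have "PhiYH r \<in> carrier (T_End d N n)"
    using alg_homD(3)[OF PhiYH_alg_hom] r CTL_rels_carrier by blast
  then have "PhiYH r \<in> extensional (T_space d N n)" by (auto simp: PiE_def)
  then show ?thesis
    by (rule extensionalityI[of _ "T_space d N n"]) (use PhiYH_CTL_relator[OF n N1] r' in auto)
qed

lemma Phi_CTL_map: "a \<in> carrier (kFB d n) \<Longrightarrow> Phi (CTL_map a) = PhiFB a"
  unfolding Phi_def CTL_map_def
  by (subst Y.quot_lift_apply[OF CTL_rels_carrier kalg_T_End PhiYH_alg_hom PhiYH_CTL_rels])
    (auto simp: PhiYH_quot_map alg_homD(3)[OF quot_map_YH_alg_hom])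

lemma Phi_alg_hom: "Phi \<in> alg_hom (CTL d n) (End_Uq d N n)"
proof -
  have h: "Phi \<in> alg_hom (CTL d n) (T_End d N n)"
    unfolding CTL_def Phi_def[abs_def]
    by (rule Y.quot_lift_alg_hom[OF CTL_rels_carrier kalg_T_End PhiYH_alg_hom PhiYH_CTL_rels])
  have "Phi X \<in> carrier (End_Uq d N n)" if "X \<in> carrier (CTL d n)" for X
  proof -
    from that obtain a where a: "a \<in> carrier (kFB d n)" "X = CTL_map a" by (auto simp: CTL_carrier)
    then show ?thesis
      unfolding End_Uq_carrier_iff
      using alg_homD(3)[OF h that] PhiFB_commute[OF _ a(1)] by (simp add: Phi_CTL_map del: T_End_simps(1))
  qed
  then show ?thesis
    by (intro alg_homI) (simp_all add: alg_homD[OF h] del: T_End_simps(1))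
qed

lemma Phi_apply_s: "i \<in> {1..<n} \<Longrightarrow> x \<in> T_space d N n \<Longrightarrow> Phi (CTL_s d n i) x = sg (i - 1) x"
  by (simp add: CTL_s_eq Phi_CTL_map delta_kFB FB_s_closed PhiFB_delta fb_rep_s)

lemma Phi_apply_t: "i \<in> {1..n} \<Longrightarrow> x \<in> T_space d N n \<Longrightarrow> Phi (CTL_t d n i) x = ta \<zeta> (i - 1) x"
  by (simp add: CTL_t_eq Phi_CTL_map delta_kFB FB_t_closed PhiFB_delta fb_rep_t)

lemma Phi_s: "i \<in> {1..<n} \<Longrightarrow> Phi (CTL_s d n i) = sigma d N n i"
proof (rule extensionalityI[of _ "T_space d N n"])
  assume i: "i \<in> {1..<n}"
  have "CTL_s d n i \<in> carrier (CTL d n)"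
    using i by (simp add: CTL_s_eq alg_homD(3)[OF CTL_map_alg_hom] delta_kFB FB_s_closed)
  from alg_homD(3)[OF Phi_alg_hom this]
  show "Phi (CTL_s d n i) \<in> extensional (T_space d N n)"
    unfolding End_Uq_carrier_iff by (auto simp: PiE_def)
  show "sigma d N n i \<in> extensional (T_space d N n)" by (simp add: sigma_def)
  fix x assume x: "x \<in> T_space d N n"
  obtain k where k: "i = Suc k" "Suc k < n" using i by (cases i) auto
  have "sg k x = sg k (\<lambda>l. \<Sum>m\<in>T_basis d N n. x m * delta m l)"
    using T_space_expand[OF x] by simp
  also have "\<dots> = (\<lambda>l. \<Sum>m\<in>T_basis d N n. x m * sg k (delta m) l)"
    by (rule linop_sum[OF linop_sg])
  also have "\<dots> = (\<lambda>l. \<Sum>m\<in>T_basis d N n. x m * sigma_basis i m l)"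
    using k by (intro ext sum.cong refl) (simp add: sg_delta_sigma_basis T_basis_length)
  finally show "Phi (CTL_s d n i) x = sigma d N n i x"
    using x k Phi_apply_s[OF i x] by (simp add: sigma_def lin_ext_def)
qed

lemma Phi_t: "i \<in> {1..n} \<Longrightarrow> Phi (CTL_t d n i) = tau d N n \<zeta> i"
proof (rule extensionalityI[of _ "T_space d N n"])
  assume i: "i \<in> {1..n}"
  have "CTL_t d n i \<in> carrier (CTL d n)"
    using i by (simp add: CTL_t_eq alg_homD(3)[OF CTL_map_alg_hom] delta_kFB FB_t_closed)
  from alg_homD(3)[OF Phi_alg_hom this]
  show "Phi (CTL_t d n i) \<in> extensional (T_space d N n)"
    unfolding End_Uq_carrier_iff by (auto simp: PiE_def)
  show "tau d N n \<zeta> i \<in> extensional (T_space d N n)" by (simp add: tau_def)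
  fix x assume x: "x \<in> T_space d N n"
  have "ta \<zeta> (i - 1) x = ta \<zeta> (i - 1) (\<lambda>l. \<Sum>m\<in>T_basis d N n. x m * delta m l)"
    using T_space_expand[OF x] by simp
  also have "\<dots> = (\<lambda>l. \<Sum>m\<in>T_basis d N n. x m * ta \<zeta> (i - 1) (delta m) l)"
    by (rule linop_sum[OF linop_ta])
  also have "\<dots> = (\<lambda>l. \<Sum>m\<in>T_basis d N n. x m * (\<zeta> ^ (fst (m ! (i - 1)) - 1) * delta m l))"
    by (intro ext sum.cong refl) (auto simp: ta_def delta_def)
  finally show "Phi (CTL_t d n i) x = tau d N n \<zeta> i x"
    using x Phi_apply_t[OF i x] by (simp add: tau_def lin_ext_def)
qed

end
end

section \<open>Functions as vectors, for use with spans\<close>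

definition fscale :: "kq \<Rightarrow> ('i \<Rightarrow> kq) \<Rightarrow> 'i \<Rightarrow> kq" where
  "fscale c f = (\<lambda>l. c * f l)"

global_interpretation fs: vector_space fscale
  by unfold_locales (simp_all add: fscale_def fun_eq_iff algebra_simps)

lemma linop_plus: "linop h \<Longrightarrow> h (x + y) = h x + h y"
  and linop_fscale: "linop h \<Longrightarrow> h (fscale c x) = fscale c (h x)"
  using linop_add[of h x y] linop_scale[of h c x]
  by (simp_all add: plus_fun_def fscale_def)

lemma linop_zero: "linop h \<Longrightarrow> h 0 = 0"
  using linop_0[of h] by (simp add: zero_fun_def)

subsection \<open>Raising and lowering operators on basis tensors\<close>

lemma opE_apply:
  "opE b i x l = (\<Sum>p<length l. if l ! p = (b, i) then kap b i (drop (Suc p) l) * x (l[p := (b, Suc i)]) else 0)"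
proof (induction l arbitrary: x)
  case (Cons a l)
  show ?case
    unfolding opE.simps Cons.IH[of "\<lambda>l'. x (a # l')"]
    by (simp add: sum.lessThan_Suc_shift del: sum.lessThan_Suc cong: if_cong)
qed simp

lemma opF_apply:
  "opF b i x l = (\<Sum>p<length l. if l ! p = (b, Suc i) then inverse (kap b i (take p l)) * x (l[p := (b, i)]) else 0)"
proof (induction l arbitrary: x)
  case (Cons a l)
  show ?case
    unfolding opF.simps Cons.IH[of "\<lambda>l'. x (a # l')"]
    by (simp add: sum.lessThan_Suc_shift sum_distrib_left if_distrib mult.assoc del: sum.lessThan_Suc cong: if_cong)
qed simp

lemma opE_support:
  assumes "opE b i x l \<noteq> 0"
  obtains p where "p < length l" "l ! p = (b, i)" "x (l[p := (b, Suc i)]) \<noteq> 0"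
proof -
  obtain p where "p \<in> {..<length l}" "(if l ! p = (b, i) then kap b i (drop (Suc p) l) * x (l[p := (b, Suc i)]) else 0) \<noteq> 0"
    using sum.not_neutral_contains_not_neutral[OF assms[unfolded opE_apply]] by auto
  with that show thesis by (auto split: if_splits)
qed

lemma opF_support:
  assumes "opF b i x l \<noteq> 0"
  obtains p where "p < length l" "l ! p = (b, Suc i)" "x (l[p := (b, i)]) \<noteq> 0"
proof -
  obtain p where "p \<in> {..<length l}" "(if l ! p = (b, Suc i) then inverse (kap b i (take p l)) * x (l[p := (b, i)]) else 0) \<noteq> 0"
    using sum.not_neutral_contains_not_neutral[OF assms[unfolded opF_apply]] by auto
  with that show thesis by (auto split: if_splits)
qed

lemma delta_list_update:
  assumes "p < length l"
  shows "l ! p = a \<and> l[p := c] = m \<longleftrightarrow> length l = length m \<and> m ! p = c \<and> l = m[p := a]"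
  using assms by (auto simp: list_update_same_conv)

lemma opE_delta:
  "opE b i (delta m) = (\<lambda>l. \<Sum>p<length m. if m ! p = (b, Suc i) then kap b i (drop (Suc p) m) * delta (m[p := (b, i)]) l else 0)"
proof
  fix l
  show "opE b i (delta m) l = (\<Sum>p<length m. if m ! p = (b, Suc i) then kap b i (drop (Suc p) m) * delta (m[p := (b, i)]) l else 0)"
  proof (cases "length l = length m")
    case True
    show ?thesis
      unfolding opE_apply True
    proof (intro sum.cong refl)
      fix p assume "p \<in> {..<length m}"
      then have p: "p < length l" using True by simp
      show "(if l ! p = (b, i) then kap b i (drop (Suc p) l) * delta m (l[p := (b, Suc i)]) else 0)
          = (if m ! p = (b, Suc i) then kap b i (drop (Suc p) m) * delta (m[p := (b, i)]) l else 0)"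
      proof (cases "l ! p = (b, i) \<and> l[p := (b, Suc i)] = m")
        case True
        then have "drop (Suc p) m = drop (Suc p) l" by auto
        with True delta_list_update[OF p, of "(b, i)" "(b, Suc i)" m] show ?thesis by auto
      next
        case False
        with delta_list_update[OF p, of "(b, i)" "(b, Suc i)" m] \<open>length l = length m\<close>
        show ?thesis by (auto simp: delta_def)
      qed
    qed
  next
    case False
    then have "l \<noteq> m[p := (b, i)]" "l[p := (b, Suc i)] \<noteq> m" for p by auto
    then show ?thesis
      unfolding opE_apply delta_def
      by (intro trans[OF sum.neutral sum.neutral[symmetric]] ballI) simp_all
  qed
qed

lemma opF_delta:
  "opF b i (delta m) = (\<lambda>l. \<Sum>p<length m. if m ! p = (b, i) then inverse (kap b i (take p m)) * delta (m[p := (b, Suc i)]) l else 0)"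
proof
  fix l
  show "opF b i (delta m) l = (\<Sum>p<length m. if m ! p = (b, i) then inverse (kap b i (take p m)) * delta (m[p := (b, Suc i)]) l else 0)"
  proof (cases "length l = length m")
    case True
    show ?thesis
      unfolding opF_apply True
    proof (intro sum.cong refl)
      fix p assume "p \<in> {..<length m}"
      then have p: "p < length l" using True by simp
      show "(if l ! p = (b, Suc i) then inverse (kap b i (take p l)) * delta m (l[p := (b, i)]) else 0)
          = (if m ! p = (b, i) then inverse (kap b i (take p m)) * delta (m[p := (b, Suc i)]) l else 0)"
      proof (cases "l ! p = (b, Suc i) \<and> l[p := (b, i)] = m")
        case True
        then have "take p m = take p l" by auto
        with True delta_list_update[OF p, of "(b, Suc i)" "(b, i)" m] show ?thesis by auto
      next
        case False
        with delta_list_update[OF p, of "(b, Suc i)" "(b, i)" m] \<open>length l = length m\<close>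
        show ?thesis by (auto simp: delta_def)
      qed
    qed
  next
    case False
    then have "l \<noteq> m[p := (b, Suc i)]" "l[p := (b, i)] \<noteq> m" for p by auto
    then show ?thesis
      unfolding opF_apply delta_def
      by (intro trans[OF sum.neutral sum.neutral[symmetric]] ballI) simp_all
  qed
qed

lemma opE_delta_single:
  assumes "p < length m" "m ! p = (b, Suc i)" "\<And>r. r < length m \<Longrightarrow> m ! r = (b, Suc i) \<Longrightarrow> r = p"
  shows "opE b i (delta m) = fscale (kap b i (drop (Suc p) m)) (delta (m[p := (b, i)]))"
proof
  fix l
  have "opE b i (delta m) l = (\<Sum>r\<in>{p}. if m ! r = (b, Suc i) then kap b i (drop (Suc r) m) * delta (m[r := (b, i)]) l else 0)"
    unfolding opE_delta
  proof (rule sum.mono_neutral_right)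
    show "\<forall>r\<in>{..<length m} - {p}. (if m ! r = (b, Suc i) then kap b i (drop (Suc r) m) * delta (m[r := (b, i)]) l else 0) = 0"
      using assms(3) by (intro ballI if_not_P) blast
  qed (use assms(1) in auto)
  then show "opE b i (delta m) l = fscale (kap b i (drop (Suc p) m)) (delta (m[p := (b, i)])) l"
    using assms(2) by (simp add: fscale_def)
qed

lemma opF_delta_single:
  assumes "p < length m" "m ! p = (b, i)" "\<And>r. r < length m \<Longrightarrow> m ! r = (b, i) \<Longrightarrow> r = p"
  shows "opF b i (delta m) = fscale (inverse (kap b i (take p m))) (delta (m[p := (b, Suc i)]))"
proof
  fix l
  have "opF b i (delta m) l = (\<Sum>r\<in>{p}. if m ! r = (b, i) then inverse (kap b i (take r m)) * delta (m[r := (b, Suc i)]) l else 0)"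
    unfolding opF_delta
  proof (rule sum.mono_neutral_right)
    show "\<forall>r\<in>{..<length m} - {p}. (if m ! r = (b, i) then inverse (kap b i (take r m)) * delta (m[r := (b, Suc i)]) l else 0) = 0"
      using assms(3) by (intro ballI if_not_P) blast
  qed (use assms(1) in auto)
  then show "opF b i (delta m) l = fscale (inverse (kap b i (take p m))) (delta (m[p := (b, Suc i)])) l"
    using assms(2) by (simp add: fscale_def)
qed

lemma opE_delta_pair:
  assumes "p < length m" "p' < length m" "p \<noteq> p'" "m ! p = (b, Suc i)" "m ! p' = (b, Suc i)"
    "\<And>r. r < length m \<Longrightarrow> m ! r = (b, Suc i) \<Longrightarrow> r = p \<or> r = p'"
  shows "opE b i (delta m) = fscale (kap b i (drop (Suc p) m)) (delta (m[p := (b, i)]))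
    + fscale (kap b i (drop (Suc p') m)) (delta (m[p' := (b, i)]))"
proof
  fix l
  have "opE b i (delta m) l = (\<Sum>r\<in>{p, p'}. if m ! r = (b, Suc i) then kap b i (drop (Suc r) m) * delta (m[r := (b, i)]) l else 0)"
    unfolding opE_delta
  proof (rule sum.mono_neutral_right)
    show "\<forall>r\<in>{..<length m} - {p, p'}. (if m ! r = (b, Suc i) then kap b i (drop (Suc r) m) * delta (m[r := (b, i)]) l else 0) = 0"
      using assms(6) by (intro ballI if_not_P) blast
  qed (use assms(1,2) in auto)
  then show "opE b i (delta m) l = (fscale (kap b i (drop (Suc p) m)) (delta (m[p := (b, i)]))
    + fscale (kap b i (drop (Suc p') m)) (delta (m[p' := (b, i)]))) l"
    using assms(3-5) by (simp add: fscale_def)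
qed

subsection \<open>Cyclic vectors\<close>

definition EF_gens :: "nat \<Rightarrow> (nat \<Rightarrow> nat) \<Rightarrow> qgen set" where
  "EF_gens d N = {QE b i | b i. b \<in> {1..d} \<and> i \<in> {1..<N b}} \<union> {QF b i | b i. b \<in> {1..d} \<and> i \<in> {1..<N b}}"

text \<open>For a weight vector \<open>x\<close> this is the whole cyclic module, although the
  \<open>K\<close> operators are left out: they only rescale the vectors that words in
  \<open>E\<close> and \<open>F\<close> produce from \<open>x\<close>.\<close>

definition orb :: "nat \<Rightarrow> (nat \<Rightarrow> nat) \<Rightarrow> tensor \<Rightarrow> tensor set" where
  "orb d N x = fs.span {word_op gop w x | w. w \<in> lists (EF_gens d N)}"

lemma span_linop:
  assumes "linop h" "\<And>y. y \<in> S \<Longrightarrow> h y \<in> fs.span S" "x \<in> fs.span S"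
  shows "h x \<in> fs.span S"
  using assms(3)
proof (induction rule: fs.span_induct_alt)
  case base
  show ?case unfolding linop_zero[OF assms(1)] by (rule fs.span_zero)
next
  case (step c x y)
  show ?case
    unfolding linop_plus[OF assms(1)] linop_fscale[OF assms(1)]
    by (rule fs.span_add[OF fs.span_scale[OF assms(2)[OF step(1)]] step(2)])
qed

lemma orb_gop:
  assumes "y \<in> orb d N x" "a \<in> EF_gens d N" shows "gop a y \<in> orb d N x"
  unfolding orb_def
proof (rule span_linop[OF linop_gop _ assms(1)[unfolded orb_def]])
  fix z assume "z \<in> {word_op gop w x | w. w \<in> lists (EF_gens d N)}"
  then obtain w where "w \<in> lists (EF_gens d N)" "z = word_op gop w x" by blast
  then show "gop a z \<in> fs.span {word_op gop w x | w. w \<in> lists (EF_gens d N)}"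
    using assms(2) by (intro fs.span_base CollectI exI[of _ "a # w"]) simp
qed

lemma orb_self: "x \<in> orb d N x"
  unfolding orb_def by (intro fs.span_base CollectI exI[of _ "[]"]) simp

lemma orb_add: "y \<in> orb d N x \<Longrightarrow> z \<in> orb d N x \<Longrightarrow> y + z \<in> orb d N x"
  and orb_diff: "y \<in> orb d N x \<Longrightarrow> z \<in> orb d N x \<Longrightarrow> y - z \<in> orb d N x"
  and orb_scale: "y \<in> orb d N x \<Longrightarrow> fscale c y \<in> orb d N x"
  unfolding orb_def by (auto intro: fs.span_add fs.span_diff fs.span_scale)

lemma orb_unscale: "fscale c y \<in> orb d N x \<Longrightarrow> c \<noteq> 0 \<Longrightarrow> y \<in> orb d N x"
  using orb_scale[of "fscale c y" d N x "inverse c"] by simp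

lemma count_list_le_1_iff:
  "count_list l a \<le> 1 \<longleftrightarrow> (\<forall>p r. p < length l \<longrightarrow> r < length l \<longrightarrow> l ! p = a \<longrightarrow> l ! r = a \<longrightarrow> p = r)"
proof -
  have c: "count_list l a = card {p. p < length l \<and> l ! p = a}"
    by (simp add: count_list_eq_length_filter length_filter_conv_card eq_commute)
  show ?thesis unfolding c
    by (subst One_nat_def, subst card_le_Suc0_iff_eq) auto
qed

text \<open>If both letters occur, \<open>F\<close> first turns \<open>(b, i)\<close> into a second
  \<open>(b, Suc i)\<close>; \<open>E\<close> then lowers either copy and gives multiples of
  \<open>l\<close> and of the exchanged tensor, and the multiple of \<open>l\<close> can be
  subtracted. If only one letter occurs, a single \<open>E\<close> or \<open>F\<close> does
  it.\<close>

lemma orb_transpose_adjacent: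
  assumes l: "delta l \<in> orb d N x" and b: "b \<in> {1..d}" and i: "i \<in> {1..<N b}"
    and once: "count_list l (b, i) \<le> 1" "count_list l (b, Suc i) \<le> 1"
  shows "delta (map (transpose (b, i) (b, Suc i)) l) \<in> orb d N x"
proof -
  let ?t = "transpose (b, i) (b, Suc i)"
  have EF: "QE b i \<in> EF_gens d N" "QF b i \<in> EF_gens d N" using b i by (auto simp: EF_gens_def)
  note o1 = once(1)[unfolded count_list_le_1_iff, rule_format]
  note o2 = once(2)[unfolded count_list_le_1_iff, rule_format]
  consider (none) "(b, i) \<notin> set l" "(b, Suc i) \<notin> set l"
    | (low) p where "p < length l" "l ! p = (b, i)" "(b, Suc i) \<notin> set l"
    | (high) p where "p < length l" "l ! p = (b, Suc i)" "(b, i) \<notin> set l"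
    | (both) p p' where "p < length l" "l ! p = (b, i)" "p' < length l" "l ! p' = (b, Suc i)"
    by (metis in_set_conv_nth)
  then show ?thesis
  proof cases
    case none
    then have "map ?t l = l" by (intro map_idI) (auto simp: transpose_def)
    with l show ?thesis by simp
  next
    case low
    have "map ?t l = l[p := (b, Suc i)]"
    proof (intro nth_equalityI)
      fix r assume "r < length (map ?t l)"
      then have r: "r < length l" by simp
      have "l ! r \<noteq> (b, Suc i)" using low(3) r by (metis nth_mem)
      moreover have "l ! r = (b, i) \<longleftrightarrow> r = p" using low(1,2) o1 r by blast
      ultimately show "map ?t l ! r = l[p := (b, Suc i)] ! r"
        using r by (simp add: nth_list_update transpose_def)
    qed simp
    moreover have "opF b i (delta l) = fscale (inverse (kap b i (take p l))) (delta (l[p := (b, Suc i)]))"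
      using low o1 by (intro opF_delta_single) auto
    ultimately show ?thesis
      using orb_gop[OF l EF(2)] by (auto dest: orb_unscale)
  next
    case high
    have "map ?t l = l[p := (b, i)]"
    proof (intro nth_equalityI)
      fix r assume "r < length (map ?t l)"
      then have r: "r < length l" by simp
      have "l ! r \<noteq> (b, i)" using high(3) r by (metis nth_mem)
      moreover have "l ! r = (b, Suc i) \<longleftrightarrow> r = p" using high(1,2) o2 r by blast
      ultimately show "map ?t l ! r = l[p := (b, i)] ! r"
        using r by (simp add: nth_list_update transpose_def)
    qed simp
    moreover have "opE b i (delta l) = fscale (kap b i (drop (Suc p) l)) (delta (l[p := (b, i)]))"
      using high o2 by (intro opE_delta_single) auto
    ultimately show ?thesis
      using orb_gop[OF l EF(1)] by (auto dest: orb_unscale)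
  next
    case both
    let ?m = "l[p := (b, Suc i)]"
    have ne: "p \<noteq> p'" using both by auto
    have F: "opF b i (delta l) = fscale (inverse (kap b i (take p l))) (delta ?m)"
      using both o1 by (intro opF_delta_single) auto
    then have m: "delta ?m \<in> orb d N x"
      using orb_gop[OF l EF(2)] by (auto dest: orb_unscale)
    have r: "r = p \<or> r = p'" if "r < length l" "l[p := (b, Suc i)] ! r = (b, Suc i)" for r
      using that both o2[of r p'] by (auto simp: nth_list_update split: if_splits)
    have E: "opE b i (delta ?m) = fscale (kap b i (drop (Suc p) ?m)) (delta (?m[p := (b, i)]))
        + fscale (kap b i (drop (Suc p') ?m)) (delta (?m[p' := (b, i)]))"
      using both ne r by (intro opE_delta_pair) auto
    have ml: "?m[p := (b, i)] = l" using both by (metis list_update_id list_update_overwrite)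
    have mt: "?m[p' := (b, i)] = map ?t l"
      using both ne o1 o2 by (intro nth_equalityI) (auto simp: nth_list_update transpose_def)
    have "opE b i (delta ?m) - fscale (kap b i (drop (Suc p) ?m)) (delta l)
        = fscale (kap b i (drop (Suc p') ?m)) (delta (map ?t l))"
      unfolding E ml mt by simp
    moreover have "opE b i (delta ?m) - fscale (kap b i (drop (Suc p) ?m)) (delta l) \<in> orb d N x"
      using orb_gop[OF m EF(1)] l by (intro orb_diff orb_scale) simp_all
    ultimately have "fscale (kap b i (drop (Suc p') ?m)) (delta (map ?t l)) \<in> orb d N x" by simp
    then show ?thesis by (rule orb_unscale) simp
  qed
qed

lemma count_list_map_transpose:
  "count_list (map (transpose a c) l) e = count_list l (transpose a c e)"
  by (induction l) (auto simp: transpose_def)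

text \<open>The transposition of \<open>i\<close> and \<open>j + 1\<close> is the conjugate of that
  of \<open>i\<close> and \<open>j\<close> by an adjacent one. The intermediate tensors must again
  have multiplicities at most one, hence the bound on the whole interval of indices.\<close>

lemma orb_transpose:
  assumes "delta l \<in> orb d N x" and "b \<in> {1..d}" and "1 \<le> i" "i \<le> j" "j \<le> N b"
    and "\<And>k. i \<le> k \<Longrightarrow> k \<le> j \<Longrightarrow> count_list l (b, k) \<le> 1"
  shows "delta (map (transpose (b, i) (b, j)) l) \<in> orb d N x"
  using assms(4,1,3,5,6)
proof (induction j arbitrary: l rule: dec_induct)
  case base
  then show ?case by (simp add: map_idI transpose_def)
next
  case (step j)
  let ?a = "transpose (b, j) (b, Suc j)"
  show ?case
  proof (cases "i = j")
    case True
    show ?thesis unfolding True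
      using step.prems step.hyps assms(2) True by (intro orb_transpose_adjacent) auto
  next
    case False
    let ?l1 = "map ?a l" let ?l2 = "map (transpose (b, i) (b, j)) ?l1"
    have c1: "count_list ?l1 (b, k) \<le> 1" if "i \<le> k" "k \<le> Suc j" for k
      using that step.prems(4) step.hyps by (auto simp: count_list_map_transpose transpose_def)
    have c2: "count_list ?l2 (b, k) \<le> 1" if "i \<le> k" "k \<le> Suc j" for k
      using that c1 step.hyps by (subst count_list_map_transpose) (auto simp: transpose_def)
    have 1: "delta ?l1 \<in> orb d N x"
      using step.prems step.hyps assms(2) by (intro orb_transpose_adjacent) auto
    have 2: "delta ?l2 \<in> orb d N x"
      using step.prems c1 by (intro step.IH[OF 1]) auto
    have 3: "delta (map ?a ?l2) \<in> orb d N x"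
      using step.prems step.hyps assms(2) c2 by (intro orb_transpose_adjacent[OF 2]) auto
    have 4: "map ?a ?l2 = map (transpose (b, i) (b, Suc j)) l"
      using False step.hyps by (auto simp: transpose_def)
    show ?thesis using 3 unfolding 4 .
  qed
qed

lemma distinct_count_list_le_1: "distinct l \<Longrightarrow> count_list l a \<le> 1"
  by (simp add: distinct_count_atmost_1 flip: count_mset)

lemma T_basis_V: "l \<in> T_basis d N n \<Longrightarrow> p < length l \<Longrightarrow> l ! p \<in> V_basis d N"
  using nth_mem[of p l] by (auto simp: T_basis_def)

text \<open>Each transposition repairs one place. Since the entries of \<open>l\<close> and of
  \<open>t\<close> are distinct, it spoils none of the places where they already agree.\<close>

lemma orb_distinct:
  assumes "delta l \<in> orb d N x" "l \<in> T_basis d N n" "distinct l"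
    "t \<in> T_basis d N n" "distinct t" "map fst l = map fst t"
  shows "delta t \<in> orb d N x"
  using assms(1-3,6)
proof (induction "card {k. k < n \<and> l ! k \<noteq> t ! k}" arbitrary: l rule: less_induct)
  case less
  have len: "length l = n" "length t = n" using less.prems assms(4) by (auto simp: T_basis_def)
  show ?case
  proof (cases "l = t")
    case True
    with less.prems show ?thesis by simp
  next
    case False
    then obtain k where k: "k < n" "l ! k \<noteq> t ! k" using len nth_equalityI[of l t] by auto
    have "fst (l ! k) = fst (t ! k)"
      using arg_cong[OF less.prems(4), of "\<lambda>l. l ! k"] k len by simp
    then obtain b i j where ij: "l ! k = (b, i)" "t ! k = (b, j)" by (metis prod.collapse)
    have V: "(b, i) \<in> V_basis d N" "(b, j) \<in> V_basis d N"
      using T_basis_V[OF less.prems(2), of k] T_basis_V[OF assms(4), of k] k ij len by auto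
    let ?l = "map (transpose (b, i) (b, j)) l"
    have inj: "inj (transpose (b, i) (b, j))" by (rule inj_on_subset[OF inj_transpose]) simp
    have 1: "delta ?l \<in> orb d N x"
    proof (cases "i \<le> j")
      case True
      then show ?thesis
        using V less.prems by (intro orb_transpose) (auto simp: V_basis_def distinct_count_list_le_1[simplified])
    next
      case False
      then have "delta (map (transpose (b, j) (b, i)) l) \<in> orb d N x"
        using V less.prems by (intro orb_transpose) (auto simp: V_basis_def distinct_count_list_le_1[simplified])
      then show ?thesis by (simp add: transpose_commute)
    qed
    have 2: "?l \<in> T_basis d N n"
      using less.prems(2) V by (auto simp: T_basis_def transpose_def)
    have 3: "distinct ?l" using less.prems(3) inj_on_subset[OF inj subset_UNIV] by (simp add: distinct_map)
    have 4: "map fst ?l = map fst t"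
      unfolding less.prems(4)[symmetric] by (auto simp: transpose_def)
    have "{r. r < n \<and> ?l ! r \<noteq> t ! r} \<subset> {r. r < n \<and> l ! r \<noteq> t ! r}"
    proof
      show "{r. r < n \<and> ?l ! r \<noteq> t ! r} \<subseteq> {r. r < n \<and> l ! r \<noteq> t ! r}"
      proof (clarsimp simp: len)
        fix r assume r: "r < n" "l ! r = t ! r" "transpose (b, i) (b, j) (t ! r) \<noteq> t ! r"
        then have "t ! r = (b, i) \<or> t ! r = (b, j)" by (auto simp: transpose_def split: if_splits)
        then have "l ! r = l ! k \<or> t ! r = t ! k" using r ij by auto
        then have "r = k" using less.prems(3) assms(5) len r k by (auto simp: nth_eq_iff_index_eq)
        with r k show False by simp
      qed
      have "k \<in> {r. r < n \<and> l ! r \<noteq> t ! r}" "k \<notin> {r. r < n \<and> ?l ! r \<noteq> t ! r}"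
        using k ij len by auto
      then show "{r. r < n \<and> ?l ! r \<noteq> t ! r} \<noteq> {r. r < n \<and> l ! r \<noteq> t ! r}" by blast
    qed
    then have "card {r. r < n \<and> ?l ! r \<noteq> t ! r} < card {r. r < n \<and> l ! r \<noteq> t ! r}"
      by (intro psubset_card_mono) auto
    from less.hyps[OF this 1 2 3 4] show ?thesis .
  qed
qed

text \<open>Repeated application of \<open>E\<close>; at each step the letter it acts on occurs at
  the place \<open>p\<close> only, so no second tensor appears. Further copies of
  \<open>(b, i)\<close> itself do no harm.\<close>

lemma orb_lower:
  assumes b: "b \<in> {1..d}" and p: "p < length l" "l ! p = (b, i)" and i: "1 \<le> i" "i \<le> s" "s \<le> M b"
    and free: "\<And>r j. r < length l \<Longrightarrow> r \<noteq> p \<Longrightarrow> i < j \<Longrightarrow> j \<le> s \<Longrightarrow> l ! r \<noteq> (b, j)"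
    and top: "delta (l[p := (b, s)]) \<in> orb d M x"
  shows "delta l \<in> orb d M x"
proof -
  have "delta (l[p := (b, i)]) \<in> orb d M x"
    using i(2)
  proof (induction i rule: inc_induct)
    case base
    show ?case by (rule top)
  next
    case (step j)
    let ?m = "l[p := (b, Suc j)]"
    have "QE b j \<in> EF_gens d M" using b i step by (auto simp: EF_gens_def)
    then have "opE b j (delta ?m) \<in> orb d M x" using orb_gop[OF step.IH] by fastforce
    moreover have "opE b j (delta ?m) = fscale (kap b j (drop (Suc p) ?m)) (delta (?m[p := (b, j)]))"
    proof (rule opE_delta_single)
      fix r assume "r < length ?m" "?m ! r = (b, Suc j)"
      with free[of r "Suc j"] step.hyps show "r = p" by (cases "r = p") auto
    qed (use p in auto)
    ultimately show ?case by (auto dest: orb_unscale)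
  qed
  then show ?thesis using p by (metis list_update_id)
qed

lemma orb_generate:
  assumes v: "v \<in> T_basis d (\<lambda>b. N b + n) n" "distinct v" "\<And>b j. (b, j) \<in> set v \<Longrightarrow> N b < j"
    and l: "l \<in> T_basis d (\<lambda>b. N b + n) n" "map fst l = map fst v"
    and high: "\<And>b j. N b < j \<Longrightarrow> count_list l (b, j) \<le> 1"
  shows "delta l \<in> orb d (\<lambda>b. N b + n) (delta v)"
  using l high
proof (induction "card {r. r < n \<and> snd (l ! r) \<le> N (fst (l ! r))}" arbitrary: l rule: less_induct)
  case less
  let ?M = "\<lambda>b. N b + n"
  have len: "length l = n" using less.prems by (simp add: T_basis_def)
  show ?case
  proof (cases "\<exists>r<n. snd (l ! r) \<le> N (fst (l ! r))")
    case False
    have "count_list l a \<le> 1" for a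
    proof (cases "a \<in> set l")
      case True
      then obtain r where "r < n" "l ! r = a" using len by (auto simp: in_set_conv_nth)
      with False less.prems(3)[of "fst a" "snd a"] show ?thesis by auto
    next
      case False
      then show ?thesis by (simp add: count_notin)
    qed
    then have "distinct l"
      unfolding distinct_conv_nth count_list_le_1_iff by blast
    then show ?thesis
      using less.prems v by (intro orb_distinct[OF orb_self v(1,2)]) auto
  next
    case True
    then obtain r0 where r0: "r0 < n" "snd (l ! r0) \<le> N (fst (l ! r0))" by blast
    define b where "b = fst (l ! r0)"
    let ?P = "{r. r < n \<and> fst (l ! r) = b \<and> snd (l ! r) \<le> N b}"
    have P: "finite ?P" "?P \<noteq> {}" using r0 by (auto simp: b_def)
    then have "Max ((\<lambda>r. snd (l ! r)) ` ?P) \<in> (\<lambda>r. snd (l ! r)) ` ?P" by (intro Max_in) auto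
    then obtain p where p: "p \<in> ?P" "Max ((\<lambda>r. snd (l ! r)) ` ?P) = snd (l ! p)" by blast
    define i where "i = snd (l ! p)"
    have max: "snd (l ! r) \<le> i" if "r \<in> ?P" for r
      unfolding i_def p(2)[symmetric] using P that by (intro Max_ge) auto
    have lp: "p < n" "l ! p = (b, i)" "i \<le> N b" using p(1) by (auto simp: i_def prod_eq_iff)
    have Vb: "b \<in> {1..d}" "1 \<le> i"
      using T_basis_V[OF less.prems(1), of p] lp len by (auto simp: V_basis_def)
    \<comment> \<open>Pigeonhole: the place \<open>p\<close> holds a small entry, so at most
      \<open>n - 1\<close> places are left for the \<open>n\<close> large indices of colour
      \<open>b\<close>. This is why the ranks are enlarged by \<open>n\<close>.\<close>
    have "\<exists>s\<in>{Suc (N b)..N b + n}. (b, s) \<notin> set l"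
    proof (rule ccontr)
      assume "\<not> ?thesis"
      moreover have "l ! p \<in> set l" using lp(1) len nth_mem by blast
      ultimately have "insert (l ! p) (Pair b ` {Suc (N b)..N b + n}) \<subseteq> set l" by auto
      then have "card (insert (l ! p) (Pair b ` {Suc (N b)..N b + n})) \<le> card (set l)"
        by (intro card_mono) auto
      moreover have "card (insert (l ! p) (Pair b ` {Suc (N b)..N b + n})) = Suc n"
        using lp by (subst card_insert_disjoint) (auto simp: card_image inj_on_def)
      ultimately show False using card_length[of l] len by simp
    qed
    then obtain s where s: "s \<in> {Suc (N b)..N b + n}" "(b, s) \<notin> set l" by blast
    let ?t = "transpose (b, Suc (N b)) (b, s)"
    define l2 where "l2 = map ?t l"
    define l3 where "l3 = l2[p := (b, Suc (N b))]"
    have len2: "length l2 = n" by (simp add: l2_def len)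
    have cl2: "count_list l2 (c, j) \<le> 1" if "N c < j" for c j
      using less.prems(3)[of c j] less.prems(3)[of b s] less.prems(3)[of b "Suc (N b)"] that s
      by (auto simp: l2_def count_list_map_transpose transpose_def)
    have free2: "(b, Suc (N b)) \<notin> set l2"
      using s(2) by (auto simp: l2_def transpose_def split: if_splits)
    have low2: "l2 ! r = (c, j) \<longleftrightarrow> l ! r = (c, j)" if "r < n" "j \<le> N c" for r c j
      using that s(1) len by (auto simp: l2_def transpose_def)
    have T2: "l2 \<in> T_basis d ?M n"
      using less.prems(1) s Vb unfolding T_basis_def l2_def
      by (auto simp: transpose_def V_basis_def)
    have f2: "map fst l2 = map fst v"
      unfolding less.prems(2)[symmetric] l2_def by (auto simp: transpose_def)
    have T3: "l3 \<in> T_basis d ?M n"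
      using T2 Vb s set_update_subset_insert[of l2 p "(b, Suc (N b))"]
      unfolding T_basis_def l3_def by (auto simp: V_basis_def)
    have l2p: "l2 ! p = (b, i)" using low2[OF lp(1,3)] lp by simp
    have f3: "map fst l3 = map fst v"
      unfolding f2[symmetric] l3_def using l2p lp len2
      by (intro nth_equalityI) (auto simp: nth_list_update)
    have cl3: "count_list l3 (c, j) \<le> 1" if "N c < j" for c j
      unfolding count_list_le_1_iff
    proof (intro allI impI)
      fix r r' assume r: "r < length l3" "r' < length l3" "l3 ! r = (c, j)" "l3 ! r' = (c, j)"
      have *: "l2 ! k \<noteq> (b, Suc (N b))" if "k < n" for k
        using free2 that len2 by (metis nth_mem)
      show "r = r'"
        using r * len2 cl2[OF that, unfolded count_list_le_1_iff]
        by (cases "r = p"; cases "r' = p") (auto simp: l3_def)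
    qed
    have "{r. r < n \<and> snd (l3 ! r) \<le> N (fst (l3 ! r))} \<subset> {r. r < n \<and> snd (l ! r) \<le> N (fst (l ! r))}"
    proof
      show "{r. r < n \<and> snd (l3 ! r) \<le> N (fst (l3 ! r))} \<subseteq> {r. r < n \<and> snd (l ! r) \<le> N (fst (l ! r))}"
      proof clarify
        fix r assume r: "r < n" "snd (l3 ! r) \<le> N (fst (l3 ! r))"
        then have "r \<noteq> p" using len2 by (auto simp: l3_def)
        then have "l3 ! r = l2 ! r" by (simp add: l3_def)
        with r low2[of r "snd (l2 ! r)" "fst (l2 ! r)"] show "snd (l ! r) \<le> N (fst (l ! r))" by simp
      qed
      have "p \<in> {r. r < n \<and> snd (l ! r) \<le> N (fst (l ! r))}" "p \<notin> {r. r < n \<and> snd (l3 ! r) \<le> N (fst (l3 ! r))}"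
        using lp len2 by (auto simp: l3_def)
      then show "{r. r < n \<and> snd (l3 ! r) \<le> N (fst (l3 ! r))} \<noteq> {r. r < n \<and> snd (l ! r) \<le> N (fst (l ! r))}"
        by blast
    qed
    then have "card {r. r < n \<and> snd (l3 ! r) \<le> N (fst (l3 ! r))} < card {r. r < n \<and> snd (l ! r) \<le> N (fst (l ! r))}"
      by (intro psubset_card_mono) auto
    from less.hyps[OF this T3 f3 cl3] have 3: "delta l3 \<in> orb d ?M (delta v)" .
    have 2: "delta l2 \<in> orb d ?M (delta v)"
    proof (rule orb_lower[of b d p l2 i "Suc (N b)"])
      show "delta (l2[p := (b, Suc (N b))]) \<in> orb d ?M (delta v)" using 3 by (simp add: l3_def)
      fix r j assume r: "r < length l2" "r \<noteq> p" "i < j" "j \<le> Suc (N b)"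
      show "l2 ! r \<noteq> (b, j)"
      proof
        assume e: "l2 ! r = (b, j)"
        then have "j \<noteq> Suc (N b)" using free2 r by (metis nth_mem)
        with r have "j \<le> N b" by simp
        with e low2[of r j b] r len2 have "l ! r = (b, j)" by simp
        with max[of r] r len2 \<open>j \<le> N b\<close> show False by simp
      qed
    qed (use Vb lp len2 l2p s in auto)
    have "delta (map ?t l2) \<in> orb d ?M (delta v)"
      using Vb s cl2 by (intro orb_transpose[OF 2]) auto
    moreover have "map ?t l2 = l" by (auto simp: l2_def comp_def)
    ultimately show ?thesis by simp
  qed
qed

subsection \<open>Weights\<close>

definition homog :: "idx multiset \<Rightarrow> tensor \<Rightarrow> bool" where
  "homog \<mu> x \<longleftrightarrow> (\<forall>l. x l \<noteq> 0 \<longrightarrow> mset l = \<mu>)"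

text \<open>If the letter to be removed is absent, the operator kills all vectors of weight
  \<open>\<mu>\<close>, and zero is homogeneous of every weight. The truncated difference of
  multisets is therefore harmless.\<close>

fun shift :: "qgen \<Rightarrow> idx multiset \<Rightarrow> idx multiset" where
  "shift (QE b i) \<mu> = add_mset (b, i) (\<mu> - {#(b, Suc i)#})"
| "shift (QF b i) \<mu> = add_mset (b, Suc i) (\<mu> - {#(b, i)#})"
| "shift (QK b i) \<mu> = \<mu>"
| "shift (QKi b i) \<mu> = \<mu>"

definition kapm :: "nat \<Rightarrow> nat \<Rightarrow> idx multiset \<Rightarrow> kq" where
  "kapm b i \<mu> = prod_mset (image_mset (wtk b i) \<mu>)"

lemma kap_kapm: "kap b i l = kapm b i (mset l)"
  by (induction l) (simp_all add: kapm_def)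

lemma homog_delta: "homog (mset m) (delta m)"
  by (simp add: homog_def)

lemma homog_gop: "homog \<mu> x \<Longrightarrow> homog (shift g \<mu>) (gop g x)"
proof (cases g)
  case (QE b i)
  assume x: "homog \<mu> x"
  show ?thesis unfolding QE homog_def gop.simps
  proof (intro allI impI)
    fix l assume "opE b i x l \<noteq> 0"
    then obtain p where p: "p < length l" "l ! p = (b, i)" "x (l[p := (b, Suc i)]) \<noteq> 0" by (rule opE_support)
    then have "mset (l[p := (b, Suc i)]) = \<mu>" using x unfolding homog_def by blast
    then have "\<mu> = add_mset (b, Suc i) (mset l - {#(b, i)#})"
      using p by (simp add: mset_update)
    moreover have "(b, i) \<in># mset l" using p by (metis nth_mem set_mset_mset)
    ultimately show "mset l = shift (QE b i) \<mu>" by simp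
  qed
next
  case (QF b i)
  assume x: "homog \<mu> x"
  show ?thesis unfolding QF homog_def gop.simps
  proof (intro allI impI)
    fix l assume "opF b i x l \<noteq> 0"
    then obtain p where p: "p < length l" "l ! p = (b, Suc i)" "x (l[p := (b, i)]) \<noteq> 0" by (rule opF_support)
    then have "mset (l[p := (b, i)]) = \<mu>" using x unfolding homog_def by blast
    then have "\<mu> = add_mset (b, i) (mset l - {#(b, Suc i)#})"
      using p by (simp add: mset_update)
    moreover have "(b, Suc i) \<in># mset l" using p by (metis nth_mem set_mset_mset)
    ultimately show "mset l = shift (QF b i) \<mu>" by simp
  qed
qed (auto simp: homog_def opK_def opKi_def)

lemma homog_word: "homog \<mu> x \<Longrightarrow> homog (fold shift (rev w) \<mu>) (word_op gop w x)"
  by (induction w) (auto simp: homog_gop)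

section \<open>Compression to the small tensor space\<close>

definition proj :: "nat \<Rightarrow> (nat \<Rightarrow> nat) \<Rightarrow> nat \<Rightarrow> tensor \<Rightarrow> tensor" where
  "proj d N n x = (\<lambda>l. if l \<in> T_basis d N n then x l else 0)"

lemma linop_proj: "linop (proj d N n)"
  by (simp add: linop_def proj_def)

lemma proj_T_space: "proj d N n x \<in> T_space d N n"
  by (simp add: proj_def T_space_def)

lemma proj_id: "x \<in> T_space d N n \<Longrightarrow> proj d N n x = x"
  by (auto simp: proj_def T_space_def)

text \<open>The compression to \<open>T_space d N n\<close> of a word in the generators for larger ranks is, up to the
  commutator relation, a word for the smaller ranks: once all lowering operators stand to the left, any
  generator outside the smaller algebra makes the compression vanish.\<close>

definition all_EF :: "nat \<Rightarrow> qgen set" where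
  "all_EF d = {QE b i | b i. b \<in> {1..d} \<and> 1 \<le> i} \<union> {QF b i | b i. b \<in> {1..d} \<and> 1 \<le> i}"

lemma EF_gens_all: "EF_gens d N \<subseteq> all_EF d"
  by (auto simp: EF_gens_def all_EF_def)

context
  fixes d n :: nat and N :: "nat \<Rightarrow> nat" and f :: "tensor \<Rightarrow> tensor"
  assumes f: "f \<in> carrier (End_Uq d N n)"
begin

lemma f_End: "f \<in> carrier (T_End d N n)"
  using f by (simp add: End_Uq_carrier_iff)

lemma f_closed: "x \<in> T_space d N n \<Longrightarrow> f x \<in> T_space d N n"
  using f_End by auto

lemma f_add: "x \<in> T_space d N n \<Longrightarrow> y \<in> T_space d N n \<Longrightarrow> f (x + y) = f x + f y"
  using f_End by (simp add: plus_fun_def)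

lemma f_scale: "x \<in> T_space d N n \<Longrightarrow> f (fscale c x) = fscale c (f x)"
  using f_End by (simp add: fscale_def)

lemma f_0: "f 0 = 0"
  using f_scale[of 0 0] T_space_0[of d N n] by (simp add: zero_fun_def fscale_def)

lemma f_gop: "g \<in> U_gens d N \<Longrightarrow> x \<in> T_space d N n \<Longrightarrow> f (gop g x) = gop g (f x)"
  using f by (simp add: End_Uq_carrier_iff)

lemma kk_count: "kk b i l = q ^ count (mset l) (b, i)"
  by (induction l) (auto simp: wt1_def)

text \<open>\<open>f\<close> commutes with \<open>K b i\<close>, whose eigenvalue is
  \<open>q\<close> to the multiplicity of \<open>(b, i)\<close>, and different powers of
  \<open>q\<close> are different.\<close>

lemma f_homog:
  assumes x: "x \<in> T_space d N n" "homog \<mu> x" shows "homog \<mu> (f x)"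
proof (cases "x = 0")
  case True
  then show ?thesis by (simp add: f_0 homog_def)
next
  case False
  then obtain l0 where l0: "x l0 \<noteq> 0" by (auto simp: fun_eq_iff)
  then have "l0 \<in> T_basis d N n" "mset l0 = \<mu>"
    using x by (auto simp: T_space_def homog_def)
  then have \<mu>: "set_mset \<mu> \<subseteq> V_basis d N" by (auto simp: T_basis_def)
  show ?thesis unfolding homog_def
  proof (intro allI impI)
    fix l assume l: "f x l \<noteq> 0"
    then have "l \<in> T_basis d N n" using f_closed[OF x(1)] by (auto simp: T_space_def)
    then have sl: "set_mset (mset l) \<subseteq> V_basis d N" by (auto simp: T_basis_def)
    show "mset l = \<mu>"
    proof (rule multiset_eqI)
      fix a :: idx
      show "count (mset l) a = count \<mu> a"
      proof (cases "a \<in> V_basis d N")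
        case True
        then obtain b i where a: "a = (b, i)" "QK b i \<in> U_gens d N" by (cases a) (auto simp: V_basis_def U_gens_def)
        have "opK b i x = fscale (q ^ count \<mu> a) x"
          using x(2) by (auto simp: fun_eq_iff opK_def fscale_def kk_count a homog_def)
        then have "opK b i (f x) = fscale (q ^ count \<mu> a) (f x)"
          using f_gop[OF a(2) x(1)] by (simp add: f_scale[OF x(1)])
        from fun_cong[OF this, of l] l have "q powi int (count (mset l) a) = q powi int (count \<mu> a)"
          by (simp add: opK_def fscale_def kk_count a)
        then show ?thesis by (simp only: q_powi_inj of_nat_eq_iff)
      next
        case False
        then show ?thesis using \<mu> sl by (metis count_inI subsetD)
      qed
    qed
  qed
qed

text \<open>The condition is tested on homogeneous vectors only, because the commutator of
  \<open>E\<close> and \<open>F\<close> is a scalar on each weight space but not on the whole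
  space.\<close>

definition compat :: "qgen list \<Rightarrow> bool" where
  "compat w \<longleftrightarrow> (\<forall>x \<mu>. x \<in> T_space d N n \<longrightarrow> homog \<mu> x \<longrightarrow>
     f (proj d N n (word_op gop w x)) = proj d N n (word_op gop w (f x)))"

lemma linop_word_gop: "linop (word_op gop w)"
  by (rule linop_word_op[OF linop_gop])

text \<open>Exchanging \<open>E\<close> and \<open>F\<close> costs a multiple of the shorter word
  \<open>u @ v\<close>. The same scalar \<open>s\<close> serves for \<open>x\<close> and for
  \<open>f x\<close>, since \<open>f\<close> preserves weights.\<close>

lemma compat_swap:
  assumes "compat (u @ QF b i # QE c j # v)" "compat (u @ v)"
  shows "compat (u @ QE c j # QF b i # v)"
  unfolding compat_def
proof (intro allI impI)
  fix x \<mu> assume x: "x \<in> T_space d N n" "homog \<mu> x"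
  define \<nu> where "\<nu> = fold shift (rev v) \<mu>"
  define s where "s = (if (b, i) = (c, j) then 1 / (q - inverse q) * (kapm b i \<nu> - inverse (kapm b i \<nu>)) else 0)"
  have key: "word_op gop (u @ QE c j # QF b i # v) y
      = word_op gop (u @ QF b i # QE c j # v) y + fscale s (word_op gop (u @ v) y)" if y: "homog \<mu> y" for y
  proof -
    let ?z = "word_op gop v y"
    have z: "homog \<nu> ?z" unfolding \<nu>_def by (rule homog_word[OF y])
    have "opE c j (opF b i ?z) = opF b i (opE c j ?z) + fscale s ?z"
    proof
      fix l
      show "opE c j (opF b i ?z) l = (opF b i (opE c j ?z) + fscale s ?z) l"
      proof (cases "(b, i) = (c, j)")
        case True
        have "opE b i (opF b i ?z) l - opF b i (opE b i ?z) l
            = 1 / (q - inverse q) * ((kap b i l - inverse (kap b i l)) * ?z l)"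
          by (rule opE_opF_commutator)
        also have "\<dots> = s * ?z l"
          using z True by (cases "?z l = 0") (auto simp: homog_def kap_kapm s_def)
        finally show ?thesis using True by (simp add: fscale_def algebra_simps)
      next
        case False
        then show ?thesis using opE_opF_commute[of c j b i ?z l] by (auto simp: s_def fscale_def)
      qed
    qed
    then show ?thesis
      by (simp add: word_op_append linop_plus[OF linop_word_gop] linop_fscale[OF linop_word_gop] del: plus_fun_apply)
  qed
  have 1: "f (proj d N n (word_op gop (u @ QF b i # QE c j # v) x))
      = proj d N n (word_op gop (u @ QF b i # QE c j # v) (f x))"
    and 2: "f (proj d N n (word_op gop (u @ v) x)) = proj d N n (word_op gop (u @ v) (f x))"
    using assms x unfolding compat_def by blast+
  have "fscale s (proj d N n y) \<in> T_space d N n" for y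
    using proj_T_space[of d N n y] by (simp add: fscale_def T_space_scale)
  then show "f (proj d N n (word_op gop (u @ QE c j # QF b i # v) x))
      = proj d N n (word_op gop (u @ QE c j # QF b i # v) (f x))"
    unfolding key[OF x(2)] key[OF f_homog[OF x]] linop_plus[OF linop_proj] linop_fscale[OF linop_proj]
    by (simp only: f_add[OF proj_T_space] f_scale[OF proj_T_space] 1 2)
qed

definition is_F :: "qgen \<Rightarrow> bool" where
  "is_F g \<longleftrightarrow> (\<exists>b i. g = QF b i)"

lemma all_EF_cases: "g \<in> all_EF d \<Longrightarrow> (\<exists>b i. g = QF b i \<and> b \<in> {1..d} \<and> 1 \<le> i) \<or> (\<exists>b i. g = QE b i \<and> b \<in> {1..d} \<and> 1 \<le> i)"
  by (auto simp: all_EF_def)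

lemma compat_move:
  assumes short: "\<And>w. w \<in> lists (all_EF d) \<Longrightarrow> length w < k \<Longrightarrow> compat w"
    and F: "\<forall>g\<in>set fs. is_F g"
    and w: "u @ fs @ QE c j # v \<in> lists (all_EF d)" "length (u @ fs @ QE c j # v) = k"
    and c: "compat (u @ fs @ QE c j # v)"
  shows "compat (u @ QE c j # fs @ v)"
  using F w c
proof (induction fs arbitrary: u)
  case (Cons g fs)
  then obtain b i where g: "g = QF b i" by (auto simp: is_F_def)
  have "compat ((u @ [g]) @ QE c j # fs @ v)" using Cons by (intro Cons.IH) auto
  moreover have "compat (u @ fs @ v)" using Cons.prems by (intro short) auto
  ultimately show ?case using compat_swap[of u b i c j "fs @ v"] by (simp add: g)
qed simp

text \<open>Words act from the right, so the sorted word applies its \<open>E\<close> letters first.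
  Each exchange needed to undo the sorting costs a shorter word, which is covered by the assumption
  \<open>short\<close>.\<close>

lemma compat_sort:
  assumes short: "\<And>w. w \<in> lists (all_EF d) \<Longrightarrow> length w < k \<Longrightarrow> compat w"
    and w: "u @ w \<in> lists (all_EF d)" "length (u @ w) = k"
    and c: "compat (u @ filter is_F w @ filter (\<lambda>g. \<not> is_F g) w)"
  shows "compat (u @ w)"
  using w c
proof (induction w arbitrary: u)
  case (Cons g w)
  have len: "length (filter is_F w) + length (filter (\<lambda>g. \<not> is_F g) w) = length w"
    by (rule sum_length_filter_compl)
  have mem: "set (filter is_F w) \<subseteq> all_EF d" "set (filter (\<lambda>g. \<not> is_F g) w) \<subseteq> all_EF d" "set u \<subseteq> all_EF d" "g \<in> all_EF d"
    using Cons.prems(1) by auto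
  have "compat ((u @ [g]) @ filter is_F w @ filter (\<lambda>g. \<not> is_F g) w)"
  proof (cases "is_F g")
    case True
    with Cons.prems show ?thesis by simp
  next
    case False
    with mem(4) obtain b j where g: "g = QE b j" using all_EF_cases[OF mem(4)] by (auto simp: is_F_def)
    have "compat (u @ QE b j # filter is_F w @ filter (\<lambda>g. \<not> is_F g) w)"
      using Cons.prems False mem len by (intro compat_move[OF short]) (auto simp: g subset_iff)
    then show ?thesis by (simp add: g)
  qed
  with Cons.IH[of "u @ [g]"] Cons.prems show ?case by simp
qed simp

definition high :: "idx list \<Rightarrow> bool" where
  "high l \<longleftrightarrow> (\<exists>a\<in>set l. N (fst a) < snd a)"

lemma T_basis_not_high: "l \<in> T_basis d N n \<Longrightarrow> \<not> high l"
  by (auto simp: T_basis_def V_basis_def high_def)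

lemma opF_high:
  assumes "\<And>l. x l \<noteq> 0 \<Longrightarrow> high l \<or> N b \<le> i \<and> True" "opF b i x l \<noteq> 0"
  shows "high l"
proof -
  from assms(2) obtain p where p: "p < length l" "l ! p = (b, Suc i)" "x (l[p := (b, i)]) \<noteq> 0" by (rule opF_support)
  then have mem: "(b, Suc i) \<in> set l" by (metis nth_mem)
  from assms(1)[OF p(3)] show ?thesis
  proof
    assume "high (l[p := (b, i)])"
    then obtain a where a: "a \<in> set (l[p := (b, i)])" "N (fst a) < snd a" by (auto simp: high_def)
    then have "a = (b, i) \<or> a \<in> set l" using set_update_subset_insert[of l p "(b, i)"] by auto
    then show ?thesis
    proof
      assume "a = (b, i)"
      with a(2) have "N b < Suc i" by simp
      with mem show ?thesis unfolding high_def by (intro bexI[of _ "(b, Suc i)"]) simp_all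
    qed (use a(2) in \<open>auto simp: high_def\<close>)
  next
    assume "N b \<le> i \<and> True"
    with mem show ?thesis by (auto simp: high_def intro!: bexI[of _ "(b, Suc i)"])
  qed
qed

text \<open>Either all letters belong to the small algebra, with which \<open>f\<close> commutes, or
  some \<open>F\<close> pushes an index beyond its rank. As \<open>F\<close> only increases indices,
  such an entry never returns and the compression is zero on both sides.\<close>

lemma compat_F_word:
  assumes w: "w \<in> lists (all_EF d)" "\<forall>g\<in>set w. is_F g" shows "compat w"
proof (cases "set w \<subseteq> U_gens d N")
  case True
  have "word_op gop w x \<in> T_space d N n \<and> f (word_op gop w x) = word_op gop w (f x)" if "x \<in> T_space d N n" for x
    using True
  proof (induction w)
    case (Cons g w)
    then show ?case by (simp add: f_gop gop_T_space)
  qed (use that in simp)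
  then show ?thesis by (simp add: compat_def proj_id f_closed)
next
  case False
  have hw: "high l" if "\<not> set w \<subseteq> U_gens d N" "word_op gop w x l \<noteq> 0" for x l
    using w that
  proof (induction w arbitrary: l)
    case (Cons g w)
    then obtain b i where g: "g = QF b i" "b \<in> {1..d}" "1 \<le> i" using all_EF_cases[of g] by (auto simp: is_F_def)
    show ?case
    proof (rule opF_high[of "word_op gop w x" b i])
      show "opF b i (word_op gop w x) l \<noteq> 0" using Cons.prems by (simp add: g)
      fix l' assume l': "word_op gop w x l' \<noteq> 0"
      show "high l' \<or> N b \<le> i \<and> True"
      proof (cases "set w \<subseteq> U_gens d N")
        case True
        then have "g \<notin> U_gens d N" using Cons.prems by auto
        then show ?thesis using g by (auto simp: U_gens_simps)
      next
        case False
        then show ?thesis using Cons.IH[of l'] Cons.prems l' by simp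
      qed
    qed
  qed simp
  have "proj d N n (word_op gop w x) = 0" for x
    using hw[OF False] T_basis_not_high by (auto simp: proj_def fun_eq_iff)
  then show ?thesis by (simp add: compat_def f_0)
qed

text \<open>An \<open>E\<close> outside the small algebra consumes an entry beyond the rank, so it
  kills the small space; the others preserve it and commute with \<open>f\<close>. After the
  \<open>E\<close> part everything still lies in the small space, and \<open>compat_F_word\<close>
  takes over.\<close>

lemma compat_F_E:
  assumes F: "u \<in> lists (all_EF d)" "\<forall>g\<in>set u. is_F g"
    and E: "v \<in> lists (all_EF d)" "\<forall>g\<in>set v. \<not> is_F g"
  shows "compat (u @ v)"
  unfolding compat_def
proof (intro allI impI)
  fix x \<mu> assume x: "x \<in> T_space d N n" "homog \<mu> x"
  have "word_op gop v x \<in> T_space d N n \<and> f (word_op gop v x) = word_op gop v (f x)"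
    using E
  proof (induction v)
    case (Cons g v)
    then obtain b i where g: "g = QE b i" "b \<in> {1..d}" "1 \<le> i" using all_EF_cases[of g] by (auto simp: is_F_def)
    from Cons have v: "word_op gop v x \<in> T_space d N n" "f (word_op gop v x) = word_op gop v (f x)" by auto
    show ?case
    proof (cases "g \<in> U_gens d N")
      case True
      then show ?thesis using v by (simp add: f_gop gop_T_space)
    next
      case False
      then have i: "N b \<le> i" using g by (auto simp: U_gens_simps)
      have "opE b i y = 0" if y: "y \<in> T_space d N n" for y
      proof (rule ext, rule ccontr)
        fix l assume "opE b i y l \<noteq> 0 l"
        then obtain p where p: "p < length l" "y (l[p := (b, Suc i)]) \<noteq> 0"
          by (auto elim: opE_support)
        then have "l[p := (b, Suc i)] \<in> T_basis d N n" using y by (auto simp: T_space_def)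
        moreover have "high (l[p := (b, Suc i)])"
          using p i by (auto simp: high_def set_update_memI intro!: bexI[of _ "(b, Suc i)"])
        ultimately show False using T_basis_not_high by blast
      qed
      then have "gop g (word_op gop v x) = 0" "gop g (word_op gop v (f x)) = 0"
        using v f_closed[OF v(1)] by (auto simp: g)
      then show ?thesis using T_space_0[of d N n] by (simp add: f_0[unfolded zero_fun_def])
    qed
  qed (use x in simp)
  then have A: "word_op gop v x \<in> T_space d N n" "f (word_op gop v x) = word_op gop v (f x)" by auto
  have "f (proj d N n (word_op gop u (word_op gop v x))) = proj d N n (word_op gop u (f (word_op gop v x)))"
    using compat_F_word[OF F] A(1) homog_word[OF x(2)] unfolding compat_def by blast
  then show "f (proj d N n (word_op gop (u @ v) x)) = proj d N n (word_op gop (u @ v) (f x))"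
    by (simp add: word_op_append A(2))
qed

lemma compat_word: "w \<in> lists (all_EF d) \<Longrightarrow> compat w"
proof (induction "length w" arbitrary: w rule: less_induct)
  case less
  have "compat (filter is_F w @ filter (\<lambda>g. \<not> is_F g) w)"
    using less.prems by (intro compat_F_E) auto
  then show ?case
    using compat_sort[of "length w" "[]" w] less by simp
qed

end

subsection \<open>Orthogonal projection\<close>

text \<open>Gram-Schmidt, possible because the standard bilinear form is anisotropic on \<open>realq\<close>-valued functions.\<close>

lemma gram_schmidt:
  assumes I: "finite I" and "finite B" "\<And>g l. g \<in> B \<Longrightarrow> g l \<in> realq" "\<And>l. v l \<in> realq"
  shows "\<exists>c. (\<forall>h. c h \<in> realq) \<and> (\<forall>g\<in>B. (\<Sum>l\<in>I. g l * (v l - (\<Sum>h\<in>B. c h * h l))) = 0)"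
  using assms(2-4)
proof (induction B arbitrary: v)
  case empty
  show ?case by (intro exI[of _ "\<lambda>_. 0"]) auto
next
  case (insert g B)
  have IH: "\<exists>c. (\<forall>h. c h \<in> realq) \<and> (\<forall>g\<in>B. (\<Sum>l\<in>I. g l * (v l - (\<Sum>h\<in>B. c h * h l))) = 0)"
    if "\<And>l. v l \<in> realq" for v
    by (rule insert.IH) (use insert.prems that in auto)
  obtain c where "\<forall>h. c h \<in> realq" "\<forall>g\<in>B. (\<Sum>l\<in>I. g l * (v l - (\<Sum>h\<in>B. c h * h l))) = 0"
    using IH[of v] insert.prems(2) by blast
  then have c: "\<And>h. c h \<in> realq" "\<And>h. h \<in> B \<Longrightarrow> (\<Sum>l\<in>I. h l * (v l - (\<Sum>h\<in>B. c h * h l))) = 0"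
    by blast+
  have "\<And>l. g l \<in> realq" using insert.prems(1) by blast
  from IH[of g, OF this] obtain e where "\<forall>h. e h \<in> realq" "\<forall>h\<in>B. (\<Sum>l\<in>I. h l * (g l - (\<Sum>h\<in>B. e h * h l))) = 0"
    by blast
  then have e: "\<And>h. e h \<in> realq" "\<And>h. h \<in> B \<Longrightarrow> (\<Sum>l\<in>I. h l * (g l - (\<Sum>h\<in>B. e h * h l))) = 0"
    by blast+
  define g' where "g' = (\<lambda>l. g l - (\<Sum>h\<in>B. e h * h l))"
  define v' where "v' = (\<lambda>l. v l - (\<Sum>h\<in>B. c h * h l))"
  have g'r: "g' l \<in> realq" for l unfolding g'_def using insert.prems e(1) by auto
  have v'r: "v' l \<in> realq" for l unfolding v'_def using insert.prems c(1) by auto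
  define t where "t = (\<Sum>l\<in>I. g' l * v' l) / (\<Sum>l\<in>I. g' l * g' l)"
  have t: "t \<in> realq" unfolding t_def using g'r v'r by auto
  define a where "a = (\<lambda>h. if h = g then t else c h - t * e h)"
  have v'': "v l - (\<Sum>h\<in>insert g B. a h * h l) = v' l - t * g' l" for l
  proof -
    have "(\<Sum>h\<in>B. a h * h l) = (\<Sum>h\<in>B. c h * h l - t * (e h * h l))"
      using insert.hyps by (intro sum.cong) (auto simp: a_def algebra_simps)
    then show ?thesis
      using insert.hyps by (simp add: sum_subtractf v'_def g'_def algebra_simps flip: sum_distrib_left) (simp add: a_def)
  qed
  have B: "(\<Sum>l\<in>I. h l * (v' l - t * g' l)) = 0" if "h \<in> B" for h
  proof -
    have "(\<Sum>l\<in>I. h l * (v' l - t * g' l)) = (\<Sum>l\<in>I. h l * v' l) - t * (\<Sum>l\<in>I. h l * g' l)"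
      by (simp add: algebra_simps sum_subtractf sum_distrib_left)
    then show ?thesis using c(2)[OF that] e(2)[OF that] by (simp add: v'_def g'_def)
  qed
  \<comment> \<open>If \<open>g'\<close> has norm zero, it vanishes on \<open>I\<close> by
    anisotropy, and the value of the quotient \<open>t\<close> is irrelevant. This is the only place
    where the real subfield is decisive.\<close>
  have g'0: "(\<Sum>l\<in>I. g' l * (v' l - t * g' l)) = 0"
  proof (cases "(\<Sum>l\<in>I. g' l * g' l) = 0")
    case True
    then have "g' l = 0" if "l \<in> I" for l using realq_sum_squares_eq_0[of I g' l] I g'r True that by blast
    then show ?thesis by simp
  next
    case False
    have "(\<Sum>l\<in>I. g' l * (v' l - t * g' l)) = (\<Sum>l\<in>I. g' l * v' l) - t * (\<Sum>l\<in>I. g' l * g' l)"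
      by (simp add: algebra_simps sum_subtractf sum_distrib_left)
    then show ?thesis using False by (simp add: t_def)
  qed
  have "g l = g' l + (\<Sum>h\<in>B. e h * h l)" for l by (simp add: g'_def)
  then have "g l * X = g' l * X + (\<Sum>h\<in>B. e h * (h l * X))" for l X
    by (simp only: distrib_right sum_distrib_right mult.assoc)
  then have "(\<Sum>l\<in>I. g l * (v' l - t * g' l))
      = (\<Sum>l\<in>I. g' l * (v' l - t * g' l)) + (\<Sum>l\<in>I. \<Sum>h\<in>B. e h * (h l * (v' l - t * g' l)))"
    by (simp only: sum.distrib)
  also have "(\<Sum>l\<in>I. \<Sum>h\<in>B. e h * (h l * (v' l - t * g' l))) = (\<Sum>h\<in>B. e h * (\<Sum>l\<in>I. h l * (v' l - t * g' l)))"
    by (subst sum.swap) (simp add: sum_distrib_left)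
  also have "\<dots> = 0" using B by simp
  finally have G: "(\<Sum>l\<in>I. g l * (v' l - t * g' l)) = 0" using g'0 by simp
  show ?case
  proof (intro exI conjI)
    show "\<forall>h. a h \<in> realq" using t c(1) e(1) by (simp add: a_def)
    show "\<forall>h\<in>insert g B. (\<Sum>l\<in>I. h l * (v l - (\<Sum>h\<in>insert g B. a h * h l))) = 0"
      unfolding v'' using B G by blast
  qed
qed

lemma fun_sum_apply: "(\<Sum>i\<in>I. F i) l = (\<Sum>i\<in>I. F i l)"
  by (induction I rule: infinite_finite_induct) auto

text \<open>\<open>G\<close> may be infinite. Gram-Schmidt is applied to a maximal independent
  subset, which is finite because the tensor space has finite dimension, and orthogonality extends
  to its span.\<close>

lemma orthogonal_projection:
  assumes I: "finite (T_basis d N n)" and G: "\<And>g. g \<in> G \<Longrightarrow> g \<in> T_space d N n"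
    "\<And>g l. g \<in> G \<Longrightarrow> g l \<in> realq" and v: "\<And>l. v l \<in> realq"
  shows "\<exists>B c. finite B \<and> B \<subseteq> G \<and>
    (\<forall>g\<in>G. (\<Sum>l\<in>T_basis d N n. g l * (v l - (\<Sum>h\<in>B. c h * h l))) = 0)"
proof -
  obtain B where B: "B \<subseteq> G" "fs.independent B" "G \<subseteq> fs.span B"
    by (rule fs.maximal_independent_subset[of G])
  have "g \<in> fs.span (delta ` T_basis d N n)" if "g \<in> G" for g
  proof -
    have "g = (\<Sum>m\<in>T_basis d N n. fscale (g m) (delta m))"
      by (rule ext, unfold fun_sum_apply fscale_def, rule fun_cong[OF T_space_expand[OF G(1)[OF that]]])
    also have "\<dots> \<in> fs.span (delta ` T_basis d N n)"
      by (intro fs.span_sum fs.span_scale fs.span_base imageI)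
    finally show ?thesis .
  qed
  with B have "finite B"
    using fs.independent_span_bound[of "delta ` T_basis d N n" B] finite_T_basis by blast
  have Br: "\<And>g l. g \<in> B \<Longrightarrow> g l \<in> realq" using G(2) B(1) by (meson subsetD)
  have "\<exists>c. (\<forall>h. c h \<in> realq) \<and>
      (\<forall>g\<in>B. (\<Sum>l\<in>T_basis d N n. g l * (v l - (\<Sum>h\<in>B. c h * h l))) = 0)"
    by (rule gram_schmidt) (rule I \<open>finite B\<close> v | erule Br)+
  then obtain c where c: "\<forall>g\<in>B. (\<Sum>l\<in>T_basis d N n. g l * (v l - (\<Sum>h\<in>B. c h * h l))) = 0"
    by (elim exE conjE)
  define R where "R = (\<lambda>l. v l - (\<Sum>h\<in>B. c h * h l))"
  have "(\<Sum>l\<in>T_basis d N n. g l * R l) = 0" if "g \<in> G" for g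
  proof -
    have "g \<in> fs.span B" using that B(3) by (rule rev_subsetD)
    then show ?thesis
    proof (induction rule: fs.span_induct_alt)
      case base
      show ?case by (intro sum.neutral) simp
    next
      case (step a x y)
      have "(\<Sum>l\<in>T_basis d N n. (fscale a x + y) l * R l) =
          a * (\<Sum>l\<in>T_basis d N n. x l * R l) + (\<Sum>l\<in>T_basis d N n. y l * R l)"
        by (simp add: fscale_def distrib_right sum.distrib sum_distrib_left mult.assoc)
      also have "(\<Sum>l\<in>T_basis d N n. x l * R l) = 0" unfolding R_def by (rule bspec[OF c step.hyps])
      finally show ?case by (simp only: step.IH mult_zero_right add_0_left)
    qed
  qed
  then have "\<forall>g\<in>G. (\<Sum>l\<in>T_basis d N n. g l * (v l - (\<Sum>h\<in>B. c h * h l))) = 0"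
    unfolding R_def by (rule ballI)
  with \<open>finite B\<close> B(1) show ?thesis by (intro exI conjI)
qed

subsection \<open>Adjoints\<close>

definition pairing :: "nat \<Rightarrow> (nat \<Rightarrow> nat) \<Rightarrow> nat \<Rightarrow> tensor \<Rightarrow> tensor \<Rightarrow> kq" where
  "pairing d N n x y = (\<Sum>l\<in>T_basis d N n. x l * y l)"

fun dual :: "qgen \<Rightarrow> qgen" where
  "dual (QE b i) = QF b i"
| "dual (QF b i) = QE b i"
| "dual (QK b i) = QK b i"
| "dual (QKi b i) = QKi b i"

lemma EF_gens_U: "EF_gens d N \<subseteq> U_gens d N"
  by (auto simp: EF_gens_def U_gens_def)

lemma linop_expand:
  assumes "linop h" "y \<in> T_space d N n"
  shows "h y l = (\<Sum>m\<in>T_basis d N n. y m * h (delta m) l)"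
proof -
  have "h y = h (\<lambda>l. \<Sum>m\<in>T_basis d N n. y m * delta m l)"
    using T_space_expand[OF assms(2)] by simp
  then show ?thesis by (simp add: linop_sum[OF assms(1)])
qed

text \<open>The factor in \<open>opE_delta_opF_delta\<close> depends only on a weight and so comes
  out of the sum. Its value is left open, since pairings are used only to show that something
  vanishes.\<close>

lemma pairing_gop:
  assumes g: "g \<in> EF_gens d N" and x: "x \<in> T_space d N n" "homog \<mu> x" and y: "y \<in> T_space d N n"
  shows "\<exists>s. pairing d N n x (gop g y) = s * pairing d N n (gop (dual g) x) y"
proof -
  have adj: "\<exists>s. pairing d N n x (h y) = s * pairing d N n (h' x) y"
    if h: "linop h" and h': "linop h'"
      and a: "\<And>l m. x l \<noteq> 0 \<Longrightarrow> h (delta m) l = s * h' (delta l) m" for h h' s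
  proof -
    have "pairing d N n x (h y) = (\<Sum>l\<in>T_basis d N n. \<Sum>m\<in>T_basis d N n. x l * (y m * h (delta m) l))"
      unfolding pairing_def by (simp add: linop_expand[OF h y] sum_distrib_left)
    also have "\<dots> = (\<Sum>l\<in>T_basis d N n. \<Sum>m\<in>T_basis d N n. s * (x l * h' (delta l) m * y m))"
    proof (intro sum.cong refl)
      fix l m show "x l * (y m * h (delta m) l) = s * (x l * h' (delta l) m * y m)"
        using a[of l m] by (cases "x l = 0") auto
    qed
    also have "\<dots> = (\<Sum>m\<in>T_basis d N n. \<Sum>l\<in>T_basis d N n. s * (x l * h' (delta l) m * y m))"
      by (rule sum.swap)
    also have "\<dots> = s * pairing d N n (h' x) y"
      unfolding pairing_def by (simp add: linop_expand[OF h' x(1)] sum_distrib_left sum_distrib_right)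
    finally show ?thesis by blast
  qed
  from g consider (E) b i where "g = QE b i" | (F) b i where "g = QF b i"
    by (auto simp: EF_gens_def)
  then show ?thesis
  proof cases
    case E
    have l: "linop (opE b i)" "linop (opF b i)" using linop_gop[of "QE b i"] linop_gop[of "QF b i"] by simp_all
    have "opE b i (delta m) l = (inverse q * kapm b i \<mu>) * opF b i (delta l) m" if "x l \<noteq> 0" for l m
      using that x(2) by (auto simp: opE_delta_opF_delta kap_kapm homog_def)
    from adj[OF l this] E show ?thesis by simp
  next
    case F
    have l: "linop (opF b i)" "linop (opE b i)" using linop_gop[of "QE b i"] linop_gop[of "QF b i"] by simp_all
    have "opF b i (delta m) l = (q * inverse (kapm b i (shift (QE b i) \<mu>))) * opE b i (delta l) m" if "x l \<noteq> 0" for l m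
    proof (cases "opE b i (delta l) m = 0")
      case True
      then show ?thesis using opE_delta_opF_delta[of b i l m] by simp
    next
      case False
      have "mset l = \<mu>" using that x(2) by (simp add: homog_def)
      then have "mset m = shift (QE b i) \<mu>"
        using False homog_gop[OF homog_delta, of "QE b i" l] by (simp add: homog_def)
      then have "kapm b i (shift (QE b i) \<mu>) = kap b i m" by (simp add: kap_kapm)
      then show ?thesis
        using opE_delta_opF_delta[of b i l m] by (simp add: field_simps)
    qed
    from adj[OF l this] F show ?thesis by simp
  qed
qed

lemma dual_EF: "g \<in> EF_gens d N \<Longrightarrow> dual g \<in> EF_gens d N"
  by (auto simp: EF_gens_def)

lemma word_EF_T_space: "w \<in> lists (EF_gens d N) \<Longrightarrow> x \<in> T_space d N n \<Longrightarrow> word_op gop w x \<in> T_space d N n"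
  using EF_gens_U[of d N] by (induction w) (auto simp: gop_T_space subset_iff)

lemma pairing_word:
  assumes "u \<in> lists (EF_gens d N)" "x \<in> T_space d N n" "homog \<mu> x" "y \<in> T_space d N n"
  shows "\<exists>s. pairing d N n x (word_op gop u y) = s * pairing d N n (word_op gop (rev (map dual u)) x) y"
  using assms
proof (induction u arbitrary: x \<mu>)
  case Nil
  show ?case by (intro exI[of _ 1]) simp
next
  case (Cons g u)
  have gu: "g \<in> EF_gens d N" "u \<in> lists (EF_gens d N)" using Cons.hyps by auto
  obtain s where s: "pairing d N n x (gop g (word_op gop u y)) = s * pairing d N n (gop (dual g) x) (word_op gop u y)"
    using pairing_gop[OF gu(1) Cons.prems(1,2) word_EF_T_space[OF gu(2) Cons.prems(3)]] by blast
  have "gop (dual g) x \<in> T_space d N n"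
    using gu dual_EF EF_gens_U Cons.prems by (intro gop_T_space) blast+
  from Cons.IH[OF this homog_gop[OF Cons.prems(2)] Cons.prems(3)]
  obtain s' where "pairing d N n (gop (dual g) x) (word_op gop u y)
      = s' * pairing d N n (word_op gop (rev (map dual u)) (gop (dual g) x)) y" by blast
  with s show ?case by (intro exI[of _ "s * s'"]) (simp add: word_op_append)
qed

lemma realq_kap: "kap b i l \<in> realq"
  by (induction l) (auto simp: wtk_def)

lemma realq_word: "w \<in> lists (EF_gens d N) \<Longrightarrow> word_op gop w (delta m) l \<in> realq"
proof (induction w arbitrary: l)
  case Nil
  show ?case by (simp add: delta_def)
next
  case (Cons g w)
  then have r: "word_op gop w (delta m) l \<in> realq" for l by simp
  from Cons.prems consider (E) b i where "g = QE b i" | (F) b i where "g = QF b i"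
    by (auto simp: EF_gens_def)
  then show ?case
    using r realq_kap by cases (simp_all add: opE_apply opF_apply)
qed

section \<open>Transport of a tensor of the enlarged space by an endomorphism of the small
  one\<close>

context
  fixes d n :: nat and N :: "nat \<Rightarrow> nat" and f :: "tensor \<Rightarrow> tensor" and v :: "idx list"
  assumes f: "f \<in> carrier (End_Uq d N n)" and v: "v \<in> T_basis d (\<lambda>b. N b + n) n"
begin

abbreviation (input) "M \<equiv> \<lambda>b. N b + n"

lemma T_basis_mono: "T_basis d N n \<subseteq> T_basis d M n"
  by (fastforce simp: T_basis_def V_basis_def)

lemma EF_all: "w \<in> lists (EF_gens d M) \<Longrightarrow> w \<in> lists (all_EF d)"
  using EF_gens_all by blast

text \<open>\<open>y\<close> stands for the image of \<open>v\<close> under \<open>f\<close>. With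
  \<open>delta v\<close> written as a combination of the words in \<open>G\<close> plus a remainder
  \<open>r\<close>, it is obtained by replacing each small tensor \<open>delta (m g)\<close> by its
  image under \<open>f\<close> and dropping \<open>r\<close>.\<close>

lemma transport_vector:
  "\<exists>y\<in>T_space d M n. homog (mset v) y \<and> (\<forall>u\<in>lists (EF_gens d M).
      proj d N n (word_op gop u y) = f (proj d N n (word_op gop u (delta v))))"
proof -
  define G where "G = {word_op gop w (delta m) | w m. w \<in> lists (EF_gens d M) \<and> m \<in> T_basis d N n
    \<and> fold shift (rev w) (mset m) = mset v}"
  have G: "g \<in> T_space d M n \<and> (\<forall>l. g l \<in> realq) \<and> homog (mset v) g" if "g \<in> G" for g
  proof -
    from that obtain w m where wm: "g = word_op gop w (delta m)" "w \<in> lists (EF_gens d M)" "m \<in> T_basis d N n"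
      "fold shift (rev w) (mset m) = mset v" unfolding G_def by blast
    then have "m \<in> T_basis d M n" using T_basis_mono by blast
    moreover have "homog (mset v) g" using homog_word[OF homog_delta, of w m] wm(1,4) by simp
    ultimately show ?thesis using wm(1,2) by (simp add: word_EF_T_space delta_T_space realq_word)
  qed
  then have GT: "g \<in> T_space d M n" and Gr: "g l \<in> realq" and Gh: "homog (mset v) g" if "g \<in> G" for g l
    using that by blast+
  have dv: "delta v l \<in> realq" for l by (simp add: delta_def)
  have "\<exists>B c. finite B \<and> B \<subseteq> G \<and>
    (\<forall>g\<in>G. (\<Sum>l\<in>T_basis d M n. g l * (delta v l - (\<Sum>h\<in>B. c h * h l))) = 0)"
    by (rule orthogonal_projection[OF finite_T_basis]; (erule GT | erule Gr | rule dv))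
  then obtain B c where B: "finite B" "B \<subseteq> G"
    and orth: "\<And>g. g \<in> G \<Longrightarrow> (\<Sum>l\<in>T_basis d M n. g l * (delta v l - (\<Sum>h\<in>B. c h * h l))) = 0"
    by blast
  have "\<forall>g\<in>B. \<exists>w m. g = word_op gop w (delta m) \<and> w \<in> lists (EF_gens d M) \<and> m \<in> T_basis d N n
      \<and> fold shift (rev w) (mset m) = mset v"
    using B(2) unfolding G_def by blast
  then obtain w m where wm: "\<And>g. g \<in> B \<Longrightarrow> g = word_op gop (w g) (delta (m g))"
    "\<And>g. g \<in> B \<Longrightarrow> w g \<in> lists (EF_gens d M)" "\<And>g. g \<in> B \<Longrightarrow> m g \<in> T_basis d N n"
    "\<And>g. g \<in> B \<Longrightarrow> fold shift (rev (w g)) (mset (m g)) = mset v"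
    by metis
  define r where "r = (\<lambda>l. delta v l - (\<Sum>h\<in>B. c h * h l))"
  have rT: "r \<in> T_space d M n"
  proof -
    have "r l = 0" if "l \<notin> T_basis d M n" for l
    proof -
      have "h l = 0" if "h \<in> B" for h
        using GT[of h] B(2) that \<open>l \<notin> T_basis d M n\<close> by (auto simp: T_space_def)
      then have "(\<Sum>h\<in>B. c h * h l) = 0" by (intro sum.neutral) simp
      moreover have "l \<noteq> v" using v that by blast
      ultimately show ?thesis by (simp add: r_def delta_def)
    qed
    then show ?thesis by (simp add: T_space_def)
  qed
  have rh: "homog (mset v) r"
  proof -
    have "r l = 0" if "mset l \<noteq> mset v" for l
    proof -
      have "h l = 0" if "h \<in> B" for h using Gh[of h] B(2) that \<open>mset l \<noteq> mset v\<close> by (auto simp: homog_def)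
      then have "(\<Sum>h\<in>B. c h * h l) = 0" by (intro sum.neutral) simp
      moreover have "l \<noteq> v" using that by auto
      ultimately show ?thesis by (simp add: r_def delta_def)
    qed
    then show ?thesis by (auto simp: homog_def)
  qed
  \<comment> \<open>A coefficient at a small \<open>t\<close> is the pairing with
    \<open>delta t\<close>. With \<open>u\<close> moved to the other side, \<open>delta t\<close>
    becomes either a member of \<open>G\<close>, orthogonal to \<open>r\<close>, or a vector whose
    weight differs from that of \<open>r\<close>.\<close>
  have r0: "proj d N n (word_op gop u r) = (\<lambda>l. 0)" if u: "u \<in> lists (EF_gens d M)" for u
  proof
    fix t
    show "proj d N n (word_op gop u r) t = 0"
    proof (cases "t \<in> T_basis d N n")
      case True
      then have t: "t \<in> T_basis d M n" using T_basis_mono by blast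
      let ?w = "rev (map dual u)"
      obtain s where s: "pairing d M n (delta t) (word_op gop u r) = s * pairing d M n (word_op gop ?w (delta t)) r"
        using pairing_word[OF u delta_T_space[OF t] homog_delta rT] by blast
      have wE: "?w \<in> lists (EF_gens d M)" using u dual_EF by auto
      have "pairing d M n (word_op gop ?w (delta t)) r = 0"
      proof (cases "fold shift (rev ?w) (mset t) = mset v")
        case eq: True
        then have "word_op gop ?w (delta t) \<in> G" using wE True unfolding G_def by blast
        from orth[OF this] show ?thesis by (simp add: pairing_def r_def)
      next
        case False
        then have "word_op gop ?w (delta t) l * r l = 0" for l
          using homog_word[OF homog_delta, of ?w t] rh by (auto simp: homog_def)
        then show ?thesis unfolding pairing_def by (intro sum.neutral ballI)
      qed
      moreover have "pairing d M n (delta t) (word_op gop u r) = word_op gop u r t"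
        using t by (simp add: pairing_def sum_delta_mult finite_T_basis)
      ultimately show ?thesis using s by (simp add: proj_def)
    qed (simp add: proj_def)
  qed
  define y where "y = (\<lambda>l. \<Sum>g\<in>B. c g * word_op gop (w g) (f (delta (m g))) l)"
  have fm: "f (delta (m g)) \<in> T_space d N n" "homog (mset (m g)) (f (delta (m g)))" if "g \<in> B" for g
    using wm(3)[OF that] by (auto intro!: f_closed[OF f] f_homog[OF f] delta_T_space homog_delta)
  have sub: "x \<in> T_space d M n" if "x \<in> T_space d N n" for x
    using that T_basis_mono by (auto simp: T_space_def)
  have 1: "y \<in> T_space d M n"
    unfolding y_def by (intro T_space_sum T_space_scale word_EF_T_space wm(2) sub fm)
  have 2: "homog (mset v) y"
  proof -
    have "y l = 0" if "mset l \<noteq> mset v" for l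
    proof -
      have "word_op gop (w g) (f (delta (m g))) l = 0" if "g \<in> B" for g
        using homog_word[OF fm(2)[OF that], of "w g"] wm(4)[OF that] \<open>mset l \<noteq> mset v\<close> by (auto simp: homog_def)
      then show ?thesis by (simp add: y_def)
    qed
    then show ?thesis by (auto simp: homog_def)
  qed
  have 3: "proj d N n (word_op gop u y) = f (proj d N n (word_op gop u (delta v)))"
    if u: "u \<in> lists (EF_gens d M)" for u
  proof -
    let ?P = "\<lambda>x. proj d N n (word_op gop u x)"
    have lin: "linop ?P" by (rule linop_comp[OF linop_proj linop_word_gop[OF f]])
    \<comment> \<open>Compatibility is used for the concatenation \<open>u @ w g\<close>, not for
      \<open>u\<close>: the vector \<open>g\<close> need not lie in the small space, but
      \<open>delta (m g)\<close> does.\<close>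
    have cmp: "f (?P g) = ?P (word_op gop (w g) (f (delta (m g))))" if g: "g \<in> B" for g
    proof -
      have "compat d n N f (u @ w g)" using u wm(2)[OF g] by (intro compat_word[OF f] EF_all) auto
      then have "f (proj d N n (word_op gop (u @ w g) (delta (m g)))) = proj d N n (word_op gop (u @ w g) (f (delta (m g))))"
        using delta_T_space[OF wm(3)[OF g]] homog_delta unfolding compat_def[OF f] by blast
      then show ?thesis using wm(1)[OF g] by (simp add: word_op_append)
    qed
    have dv: "delta v = (\<lambda>l. (\<Sum>h\<in>B. c h * h l) + r l)" by (simp add: r_def)
    have "?P (delta v) = (\<lambda>l. (\<Sum>h\<in>B. c h * ?P h l))"
      by (subst dv) (simp add: linop_add[OF lin] linop_sum[OF lin] r0[OF u])
    then have "f (?P (delta v)) = (\<lambda>l. \<Sum>h\<in>B. c h * f (?P h) l)"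
      using T_End_apply_sum[OF f_End[OF f], of B ?P c] by (simp add: proj_T_space)
    also have "\<dots> = ?P y"
      unfolding y_def linop_sum[OF lin] by (intro ext sum.cong refl) (simp add: cmp)
    finally show ?thesis by simp
  qed
  show ?thesis by (rule bexI[OF _ 1]) (intro conjI ballI 2 3)
qed

end

subsection \<open>Rearrangements\<close>

text \<open>Bubble sort: the head of \<open>m\<close> is moved to the front of \<open>l\<close>, and
  the induction continues with \<open>P\<close> restricted to lists that begin with this
  head.\<close>

lemma adjacent_swaps:
  assumes "\<And>m k. P m \<Longrightarrow> Suc k < length m \<Longrightarrow> P (m[k := m ! Suc k, Suc k := m ! k])"
    and "mset l = mset m" "P l"
  shows "P m"
  using assms
proof (induction m arbitrary: l P)
  case (Cons a m)
  note swap = Cons.prems(1)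
  have front: "P (a # l1 @ l2)" if "P (l1 @ a # l2)" for l1 l2
    using that
  proof (induction l1 arbitrary: l2 rule: rev_induct)
    case (snoc x l1)
    from swap[OF snoc.prems, of "length l1"] have "P (l1 @ a # x # l2)"
      by (simp add: nth_append list_update_append)
    from snoc.IH[OF this] show ?case by simp
  qed simp
  have "a \<in> set l" using Cons.prems(2) by (metis list.set_intros(1) set_mset_mset)
  then obtain l1 l2 where l: "l = l1 @ a # l2" by (meson split_list)
  have "P (a # l1 @ l2)" using front Cons.prems(3) by (simp add: l)
  moreover have "mset (l1 @ l2) = mset m" using Cons.prems(2) by (simp add: l)
  moreover have "P (a # m'[k := m' ! Suc k, Suc k := m' ! k])" if "P (a # m')" "Suc k < length m'" for m' k
    using swap[OF that(1), of "Suc k"] that(2) by simp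
  ultimately show ?case using Cons.IH[of "\<lambda>m. P (a # m)" "l1 @ l2"] by blast
qed simp

lemma sg_delta_swap:
  assumes "Suc k < length m" "m ! k \<noteq> m ! Suc k"
  shows "\<exists>s. sg k (delta m) = delta (m[k := m ! Suc k, Suc k := m ! k]) + fscale s (delta m)"
proof -
  obtain b j c e where bj: "m ! k = (b, j)" "m ! Suc k = (c, e)" by (metis surj_pair)
  then consider "b \<noteq> c \<or> j < e" | "b = c" "e < j" using assms(2) by fastforce
  then show ?thesis
  proof cases
    case 1
    then show ?thesis using assms bj
      by (intro exI[of _ 0]) (auto simp: sg_delta_sigma_basis fun_eq_iff sigma_basis_def swap_factors_def fscale_def Let_def)
  next
    case 2
    then show ?thesis using assms bj
      by (intro exI[of _ "q - inverse q"])
        (auto simp: sg_delta_sigma_basis fun_eq_iff sigma_basis_def swap_factors_def fscale_def Let_def)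
  qed
qed

lemma linop_word_sg: "linop (word_op sg w)"
  by (rule linop_word_op[OF linop_sg])

text \<open>On different neighbours \<open>sg k\<close> is the exchange up to a multiple of the
  tensor itself, so every exchange stays in the span. Distinct entries exclude the case where
  \<open>sg k\<close> is only a scalar.\<close>

lemma delta_rearrangement_span:
  assumes v: "distinct v" "length v = n" and m: "mset m = mset v"
  shows "delta m \<in> fs.span {word_op sg w (delta v) | w. w \<in> lists {k. Suc k < n}}" (is "_ \<in> fs.span ?S")
proof -
  have "length m = n \<and> distinct m \<and> delta m \<in> fs.span ?S"
  proof (rule adjacent_swaps[where P = "\<lambda>m. length m = n \<and> distinct m \<and> delta m \<in> fs.span ?S"])
    fix m k assume P: "length m = n \<and> distinct m \<and> delta m \<in> fs.span ?S" and k: "Suc k < length m"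
    let ?m = "m[k := m ! Suc k, Suc k := m ! k]"
    have ne: "m ! k \<noteq> m ! Suc k" using P k by (simp add: nth_eq_iff_index_eq)
    have "sg k (delta m) \<in> fs.span ?S"
    proof (rule span_linop[OF linop_sg])
      fix y assume "y \<in> ?S"
      then obtain w where "w \<in> lists {k. Suc k < n}" "y = word_op sg w (delta v)" by blast
      then show "sg k y \<in> fs.span ?S"
        using k P by (intro fs.span_base CollectI exI[of _ "k # w"]) simp
    qed (use P in simp)
    moreover obtain s where "sg k (delta m) = delta ?m + fscale s (delta m)" using sg_delta_swap[OF k ne] by blast
    then have "delta ?m = sg k (delta m) - fscale s (delta m)" by (simp add: fun_eq_iff)
    ultimately have "delta ?m \<in> fs.span ?S" using P by (simp only: fs.span_diff fs.span_scale)
    moreover have "distinct ?m" using P k by (simp add: distinct_swap)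
    ultimately show "length ?m = n \<and> distinct ?m \<and> delta ?m \<in> fs.span ?S" using P by simp
  next
    show "mset v = mset m" using m by simp
    have "delta v \<in> fs.span ?S" by (intro fs.span_base CollectI exI[of _ "[]"]) simp
    then show "length v = n \<and> distinct v \<and> delta v \<in> fs.span ?S" using v by simp
  qed
  then show ?thesis by blast
qed

lemma word_sg_gop: "word_op sg w (word_op gop u x) = word_op gop u (word_op sg w x)"
proof (induction w)
  case (Cons k w)
  have "sg k (word_op gop u y) = word_op gop u (sg k y)" for y
    by (induction u) (simp_all add: sg_gop)
  with Cons show ?case by simp
qed simp

text \<open>The vector \<open>y\<close> that stands for the image of \<open>v\<close> has the weight
  of \<open>v\<close>, hence is \<open>\<Theta>\<close> applied to \<open>delta v\<close> for a
  combination \<open>\<Theta>\<close> of braid words. As \<open>\<Theta>\<close> commutes with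
  raising and lowering, it agrees with \<open>f\<close> after compression on the whole module
  generated by \<open>v\<close>, and by \<open>orb_generate\<close> this contains every small tensor
  with the colours of \<open>v\<close>.\<close>

theorem commutant_formula:
  assumes f: "f \<in> carrier (End_Uq d N n)"
    and v: "v \<in> T_basis d (\<lambda>b. N b + n) n" "distinct v" "\<And>b j. (b, j) \<in> set v \<Longrightarrow> N b < j"
  shows "\<exists>W c. finite W \<and> W \<subseteq> lists {k. Suc k < n} \<and>
    (\<forall>t\<in>T_basis d N n. map fst t = map fst v \<longrightarrow>
      f (delta t) = (\<lambda>l. \<Sum>w\<in>W. c w * word_op sg w (delta t) l))"
proof -
  let ?M = "\<lambda>b. N b + n"
  let ?S = "{word_op sg w (delta v) | w. w \<in> lists {k. Suc k < n}}"
  obtain y where y: "y \<in> T_space d ?M n" "homog (mset v) y"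
    "\<And>u. u \<in> lists (EF_gens d ?M) \<Longrightarrow> proj d N n (word_op gop u y) = f (proj d N n (word_op gop u (delta v)))"
    using transport_vector[OF f v(1)] by blast
  have len: "length v = n" using v(1) by (simp add: T_basis_def)
  have "y = (\<Sum>m\<in>T_basis d ?M n. fscale (y m) (delta m))"
    by (rule ext, unfold fun_sum_apply fscale_def, rule fun_cong[OF T_space_expand[OF y(1)]])
  also have "\<dots> \<in> fs.span ?S"
  proof (rule fs.span_sum)
    fix m assume "m \<in> T_basis d ?M n"
    show "fscale (y m) (delta m) \<in> fs.span ?S"
    proof (cases "y m = 0")
      case True
      then have "fscale (y m) (delta m) = 0" by simp
      then show ?thesis by (simp only: fs.span_zero)
    next
      case False
      then have "mset m = mset v" using y(2) by (simp add: homog_def)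
      then show ?thesis by (intro fs.span_scale delta_rearrangement_span v len)
    qed
  qed
  finally obtain B r where B: "finite B" "B \<subseteq> ?S" "y = (\<Sum>a\<in>B. fscale (r a) a)"
    unfolding fs.span_explicit by blast
  have "\<forall>a\<in>B. \<exists>w. a = word_op sg w (delta v) \<and> w \<in> lists {k. Suc k < n}" using B(2) by blast
  then obtain wd where wd: "\<And>a. a \<in> B \<Longrightarrow> a = word_op sg (wd a) (delta v)" "\<And>a. a \<in> B \<Longrightarrow> wd a \<in> lists {k. Suc k < n}"
    by metis
  define W where "W = wd ` B"
  define c where "c = (\<lambda>w. r (word_op sg w (delta v)))"
  define \<Theta> where "\<Theta> = (\<lambda>x l. \<Sum>w\<in>W. c w * word_op sg w x l)"
  have inj: "inj_on wd B" by (rule inj_onI) (metis wd(1))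
  have y\<Theta>: "y = \<Theta> (delta v)"
  proof
    fix l
    have "y l = (\<Sum>a\<in>B. r a * a l)" by (simp add: B(3) fun_sum_apply fscale_def)
    also have "\<dots> = (\<Sum>a\<in>B. c (wd a) * word_op sg (wd a) (delta v) l)"
      using wd(1) by (intro sum.cong refl) (simp add: c_def)
    also have "\<dots> = \<Theta> (delta v) l" using inj by (simp add: \<Theta>_def W_def sum.reindex)
    finally show "y l = \<Theta> (delta v) l" .
  qed
  have lin: "linop \<Theta>"
    unfolding linop_def \<Theta>_def linop_add[OF linop_word_sg] linop_scale[OF linop_word_sg]
      distrib_left sum.distrib sum_distrib_left by (simp add: mult.left_commute)
  have com: "\<Theta> (word_op gop u x) = word_op gop u (\<Theta> x)" for u x
    by (simp add: \<Theta>_def linop_sum[OF linop_word_gop[OF f]] word_sg_gop)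
  have key: "f (proj d N n z) = proj d N n (\<Theta> z)" if "z \<in> orb d ?M (delta v)" for z
    using that unfolding orb_def
  proof (induction rule: fs.span_induct_alt)
    case base
    show ?case
      unfolding linop_zero[OF lin] linop_zero[OF linop_proj] by (rule f_0[OF f])
  next
    case (step e x z)
    then obtain u where u: "u \<in> lists (EF_gens d ?M)" "x = word_op gop u (delta v)" by blast
    have x: "f (proj d N n x) = proj d N n (\<Theta> x)"
      using y(3)[OF u(1)] by (simp add: u(2) com y\<Theta>)
    have "fscale e (proj d N n x) \<in> T_space d N n"
      using proj_T_space[of d N n x] by (simp add: fscale_def T_space_scale)
    then show ?case
      unfolding linop_plus[OF lin] linop_plus[OF linop_proj] linop_fscale[OF lin] linop_fscale[OF linop_proj]
      by (simp only: f_add[OF f _ proj_T_space] f_scale[OF f proj_T_space] x step.IH)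
  qed
  have "f (delta t) = \<Theta> (delta t)" if t: "t \<in> T_basis d N n" "map fst t = map fst v" for t
  proof -
    have tM: "t \<in> T_basis d ?M n" using T_basis_mono[OF f v(1)] t(1) by blast
    have "count_list t (b, j) \<le> 1" if "N b < j" for b j
    proof -
      have "(b, j) \<notin> set t" using t(1) that by (auto simp: T_basis_def V_basis_def)
      then show ?thesis by (simp add: count_notin)
    qed
    then have "delta t \<in> orb d ?M (delta v)" by (intro orb_generate v tM t(2))
    from key[OF this] have "f (delta t) = proj d N n (\<Theta> (delta t))"
      by (simp add: proj_id delta_T_space t(1))
    moreover have "word_op sg w (delta t) \<in> T_space d N n" for w
      by (induction w) (auto simp: sg_T_space delta_T_space t(1))
    then have "\<Theta> (delta t) \<in> T_space d N n"
      unfolding \<Theta>_def by (intro T_space_sum T_space_scale)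
    ultimately show ?thesis by (simp add: proj_id)
  qed
  moreover have "finite W" "W \<subseteq> lists {k. Suc k < n}" using B(1) wd(2) by (auto simp: W_def)
  ultimately show ?thesis unfolding \<Theta>_def by blast
qed

subsection \<open>Operators attached to permutations\<close>

text \<open>For the head \<open>a\<close> of a list with tail \<open>m\<close> this is a digit of
  the Lehmer code.\<close>

definition below :: "nat \<Rightarrow> nat list \<Rightarrow> nat" where
  "below a m = length (filter (\<lambda>x. x < a) m)"

lemma below_simps [simp]:
  "below a [] = 0" "below a (x # m) = (if x < a then Suc (below a m) else below a m)"
  by (simp_all add: below_def)

lemma below_append [simp]: "below a (m @ m') = below a m + below a m'"
  by (simp add: below_def)

lemma below_le_length: "below a m \<le> length m"
  by (simp add: below_def)

lemma below_mono: "a \<le> b \<Longrightarrow> below a m \<le> below b m"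
  by (induction m) auto

lemma below_less: "a < b \<Longrightarrow> a \<in> set m \<Longrightarrow> below a m < below b m"
proof (induction m)
  case (Cons x m)
  then show ?case using below_mono[of a b m] by auto
qed simp

text \<open>The product of \<open>S k\<close>, ..., \<open>S (k + r - 1)\<close>, the last one
  applied first; on tensors it brings the factor from place \<open>k + r\<close> to place
  \<open>k\<close>.\<close>

primrec asc :: "(nat \<Rightarrow> 'v \<Rightarrow> 'v) \<Rightarrow> nat \<Rightarrow> nat \<Rightarrow> 'v \<Rightarrow> 'v" where
  "asc S k 0 x = x"
| "asc S k (Suc r) x = S k (asc S (Suc k) r x)"

text \<open>For a permutation \<open>m\<close> of \<open>0, \<dots>, n - 1\<close> in one-line notation, \<open>tw S 0 m\<close> is the product of the
  \<open>S i\<close> along a reduced word of \<open>m\<close>; it moves the tensor factor \<open>m ! j\<close> to the position \<open>j\<close>.\<close>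

primrec tw :: "(nat \<Rightarrow> 'v \<Rightarrow> 'v) \<Rightarrow> nat \<Rightarrow> nat list \<Rightarrow> 'v \<Rightarrow> 'v" where
  "tw S k [] x = x"
| "tw S k (a # m) x = tw S (Suc k) m (asc S k (below a m) x)"

definition perms :: "nat \<Rightarrow> nat list set" where
  "perms n = {m. distinct m \<and> set m = {0..<n}}"

lemma perms_length: "m \<in> perms n \<Longrightarrow> length m = n"
  by (auto simp: perms_def dest: distinct_card)

lemma perms_below:
  assumes "m \<in> perms n" "a < n" shows "below a m = a"
proof -
  have "below a m = card (set (filter (\<lambda>x. x < a) m))"
    using assms(1) by (simp only: below_def perms_def distinct_card distinct_filter mem_Collect_eq)
  also have "set (filter (\<lambda>x. x < a) m) = {0..<a}"
    using assms by (auto simp: perms_def)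
  finally show ?thesis by simp
qed

lemma finite_perms: "finite (perms n)"
proof (rule finite_subset)
  show "perms n \<subseteq> {m. set m \<subseteq> {0..<n} \<and> length m = n}" using perms_length by (auto simp: perms_def)
  show "finite \<dots>" by (rule finite_lists_length_eq) simp
qed

lemma perms_swap: "p @ a # b # s \<in> perms n \<longleftrightarrow> p @ b # a # s \<in> perms n"
  by (auto simp: perms_def)

locale braid_op =
  fixes n :: nat and S :: "nat \<Rightarrow> 'v \<Rightarrow> 'v" and C :: "'v set"
  assumes S_closed: "Suc i < n \<Longrightarrow> x \<in> C \<Longrightarrow> S i x \<in> C"
    and S_far: "Suc i < j \<Longrightarrow> Suc j < n \<Longrightarrow> x \<in> C \<Longrightarrow> S i (S j x) = S j (S i x)"
    and S_braid: "Suc (Suc i) < n \<Longrightarrow> x \<in> C \<Longrightarrow> S i (S (Suc i) (S i x)) = S (Suc i) (S i (S (Suc i) x))"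
begin

lemma asc_closed: "k + r < n \<Longrightarrow> x \<in> C \<Longrightarrow> asc S k r x \<in> C"
  by (induction r arbitrary: k) (auto intro: S_closed)

lemma asc_far: "Suc i < k \<Longrightarrow> k + r < n \<Longrightarrow> x \<in> C \<Longrightarrow> S i (asc S k r x) = asc S k r (S i x)"
proof (induction r arbitrary: k)
  case (Suc r)
  have "S i (S k (asc S (Suc k) r x)) = S k (S i (asc S (Suc k) r x))"
    using Suc.prems by (intro S_far asc_closed) auto
  then show ?case using Suc by simp
qed simp

text \<open>One braid relation at the place where \<open>S i\<close> meets its neighbours in the
  ascending product; all other generators are far from it and commute.\<close>

lemma asc_shift:
  "k \<le> i \<Longrightarrow> i < k + r \<Longrightarrow> k + Suc r < n \<Longrightarrow> x \<in> C \<Longrightarrow>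
    asc S k (Suc r) (S i x) = S (Suc i) (asc S k (Suc r) x)"
proof (induction r arbitrary: k)
  case (Suc r)
  show ?case
  proof (cases "i = k")
    case True
    have "asc S k (Suc (Suc r)) (S k x) = S k (S (Suc k) (S k (asc S (Suc (Suc k)) r x)))"
      using asc_far[of k "Suc (Suc k)" r x] Suc.prems by simp
    also have "\<dots> = S (Suc k) (S k (S (Suc k) (asc S (Suc (Suc k)) r x)))"
      using Suc.prems by (intro S_braid asc_closed) auto
    finally show ?thesis using True by simp
  next
    case False
    have "asc S k (Suc (Suc r)) (S i x) = S k (S (Suc i) (asc S (Suc k) (Suc r) x))"
      using Suc.IH[of "Suc k"] Suc.prems False by simp
    also have "\<dots> = S (Suc i) (S k (asc S (Suc k) (Suc r) x))"
      using Suc.prems False by (intro S_far asc_closed) auto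
    finally show ?thesis by simp
  qed
qed simp

lemma asc_asc:
  "k \<le> j \<Longrightarrow> j + s \<le> k + r \<Longrightarrow> k + Suc r < n \<Longrightarrow> x \<in> C \<Longrightarrow>
    asc S k (Suc r) (asc S j s x) = asc S (Suc j) s (asc S k (Suc r) x)"
proof (induction s arbitrary: j)
  case (Suc s)
  have "asc S k (Suc r) (S j (asc S (Suc j) s x)) = S (Suc j) (asc S k (Suc r) (asc S (Suc j) s x))"
    using Suc.prems by (intro asc_shift asc_closed) auto
  also have "asc S k (Suc r) (asc S (Suc j) s x) = asc S (Suc (Suc j)) s (asc S k (Suc r) x)"
    using Suc.prems by (intro Suc.IH) auto
  finally show ?case by (simp only: asc.simps)
qed simp

lemma tw_closed: "k + length m \<le> n \<Longrightarrow> x \<in> C \<Longrightarrow> tw S k m x \<in> C"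
proof (induction m arbitrary: k x)
  case (Cons a m)
  then show ?case using below_le_length[of a m] by (auto intro!: Cons.IH asc_closed)
qed simp

lemma tw_far: "Suc i < k \<Longrightarrow> k + length m \<le> n \<Longrightarrow> x \<in> C \<Longrightarrow> S i (tw S k m x) = tw S k m (S i x)"
proof (induction m arbitrary: k x)
  case (Cons a m)
  have r: "k + below a m < n" using below_le_length[of a m] Cons.prems by simp
  have "S i (tw S (Suc k) m (asc S k (below a m) x)) = tw S (Suc k) m (S i (asc S k (below a m) x))"
    using Cons.prems r by (intro Cons.IH asc_closed) auto
  then show ?case using asc_far[OF _ r] Cons.prems by simp
qed simp

text \<open>For \<open>a < b\<close> the exchange adds an inversion, so the word stays reduced and
  no quadratic relation is needed. Once the prefix is peeled off, two consecutive ascending products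
  remain, and \<open>asc_asc\<close> exchanges them.\<close>

lemma S_tw:
  assumes "a < b" "k + length (p @ a # b # s) \<le> n" "x \<in> C"
  shows "S (k + length p) (tw S k (p @ a # b # s) x) = tw S k (p @ b # a # s) x"
  using assms(2,3)
proof (induction p arbitrary: k x)
  case Nil
  have le: "below a s \<le> below b s" "below b s \<le> length s"
    using assms(1) by (simp_all add: below_mono below_le_length)
  have "S k (tw S (Suc (Suc k)) s (asc S (Suc k) (below b s) (asc S k (below a s) x)))
      = tw S (Suc (Suc k)) s (S k (asc S (Suc k) (below b s) (asc S k (below a s) x)))"
    using Nil le by (intro tw_far asc_closed) auto
  also have "S k (asc S (Suc k) (below b s) (asc S k (below a s) x)) = asc S k (Suc (below b s)) (asc S k (below a s) x)"
    by simp
  also have "\<dots> = asc S (Suc k) (below a s) (asc S k (Suc (below b s)) x)"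
    using Nil le by (intro asc_asc) auto
  finally show ?case using assms(1) by simp
next
  case (Cons c p)
  have e: "below c (p @ a # b # s) = below c (p @ b # a # s)" by simp
  show ?case
    using Cons.IH[of "Suc k" "asc S k (below c (p @ b # a # s)) x"] Cons.prems
      below_le_length[of c "p @ b # a # s"]
    unfolding append_Cons tw.simps e by (simp add: asc_closed)
qed

end

locale framed_braid_op = braid_op n S C for n S and C :: "'v set" +
  fixes T :: "nat \<Rightarrow> 'v \<Rightarrow> 'v"
  assumes T_closed: "j < n \<Longrightarrow> x \<in> C \<Longrightarrow> T j x \<in> C"
    and S_T: "Suc i < n \<Longrightarrow> j < n \<Longrightarrow> x \<in> C \<Longrightarrow> S i (T j x) = T (transpose i (Suc i) j) (S i x)"
begin

lemma asc_T_out: "j < k \<or> k + r < j \<Longrightarrow> j < n \<Longrightarrow> k + r < n \<Longrightarrow> x \<in> C \<Longrightarrow> asc S k r (T j x) = T j (asc S k r x)"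
proof (induction r arbitrary: k)
  case (Suc r)
  have "S k (T j (asc S (Suc k) r x)) = T (transpose k (Suc k) j) (S k (asc S (Suc k) r x))"
    using Suc.prems by (intro S_T asc_closed) auto
  then show ?case using Suc.prems Suc.IH[of "Suc k"] by (auto simp: transpose_def)
qed simp

lemma asc_T_last: "k + r < n \<Longrightarrow> x \<in> C \<Longrightarrow> asc S k r (T (k + r) x) = T k (asc S k r x)"
proof (induction r arbitrary: k)
  case (Suc r)
  have "S k (T (Suc k) (asc S (Suc k) r x)) = T (transpose k (Suc k) (Suc k)) (S k (asc S (Suc k) r x))"
    using Suc.prems by (intro S_T asc_closed) auto
  then show ?case using Suc.prems Suc.IH[of "Suc k"] by simp
qed simp

lemma asc_T_mid: "u < r \<Longrightarrow> k + r < n \<Longrightarrow> x \<in> C \<Longrightarrow> asc S k r (T (k + u) x) = T (Suc (k + u)) (asc S k r x)"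
proof (induction r arbitrary: k u)
  case (Suc r)
  show ?case
  proof (cases u)
    case 0
    have "S k (T k (asc S (Suc k) r x)) = T (transpose k (Suc k) k) (S k (asc S (Suc k) r x))"
      using Suc.prems by (intro S_T asc_closed) auto
    then show ?thesis using 0 Suc.prems asc_T_out[of k "Suc k" r x] by simp
  next
    case (Suc u')
    have "S k (T (Suc (k + u)) (asc S (Suc k) r x)) = T (transpose k (Suc k) (Suc (k + u))) (S k (asc S (Suc k) r x))"
      using Suc.prems by (intro S_T asc_closed) auto
    then show ?thesis using Suc Suc.prems Suc.IH[of u' "Suc k"] by (simp add: transpose_def)
  qed
qed simp

lemma tw_T_out: "j < k \<Longrightarrow> k + length m \<le> n \<Longrightarrow> x \<in> C \<Longrightarrow> tw S k m (T j x) = T j (tw S k m x)"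
proof (induction m arbitrary: k x)
  case (Cons a m)
  have "k + below a m < n" using below_le_length[of a m] Cons.prems by simp
  then show ?case using Cons.prems by (auto simp: asc_T_out asc_closed Cons.IH)
qed simp

text \<open>The factor now at place \<open>j\<close> came from the place given by the rank of
  \<open>m ! j\<close> among the entries. In the induction, moving the factor for \<open>a\<close>
  to the front shifts those of lower rank by one (\<open>asc_T_mid\<close>) and leaves those of
  higher rank in place (\<open>asc_T_out\<close>).\<close>

lemma T_tw:
  "j < length m \<Longrightarrow> k + length m \<le> n \<Longrightarrow> distinct m \<Longrightarrow> x \<in> C \<Longrightarrow>
    T (k + j) (tw S k m x) = tw S k m (T (k + below (m ! j) m) x)"
proof (induction m arbitrary: k j x)
  case (Cons a m)
  have r: "k + below a m < n" using below_le_length[of a m] Cons.prems by simp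
  show ?case
  proof (cases j)
    case 0
    then show ?thesis using Cons.prems r by (simp add: tw_T_out[symmetric] asc_T_last asc_closed)
  next
    case (Suc i)
    let ?c = "m ! i"
    have c: "?c \<in> set m" "?c \<noteq> a" "i < length m" using Cons.prems Suc by auto
    have lt: "below ?c m < length m"
      using c(1) below_less[of ?c "Suc ?c" m] below_le_length[of "Suc ?c" m] by simp
    have "T (Suc k + i) (tw S (Suc k) m (asc S k (below a m) x))
        = tw S (Suc k) m (T (Suc k + below ?c m) (asc S k (below a m) x))"
      using Cons.prems c r by (intro Cons.IH asc_closed) auto
    also have "T (Suc k + below ?c m) (asc S k (below a m) x) = asc S k (below a m) (T (k + below ?c (a # m)) x)"
    proof (cases "?c < a")
      case True
      then show ?thesis using asc_T_mid[OF below_less[OF True c(1)] r] Cons.prems by simp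
    next
      case False
      then have "below a m \<le> below ?c m" "a < ?c" using c(2) by (auto intro: below_mono)
      then show ?thesis
        using asc_T_out[of "Suc (k + below ?c m)" k "below a m" x] lt r Cons.prems by simp
    qed
    finally show ?thesis using Suc by simp
  qed
qed simp

corollary T_tw_perm:
  assumes "m \<in> perms n" "j < n" "x \<in> C"
  shows "T j (tw S 0 m x) = tw S 0 m (T (m ! j) x)"
proof -
  have "m ! j \<in> set m" using assms perms_length by (metis nth_mem)
  then have "m ! j < n" using assms(1) by (auto simp: perms_def)
  then show ?thesis
    using T_tw[of j m 0 x] assms perms_length[OF assms(1)] perms_below[OF assms(1)] by (simp add: perms_def)
qed

end

subsection \<open>Inversions between equally coloured entries\<close>

text \<open>Pairs of different colours are not counted: exchanging them is its own inverse modulo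
  the relations, without a linear term, so it neither helps nor hinders a reduction.\<close>

primrec cinv :: "(nat \<Rightarrow> nat) \<Rightarrow> nat list \<Rightarrow> nat" where
  "cinv \<chi> [] = 0"
| "cinv \<chi> (a # m) = length (filter (\<lambda>z. z < a \<and> \<chi> z = \<chi> a) m) + cinv \<chi> m"

lemma cinv_swap:
  "a < b \<Longrightarrow> cinv \<chi> (p @ b # a # s) = cinv \<chi> (p @ a # b # s) + (if \<chi> a = \<chi> b then 1 else 0)"
  by (induction p) auto

text \<open>The decreasing triples of colour \<open>1\<close> are the ones that the Temperley--Lieb relator removes.\<close>

definition has_triple :: "(nat \<Rightarrow> nat) \<Rightarrow> nat list \<Rightarrow> bool" where
  "has_triple \<chi> m \<longleftrightarrow> (\<exists>p c u b v a s. m = p @ c # u @ b # v @ a # s \<and> a < b \<and> b < c \<and>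
     \<chi> a = 1 \<and> \<chi> b = 1 \<and> \<chi> c = 1)"

subsection \<open>Reduction to permutations without decreasing triples\<close>

text \<open>A model of the left regular module, with \<open>J\<close> the part that becomes zero in
  \<open>CTL\<close>. The quadratic relation and the relator are imposed modulo \<open>J\<close> and
  only on joint eigenvectors of the framings, where \<open>E_i\<close> and the averaging factor of
  the relator have become scalars. Colour \<open>1\<close> means eigenvalue
  \<open>1\<close>.\<close>

locale ctl_module = vector_space scale + framed_braid_op n S C T
  for scale :: "kq \<Rightarrow> 'v::ab_group_add \<Rightarrow> 'v" and n :: nat and S T :: "nat \<Rightarrow> 'v \<Rightarrow> 'v" and C :: "'v set" +
  fixes J :: "'v set" and d :: nat and \<zeta> :: kq
  assumes S_add: "S i (x + y) = S i x + S i y" and S_scale: "S i (scale r x) = scale r (S i x)"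
    and J: "subspace J" and S_J: "Suc i < n \<Longrightarrow> x \<in> J \<Longrightarrow> S i x \<in> J"
    and quad: "\<lbrakk>Suc i < n; x \<in> C; T i x = scale (\<zeta> ^ (b - 1)) x; T (Suc i) x = scale (\<zeta> ^ (c - 1)) x;
        b \<in> {1..d}; c \<in> {1..d}\<rbrakk> \<Longrightarrow>
        S i (S i x) - ((if b = c then scale (q - inverse q) (S i x) else 0) + x) \<in> J"
    and relator: "\<lbrakk>Suc (Suc i) < n; x \<in> C; T i x = x; T (Suc i) x = x; T (Suc (Suc i)) x = x\<rbrakk> \<Longrightarrow>
        x - scale (inverse q) (S i x) - scale (inverse q) (S (Suc i) x)
          + scale (inverse q ^ 2) (S i (S (Suc i) x)) + scale (inverse q ^ 2) (S (Suc i) (S i x))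
          - scale (inverse q ^ 3) (S i (S (Suc i) (S i x))) \<in> J"
begin

lemma S_linear: "module_hom scale scale (S i)"
  by (intro module_hom.intro module_axioms module_hom_axioms.intro S_add S_scale)

lemma span_S:
  assumes "x \<in> span X" "\<And>y. y \<in> X \<Longrightarrow> S i y \<in> span Z"
  shows "S i x \<in> span Z"
  using assms(1)
proof (induction rule: span_induct_alt)
  case base
  then show ?case by (metis module_hom.zero[OF S_linear] span_zero)
next
  case (step c x y)
  then show ?case using assms(2) by (simp add: S_add S_scale span_add span_scale)
qed

context
  fixes \<chi> :: "nat \<Rightarrow> nat" and y :: 'v
  assumes y: "y \<in> C" "\<And>j. j < n \<Longrightarrow> T j y = scale (\<zeta> ^ (\<chi> j - 1)) y"
    and \<chi>: "\<And>j. j < n \<Longrightarrow> \<chi> j \<in> {1..d}"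
begin

definition Y :: "nat list \<Rightarrow> 'v" where "Y m = tw S 0 m y"

lemma Y_closed: "m \<in> perms n \<Longrightarrow> Y m \<in> C"
  unfolding Y_def by (intro tw_closed y(1)) (simp add: perms_length)

lemma asc_scale: "asc S k r (scale c x) = scale c (asc S k r x)"
  by (induction r arbitrary: k) (simp_all add: S_scale)

lemma tw_scale: "tw S k m (scale c x) = scale c (tw S k m x)"
  by (induction m arbitrary: k x) (simp_all add: asc_scale)

lemma T_Y:
  assumes "m \<in> perms n" "j < n" shows "T j (Y m) = scale (\<zeta> ^ (\<chi> (m ! j) - 1)) (Y m)"
proof -
  have "m ! j \<in> set m" using assms perms_length by (metis nth_mem)
  then have "m ! j < n" using assms(1) by (auto simp: perms_def)
  then show ?thesis unfolding Y_def T_tw_perm[OF assms y(1)] by (simp add: y(2) tw_scale)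
qed

lemma S_Y_up:
  assumes "p @ a # b # s \<in> perms n" "a < b"
  shows "S (length p) (Y (p @ a # b # s)) = Y (p @ b # a # s)"
  using S_tw[OF assms(2), of 0 p s y] y(1) perms_length[OF assms(1)] by (simp add: Y_def)

lemma S_Y_down:
  assumes m: "p @ b # a # s \<in> perms n" and "a < b"
  shows "S (length p) (Y (p @ b # a # s)) -
    ((if \<chi> a = \<chi> b then scale (q - inverse q) (Y (p @ b # a # s)) else 0) + Y (p @ a # b # s)) \<in> J"
proof -
  have m': "p @ a # b # s \<in> perms n" using m by (simp add: perms_swap)
  have l: "Suc (length p) < n" using perms_length[OF m] by simp
  have ab: "a < n" "b < n" using m by (auto simp: perms_def)
  have "T (length p) (Y (p @ a # b # s)) = scale (\<zeta> ^ (\<chi> a - 1)) (Y (p @ a # b # s))"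
    "T (Suc (length p)) (Y (p @ a # b # s)) = scale (\<zeta> ^ (\<chi> b - 1)) (Y (p @ a # b # s))"
    using T_Y[OF m', of "length p"] T_Y[OF m', of "Suc (length p)"] l by (simp_all add: nth_append)
  from quad[OF l Y_closed[OF m'] this \<chi>[OF ab(1)] \<chi>[OF ab(2)]]
  show ?thesis unfolding S_Y_up[OF m' \<open>a < b\<close>] .
qed

lemma span_J: "x - z \<in> J \<Longrightarrow> J \<subseteq> X \<Longrightarrow> z \<in> span X \<Longrightarrow> x \<in> span X"
  using span_add[of "x - z" X z] span_base[of "x - z" X] by auto

text \<open>The ascending and the descending case in one form. The quantifier over \<open>X\<close>
  lets it serve both the reduction, with \<open>X\<close> a set of lower terms, and the spanning
  argument; \<open>Y m\<close> itself is needed only for equal colours.\<close>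

lemma S_Y:
  assumes "Suc i < n" "m \<in> perms n"
  shows "\<exists>m'\<in>perms n. map \<chi> m' = (map \<chi> m)[i := \<chi> (m ! Suc i), Suc i := \<chi> (m ! i)] \<and>
    cinv \<chi> m' \<le> cinv \<chi> m + (if \<chi> (m ! i) = \<chi> (m ! Suc i) then 1 else 0) \<and>
    (\<forall>X. J \<subseteq> X \<longrightarrow> Y m \<in> span X \<or> \<chi> (m ! i) \<noteq> \<chi> (m ! Suc i) \<longrightarrow> Y m' \<in> span X \<longrightarrow> S i (Y m) \<in> span X)"
proof -
  have l: "length m = n" using assms perms_length by blast
  then have m: "m = take i m @ m ! i # m ! Suc i # drop (Suc (Suc i)) m"
    using assms(1) by (metis Cons_nth_drop_Suc Suc_lessD id_take_nth_drop)
  obtain p a b s where m: "m = p @ a # b # s" and p: "length p = i"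
    using m assms(1) l by (metis Suc_lessD length_take min.strict_order_iff min.commute)
  have ab: "m ! i = a" "m ! Suc i = b" using p by (auto simp: m nth_append)
  have "a \<noteq> b" using assms(2) by (auto simp: m perms_def)
  show ?thesis
  proof (intro bexI[of _ "p @ b # a # s"] conjI allI impI)
    show "map \<chi> (p @ b # a # s) = (map \<chi> m)[i := \<chi> (m ! Suc i), Suc i := \<chi> (m ! i)]"
      unfolding ab by (simp add: m list_update_append flip: p)
    show "cinv \<chi> (p @ b # a # s) \<le> cinv \<chi> m + (if \<chi> (m ! i) = \<chi> (m ! Suc i) then 1 else 0)"
      unfolding ab using cinv_swap[of a b \<chi> p s] cinv_swap[of b a \<chi> p s] \<open>a \<noteq> b\<close> by (cases "a < b") (auto simp: m)
    show pm: "p @ b # a # s \<in> perms n" using assms(2) perms_swap m by blast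
    fix X assume X: "J \<subseteq> X" "Y m \<in> span X \<or> \<chi> (m ! i) \<noteq> \<chi> (m ! Suc i)" "Y (p @ b # a # s) \<in> span X"
    show "S i (Y m) \<in> span X"
    proof (cases "a < b")
      case True
      then show ?thesis using S_Y_up[of p a b s] assms(2) X(3) by (simp add: m p)
    next
      case False
      then have "b < a" using \<open>a \<noteq> b\<close> by simp
      have "(if \<chi> b = \<chi> a then scale (q - inverse q) (Y (p @ a # b # s)) else 0) + Y (p @ b # a # s) \<in> span X"
        using X unfolding ab m[symmetric] by (auto intro: span_add span_scale)
      from span_J[OF S_Y_down[OF _ \<open>b < a\<close>] X(1) this] assms(2) show ?thesis by (simp add: m p)
    qed
  qed
qed

definition lower :: "nat list \<Rightarrow> 'v set" where
  "lower m = J \<union> {Y m' | m'. m' \<in> perms n \<and> map \<chi> m' = map \<chi> m \<and> cinv \<chi> m' < cinv \<chi> m}"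

lemma lowerI:
  "m' \<in> perms n \<Longrightarrow> map \<chi> m' = map \<chi> m \<Longrightarrow> cinv \<chi> m' < cinv \<chi> m \<Longrightarrow> Y m' \<in> lower m"
  unfolding lower_def by blast

text \<open>\<open>S\<close> is applied to the relation that reduces the neighbour. The step adds
  one coloured inversion exactly when the colours agree, and \<open>S\<close> adds no more than that
  to the lower terms, so they stay lower.\<close>

lemma lower_swap:
  assumes m: "p @ a # b # s \<in> perms n" and c: "\<chi> a \<noteq> \<chi> b \<or> b < a"
    and r: "Y (p @ b # a # s) \<in> span (lower (p @ b # a # s))"
  shows "Y (p @ a # b # s) \<in> span (lower (p @ a # b # s))"
proof -
  let ?m = "p @ a # b # s" and ?m' = "p @ b # a # s" and ?k = "length p"
  have m': "?m' \<in> perms n" using m perms_swap by blast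
  have l: "Suc ?k < n" using perms_length[OF m] by simp
  have ne: "a \<noteq> b" using m by (auto simp: perms_def)
  have ci: "cinv \<chi> ?m = cinv \<chi> ?m' + (if \<chi> a = \<chi> b then 1 else 0)"
    using c ne cinv_swap[of a b \<chi> p s] cinv_swap[of b a \<chi> p s] by (cases "a < b") auto
  have "S ?k (Y ?m') \<in> span (lower ?m)"
  proof (rule span_S[OF r])
    fix z assume "z \<in> lower ?m'"
    then consider "z \<in> J" | m'' where "z = Y m''" "m'' \<in> perms n" "map \<chi> m'' = map \<chi> ?m'" "cinv \<chi> m'' < cinv \<chi> ?m'"
      by (auto simp: lower_def)
    then show "S ?k z \<in> span (lower ?m)"
    proof cases
      case 1
      then show ?thesis using S_J[OF l] by (intro span_base) (auto simp: lower_def)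
    next
      case 2
      have len: "length m'' = n" using 2(2) perms_length by blast
      have nth: "\<chi> (m'' ! ?k) = \<chi> b" "\<chi> (m'' ! Suc ?k) = \<chi> a"
        using arg_cong[OF 2(3), of "\<lambda>l. l ! ?k"] arg_cong[OF 2(3), of "\<lambda>l. l ! Suc ?k"] l len
        by (simp_all add: nth_append)
      obtain m1 where m1: "m1 \<in> perms n" "map \<chi> m1 = (map \<chi> m'')[?k := \<chi> (m'' ! Suc ?k), Suc ?k := \<chi> (m'' ! ?k)]"
        "cinv \<chi> m1 \<le> cinv \<chi> m'' + (if \<chi> b = \<chi> a then 1 else 0)"
        "\<And>X. J \<subseteq> X \<Longrightarrow> Y m'' \<in> span X \<or> \<chi> b \<noteq> \<chi> a \<Longrightarrow> Y m1 \<in> span X \<Longrightarrow> S ?k (Y m'') \<in> span X"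
        using S_Y[OF l 2(2)] unfolding nth by auto
      have "map \<chi> m1 = map \<chi> ?m"
        unfolding m1(2) nth 2(3) by (simp add: list_update_append)
      moreover have "cinv \<chi> m1 < cinv \<chi> ?m" using m1(3) 2(4) ci by (auto split: if_splits)
      ultimately have "Y m1 \<in> lower ?m" using m1(1) by (auto simp: lower_def)
      moreover have "Y m'' \<in> lower ?m" if "\<chi> b = \<chi> a"
        using 2 ci that by (auto simp: lower_def)
      ultimately show ?thesis unfolding 2(1)
        by (intro m1(4)) (auto simp: lower_def intro: span_base)
    qed
  qed
  moreover have "Y ?m - S ?k (Y ?m') \<in> J" if "b < a"
    using S_Y_up[OF m' that] by (simp add: subspace_0[OF J])
  moreover have "S ?k (Y ?m') - Y ?m \<in> J" if "a < b"
    using S_Y_down[OF m' that] c that by auto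
  then have "Y ?m - S ?k (Y ?m') \<in> J" if "a < b"
    using that subspace_neg[OF J, of "S ?k (Y ?m') - Y ?m"] by simp
  ultimately show ?thesis
    using ne by (cases "a < b") (auto intro!: span_J[of "Y ?m" "S ?k (Y ?m')"] simp: lower_def)
qed

text \<open>The relator, applied to the increasing arrangement, involves all six arrangements of
  \<open>a\<close>, \<open>b\<close>, \<open>c\<close>. The decreasing one has the most inversions
  and the invertible coefficient \<open>- inverse q ^ 3\<close>, so it can be solved for.\<close>

lemma lower_adjacent:
  assumes m: "p @ c # b # a # s \<in> perms n" and o: "a < b" "b < c" and x: "\<chi> a = 1" "\<chi> b = 1" "\<chi> c = 1"
  shows "Y (p @ c # b # a # s) \<in> span (lower (p @ c # b # a # s))"
proof -
  let ?k = "length p"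
  have sw: "p @ x # y # z # s \<in> perms n \<longleftrightarrow> p @ c # b # a # s \<in> perms n"
    if "{#x, y, z#} = {#a, b, c#}" for x y z
  proof -
    have "mset (p @ x # y # z # s) = mset (p @ c # b # a # s)"
      using that by (simp add: add_mset_commute)
    then show ?thesis unfolding perms_def by (metis (mono_tags, lifting) mem_Collect_eq mset_eq_imp_distinct_iff mset_eq_setD)
  qed
  have P: "p @ a # b # c # s \<in> perms n" "p @ b # a # c # s \<in> perms n" "p @ a # c # b # s \<in> perms n"
    "p @ c # a # b # s \<in> perms n" "p @ b # c # a # s \<in> perms n"
    using m sw[of a b c] sw[of b a c] sw[of a c b] sw[of c a b] sw[of b c a]
    by (simp_all add: add_mset_commute)
  have l: "Suc (Suc ?k) < n" using perms_length[OF m] by simp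
  have up1: "S ?k (Y (p @ a # b # c # s)) = Y (p @ b # a # c # s)"
    "S ?k (Y (p @ a # c # b # s)) = Y (p @ c # a # b # s)"
    "S ?k (Y (p @ b # c # a # s)) = Y (p @ c # b # a # s)"
    using S_Y_up[OF P(1)] S_Y_up[OF P(3)] S_Y_up[OF P(5)] o by simp_all
  have up2: "S (Suc ?k) (Y (p @ a # b # c # s)) = Y (p @ a # c # b # s)"
    "S (Suc ?k) (Y (p @ b # a # c # s)) = Y (p @ b # c # a # s)"
    using S_Y_up[of "p @ [a]" b c s] S_Y_up[of "p @ [b]" a c s] P o by simp_all
  let ?x = "Y (p @ a # b # c # s)"
  have "T ?k ?x = ?x" "T (Suc ?k) ?x = ?x" "T (Suc (Suc ?k)) ?x = ?x"
    using T_Y[OF P(1), of ?k] T_Y[OF P(1), of "Suc ?k"] T_Y[OF P(1), of "Suc (Suc ?k)"] l x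
    by (simp_all add: nth_append)
  from relator[OF l Y_closed[OF P(1)] this]
  have rel: "?x - scale (inverse q) (Y (p @ b # a # c # s)) - scale (inverse q) (Y (p @ a # c # b # s))
    + scale (inverse q ^ 2) (Y (p @ c # a # b # s)) + scale (inverse q ^ 2) (Y (p @ b # c # a # s))
    - scale (inverse q ^ 3) (Y (p @ c # b # a # s)) \<in> J" (is "?z - _ \<in> J")
    unfolding up1 up2 .
  let ?L = "lower (p @ c # b # a # s)"
  have ci: "cinv \<chi> (p @ b # a # c # s) = cinv \<chi> (p @ a # b # c # s) + 1"
    "cinv \<chi> (p @ b # c # a # s) = cinv \<chi> (p @ b # a # c # s) + 1"
    "cinv \<chi> (p @ c # b # a # s) = cinv \<chi> (p @ b # c # a # s) + 1"
    "cinv \<chi> (p @ a # c # b # s) = cinv \<chi> (p @ a # b # c # s) + 1"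
    "cinv \<chi> (p @ c # a # b # s) = cinv \<chi> (p @ a # c # b # s) + 1"
    using cinv_swap[of a b \<chi> p "c # s"] cinv_swap[of a c \<chi> "p @ [b]" s] cinv_swap[of b c \<chi> p "a # s"]
      cinv_swap[of b c \<chi> "p @ [a]" s] cinv_swap[of a c \<chi> p "b # s"] o x by simp_all
  have "Y (p @ a # b # c # s) \<in> ?L" "Y (p @ b # a # c # s) \<in> ?L" "Y (p @ a # c # b # s) \<in> ?L"
    "Y (p @ c # a # b # s) \<in> ?L" "Y (p @ b # c # a # s) \<in> ?L"
    using P ci x by (auto intro!: lowerI)
  then have "?z \<in> span ?L"
    by (intro span_add span_diff span_scale) (auto intro: span_base)
  moreover have "?z - scale (inverse q ^ 3) (Y (p @ c # b # a # s)) \<in> span ?L"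
    using rel by (intro span_base) (auto simp: lower_def)
  ultimately have "scale (inverse q ^ 3) (Y (p @ c # b # a # s)) \<in> span ?L"
    using span_diff[of ?z ?L "?z - scale (inverse q ^ 3) (Y (p @ c # b # a # s))"] by simp
  from span_scale[OF this, of "q ^ 3"] show ?thesis
    by (simp add: q_neq_0 flip: power_mult_distrib)
qed

text \<open>Induction on the number of entries inside the triple. The entry \<open>x\<close> next to
  \<open>c\<close> either has colour \<open>1\<close> and exceeds \<open>c\<close>, so that it can
  replace \<open>c\<close> in a tighter triple, or it can be exchanged with \<open>c\<close> by
  \<open>lower_swap\<close>; the same holds at the other end with \<open>a\<close>.\<close>

lemma lower_triple:
  assumes "p @ c # u @ b # v @ a # s \<in> perms n" "a < b" "b < c" "\<chi> a = 1" "\<chi> b = 1" "\<chi> c = 1"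
  shows "Y (p @ c # u @ b # v @ a # s) \<in> span (lower (p @ c # u @ b # v @ a # s))"
  using assms
proof (induction "length u + length v" arbitrary: p c u b v a s rule: less_induct)
  case less
  consider "u = []" "v = []" | x u' where "u = x # u'" | x v' where "v = v' @ [x]"
    by (metis rev_exhaust list.exhaust)
  then show ?case
  proof cases
    case 1
    with less.prems show ?thesis using lower_adjacent[of p c b a s] by simp
  next
    case (2 x u')
    have "x \<noteq> c" using less.prems(1) 2 by (auto simp: perms_def)
    then consider "\<chi> x = 1" "c < x" | "\<chi> x \<noteq> \<chi> c \<or> x < c" using less.prems by fastforce
    then show ?thesis
    proof cases
      case 1
      then show ?thesis using less.hyps[of u' v "p @ [c]" x b a s] less.prems 2 by simp
    next
      case c: 2
      have m: "p @ c # x # u' @ b # v @ a # s \<in> perms n" using less.prems(1) 2 by simp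
      then have "p @ x # c # u' @ b # v @ a # s \<in> perms n" using perms_swap by blast
      then have "Y (p @ x # c # u' @ b # v @ a # s) \<in> span (lower (p @ x # c # u' @ b # v @ a # s))"
        using less.hyps[of u' v "p @ [x]" c b a s] less.prems 2 by simp
      from lower_swap[OF m _ this] c show ?thesis using 2 by auto
    qed
  next
    case (3 x v')
    have "x \<noteq> a" using less.prems(1) 3 by (auto simp: perms_def)
    then consider "\<chi> x = 1" "x < a" | "\<chi> x \<noteq> \<chi> a \<or> a < x" using less.prems by fastforce
    then show ?thesis
    proof cases
      case 1
      then show ?thesis using less.hyps[of u v' p c b x "a # s"] less.prems 3 by simp
    next
      case c: 2
      let ?p = "p @ c # u @ b # v'"
      have m: "?p @ x # a # s \<in> perms n" using less.prems(1) 3 by simp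
      then have "?p @ a # x # s \<in> perms n" using perms_swap by blast
      then have "Y (?p @ a # x # s) \<in> span (lower (?p @ a # x # s))"
        using less.hyps[of u v' p c b a "x # s"] less.prems 3 by simp
      from lower_swap[OF m _ this] c show ?thesis using 3 by auto
    qed
  qed
qed

theorem Y_reduce:
  assumes "m \<in> perms n"
  shows "Y m \<in> span (J \<union> Y ` {m \<in> perms n. \<not> has_triple \<chi> m})" (is "_ \<in> span ?X")
  using assms
proof (induction "cinv \<chi> m" arbitrary: m rule: less_induct)
  case less
  show ?case
  proof (cases "has_triple \<chi> m")
    case True
    then obtain p c u b v a s where m: "m = p @ c # u @ b # v @ a # s"
      "a < b" "b < c" "\<chi> a = 1" "\<chi> b = 1" "\<chi> c = 1"
      unfolding has_triple_def by blast
    have "Y m \<in> span (lower m)" unfolding m(1) by (rule lower_triple[OF _ m(2-6)]) (use less.prems m(1) in simp)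
    moreover have "lower m \<subseteq> span ?X"
    proof
      fix z assume "z \<in> lower m"
      then show "z \<in> span ?X" unfolding lower_def using less.hyps by (auto intro: span_base)
    qed
    then have "span (lower m) \<subseteq> span ?X" by (rule span_minimal[OF _ subspace_span])
    ultimately show ?thesis by (rule rev_subsetD)
  next
    case False
    then show ?thesis using less.prems by (intro span_base) auto
  qed
qed

lemma S_Y_span:
  assumes "Suc i < n" "m \<in> perms n" shows "S i (Y m) \<in> span (J \<union> Y ` perms n)"
  using S_Y[OF assms] assms(2) by (auto intro: span_base)

end

end

subsection \<open>Independence on tensor space\<close>

lemma adjacent_split:
  assumes "Suc i < length m" obtains p a b s where "m = p @ a # b # s" "length p = i"
proof
  show "m = take i m @ m ! i # m ! Suc i # drop (Suc (Suc i)) m"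
    using assms by (metis Cons_nth_drop_Suc Suc_lessD id_take_nth_drop)
  show "length (take i m) = i" using assms by simp
qed

text \<open>Induction along reduced words: every permutation arises from the identity by adjacent
  exchanges, each of which adds an inversion.\<close>

lemma perms_induct [consumes 1, case_names sorted swap]:
  assumes "m \<in> perms n" "P [0..<n]"
    "\<And>p a b s. a < b \<Longrightarrow> p @ b # a # s \<in> perms n \<Longrightarrow> P (p @ a # b # s) \<Longrightarrow> P (p @ b # a # s)"
  shows "P m"
  using assms(1)
proof (induction "cinv (\<lambda>_. 0) m" arbitrary: m rule: less_induct)
  case less
  show ?case
  proof (cases "sorted m")
    case True
    then have "m = [0..<n]" using less.prems
      by (intro sorted_distinct_set_unique) (auto simp: perms_def)
    then show ?thesis using assms(2) by simp
  next
    case False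
    then obtain i where i: "Suc i < length m" "m ! Suc i < m ! i"
      by (auto simp: sorted_iff_nth_Suc not_le)
    obtain p b a s where m: "m = p @ b # a # s" "length p = i" using adjacent_split[OF i(1)] by metis
    have ab: "a < b" using i(2) m by (auto simp: nth_append)
    then have "P (p @ a # b # s)"
      using less.prems cinv_swap[OF ab, of "\<lambda>_. 0" p s] m perms_swap by (intro less.hyps) auto
    then show ?thesis using assms(3)[OF ab] less.prems m by simp
  qed
qed

lemma tw_sorted: "sorted m \<Longrightarrow> tw S k m x = x"
proof (induction m arbitrary: k x)
  case (Cons a m)
  then have "below a m = 0" by (auto simp: below_def filter_empty_conv)
  then show ?case using Cons by simp
qed simp

text \<open>Fixing the length makes the braid relation an identity of functions, since
  \<open>sg_braid\<close> requires lists that are long enough. The entries are not bounded, so no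
  ranks are involved.\<close>

definition tens :: "nat \<Rightarrow> tensor set" where
  "tens n = {x. \<forall>l. length l \<noteq> n \<longrightarrow> x l = 0}"

lemma delta_tens: "length m = n \<Longrightarrow> delta m \<in> tens n"
  by (auto simp: tens_def delta_def)

lemma sg_tens: "x \<in> tens n \<Longrightarrow> Suc k < n \<Longrightarrow> sg k x \<in> tens n"
proof -
  assume x: "x \<in> tens n" "Suc k < n"
  have "sg k x l = 0" if "\<And>l'. length l' = length l \<Longrightarrow> x l' = 0" for l
    using that by (induction k x l rule: sg.induct) (auto simp: Let_def)
  then show ?thesis using x by (auto simp: tens_def)
qed

lemma tens_eqI: "x \<in> tens n \<Longrightarrow> y \<in> tens n \<Longrightarrow> (\<And>l. length l = n \<Longrightarrow> x l = y l) \<Longrightarrow> x = y"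
  by (rule ext) (metis (mono_tags, lifting) mem_Collect_eq tens_def)

interpretation sgb: braid_op n sg "tens n" for n
proof
  fix i j x assume "Suc i < j" "Suc j < n" "x \<in> tens n"
  moreover from this obtain k where "j = Suc (Suc (i + k))" using less_iff_Suc_add by auto
  ultimately show "sg i (sg j x) = sg j (sg i x)"
    by (intro tens_eqI[of _ n] sg_tens) (auto simp: sg_far_commute)
next
  fix i x assume "Suc (Suc i) < n" "x \<in> tens n"
  then show "sg i (sg (Suc i) (sg i x)) = sg (Suc i) (sg i (sg (Suc i) x))"
    by (intro tens_eqI[of _ n] sg_tens) (auto simp: sg_braid)
qed (rule sg_tens)

lemma sg_append:
  "sg (length p) x (p @ a # c # s) =
     (if fst a \<noteq> fst c then x (p @ c # a # s)
      else if snd a = snd c then q * x (p @ a # c # s)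
      else if snd a < snd c then x (p @ c # a # s)
      else x (p @ c # a # s) + (q - inverse q) * x (p @ a # c # s))"
  by (simp add: sg_apply Let_def nth_append list_update_append)

lemma cinv_append:
  "cinv \<chi> (u @ v) = cinv \<chi> u + cinv \<chi> v + (\<Sum>z\<leftarrow>u. length (filter (\<lambda>w. w < z \<and> \<chi> w = \<chi> z) v))"
  by (induction u) auto

text \<open>Besides the exchanged pair only entries between them matter. Such an entry below
  \<open>y\<close> is also below \<open>x\<close>, and one above \<open>x\<close> is also above
  \<open>y\<close>, so with equal colours these contributions cannot grow.\<close>

lemma cinv_exchange:
  assumes "y < x" "\<chi> x = \<chi> y"
  shows "cinv \<chi> (p @ y # u @ x # s) < cinv \<chi> (p @ x # u @ y # s)"
proof (induction p)
  case Nil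
  have "length (filter (\<lambda>w. w < y \<and> \<chi> w = \<chi> y) u) \<le> length (filter (\<lambda>w. w < x \<and> \<chi> w = \<chi> x) u)"
    using assms by (induction u) auto
  moreover have "(\<Sum>z\<leftarrow>u. if x < z \<and> \<chi> x = \<chi> z then 1 else 0) \<le> (\<Sum>z\<leftarrow>u. if y < z \<and> \<chi> y = \<chi> z then 1 else 0 :: nat)"
    using assms by (intro sum_list_mono) auto
  moreover have e: "(\<Sum>z\<leftarrow>u. length (filter (\<lambda>w. w < z \<and> \<chi> w = \<chi> z) (c # s)))
    = (\<Sum>z\<leftarrow>u. if c < z \<and> \<chi> c = \<chi> z then 1 else 0) + (\<Sum>z\<leftarrow>u. length (filter (\<lambda>w. w < z \<and> \<chi> w = \<chi> z) s))" for c
    by (induction u) auto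
  ultimately show ?case using assms unfolding append_Nil cinv.simps cinv_append e by simp
next
  case (Cons c p)
  then show ?case by auto
qed

text \<open>Permutations with the same list of labels \<open>map f m\<close> form a coset of the
  stabiliser of the labelling; these are the shortest coset representatives.\<close>

definition fsorted :: "(nat \<Rightarrow> 'a) \<Rightarrow> nat list \<Rightarrow> bool" where
  "fsorted f = sorted_wrt (\<lambda>x y. f x = f y \<longrightarrow> x < y)"

lemma fsorted_unique:
  "\<lbrakk>fsorted f m; fsorted f m'; map f m = map f m'; set m = set m'; distinct m; distinct m'\<rbrakk> \<Longrightarrow> m = m'"
proof (induction m arbitrary: m')
  case (Cons a m)
  from Cons.prems(3) obtain a' ms where m': "m' = a' # ms" by (cases m') auto
  have "a = a'"
  proof (rule ccontr)
    assume ne: "a \<noteq> a'"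
    then have "a \<in> set ms" "a' \<in> set m" using Cons.prems(4) by (auto simp: m')
    then have "a < a'" "a' < a" using Cons.prems(1-3) by (auto simp: fsorted_def m')
    then show False by simp
  qed
  moreover have "set m = set ms"
    using Cons.prems(4-6) \<open>a = a'\<close> by (simp add: m') (metis insert_ident)
  ultimately show ?case using Cons.prems Cons.IH[of ms] by (auto simp: m' fsorted_def)
qed simp

lemma not_sorted_wrt: "\<not> sorted_wrt R m \<Longrightarrow> \<exists>p x u y s. m = p @ x # u @ y # s \<and> \<not> R x y"
proof (induction m)
  case (Cons a m)
  show ?case
  proof (cases "sorted_wrt R m")
    case True
    then obtain y where "y \<in> set m" "\<not> R a y" using Cons.prems by auto
    then show ?thesis by (metis append_Nil split_list)
  next
    case False
    then show ?thesis using Cons.IH by (metis append_Cons)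
  qed
qed simp

text \<open>Any other list is sorted by exchanging inverted pairs with equal labels. Each exchange
  keeps \<open>map f\<close> and, as equal labels have equal colours, lowers
  \<open>cinv\<close>.\<close>

lemma fsorted_minimal:
  assumes m: "fsorted f m" "distinct m" and f: "\<And>x y. f x = f y \<Longrightarrow> \<chi> x = \<chi> y"
  shows "\<lbrakk>map f m' = map f m; set m' = set m; distinct m'\<rbrakk> \<Longrightarrow> m' = m \<or> cinv \<chi> m < cinv \<chi> m'"
proof (induction "cinv \<chi> m'" arbitrary: m' rule: less_induct)
  case less
  show ?case
  proof (cases "fsorted f m'")
    case True
    then show ?thesis using fsorted_unique[OF _ m(1)] less.prems m(2) by blast
  next
    case False
    then obtain p x u y s where m': "m' = p @ x # u @ y # s" and xy: "f x = f y" "\<not> x < y"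
      using not_sorted_wrt[OF False[unfolded fsorted_def]] by blast
    have "y < x" using xy(2) less.prems(3) by (auto simp: m')
    note lt = cinv_exchange[OF this f[OF xy(1)], of p u s]
    have "p @ y # u @ x # s = m \<or> cinv \<chi> m < cinv \<chi> (p @ y # u @ x # s)"
      using less.prems lt xy(1) by (intro less.hyps) (auto simp: m')
    then show ?thesis using lt by (auto simp: m')
  qed
qed

lemma map_eq_adjacent:
  assumes "map f m = p @ x # y # s"
  obtains p' a b s' where "m = p' @ a # b # s'" "map f p' = p" "f a = x" "f b = y" "map f s' = s"
  using assms by (auto simp: map_eq_append_conv map_eq_Cons_conv)

context
  fixes n :: nat and \<chi> :: "nat \<Rightarrow> nat" and f :: "nat \<Rightarrow> idx"
  assumes f: "\<And>p. fst (f p) = \<chi> p"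
begin

lemma f_col: "f x = f y \<Longrightarrow> \<chi> x = \<chi> y"
  by (metis f)

lemma start_tens: "delta (map f [0..<n]) \<in> tens n"
  by (simp add: delta_tens)

text \<open>One half of unitriangularity. Along a reduced word each generator exchanges two
  neighbours of a tensor or, for equal colours, also keeps the tensor; in the latter case the tensor
  falls one inversion short of the new permutation.\<close>

lemma tw_sg_support:
  assumes "m \<in> perms n" "tw sg 0 m (delta (map f [0..<n])) l \<noteq> 0"
  shows "\<exists>m'\<in>perms n. map f m' = l \<and> map \<chi> m' = map \<chi> m \<and> (m' = m \<or> cinv \<chi> m' < cinv \<chi> m)"
  using assms
proof (induction m arbitrary: l rule: perms_induct)
  case sorted
  then have "l = map f [0..<n]" by (simp add: tw_sorted delta_def split: if_splits)
  then show ?case by (intro bexI[of _ "[0..<n]"]) (auto simp: perms_def)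
next
  case (swap p a b s)
  let ?z = "tw sg 0 (p @ a # b # s) (delta (map f [0..<n]))" and ?k = "length p"
  have m1: "p @ a # b # s \<in> perms n" using swap.hyps(2) by (simp add: perms_swap)
  have ln: "length (p @ a # b # s) = n" using perms_length[OF m1] .
  have S: "tw sg 0 (p @ b # a # s) (delta (map f [0..<n])) = sg ?k ?z"
    using sgb.S_tw[OF swap.hyps(1), of 0 p s n] start_tens ln by simp
  have "sg ?k ?z \<in> tens n" using ln by (intro sg_tens sgb.tw_closed start_tens) auto
  with swap.prems S have l: "length l = n" by (auto simp: tens_def)
  have "Suc ?k < length l" using l ln by simp
  then obtain lp x y ls where ls: "l = lp @ x # y # ls" and lp: "length lp = ?k"
    by (rule adjacent_split)
  have ci: "cinv \<chi> (p @ b # a # s) = cinv \<chi> (p @ a # b # s) + (if \<chi> a = \<chi> b then 1 else 0)"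
    by (rule cinv_swap[OF swap.hyps(1)])
  have "?z (lp @ y # x # ls) \<noteq> 0 \<or> ?z l \<noteq> 0 \<and> fst x = fst y"
    using swap.prems sg_append[of lp ?z x y ls] unfolding S ls lp by (auto split: if_splits)
  then show ?case
  proof
    assume "?z (lp @ y # x # ls) \<noteq> 0"
    from swap.IH[OF this] obtain m' where m': "m' \<in> perms n" "map f m' = lp @ y # x # ls"
      "map \<chi> m' = map \<chi> (p @ a # b # s)" "m' = p @ a # b # s \<or> cinv \<chi> m' < cinv \<chi> (p @ a # b # s)"
      by blast
    from m'(2) obtain p' a' b' s' where e: "m' = p' @ a' # b' # s'" "map f p' = lp" "f a' = y" "f b' = x" "map f s' = ls"
      by (rule map_eq_adjacent)
    have lp': "length p' = length p" using e(2) lp by auto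
    have c: "map \<chi> p' = map \<chi> p" "\<chi> a' = \<chi> a" "\<chi> b' = \<chi> b" "map \<chi> s' = map \<chi> s"
      using m'(3) lp' unfolding e(1) by auto
    show ?thesis
    proof (intro bexI[of _ "p' @ b' # a' # s'"] conjI)
      show "p' @ b' # a' # s' \<in> perms n" using m'(1) perms_swap e(1) by blast
      show "map f (p' @ b' # a' # s') = l" using e ls by simp
      show "map \<chi> (p' @ b' # a' # s') = map \<chi> (p @ b # a # s)" using c by simp
      have "cinv \<chi> (p' @ b' # a' # s') \<le> cinv \<chi> m' + (if \<chi> a = \<chi> b then 1 else 0)"
        using cinv_swap[of a' b' \<chi> p' s'] cinv_swap[of b' a' \<chi> p' s'] c m'(1) e(1)
        by (cases a' b' rule: linorder_cases) auto
      then show "p' @ b' # a' # s' = p @ b # a # s \<or> cinv \<chi> (p' @ b' # a' # s') < cinv \<chi> (p @ b # a # s)"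
        using m'(4) lp' ci unfolding e(1) by auto
    qed
  next
    assume z: "?z l \<noteq> 0 \<and> fst x = fst y"
    from swap.IH[OF conjunct1[OF this]] obtain m' where m': "m' \<in> perms n" "map f m' = l"
      "map \<chi> m' = map \<chi> (p @ a # b # s)" "m' = p @ a # b # s \<or> cinv \<chi> m' < cinv \<chi> (p @ a # b # s)"
      by blast
    from m'(2) obtain p' a' b' s' where e: "m' = p' @ a' # b' # s'" "map f p' = lp" "f a' = x" "f b' = y" "map f s' = ls"
      unfolding ls by (rule map_eq_adjacent)
    have lp': "length p' = length p" using e(2) lp by auto
    have c: "\<chi> a' = \<chi> a" "\<chi> b' = \<chi> b" using m'(3) lp' unfolding e(1) by auto
    have "\<chi> a = \<chi> b" using z e(3,4) c f[of a'] f[of b'] by simp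
    then show ?thesis using m' ci by (intro bexI[of _ m']) auto
  qed
qed

text \<open>The other half. The coefficient \<open>1\<close> could be disturbed only by the diagonal
  term of \<open>sg\<close>, for which the tensor of the longer permutation would have to occur
  already for the shorter one; \<open>tw_sg_support\<close> and the minimality of sorted
  representatives exclude this.\<close>

lemma tw_sg_leading:
  assumes "m \<in> perms n" "fsorted f m"
  shows "tw sg 0 m (delta (map f [0..<n])) (map f m) = 1"
  using assms
proof (induction m rule: perms_induct)
  case sorted
  show ?case by (simp add: tw_sorted delta_def)
next
  case (swap p a b s)
  let ?z = "tw sg 0 (p @ a # b # s) (delta (map f [0..<n]))"
  have m1: "p @ a # b # s \<in> perms n" using swap.hyps(2) by (simp add: perms_swap)
  have S: "tw sg 0 (p @ b # a # s) (delta (map f [0..<n])) = sg (length (map f p)) ?z"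
    using sgb.S_tw[OF swap.hyps(1), of 0 p s n] start_tens perms_length[OF m1] by simp
  have ne: "f a \<noteq> f b"
    using swap.prems swap.hyps(1) by (auto simp: fsorted_def sorted_wrt_append)
  then have "fsorted f (p @ a # b # s)"
    using swap.prems by (auto simp: fsorted_def sorted_wrt_append)
  with swap.IH have 1: "?z (map f p @ f a # f b # map f s) = 1" by simp
  have 2: "?z (map f p @ f b # f a # map f s) = 0" if "fst (f a) = fst (f b)"
  proof (rule ccontr)
    assume "?z (map f p @ f b # f a # map f s) \<noteq> 0"
    from tw_sg_support[OF m1 this] obtain m' where m': "m' \<in> perms n"
      "map f m' = map f (p @ b # a # s)" "m' = p @ a # b # s \<or> cinv \<chi> m' < cinv \<chi> (p @ a # b # s)"
      by auto
    have "m' = p @ b # a # s \<or> cinv \<chi> (p @ b # a # s) < cinv \<chi> m'"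
      by (rule fsorted_minimal[OF swap.prems]) (use m' swap.hyps(2) in \<open>auto simp: perms_def intro: f_col\<close>)
    moreover have "cinv \<chi> (p @ b # a # s) = cinv \<chi> (p @ a # b # s) + 1"
      using cinv_swap[OF swap.hyps(1)] that f by simp
    ultimately show False using m'(3) by auto
  qed
  show ?case using ne 1 2 unfolding S map_append list.map sg_append by (auto simp: prod_eq_iff)
qed

end

text \<open>Let \<open>m0\<close> have the largest number of inversions in the support of a linear relation. The tensor \<open>f\<close>
  marks the entries of colour \<open>1\<close> by whether they exceed all earlier ones in \<open>m0\<close>; as \<open>m0\<close> has no
  decreasing triple, it has the fewest inversions among the permutations with the same image under \<open>f\<close>.\<close>

theorem tw_sg_independent:
  fixes c :: "nat list \<Rightarrow> kq"
  assumes N: "N 1 = 2" "\<And>b. 2 \<le> b \<Longrightarrow> b \<le> d \<Longrightarrow> n \<le> N b" and \<chi>: "\<And>p. \<chi> p \<in> {1..d}"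
    and G: "G \<subseteq> perms n" "\<And>m. m \<in> G \<Longrightarrow> \<not> has_triple \<chi> m"
    and 0: "\<And>y l. y \<in> T_basis d N n \<Longrightarrow> map fst y = map \<chi> [0..<n] \<Longrightarrow> (\<Sum>m\<in>G. c m * tw sg 0 m (delta y) l) = 0"
    and m: "m \<in> G"
  shows "c m = 0"
proof (rule ccontr)
  assume "c m \<noteq> 0"
  define Z where "Z = {m \<in> G. c m \<noteq> 0}"
  have fin: "finite G" using G(1) finite_perms finite_subset by blast
  then have Z: "finite Z" "Z \<noteq> {}" using m \<open>c m \<noteq> 0\<close> by (auto simp: Z_def)
  then have "Max (cinv \<chi> ` Z) \<in> cinv \<chi> ` Z" by simp
  then obtain m0 where m0: "m0 \<in> Z" "Max (cinv \<chi> ` Z) = cinv \<chi> m0" by blast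
  have m0_max: "cinv \<chi> m \<le> cinv \<chi> m0" if "m \<in> Z" for m
    using Z(1) that by (simp flip: m0(2))
  have mp: "m0 \<in> perms n" "\<not> has_triple \<chi> m0" using m0(1) G by (auto simp: Z_def)
  define bad where "bad p = (\<exists>u x v w. m0 = u @ x # v @ p # w \<and> \<chi> x = 1 \<and> p < x)" for p
  \<comment> \<open>In colours other than \<open>1\<close> all entries get different indices
    \<open>p + 1\<close>, which lie in the basis because \<open>n \<le> N b\<close>; in colour
    \<open>1\<close> only the two indices allowed by \<open>N 1 = 2\<close> are used.\<close>
  define f where "f p = (\<chi> p, if \<chi> p = 1 then if bad p then 2 else 1 else p + 1)" for p
  have ff: "fst (f p) = \<chi> p" for p by (simp add: f_def)
  have fs: "fsorted f m0"
  proof (rule ccontr)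
    assume ns: "\<not> fsorted f m0"
    obtain p x u y s where e: "m0 = p @ x # u @ y # s" and xy: "f x = f y" "\<not> x < y"
      using not_sorted_wrt[OF ns[unfolded fsorted_def]] by blast
    have "y < x" using xy(2) mp(1) by (auto simp: e perms_def)
    then have xne: "x \<noteq> y" by simp
    have e1: "\<chi> x = \<chi> y" using arg_cong[OF xy(1), of fst] by (simp only: ff)
    have e2: "snd (f x) = snd (f y)" by (simp only: xy(1))
    have c1: "\<chi> y = 1" using e2 xne unfolding f_def snd_conv e1 by (simp split: if_splits)
    have "bad x = bad y" using e2 unfolding f_def snd_conv e1 c1 by (simp split: if_splits)
    then have c: "\<chi> x = 1" "\<chi> y = 1" "bad x = bad y" using e1 c1 by simp_all
    have "bad y" unfolding bad_def by (intro exI conjI) (rule e, rule c(1), rule \<open>y < x\<close>)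
    then have "bad x" using c(3) by simp
    then obtain u' z v' w' where b: "m0 = u' @ z # v' @ x # w'" "\<chi> z = 1" "x < z"
      unfolding bad_def by (elim exE conjE)
    have x: "x \<notin> set (u' @ z # v')" "x \<notin> set w'" using mp(1) b(1) by (auto simp: perms_def)
    have "(u' @ z # v') @ x # w' = p @ x # (u @ y # s)" using b(1) e by simp
    then have "w' = u @ y # s" unfolding append_Cons_eq_iff[OF x] by (rule conjunct2)
    then have "m0 = u' @ z # v' @ x # u @ y # s" using b(1) by simp
    then have "has_triple \<chi> m0" unfolding has_triple_def
      by (intro exI conjI) (assumption, rule \<open>y < x\<close>, rule b(3), rule c(2), rule c(1), rule b(2))
    then show False using mp(2) by simp
  qed
  have T: "map f [0..<n] \<in> T_basis d N n"
  proof -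
    have "f p \<in> V_basis d N" if "p < n" for p
      using \<chi>[of p] N(1) N(2)[of "\<chi> p"] that by (auto simp: f_def V_basis_def)
    then show ?thesis by (auto simp: T_basis_def)
  qed
  \<comment> \<open>A permutation \<open>m\<close> contributing at \<open>map f m0\<close> yields
    some \<open>m'\<close> with these labels. By \<open>fsorted_minimal\<close>, \<open>m'\<close>
    is \<open>m0\<close> or has more coloured inversions than \<open>m0\<close>; either way the
    support lemma contradicts the maximality of \<open>m0\<close>, unless \<open>m\<close> is
    \<open>m0\<close>.\<close>
  have z: "c m * tw sg 0 m (delta (map f [0..<n])) (map f m0) = 0" if mG: "m \<in> G - {m0}" for m
  proof (rule ccontr)
    assume ne: "\<not> ?thesis"
    then have "m \<in> Z" using mG by (auto simp: Z_def)
    from ne obtain m' where m': "m' \<in> perms n" "map f m' = map f m0" "m' = m \<or> cinv \<chi> m' < cinv \<chi> m"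
      using tw_sg_support[where f = f and \<chi> = \<chi> and m = m and n = n and l = "map f m0", OF ff] mG G(1) by auto
    have "m' = m0 \<or> cinv \<chi> m0 < cinv \<chi> m'"
      using fsorted_minimal[where \<chi> = \<chi> and m' = m', OF fs] m' mp(1) ff by (metis (mono_tags, lifting) mem_Collect_eq perms_def)
    then show False using m'(3) m0_max[OF \<open>m \<in> Z\<close>] mG by auto
  qed
  have "0 = (\<Sum>m\<in>G. c m * tw sg 0 m (delta (map f [0..<n])) (map f m0))"
    using 0[OF T, of "map f m0"] ff by (simp add: comp_def)
  also have "\<dots> = c m0 * tw sg 0 m0 (delta (map f [0..<n])) (map f m0)
      + (\<Sum>m\<in>G - {m0}. c m * tw sg 0 m (delta (map f [0..<n])) (map f m0))"
    using m0(1) fin by (intro sum.remove) (simp_all add: Z_def)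
  also have "(\<Sum>m\<in>G - {m0}. c m * tw sg 0 m (delta (map f [0..<n])) (map f m0)) = 0"
    by (intro sum.neutral ballI z)
  also have "c m0 * tw sg 0 m0 (delta (map f [0..<n])) (map f m0) + 0 = c m0"
    using tw_sg_leading[OF ff mp(1) fs] by simp
  finally show False using m0(1) by (simp add: Z_def)
qed

subsection \<open>The group algebra as a module over the framed braid group\<close>

lemma (in kalg) smult_zero: "x \<in> carrier A \<Longrightarrow> 0 \<odot> x = \<zero>"
  using smult_add_left[of x 0 0] add.l_cancel_one[of "0 \<odot> x" "0 \<odot> x"] by simp

lemma (in kalg) finsum_eigen:
  assumes "finite I" "f \<in> I \<rightarrow> carrier A" "y \<in> carrier A" "\<And>i. i \<in> I \<Longrightarrow> f i \<otimes> y = c i \<odot> y"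
  shows "finsum A f I \<otimes> y = (\<Sum>i\<in>I. c i) \<odot> y"
  using assms
proof (induction I)
  case empty
  then show ?case by (simp add: smult_zero)
next
  case (insert i I)
  then have "f \<in> I \<rightarrow> carrier A" "f i \<in> carrier A" by auto
  with insert show ?case by (simp add: l_distr smult_add_left)
qed

text \<open>Left translation by a group element; outside the carrier it is the identity, so that it is a
  linear action on all functions, not only on the finitely supported ones.\<close>

definition lt :: "nat \<Rightarrow> nat \<Rightarrow> fb_elt \<Rightarrow> (fb_elt \<Rightarrow> kq) \<Rightarrow> fb_elt \<Rightarrow> kq" where
  "lt d n g a = (\<lambda>z. if z \<in> carrier (FB d n) then a (inv\<^bsub>FB d n\<^esub> g \<otimes>\<^bsub>FB d n\<^esub> z) else a z)"

definition lS :: "nat \<Rightarrow> nat \<Rightarrow> nat \<Rightarrow> (fb_elt \<Rightarrow> kq) \<Rightarrow> fb_elt \<Rightarrow> kq" where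
  "lS d n k = lt d n (FB_s d n (Suc k))"

definition lT :: "nat \<Rightarrow> nat \<Rightarrow> nat \<Rightarrow> (fb_elt \<Rightarrow> kq) \<Rightarrow> fb_elt \<Rightarrow> kq" where
  "lT d n k = lt d n (FB_t d n (Suc k))"

text \<open>Computing modulo this subspace of the group algebra replaces computing with cosets of
  cosets.\<close>

definition ctl_kernel :: "nat \<Rightarrow> nat \<Rightarrow> (fb_elt \<Rightarrow> kq) set" where
  "ctl_kernel d n = {a \<in> carrier (kFB d n). CTL_map d n a = \<zero>\<^bsub>CTL d n\<^esub>}"

abbreviation FB_word :: "nat \<Rightarrow> nat \<Rightarrow> (fb_gen \<times> bool) list \<Rightarrow> fb_elt" where
  "FB_word d n \<equiv> pres_class (fb_gens n) (fb_rels d n)"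

lemma lt_add: "lt d n g (x + y) = lt d n g x + lt d n g y"
  by (rule ext) (simp add: lt_def)

lemma lt_fscale: "lt d n g (fscale c x) = fscale c (lt d n g x)"
  by (rule ext) (simp add: lt_def fscale_def)

lemma lt_diff: "lt d n g (x - y) = lt d n g x - lt d n g y"
  by (rule ext) (simp add: lt_def)

lemma kFB_add: "f \<oplus>\<^bsub>kFB d n\<^esub> g = f + g"
  by (rule ext) (simp add: kFB_def)

lemma kFB_smult: "c \<odot>\<^bsub>kFB d n\<^esub> f = fscale c f"
  by (rule ext) (simp add: kFB_def fscale_def)

lemma kFB_zero: "\<zero>\<^bsub>kFB d n\<^esub> = 0"
  by (rule ext) (simp add: kFB_def)

context
  fixes d n :: nat and \<zeta> :: kq
  assumes d: "d \<ge> 1" and \<zeta>: "primitive_root_of_unity d \<zeta>"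
begin

interpretation G: group "FB d n" by (rule group_FB[OF d \<zeta>])
interpretation A: kalg "kFB d n" by (rule kalg_kFB[OF d \<zeta>])
interpretation Y: kalg "YH d n" by (rule kalg_YH[OF d \<zeta>])
interpretation Q: kalg "CTL d n" by (rule kalg_CTL[OF d \<zeta>])

lemma lt_mult:
  "g \<in> carrier (FB d n) \<Longrightarrow> h \<in> carrier (FB d n) \<Longrightarrow> lt d n g (lt d n h a) = lt d n (g \<otimes>\<^bsub>FB d n\<^esub> h) a"
  by (rule ext) (simp add: lt_def G.inv_mult_group G.m_assoc)

lemma lt_one: "lt d n \<one>\<^bsub>FB d n\<^esub> a = a"
  by (rule ext) (simp add: lt_def)

lemma lt_inv: "g \<in> carrier (FB d n) \<Longrightarrow> lt d n g (lt d n (inv\<^bsub>FB d n\<^esub> g) a) = a"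
  "g \<in> carrier (FB d n) \<Longrightarrow> lt d n (inv\<^bsub>FB d n\<^esub> g) (lt d n g a) = a"
  by (simp_all add: lt_mult lt_one)

lemma kFB_minus:
  assumes "a \<in> carrier (kFB d n)" "b \<in> carrier (kFB d n)"
  shows "a \<ominus>\<^bsub>kFB d n\<^esub> b = a - b"
proof -
  have "(a \<ominus>\<^bsub>kFB d n\<^esub> b) + b = a" unfolding kFB_add[where d = d and n = n, symmetric] using assms by (simp add: A.minus_eq A.a_assoc A.l_neg)
  then show ?thesis by (metis add_diff_cancel_right')
qed

lemma delta_mult:
  assumes g: "g \<in> carrier (FB d n)" and a: "a \<in> carrier (kFB d n)"
  shows "delta g \<otimes>\<^bsub>kFB d n\<^esub> a = lt d n g a"
proof
  fix z
  have fin: "finite {y. a y \<noteq> 0}" and sub: "\<And>y. a y \<noteq> 0 \<Longrightarrow> y \<in> carrier (FB d n)"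
    using a by (auto simp: kFB_def)
  have key: "g \<otimes>\<^bsub>FB d n\<^esub> y = z \<longleftrightarrow> y = inv\<^bsub>FB d n\<^esub> g \<otimes>\<^bsub>FB d n\<^esub> z \<and> z \<in> carrier (FB d n)"
    if "y \<in> carrier (FB d n)" for y
    using G.inv_solve_left[of y g z] G.m_closed[OF g that] g that by auto
  have "(delta g \<otimes>\<^bsub>kFB d n\<^esub> a) z = (\<Sum>x\<in>{g}. \<Sum>y | a y \<noteq> 0. delta g x * a y * delta (x \<otimes>\<^bsub>FB d n\<^esub> y) z)"
    unfolding kFB_def using fin by (intro monoid_algebra_mult_eq) auto
  also have "\<dots> = (\<Sum>y | a y \<noteq> 0. if y = inv\<^bsub>FB d n\<^esub> g \<otimes>\<^bsub>FB d n\<^esub> z \<and> z \<in> carrier (FB d n) then a y else 0)"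
    by (simp, intro sum.cong refl) (use key[OF sub] in \<open>auto simp: delta_def\<close>)
  also have "\<dots> = lt d n g a z"
    using fin sub[of z] by (auto simp: lt_def sum.delta)
  finally show "(delta g \<otimes>\<^bsub>kFB d n\<^esub> a) z = lt d n g a z" .
qed

lemma lt_closed: "g \<in> carrier (FB d n) \<Longrightarrow> a \<in> carrier (kFB d n) \<Longrightarrow> lt d n g a \<in> carrier (kFB d n)"
  by (subst delta_mult[symmetric]) (auto intro: A.m_closed delta_kFB[OF d \<zeta>])

lemma lt_delta:
  assumes "g \<in> carrier (FB d n)" "h \<in> carrier (FB d n)"
  shows "lt d n g (delta h) = delta (g \<otimes>\<^bsub>FB d n\<^esub> h)"
  using assms by (intro ext) (auto simp: lt_def delta_def G.inv_solve_left' G.m_assoc[symmetric])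

lemma CTL_map_add:
  "a \<in> carrier (kFB d n) \<Longrightarrow> b \<in> carrier (kFB d n) \<Longrightarrow> CTL_map d n (a + b) = CTL_map d n a \<oplus>\<^bsub>CTL d n\<^esub> CTL_map d n b"
  unfolding kFB_add[where d = d and n = n, symmetric] by (rule alg_homD(5)[OF CTL_map_alg_hom[OF d \<zeta>]])

lemma CTL_map_fscale:
  "a \<in> carrier (kFB d n) \<Longrightarrow> CTL_map d n (fscale c a) = c \<odot>\<^bsub>CTL d n\<^esub> CTL_map d n a"
  unfolding kFB_smult[where d = d and n = n, symmetric] by (rule alg_homD(2)[OF CTL_map_alg_hom[OF d \<zeta>]])

lemma carrier_subspace: "fs.subspace (carrier (kFB d n))"
proof (rule fs.subspaceI)
  show "0 \<in> carrier (kFB d n)" using A.zero_closed unfolding kFB_zero .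
  show "x + y \<in> carrier (kFB d n)" if "x \<in> carrier (kFB d n)" "y \<in> carrier (kFB d n)" for x y
    using A.a_closed[OF that] unfolding kFB_add .
  show "fscale c x \<in> carrier (kFB d n)" if "x \<in> carrier (kFB d n)" for c x
    using A.smult_closed[OF that] unfolding kFB_smult .
qed

lemma kernel_subspace: "fs.subspace (ctl_kernel d n)"
proof (rule fs.subspaceI)
  have "CTL_map d n 0 = \<zero>\<^bsub>CTL d n\<^esub>"
    unfolding kFB_zero[symmetric, of d n] by (rule alg_hom_zero[OF A.kalg_axioms Q.kalg_axioms CTL_map_alg_hom[OF d \<zeta>]])
  then show "0 \<in> ctl_kernel d n" unfolding ctl_kernel_def using fs.subspace_0[OF carrier_subspace] by blast
  show "x + y \<in> ctl_kernel d n" if "x \<in> ctl_kernel d n" "y \<in> ctl_kernel d n" for x y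
    using that fs.subspace_add[OF carrier_subspace] CTL_map_add[of x y] Q.l_zero[OF Q.zero_closed]
    unfolding ctl_kernel_def by (simp only: mem_Collect_eq simp_thms)
  have "c \<odot>\<^bsub>CTL d n\<^esub> \<zero>\<^bsub>CTL d n\<^esub> = \<zero>\<^bsub>CTL d n\<^esub>" for c
    using Q.smult_smult[of "\<zero>\<^bsub>CTL d n\<^esub>" c 0] Q.smult_zero[of "\<zero>\<^bsub>CTL d n\<^esub>"] by (simp del: quot_alg_simps)
  then show "fscale c x \<in> ctl_kernel d n" if "x \<in> ctl_kernel d n" for c x
    using that fs.subspace_scale[OF carrier_subspace] CTL_map_fscale[of x c]
    unfolding ctl_kernel_def by (simp only: mem_Collect_eq simp_thms)
qed

lemma kernel_left:
  assumes "b \<in> carrier (kFB d n)" "a \<in> ctl_kernel d n" shows "b \<otimes>\<^bsub>kFB d n\<^esub> a \<in> ctl_kernel d n"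
  using assms alg_homD(3,4)[OF CTL_map_alg_hom[OF d \<zeta>]] A.m_closed Q.r_null
  unfolding ctl_kernel_def by (simp only: mem_Collect_eq simp_thms)

lemma kernel_right:
  assumes "b \<in> carrier (kFB d n)" "a \<in> ctl_kernel d n" shows "a \<otimes>\<^bsub>kFB d n\<^esub> b \<in> ctl_kernel d n"
  using assms alg_homD(3,4)[OF CTL_map_alg_hom[OF d \<zeta>]] A.m_closed Q.l_null
  unfolding ctl_kernel_def by (simp only: mem_Collect_eq simp_thms)

lemma lt_kernel: "g \<in> carrier (FB d n) \<Longrightarrow> a \<in> ctl_kernel d n \<Longrightarrow> lt d n g a \<in> ctl_kernel d n"
  using kernel_left[OF delta_kFB[OF d \<zeta>], of g a] delta_mult[of g a] by (simp add: ctl_kernel_def)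

lemma lS_closed: "Suc k < n \<Longrightarrow> x \<in> carrier (kFB d n) \<Longrightarrow> lS d n k x \<in> carrier (kFB d n)"
  unfolding lS_def by (intro lt_closed FB_s_closed[OF d \<zeta>]) auto

lemma lT_closed: "k < n \<Longrightarrow> x \<in> carrier (kFB d n) \<Longrightarrow> lT d n k x \<in> carrier (kFB d n)"
  unfolding lT_def by (intro lt_closed FB_t_closed[OF d \<zeta>]) auto

lemma FB_word_closed: "w \<in> lists (fb_gens n \<times> UNIV) \<Longrightarrow> FB_word d n w \<in> carrier (FB d n)"
  by (simp add: FB_def presented_group_def)

lemma lt_word:
  "\<lbrakk>u \<in> lists (fb_gens n \<times> UNIV); v \<in> lists (fb_gens n \<times> UNIV)\<rbrakk> \<Longrightarrow>
    lt d n (FB_word d n u) (lt d n (FB_word d n v) a) = lt d n (FB_word d n (u @ v)) a"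
  by (simp add: lt_mult FB_word_closed) (simp add: FB_def presented_group_mult[OF fb_rels_lists])

lemma FB_rel: "(u, v) \<in> fb_rels d n \<Longrightarrow> FB_word d n u = FB_word d n v"
  by (intro pres_class_eqI[OF fb_rels_lists] pres_cong.rel)

lemma lS_word: "lS d n k = lt d n (FB_word d n [ws (Suc k)])" "lT d n j = lt d n (FB_word d n [wt (Suc j)])"
  by (simp_all add: lS_def lT_def FB_s_def FB_t_def)

lemma lS_lT_gens: "Suc k < n \<Longrightarrow> GenS (Suc k) \<in> fb_gens n" "j < n \<Longrightarrow> GenT (Suc j) \<in> fb_gens n"
  by (auto simp: fb_gens_def)

lemma lS_far:
  assumes "Suc i < j" "Suc j < n" shows "lS d n i (lS d n j x) = lS d n j (lS d n i x)"
proof -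
  have "([ws (Suc i), ws (Suc j)], [ws (Suc j), ws (Suc i)]) \<in> fb_rels d n"
    unfolding fb_rels_def using assms by auto
  from FB_rel[OF this] show ?thesis using assms by (simp add: lS_word lt_word lS_lT_gens)
qed

lemma lS_braid:
  assumes "Suc (Suc i) < n"
  shows "lS d n i (lS d n (Suc i) (lS d n i x)) = lS d n (Suc i) (lS d n i (lS d n (Suc i) x))"
proof -
  have "([ws (Suc i), ws (Suc (Suc i)), ws (Suc i)], [ws (Suc (Suc i)), ws (Suc i), ws (Suc (Suc i))]) \<in> fb_rels d n"
    unfolding fb_rels_def using assms by auto
  from FB_rel[OF this] show ?thesis using assms by (simp add: lS_word lt_word lS_lT_gens)
qed

lemma lS_lT:
  assumes "Suc i < n" "j < n"
  shows "lS d n i (lT d n j x) = lT d n (transpose i (Suc i) j) (lS d n i x)"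
proof -
  have "([ws (Suc i), wt (Suc j)], [wt (transpose (Suc i) (Suc i + 1) (Suc j)), ws (Suc i)]) \<in> fb_rels d n"
    unfolding fb_rels_def using assms by auto
  moreover have "transpose (Suc i) (Suc i + 1) (Suc j) = Suc (transpose i (Suc i) j)"
    by (auto simp: transpose_def)
  ultimately have "FB_word d n [ws (Suc i), wt (Suc j)] = FB_word d n [wt (Suc (transpose i (Suc i) j)), ws (Suc i)]"
    using FB_rel by simp
  moreover have "transpose i (Suc i) j < n" using assms by (auto simp: transpose_def)
  ultimately show ?thesis using assms by (simp add: lS_word lt_word lS_lT_gens)
qed

lemma lT_lT:
  assumes "i < n" "j < n" shows "lT d n i (lT d n j x) = lT d n j (lT d n i x)"
proof -
  have "([wt (Suc i), wt (Suc j)], [wt (Suc j), wt (Suc i)]) \<in> fb_rels d n"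
    unfolding fb_rels_def using assms by auto
  from FB_rel[OF this] show ?thesis using assms by (simp add: lS_word lt_word lS_lT_gens)
qed

lemma lT_funpow:
  assumes "j < n" shows "(lT d n j ^^ k) x = lt d n (FB_word d n (replicate k (wt (Suc j)))) x"
proof (induction k)
  case 0
  have "FB_word d n [] = \<one>\<^bsub>FB d n\<^esub>" by (simp add: FB_def presented_group_def)
  then show ?case by (simp add: lt_one)
next
  case (Suc k)
  have "replicate k (wt (Suc j)) \<in> lists (fb_gens n \<times> UNIV)" using lS_lT_gens(2)[OF assms] by (auto simp: in_lists_conv_set)
  from lt_word[of "[wt (Suc j)]", OF _ this, of x] show ?case
    using lS_lT_gens(2)[OF assms] by (simp add: Suc lS_word(2)[symmetric])
qed

lemma lT_funpow_d: "j < n \<Longrightarrow> (lT d n j ^^ d) x = x"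
proof -
  assume j: "j < n"
  then have "(replicate d (wt (Suc j)), []) \<in> fb_rels d n" unfolding fb_rels_def by auto
  from FB_rel[OF this] have "FB_word d n (replicate d (wt (Suc j))) = \<one>\<^bsub>FB d n\<^esub>"
    by (simp add: FB_def presented_group_def)
  then show ?thesis using lT_funpow[OF j] by (simp add: lt_one)
qed

lemma lt_pow_eigen:
  assumes "g \<in> carrier (FB d n)" "lt d n g y = fscale \<alpha> y"
  shows "lt d n (g [^]\<^bsub>FB d n\<^esub> (a::nat)) y = fscale (\<alpha> ^ a) y"
proof (induction a)
  case 0
  show ?case by (rule ext) (simp add: lt_one fscale_def)
next
  case (Suc a)
  have "lt d n (g [^]\<^bsub>FB d n\<^esub> Suc a) y = lt d n (g [^]\<^bsub>FB d n\<^esub> a) (lt d n g y)"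
    using assms(1) by (simp add: lt_mult)
  then show ?case by (simp add: assms(2) lt_fscale Suc)
qed

lemma lt_inv_eigen:
  assumes "g \<in> carrier (FB d n)" "lt d n g y = fscale \<alpha> y" "\<alpha> \<noteq> 0"
  shows "lt d n (inv\<^bsub>FB d n\<^esub> g) y = fscale (inverse \<alpha>) y"
proof -
  have "y = lt d n (inv\<^bsub>FB d n\<^esub> g) (fscale \<alpha> y)" using lt_inv(2)[OF assms(1), of y] by (simp add: assms(2))
  then have "fscale (inverse \<alpha>) y = fscale (inverse \<alpha>) (fscale \<alpha> (lt d n (inv\<^bsub>FB d n\<^esub> g) y))" by (simp add: lt_fscale)
  then show ?thesis using assms(3) by simp
qed

text \<open>The counterpart of \<open>PhiFB_E\<close> inside the group algebra: on a joint
  eigenvector of two neighbouring framings the average becomes a character sum.\<close>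

lemma E_eigen:
  assumes i: "Suc i < n" and y: "y \<in> carrier (kFB d n)"
    and T: "lT d n i y = fscale (\<zeta> ^ (b - 1)) y" "lT d n (Suc i) y = fscale (\<zeta> ^ (c - 1)) y"
    and bc: "b \<in> {1..d}" "c \<in> {1..d}"
  shows "kFB_E d n (Suc i) \<otimes>\<^bsub>kFB d n\<^esub> y = (if b = c then y else 0)"
proof -
  let ?g = "\<lambda>a. FB_t d n (Suc i) [^]\<^bsub>FB d n\<^esub> int a \<otimes>\<^bsub>FB d n\<^esub> FB_t d n (Suc i + 1) [^]\<^bsub>FB d n\<^esub> (- int a)"
  have i': "Suc i \<in> {1..<n}" using i by simp
  have t: "FB_t d n (Suc i) \<in> carrier (FB d n)" "FB_t d n (Suc i + 1) \<in> carrier (FB d n)"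
    using i by (auto intro: FB_t_closed[OF d \<zeta>])
  have gc: "?g a \<in> carrier (FB d n)" for a by (rule E_term_closed[OF d \<zeta> i'])
  have dc: "(\<lambda>a. delta (?g a)) \<in> {1..d} \<rightarrow> carrier (kFB d n)" by (rule E_terms_closed[OF d \<zeta> i'])
  have eig: "delta (?g a) \<otimes>\<^bsub>kFB d n\<^esub> y = (\<zeta> ^ (b - 1) * inverse (\<zeta> ^ (c - 1))) ^ a \<odot>\<^bsub>kFB d n\<^esub> y" for a
  proof -
    have "FB_t d n (Suc i + 1) [^]\<^bsub>FB d n\<^esub> (- int a) = inv\<^bsub>FB d n\<^esub> (FB_t d n (Suc i + 1) [^]\<^bsub>FB d n\<^esub> a)"
      using t by (simp add: G.int_pow_neg int_pow_int)
    moreover have "lt d n (inv\<^bsub>FB d n\<^esub> (FB_t d n (Suc i + 1) [^]\<^bsub>FB d n\<^esub> a)) y = fscale (inverse ((\<zeta> ^ (c - 1)) ^ a)) y"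
      using t T(2) zeta_neq_0[OF d \<zeta>] by (intro lt_inv_eigen lt_pow_eigen) (auto simp: lT_def)
    moreover have "lt d n (FB_t d n (Suc i) [^]\<^bsub>FB d n\<^esub> a) y = fscale ((\<zeta> ^ (b - 1)) ^ a) y"
      using t T(1) by (intro lt_pow_eigen) (auto simp: lT_def)
    ultimately have "lt d n (?g a) y = fscale (inverse ((\<zeta> ^ (c - 1)) ^ a)) (fscale ((\<zeta> ^ (b - 1)) ^ a) y)"
      using t by (simp only: lt_mult[symmetric] G.nat_pow_closed G.inv_closed int_pow_int lt_fscale)
    then show ?thesis unfolding delta_mult[OF gc y] kFB_smult
      by (simp add: power_mult_distrib power_inverse mult.commute)
  qed
  have "kFB_E d n (Suc i) \<otimes>\<^bsub>kFB d n\<^esub> y = (1 / of_nat d) \<odot>\<^bsub>kFB d n\<^esub>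
      (finsum (kFB d n) (\<lambda>a. delta (?g a)) {1..d} \<otimes>\<^bsub>kFB d n\<^esub> y)"
    unfolding kFB_E_def using dc y by (intro A.smult_mult_left A.finsum_closed)
  also have "finsum (kFB d n) (\<lambda>a. delta (?g a)) {1..d} \<otimes>\<^bsub>kFB d n\<^esub> y
      = (\<Sum>a\<in>{1..d}. (\<zeta> ^ (b - 1) * inverse (\<zeta> ^ (c - 1))) ^ a) \<odot>\<^bsub>kFB d n\<^esub> y"
    using dc y eig by (intro A.finsum_eigen) auto
  also have "(1 / of_nat d) \<odot>\<^bsub>kFB d n\<^esub> \<dots>
      = (1 / of_nat d * (\<Sum>a\<in>{1..d}. (\<zeta> ^ (b - 1) * inverse (\<zeta> ^ (c - 1))) ^ a)) \<odot>\<^bsub>kFB d n\<^esub> y"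
    using y by (rule A.smult_smult)
  also have "1 / of_nat d * (\<Sum>a\<in>{1..d}. (\<zeta> ^ (b - 1) * inverse (\<zeta> ^ (c - 1))) ^ a)
      = (if b - 1 = c - 1 then 1 else 0)"
    using bc by (intro root_average[OF \<zeta> d]) auto
  also have "b - 1 = c - 1 \<longleftrightarrow> b = c" using bc by auto
  finally show ?thesis by (cases "b = c") (simp_all add: kFB_smult fscale_def zero_fun_def)
qed

lemma YH_map_kernel:
  assumes "a \<in> carrier (kFB d n)" "quot_map (kFB d n) (YH_rels d n) a = \<zero>\<^bsub>YH d n\<^esub>"
  shows "a \<in> ctl_kernel d n"
proof -
  have "quot_map (YH d n) (CTL_rels d n) \<zero>\<^bsub>YH d n\<^esub> = \<zero>\<^bsub>CTL d n\<^esub>"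
    unfolding CTL_def
    by (rule alg_hom_zero[OF Y.kalg_axioms Y.kalg_quot_alg[OF CTL_rels_carrier[OF d \<zeta>]]
        Y.quot_map_alg_hom[OF CTL_rels_carrier[OF d \<zeta>]]])
  then show ?thesis using assms by (simp only: ctl_kernel_def CTL_map_def[OF d \<zeta>] mem_Collect_eq simp_thms)
qed

lemma quadratic_kernel:
  assumes i: "Suc i < n" and x: "x \<in> carrier (kFB d n)"
    and T: "lT d n i x = fscale (\<zeta> ^ (b - 1)) x" "lT d n (Suc i) x = fscale (\<zeta> ^ (c - 1)) x"
    and bc: "b \<in> {1..d}" "c \<in> {1..d}"
  shows "lS d n i (lS d n i x) - ((if b = c then fscale (q - inverse q) (lS d n i x) else 0) + x) \<in> ctl_kernel d n"
proof -
  let ?A = "kFB d n" and ?s = "delta (FB_s d n (Suc i)) :: fb_elt \<Rightarrow> kq"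
  have i': "Suc i \<in> {1..<n}" using i by simp
  have s: "?s \<in> carrier ?A" using i' by (intro delta_kFB[OF d \<zeta>] FB_s_closed[OF d \<zeta>])
  have E: "kFB_E d n (Suc i) \<in> carrier ?A" using i' by (rule kFB_E_closed[OF d \<zeta>])
  define r where "r = ?s \<otimes>\<^bsub>?A\<^esub> ?s \<ominus>\<^bsub>?A\<^esub> ((q - inverse q) \<odot>\<^bsub>?A\<^esub> (kFB_E d n (Suc i) \<otimes>\<^bsub>?A\<^esub> ?s) \<oplus>\<^bsub>?A\<^esub> \<one>\<^bsub>?A\<^esub>)"
  have "r \<in> YH_rels d n" unfolding YH_rels_def r_def using i' by blast
  then have rk: "r \<in> ctl_kernel d n"
    using YH_rels_carrier[OF d \<zeta>, of n] A.quot_map_rel[OF YH_rels_carrier[OF d \<zeta>]]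
    by (intro YH_map_kernel) (auto simp: YH_def simp del: quot_alg_simps)
  have sx: "?s \<otimes>\<^bsub>?A\<^esub> z = lS d n i z" if "z \<in> carrier ?A" for z
    using that i' unfolding lS_def by (intro delta_mult FB_s_closed[OF d \<zeta>])
  have Sx: "lS d n i x \<in> carrier ?A" by (rule lS_closed[OF i x])
  \<comment> \<open>A braid generator exchanges the two framings, hence also the eigenvalues;
    \<open>E_eigen\<close> is applied with \<open>b\<close> and \<open>c\<close>
    interchanged.\<close>
  have "lT d n i (lS d n i x) = fscale (\<zeta> ^ (c - 1)) (lS d n i x)"
    "lT d n (Suc i) (lS d n i x) = fscale (\<zeta> ^ (b - 1)) (lS d n i x)"
    using lS_lT[OF i, of "Suc i" x] lS_lT[OF i, of i x] i T by (simp_all add: lS_def lt_fscale)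
  from E_eigen[OF i Sx this bc(2,1)]
  have Ex: "kFB_E d n (Suc i) \<otimes>\<^bsub>?A\<^esub> lS d n i x = (if b = c then lS d n i x else 0)" by auto
  have "r \<otimes>\<^bsub>?A\<^esub> x = ?s \<otimes>\<^bsub>?A\<^esub> ?s \<otimes>\<^bsub>?A\<^esub> x \<ominus>\<^bsub>?A\<^esub> ((q - inverse q) \<odot>\<^bsub>?A\<^esub> (kFB_E d n (Suc i) \<otimes>\<^bsub>?A\<^esub> ?s) \<oplus>\<^bsub>?A\<^esub> \<one>\<^bsub>?A\<^esub>) \<otimes>\<^bsub>?A\<^esub> x"
    unfolding r_def using s E x by (simp add: A.minus_eq A.l_distr A.l_minus)
  also have "?s \<otimes>\<^bsub>?A\<^esub> ?s \<otimes>\<^bsub>?A\<^esub> x = lS d n i (lS d n i x)"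
    by (simp only: A.m_assoc[OF s s x] sx[OF x] sx[OF Sx])
  also have "((q - inverse q) \<odot>\<^bsub>?A\<^esub> (kFB_E d n (Suc i) \<otimes>\<^bsub>?A\<^esub> ?s) \<oplus>\<^bsub>?A\<^esub> \<one>\<^bsub>?A\<^esub>) \<otimes>\<^bsub>?A\<^esub> x
      = (q - inverse q) \<odot>\<^bsub>?A\<^esub> (kFB_E d n (Suc i) \<otimes>\<^bsub>?A\<^esub> lS d n i x) \<oplus>\<^bsub>?A\<^esub> x"
    using s E x by (simp add: A.l_distr A.smult_mult_left A.m_assoc sx)
  also have "\<dots> = (if b = c then fscale (q - inverse q) (lS d n i x) else 0) + x"
    unfolding Ex kFB_smult kFB_add by simp
  also have "lS d n i (lS d n i x) \<ominus>\<^bsub>?A\<^esub> \<dots> = lS d n i (lS d n i x) - \<dots>"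
    using Sx x by (intro kFB_minus lS_closed[OF i] fs.subspace_add[OF carrier_subspace])
      (auto intro: fs.subspace_scale[OF carrier_subspace] fs.subspace_0[OF carrier_subspace])
  finally show ?thesis using kernel_right[OF x rk] by simp
qed

definition tl_relator :: "nat \<Rightarrow> (fb_elt \<Rightarrow> kq) \<Rightarrow> fb_elt \<Rightarrow> kq" where
  "tl_relator k x = x - fscale (inverse q) (lS d n k x) - fscale (inverse q) (lS d n (Suc k) x)
    + fscale (inverse q ^ 2) (lS d n k (lS d n (Suc k) x)) + fscale (inverse q ^ 2) (lS d n (Suc k) (lS d n k x))
    - fscale (inverse q ^ 3) (lS d n k (lS d n (Suc k) (lS d n k x)))"

lemma lT_lS_fixed:
  assumes "Suc i < n" "Suc i < 3" "n > 2" "\<forall>j<3. lT d n j x = x" "j < 3"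
  shows "lT d n j (lS d n i x) = lS d n i x"
proof -
  have t: "transpose i (Suc i) j < 3" "transpose i (Suc i) j < n" using assms by (auto simp: transpose_def)
  have "lT d n (transpose i (Suc i) (transpose i (Suc i) j)) (lS d n i x) = lS d n i (lT d n (transpose i (Suc i) j) x)"
    using lS_lT[OF assms(1) t(2)] by simp
  then show ?thesis using assms(4) t by simp
qed

text \<open>The first two braid generators only permute the first three framings, so they keep the
  vectors fixed by all three. On these the averaging factor of \<open>CTL_relator\<close> is the
  identity, and its braid part alone already lands in the kernel.\<close>

lemma tl_relator_0_kernel:
  assumes n: "n > 2" and x: "x \<in> carrier (kFB d n)" and T: "\<forall>j<3. lT d n j x = x"
  shows "tl_relator 0 x \<in> ctl_kernel d n"
proof -
  let ?A = "kFB d n" and ?Y = "YH d n" and ?Q = "inverse q"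
  let ?h = "quot_map ?A (YH_rels d n)"
  note h = quot_map_YH_alg_hom[OF d \<zeta>, of n]
  let ?s1 = "delta (FB_s d n 1) :: fb_elt \<Rightarrow> kq" and ?s2 = "delta (FB_s d n 2) :: fb_elt \<Rightarrow> kq"
  have s: "?s1 \<in> carrier ?A" "?s2 \<in> carrier ?A"
    using n by (auto intro!: delta_kFB[OF d \<zeta>] FB_s_closed[OF d \<zeta>])
  have sx: "?s1 \<otimes>\<^bsub>?A\<^esub> z = lS d n 0 z" "?s2 \<otimes>\<^bsub>?A\<^esub> z = lS d n 1 z" if "z \<in> carrier ?A" for z
    using that n delta_mult[OF FB_s_closed[OF d \<zeta>], of 1 z] delta_mult[OF FB_s_closed[OF d \<zeta>], of 2 z]
    by (simp_all add: lS_def numeral_2_eq_2)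
  define S' where "S' = \<one>\<^bsub>?A\<^esub> \<ominus>\<^bsub>?A\<^esub> ?Q \<odot>\<^bsub>?A\<^esub> ?s1 \<ominus>\<^bsub>?A\<^esub> ?Q \<odot>\<^bsub>?A\<^esub> ?s2
    \<oplus>\<^bsub>?A\<^esub> ?Q ^ 2 \<odot>\<^bsub>?A\<^esub> (?s1 \<otimes>\<^bsub>?A\<^esub> ?s2) \<oplus>\<^bsub>?A\<^esub> ?Q ^ 2 \<odot>\<^bsub>?A\<^esub> (?s2 \<otimes>\<^bsub>?A\<^esub> ?s1)
    \<ominus>\<^bsub>?A\<^esub> ?Q ^ 3 \<odot>\<^bsub>?A\<^esub> (?s1 \<otimes>\<^bsub>?A\<^esub> ?s2 \<otimes>\<^bsub>?A\<^esub> ?s1)"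
  define S where "S = (\<one>\<^bsub>?Y\<^esub> \<ominus>\<^bsub>?Y\<^esub> ?Q \<odot>\<^bsub>?Y\<^esub> YH_s d n 1 \<ominus>\<^bsub>?Y\<^esub> ?Q \<odot>\<^bsub>?Y\<^esub> YH_s d n 2
    \<oplus>\<^bsub>?Y\<^esub> ?Q ^ 2 \<odot>\<^bsub>?Y\<^esub> (YH_s d n 1 \<otimes>\<^bsub>?Y\<^esub> YH_s d n 2) \<oplus>\<^bsub>?Y\<^esub> ?Q ^ 2 \<odot>\<^bsub>?Y\<^esub> (YH_s d n 2 \<otimes>\<^bsub>?Y\<^esub> YH_s d n 1)
    \<ominus>\<^bsub>?Y\<^esub> ?Q ^ 3 \<odot>\<^bsub>?Y\<^esub> (YH_s d n 1 \<otimes>\<^bsub>?Y\<^esub> YH_s d n 2 \<otimes>\<^bsub>?Y\<^esub> YH_s d n 1))"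
  define P where "P = (1 / of_nat d ^ 3) \<odot>\<^bsub>?Y\<^esub>
         (\<Oplus>\<^bsub>?Y\<^esub>a\<in>{1..d}. \<Oplus>\<^bsub>?Y\<^esub>b\<in>{1..d}. \<Oplus>\<^bsub>?Y\<^esub>c\<in>{1..d}.
            YH_t d n 1 [^]\<^bsub>?Y\<^esub> a \<otimes>\<^bsub>?Y\<^esub> YH_t d n 2 [^]\<^bsub>?Y\<^esub> b \<otimes>\<^bsub>?Y\<^esub> YH_t d n 3 [^]\<^bsub>?Y\<^esub> c)"
  have r: "CTL_relator d n = P \<otimes>\<^bsub>?Y\<^esub> S"
    unfolding CTL_relator_def Let_def P_def S_def ..
  have S'c: "S' \<in> carrier ?A"
    unfolding S'_def by (intro A.m_closed A.smult_closed A.minus_closed A.add.m_closed A.one_closed s)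
  have YS: "?h S' = S"
    unfolding S'_def S_def YH_s_def
    by (simp only: alg_hom_minus[OF A.kalg_axioms Y.kalg_axioms h] alg_homD[OF h] s
        A.m_closed A.smult_closed A.minus_closed A.add.m_closed A.one_closed)
  have t: "YH_t d n 1 \<in> carrier ?Y" "YH_t d n 2 \<in> carrier ?Y" "YH_t d n 3 \<in> carrier ?Y"
    using n by (auto intro!: YH_t_closed[OF d \<zeta>])
  note pc = CTL_projector_closed[OF d \<zeta> n]
  have Pc: "P \<in> carrier ?Y"
    unfolding P_def by (intro Y.smult_closed Y.finsum_closed pc)
  have Sx: "S' \<otimes>\<^bsub>?A\<^esub> x = tl_relator 0 x"
  proof -
    have cl: "lS d n 0 x \<in> carrier ?A" "lS d n 1 x \<in> carrier ?A" "lS d n 0 (lS d n 1 x) \<in> carrier ?A"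
      "lS d n 1 (lS d n 0 x) \<in> carrier ?A" "lS d n 0 (lS d n 1 (lS d n 0 x)) \<in> carrier ?A"
      using n x by (auto intro!: lS_closed)
    have lm: "(a \<ominus>\<^bsub>?A\<^esub> b) \<otimes>\<^bsub>?A\<^esub> c = a \<otimes>\<^bsub>?A\<^esub> c \<ominus>\<^bsub>?A\<^esub> b \<otimes>\<^bsub>?A\<^esub> c"
      if "a \<in> carrier ?A" "b \<in> carrier ?A" "c \<in> carrier ?A" for a b c
      using that by (simp add: A.minus_eq A.l_distr A.l_minus)
    have "S' \<otimes>\<^bsub>?A\<^esub> x = x \<ominus>\<^bsub>?A\<^esub> ?Q \<odot>\<^bsub>?A\<^esub> lS d n 0 x \<ominus>\<^bsub>?A\<^esub> ?Q \<odot>\<^bsub>?A\<^esub> lS d n 1 x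
      \<oplus>\<^bsub>?A\<^esub> ?Q ^ 2 \<odot>\<^bsub>?A\<^esub> lS d n 0 (lS d n 1 x) \<oplus>\<^bsub>?A\<^esub> ?Q ^ 2 \<odot>\<^bsub>?A\<^esub> lS d n 1 (lS d n 0 x)
      \<ominus>\<^bsub>?A\<^esub> ?Q ^ 3 \<odot>\<^bsub>?A\<^esub> lS d n 0 (lS d n 1 (lS d n 0 x))"
      unfolding S'_def
      by (simp only: lm A.l_distr A.smult_mult_left A.m_assoc A.l_one s x
          A.m_closed A.smult_closed A.minus_closed A.add.m_closed A.one_closed, simp only: sx x cl)
    also have "\<dots> = tl_relator 0 x"
      unfolding tl_relator_def One_nat_def[symmetric]
      by (simp only: kFB_minus[symmetric] kFB_add[where d = d and n = n, symmetric]
          kFB_smult[where d = d and n = n, symmetric] x cl A.smult_closed A.minus_closed A.add.m_closed)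
    finally show ?thesis .
  qed
  let ?y = "tl_relator 0 x"
  have y: "?y \<in> carrier ?A" unfolding Sx[symmetric] by (rule A.m_closed[OF S'c x])
  have T1: "\<forall>j<3. lT d n j (lS d n 0 x) = lS d n 0 x" "\<forall>j<3. lT d n j (lS d n (Suc 0) x) = lS d n (Suc 0) x"
    using n T lT_lS_fixed[of 0 x] lT_lS_fixed[of "Suc 0" x] by auto
  have T2: "\<forall>j<3. lT d n j (lS d n 0 (lS d n (Suc 0) x)) = lS d n 0 (lS d n (Suc 0) x)"
    "\<forall>j<3. lT d n j (lS d n (Suc 0) (lS d n 0 x)) = lS d n (Suc 0) (lS d n 0 x)"
    using n T1 lT_lS_fixed[of 0 "lS d n (Suc 0) x"] lT_lS_fixed[of "Suc 0" "lS d n 0 x"] by auto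
  have T3: "\<forall>j<3. lT d n j (lS d n 0 (lS d n (Suc 0) (lS d n 0 x))) = lS d n 0 (lS d n (Suc 0) (lS d n 0 x))"
    using n T2 lT_lS_fixed[of 0 "lS d n (Suc 0) (lS d n 0 x)"] by auto
  have Ty: "lT d n j ?y = ?y" if "j < 3" for j
  proof -
    have lT_lin: "lT d n j (u + v) = lT d n j u + lT d n j v" "lT d n j (u - v) = lT d n j u - lT d n j v"
      "lT d n j (fscale c u) = fscale c (lT d n j u)" for u v c
      by (simp_all only: lT_def lt_add lt_diff lt_fscale)
    have "lT d n j x = x" "lT d n j (lS d n 0 x) = lS d n 0 x" "lT d n j (lS d n (Suc 0) x) = lS d n (Suc 0) x"
      "lT d n j (lS d n 0 (lS d n (Suc 0) x)) = lS d n 0 (lS d n (Suc 0) x)"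
      "lT d n j (lS d n (Suc 0) (lS d n 0 x)) = lS d n (Suc 0) (lS d n 0 x)"
      "lT d n j (lS d n 0 (lS d n (Suc 0) (lS d n 0 x))) = lS d n 0 (lS d n (Suc 0) (lS d n 0 x))"
      using that T T1 T2 T3 by blast+
    then show ?thesis unfolding tl_relator_def by (simp only: lT_lin)
  qed
  have hy: "?h ?y \<in> carrier ?Y" by (rule alg_homD(3)[OF h y])
  have ty: "YH_t d n i \<otimes>\<^bsub>?Y\<^esub> ?h ?y = ?h ?y" if i3: "i \<in> {1..3}" for i
  proof -
    have g: "FB_t d n i \<in> carrier (FB d n)" using i3 n by (intro FB_t_closed[OF d \<zeta>]) auto
    obtain j where j: "i = Suc j" "j < 3" using i3 by (cases i) auto
    have "delta (FB_t d n i) \<otimes>\<^bsub>?A\<^esub> ?y = ?y"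
      unfolding delta_mult[OF g y] using Ty[OF j(2)] by (simp only: lT_def j)
    then show ?thesis
      unfolding YH_t_def by (simp only: alg_homD(4)[OF h delta_kFB[OF d \<zeta> g] y, symmetric])
  qed
  have ty_pow: "YH_t d n i [^]\<^bsub>?Y\<^esub> (a::nat) \<otimes>\<^bsub>?Y\<^esub> ?h ?y = ?h ?y" if "i \<in> {1..3}" for i a
  proof (induction a)
    case (Suc a)
    have "YH_t d n i \<in> carrier ?Y" using that n by (intro YH_t_closed[OF d \<zeta>]) auto
    then show ?case using hy by (simp only: Y.nat_pow_Suc Y.m_assoc Y.nat_pow_closed ty[OF that] Suc)
  qed (use hy in \<open>simp only: Y.nat_pow_0 Y.l_one\<close>)
  have one: "?h ?y = 1 \<odot>\<^bsub>?Y\<^esub> ?h ?y" by (rule Y.smult_one[OF hy, symmetric])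
  have e1: "(YH_t d n 1 [^]\<^bsub>?Y\<^esub> a \<otimes>\<^bsub>?Y\<^esub> YH_t d n 2 [^]\<^bsub>?Y\<^esub> b \<otimes>\<^bsub>?Y\<^esub> YH_t d n 3 [^]\<^bsub>?Y\<^esub> c) \<otimes>\<^bsub>?Y\<^esub> ?h ?y
      = 1 \<odot>\<^bsub>?Y\<^esub> ?h ?y" for a b c :: nat
  proof -
    have i: "1 \<in> {1..3::nat}" "2 \<in> {1..3::nat}" "3 \<in> {1..3::nat}" by auto
    show ?thesis using t hy unfolding one[symmetric]
      by (simp only: Y.m_assoc Y.nat_pow_closed Y.m_closed ty_pow[OF i(1)] ty_pow[OF i(2)] ty_pow[OF i(3)])
  qed
  have fd: "finite {1..d}" by simp
  note e2 = Y.finsum_eigen[OF fd pc(1) hy e1]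
  note e3 = Y.finsum_eigen[OF fd pc(2) hy e2]
  note e4 = Y.finsum_eigen[OF fd pc(3) hy e3]
  have Py: "P \<otimes>\<^bsub>?Y\<^esub> ?h ?y = ?h ?y"
  proof -
    have "P \<otimes>\<^bsub>?Y\<^esub> ?h ?y = (1 / of_nat d ^ 3) \<odot>\<^bsub>?Y\<^esub> ((\<Sum>a\<in>{1..d}. \<Sum>a\<in>{1..d}. \<Sum>a\<in>{1..d}. 1) \<odot>\<^bsub>?Y\<^esub> ?h ?y)"
      unfolding P_def e4[symmetric] by (intro Y.smult_mult_left Y.finsum_closed pc hy)
    also have "\<dots> = (1 / of_nat d ^ 3 * (\<Sum>a\<in>{1..d}. \<Sum>a\<in>{1..d}. \<Sum>a\<in>{1..d}. 1)) \<odot>\<^bsub>?Y\<^esub> ?h ?y"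
      by (rule Y.smult_smult[OF hy])
    also have "1 / of_nat d ^ 3 * (\<Sum>a\<in>{1..d}. \<Sum>a\<in>{1..d}. \<Sum>a\<in>{1..d}. 1) = (1 :: kq)"
      using of_nat_kq_neq_0[of d] d by (simp add: power3_eq_cube)
    finally show ?thesis unfolding one[symmetric] .
  qed
  have Rc: "CTL_relator d n \<in> carrier ?Y"
    unfolding r YS[symmetric] by (intro Y.m_closed Pc alg_homD(3)[OF h] S'c)
  then obtain u where u: "u \<in> carrier ?A" "CTL_relator d n = ?h u"
    unfolding YH_carrier[OF d \<zeta>] by blast
  have "quot_map ?Y (CTL_rels d n) (CTL_relator d n) = \<zero>\<^bsub>CTL d n\<^esub>"
    unfolding CTL_def by (rule Y.quot_map_rel[OF CTL_rels_carrier[OF d \<zeta>]]) (use n in \<open>simp add: CTL_rels_def\<close>)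
  then have uk: "u \<in> ctl_kernel d n"
    using u by (simp only: ctl_kernel_def CTL_map_def[OF d \<zeta>] mem_Collect_eq simp_thms)
  have "?h (u \<otimes>\<^bsub>?A\<^esub> x) = P \<otimes>\<^bsub>?Y\<^esub> S \<otimes>\<^bsub>?Y\<^esub> ?h x"
    by (simp only: alg_homD(4)[OF h u(1) x] u(2)[symmetric] r)
  also have "\<dots> = P \<otimes>\<^bsub>?Y\<^esub> ?h ?y"
    unfolding YS[symmetric] Sx[symmetric] alg_homD(4)[OF h S'c x]
    by (intro Y.m_assoc Pc alg_homD(3)[OF h] S'c x)
  finally have "?h (u \<otimes>\<^bsub>?A\<^esub> x) = ?h ?y" unfolding Py .
  then have "CTL_map d n ?y = CTL_map d n (u \<otimes>\<^bsub>?A\<^esub> x)" by (simp only: CTL_map_def[OF d \<zeta>])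
  then show ?thesis using kernel_right[OF x uk] y by (simp only: ctl_kernel_def mem_Collect_eq simp_thms)
qed

text \<open>The relator at the strands \<open>k, k + 1, k + 2\<close> is conjugate to the one at the first three strands.\<close>

lemma tl_relator_kernel:
  "\<lbrakk>Suc (Suc k) < n; x \<in> carrier (kFB d n); lT d n k x = x; lT d n (Suc k) x = x; lT d n (Suc (Suc k)) x = x\<rbrakk>
    \<Longrightarrow> tl_relator k x \<in> ctl_kernel d n"
proof (induction k arbitrary: x)
  case 0
  then show ?case by (intro tl_relator_0_kernel) (auto simp: numeral_3_eq_3 less_Suc_eq)
next
  case (Suc k)
  \<comment> \<open>The braid that takes one strand across three others. Passing it turns the
    generators \<open>k\<close> and \<open>k + 1\<close> into \<open>k + 1\<close> and
    \<open>k + 2\<close>, and shifts the three framings in the same way.\<close>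
  let ?c = "\<lambda>z. lS d n k (lS d n (Suc k) (lS d n (Suc (Suc k)) z))"
  let ?SI = "\<lambda>i. lt d n (inv\<^bsub>FB d n\<^esub> (FB_s d n (Suc i)))"
  define y where "y = ?SI (Suc (Suc k)) (?SI (Suc k) (?SI k x))"
  have g: "FB_s d n (Suc i) \<in> carrier (FB d n)" if "Suc i < n" for i
    using that by (intro FB_s_closed[OF d \<zeta>]) auto
  have k: "Suc k < n" "Suc (Suc k) < n" "Suc (Suc (Suc k)) < n" using Suc.prems(1) by auto
  have inv: "lS d n i (?SI i z) = z" "?SI i (lS d n i z) = z" if "Suc i < n" for i z
    unfolding lS_def by (rule lt_inv[OF g[OF that]])+
  have cy: "?c y = x" unfolding y_def by (simp only: inv k)
  have cinj: "u = v" if "?c u = ?c v" for u v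
    using that inv(2)[OF k(1)] inv(2)[OF k(2)] inv(2)[OF k(3)] by metis
  have yc: "y \<in> carrier (kFB d n)"
    unfolding y_def using Suc.prems(2) k g by (intro lt_closed G.inv_closed) auto
  have cT: "?c (lT d n j z) = lT d n (Suc j) (?c z)" if "j \<in> {k, Suc k, Suc (Suc k)}" for j z
    using that k by (auto simp: lS_lT transpose_def)
  have "lT d n j y = y" if "j \<in> {k, Suc k, Suc (Suc k)}" for j
    by (rule cinj) (use cT[OF that, of y] cy Suc.prems(3-5) that in auto)
  then have rel: "tl_relator k y \<in> ctl_kernel d n" using yc k by (intro Suc.IH) auto
  have c1: "?c (lS d n k z) = lS d n (Suc k) (?c z)" for z
    using k lS_far[of k "Suc (Suc k)" z] lS_braid[of k "lS d n (Suc (Suc k)) z"] by simp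
  have c2: "?c (lS d n (Suc k) z) = lS d n (Suc (Suc k)) (?c z)" for z
    using k lS_braid[of "Suc k" z] lS_far[of k "Suc (Suc k)" "lS d n (Suc k) (lS d n (Suc (Suc k)) z)"] by simp
  have lin: "lS d n i (u + v) = lS d n i u + lS d n i v" "lS d n i (u - v) = lS d n i u - lS d n i v"
    "lS d n i (fscale r u) = fscale r (lS d n i u)" for i u v r
    by (simp_all only: lS_def lt_add lt_diff lt_fscale)
  have "?c (tl_relator k y) = tl_relator (Suc k) x"
    unfolding tl_relator_def by (simp only: lin c1 c2 cy)
  moreover have "?c (tl_relator k y) \<in> ctl_kernel d n"
    unfolding lS_def by (intro lt_kernel g k rel)
  ultimately show ?case by simp
qed

theorem ctl_module_kFB:
  "ctl_module fscale n (lS d n) (lT d n) (carrier (kFB d n)) (ctl_kernel d n) d \<zeta>"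
proof unfold_locales
  show "lS d n i x \<in> carrier (kFB d n)" if "Suc i < n" "x \<in> carrier (kFB d n)" for i x
    using that by (rule lS_closed)
  show "lT d n i x \<in> carrier (kFB d n)" if "i < n" "x \<in> carrier (kFB d n)" for i x
    using that by (rule lT_closed)
  show "lS d n i (x + y) = lS d n i x + lS d n i y" "lS d n i (fscale r x) = fscale r (lS d n i x)" for i x y r
    by (simp_all only: lS_def lt_add lt_fscale)
  show "lS d n i x \<in> ctl_kernel d n" if "Suc i < n" "x \<in> ctl_kernel d n" for i x
    unfolding lS_def using that by (intro lt_kernel FB_s_closed[OF d \<zeta>]) auto
  show "lS d n i (lS d n j x) = lS d n j (lS d n i x)" if "Suc i < j" "Suc j < n" for i j x
    using that by (rule lS_far)
  show "lS d n i (lS d n (Suc i) (lS d n i x)) = lS d n (Suc i) (lS d n i (lS d n (Suc i) x))" if "Suc (Suc i) < n" for i x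
    using that by (rule lS_braid)
  show "lS d n i (lT d n j x) = lT d n (transpose i (Suc i) j) (lS d n i x)" if "Suc i < n" "j < n" for i j x
    using that by (rule lS_lT)
qed (fact kernel_subspace quadratic_kernel tl_relator_kernel[unfolded tl_relator_def])+

end

subsection \<open>Colour projectors\<close>

lemma sum_shift: "(\<Sum>a\<in>{1..d}. g (Suc a)) + g 1 = (\<Sum>a\<in>{1..d::nat}. g a) + (g (Suc d) :: 'a::comm_monoid_add)"
proof (induction d)
  case (Suc d)
  have "(\<Sum>a\<in>{1..Suc d}. g (Suc a)) + g 1 = g (Suc (Suc d)) + ((\<Sum>a\<in>{1..d}. g (Suc a)) + g 1)"
    by (simp add: ac_simps)
  then show ?case unfolding Suc.IH by (simp add: ac_simps)
qed simp

lemma sum_shift_periodic: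
  "g (Suc d) = g 1 \<Longrightarrow> (\<Sum>a\<in>{1..d}. g (Suc a)) = (\<Sum>a\<in>{1..d::nat}. g a :: 'a::cancel_comm_monoid_add)"
  using sum_shift[of g d] by simp

text \<open>The value \<open>1\<close> beyond \<open>n\<close> makes a colouring determined by its colour pattern.\<close>

definition colourings :: "nat \<Rightarrow> nat \<Rightarrow> (nat \<Rightarrow> nat) set" where
  "colourings d n = {\<chi>. \<forall>p. (p \<in> {..<n} \<longrightarrow> \<chi> p \<in> {1..d}) \<and> (p \<notin> {..<n} \<longrightarrow> \<chi> p = 1)}"

lemma finite_colourings: "finite (colourings d n)"
  unfolding colourings_def by (rule finite_set_of_finite_funs) simp_all

text \<open>The discrete Fourier projector onto the eigenvectors of the framing at place
  \<open>j\<close> with eigenvalue \<open>\<zeta> ^ (c - 1)\<close>.\<close>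

definition cproj :: "nat \<Rightarrow> nat \<Rightarrow> kq \<Rightarrow> nat \<Rightarrow> nat \<Rightarrow> (fb_elt \<Rightarrow> kq) \<Rightarrow> fb_elt \<Rightarrow> kq" where
  "cproj d n \<zeta> j c x = fscale (1 / of_nat d)
     (\<Sum>a\<in>{1..d}. fscale (inverse (\<zeta> ^ (c - 1)) ^ a) ((lT d n j ^^ a) x))"

text \<open>The idempotent of a colouring, as the image of the unit under the projectors of the
  first \<open>j\<close> strands. Adding one strand at a time allows the unit to be decomposed by
  induction.\<close>

primrec cidem :: "nat \<Rightarrow> nat \<Rightarrow> kq \<Rightarrow> (nat \<Rightarrow> nat) \<Rightarrow> nat \<Rightarrow> fb_elt \<Rightarrow> kq" where
  "cidem d n \<zeta> \<chi> 0 = delta \<one>\<^bsub>FB d n\<^esub>"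
| "cidem d n \<zeta> \<chi> (Suc j) = cproj d n \<zeta> j (\<chi> j) (cidem d n \<zeta> \<chi> j)"

lemma lT_linear: "module_hom fscale fscale (lT d n j)"
  by (intro module_hom.intro fs.module_axioms module_hom_axioms.intro) (simp_all only: lT_def lt_add lt_fscale)

lemma lt_linear: "module_hom fscale fscale (lt d n g)"
  by (intro module_hom.intro fs.module_axioms module_hom_axioms.intro) (simp_all only: lt_add lt_fscale)

lemma cidem_cong: "(\<And>i. i < j \<Longrightarrow> \<chi> i = \<chi>' i) \<Longrightarrow> cidem d n \<zeta> \<chi> j = cidem d n \<zeta> \<chi>' j"
  by (induction j) simp_all

context
  fixes d n :: nat and \<zeta> :: kq
  assumes d: "d \<ge> 1" and \<zeta>: "primitive_root_of_unity d \<zeta>"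
begin

interpretation G: group "FB d n" by (rule group_FB[OF d \<zeta>])
interpretation A: kalg "kFB d n" by (rule kalg_kFB[OF d \<zeta>])
interpretation Q: kalg "CTL d n" by (rule kalg_CTL[OF d \<zeta>])
interpretation M: ctl_module fscale n "lS d n" "lT d n" "carrier (kFB d n)" "ctl_kernel d n" d \<zeta>
  by (rule ctl_module_kFB[OF d \<zeta>])

lemma funpow_closed: "j < n \<Longrightarrow> x \<in> carrier (kFB d n) \<Longrightarrow> (lT d n j ^^ a) x \<in> carrier (kFB d n)"
  by (induction a) (simp_all add: lT_closed[OF d \<zeta>])

lemma cproj_closed: "j < n \<Longrightarrow> x \<in> carrier (kFB d n) \<Longrightarrow> cproj d n \<zeta> j c x \<in> carrier (kFB d n)"
  unfolding cproj_def
  by (intro fs.subspace_scale fs.subspace_sum carrier_subspace[OF d \<zeta>] funpow_closed)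

lemma zeta_pow_d: "inverse (\<zeta> ^ i) ^ d = 1"
proof -
  have "\<zeta> ^ d = 1" using \<zeta> by (simp add: primitive_root_of_unity_def)
  then show ?thesis by (metis inverse_1 mult.commute power_inverse power_mult power_one)
qed

lemma lT_cproj_same:
  assumes j: "j < n" shows "lT d n j (cproj d n \<zeta> j c x) = fscale (\<zeta> ^ (c - 1)) (cproj d n \<zeta> j c x)"
proof -
  let ?b = "inverse (\<zeta> ^ (c - 1))"
  let ?g = "\<lambda>a. fscale (?b ^ a) ((lT d n j ^^ a) x)"
  have z: "\<zeta> ^ (c - 1) * ?b = 1" using zeta_neq_0[OF d \<zeta>] by simp
  have gd: "?g (Suc d) = ?g 1"
    using lT_funpow_d[OF d \<zeta> j] zeta_pow_d by simp
  have s: "(\<Sum>a\<in>{1..d}. ?g (Suc a)) = (\<Sum>a\<in>{1..d}. ?g a)"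
    by (rule sum_shift_periodic[of ?g d, OF gd])
  have "lT d n j (\<Sum>a\<in>{1..d}. ?g a) = (\<Sum>a\<in>{1..d}. fscale (?b ^ a) ((lT d n j ^^ Suc a) x))"
    unfolding module_hom.sum[OF lT_linear] module_hom.scale[OF lT_linear] by simp
  also have "\<dots> = (\<Sum>a\<in>{1..d}. fscale (\<zeta> ^ (c - 1)) (?g (Suc a)))"
  proof (intro sum.cong refl)
    fix a
    have "\<zeta> ^ (c - 1) * ?b ^ Suc a = ?b ^ a" by (simp only: power_Suc mult.assoc[symmetric] z mult_1_left)
    then show "fscale (?b ^ a) ((lT d n j ^^ Suc a) x) = fscale (\<zeta> ^ (c - 1)) (?g (Suc a))"
      by (simp only: fs.scale_scale)
  qed
  also have "\<dots> = fscale (\<zeta> ^ (c - 1)) (\<Sum>a\<in>{1..d}. ?g a)"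
    by (simp only: fs.scale_sum_right[symmetric] s)
  finally show ?thesis
    unfolding cproj_def module_hom.scale[OF lT_linear] by (simp only: fs.scale_left_commute)
qed

lemma lT_cproj_other:
  assumes "i < n" "j < n" "lT d n i x = fscale \<alpha> x"
  shows "lT d n i (cproj d n \<zeta> j c x) = fscale \<alpha> (cproj d n \<zeta> j c x)"
proof -
  have "lT d n i ((lT d n j ^^ a) x) = fscale \<alpha> ((lT d n j ^^ a) x)" for a
    by (induction a) (simp_all add: assms lT_lT[OF d \<zeta>, of i n j] module_hom.scale[OF lT_linear])
  then show ?thesis
    unfolding cproj_def module_hom.sum[OF lT_linear] module_hom.scale[OF lT_linear]
    by (simp only: fs.scale_sum_right fs.scale_left_commute)
qed

text \<open>Dual orthogonality: summing over the colours leaves only the exponent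
  \<open>a = d\<close>, for which the framing power is the identity. As exponents run from
  \<open>1\<close>, the trivial power sits at \<open>d\<close> and not at \<open>0\<close>.\<close>

lemma sum_cproj:
  assumes j: "j < n" shows "(\<Sum>c\<in>{1..d}. cproj d n \<zeta> j c x) = x"
proof -
  have coef: "(\<Sum>c\<in>{1..d}. inverse (\<zeta> ^ (c - 1)) ^ a) = (if a = d then of_nat d else 0)" if a: "a \<in> {1..d}" for a
  proof -
    let ?u = "inverse \<zeta> ^ a"
    have p: "inverse (\<zeta> ^ i) ^ a = ?u ^ i" for i by (simp add: power_inverse mult.commute flip: power_mult)
    have u0: "?u \<noteq> 0" using zeta_neq_0[OF d \<zeta>] by simp
    have "?u * (\<Sum>c\<in>{1..d}. ?u ^ (c - 1)) = (\<Sum>c\<in>{1..d}. ?u ^ c)"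
      unfolding sum_distrib_left by (intro sum.cong refl) (auto simp flip: power_Suc)
    moreover have "(\<Sum>c\<in>{1..d}. ?u ^ c) = 0" if "a \<noteq> d"
    proof (rule sum_root_of_unity_powers)
      show "?u ^ d = 1" using zeta_pow_d[of a] by (simp add: power_inverse)
      show "?u \<noteq> 1"
      proof
        assume "?u = 1"
        then have "\<zeta> ^ a = 1" by (simp add: power_inverse)
        then show False using \<zeta> a that by (auto simp: primitive_root_of_unity_def)
      qed
    qed
    moreover have "?u = 1" if "a = d" using zeta_pow_d[of 1] that by simp
    ultimately show ?thesis unfolding p using u0 by auto
  qed
  have "(\<Sum>c\<in>{1..d}. cproj d n \<zeta> j c x)
      = fscale (1 / of_nat d) (\<Sum>a\<in>{1..d}. \<Sum>c\<in>{1..d}. fscale (inverse (\<zeta> ^ (c - 1)) ^ a) ((lT d n j ^^ a) x))"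
    unfolding cproj_def fs.scale_sum_right[symmetric] by (subst sum.swap) (rule refl)
  also have "(\<Sum>a\<in>{1..d}. \<Sum>c\<in>{1..d}. fscale (inverse (\<zeta> ^ (c - 1)) ^ a) ((lT d n j ^^ a) x))
      = (\<Sum>a\<in>{1..d}. fscale (if a = d then of_nat d else 0) ((lT d n j ^^ a) x))"
    by (intro sum.cong refl) (simp only: fs.scale_sum_left[symmetric] coef)
  also have "\<dots> = (\<Sum>a\<in>{1..d}. if a = d then fscale (of_nat d) ((lT d n j ^^ a) x) else 0)"
    by (intro sum.cong refl) (simp only: if_distrib[of "\<lambda>c. fscale c _"] fs.scale_zero_left)
  also have "\<dots> = fscale (of_nat d) x"
    using d lT_funpow_d[OF d \<zeta> j, of x] by (subst sum.delta) auto
  also have "fscale (1 / of_nat d) \<dots> = x"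
    using of_nat_kq_neq_0[of d] d by (simp only: fs.scale_scale) simp
  finally show ?thesis .
qed

lemma cidem_closed: "j \<le> n \<Longrightarrow> cidem d n \<zeta> \<chi> j \<in> carrier (kFB d n)"
proof (induction j)
  case 0
  show ?case by (simp add: delta_kFB[OF d \<zeta>])
next
  case (Suc j)
  then show ?case using cproj_closed[of j] by simp
qed

lemma lT_cidem:
  "i < j \<Longrightarrow> j \<le> n \<Longrightarrow> lT d n i (cidem d n \<zeta> \<chi> j) = fscale (\<zeta> ^ (\<chi> i - 1)) (cidem d n \<zeta> \<chi> j)"
proof (induction j)
  case (Suc j)
  then show ?case using lT_cproj_same[of j] lT_cproj_other[of i j] by (cases "i = j") simp_all
qed simp

text \<open>\<open>sum_cproj\<close> splits each idempotent of \<open>j\<close> strands according to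
  the colour of the next one; changing a colouring at place \<open>j\<close> does not affect what
  has been projected before.\<close>

lemma one_span_cidem: "j \<le> n \<Longrightarrow> delta \<one>\<^bsub>FB d n\<^esub> \<in> fs.span ((\<lambda>\<chi>. cidem d n \<zeta> \<chi> j) ` colourings d n)"
proof (induction j)
  case 0
  have "(\<lambda>_. 1) \<in> colourings d n" using d by (simp add: colourings_def)
  then show ?case by (intro fs.span_base image_eqI[of _ _ "\<lambda>_. 1"]) simp_all
next
  case (Suc j)
  let ?X = "(\<lambda>\<chi>. cidem d n \<zeta> \<chi> (Suc j)) ` colourings d n"
  have "(\<lambda>\<chi>. cidem d n \<zeta> \<chi> j) ` colourings d n \<subseteq> fs.span ?X"
  proof (rule image_subsetI)
    fix \<chi> assume \<chi>: "\<chi> \<in> colourings d n"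
    have "cidem d n \<zeta> \<chi> j = (\<Sum>c\<in>{1..d}. cproj d n \<zeta> j c (cidem d n \<zeta> \<chi> j))"
      using Suc.prems by (intro sum_cproj[symmetric]) simp
    also have "\<dots> \<in> fs.span ?X"
    proof (rule fs.span_sum)
      fix c assume "c \<in> {1..d}"
      then have "\<chi>(j := c) \<in> colourings d n" using \<chi> Suc.prems by (auto simp: colourings_def)
      moreover have "cproj d n \<zeta> j c (cidem d n \<zeta> \<chi> j) = cidem d n \<zeta> (\<chi>(j := c)) (Suc j)"
        using cidem_cong[of j \<chi> "\<chi>(j := c)"] by simp
      ultimately show "cproj d n \<zeta> j c (cidem d n \<zeta> \<chi> j) \<in> fs.span ?X" by (intro fs.span_base) blast
    qed
    finally show "cidem d n \<zeta> \<chi> j \<in> fs.span ?X" .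
  qed
  then have "fs.span ((\<lambda>\<chi>. cidem d n \<zeta> \<chi> j) ` colourings d n) \<subseteq> fs.span ?X"
    by (rule fs.span_minimal[OF _ fs.subspace_span])
  then show ?case using Suc by auto
qed

subsection \<open>A spanning set\<close>

definition cbase :: "(nat \<Rightarrow> nat) \<Rightarrow> nat list \<Rightarrow> fb_elt \<Rightarrow> kq" where
  "cbase \<chi> m = tw (lS d n) 0 m (cidem d n \<zeta> \<chi> n)"

lemma cbase_Y:
  assumes "\<chi> \<in> colourings d n" shows "M.Y (cidem d n \<zeta> \<chi> n) m = cbase \<chi> m"
  unfolding cbase_def using assms
  by (intro M.Y_def[where \<chi> = \<chi>] cidem_closed lT_cidem) (auto simp: colourings_def)

context
  fixes \<chi> assumes \<chi>: "\<chi> \<in> colourings d n"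
begin

lemma cidem_eigen: "cidem d n \<zeta> \<chi> n \<in> carrier (kFB d n)"
  "\<And>j. j < n \<Longrightarrow> lT d n j (cidem d n \<zeta> \<chi> n) = fscale (\<zeta> ^ (\<chi> j - 1)) (cidem d n \<zeta> \<chi> n)"
  "\<And>j. j < n \<Longrightarrow> \<chi> j \<in> {1..d}"
  using \<chi> by (auto simp: colourings_def cidem_closed lT_cidem)

lemma cbase_closed: "m \<in> perms n \<Longrightarrow> cbase \<chi> m \<in> carrier (kFB d n)"
  using M.Y_closed[OF cidem_eigen] by (simp only: cbase_Y[OF \<chi>])

lemma lT_cbase: "m \<in> perms n \<Longrightarrow> j < n \<Longrightarrow> lT d n j (cbase \<chi> m) = fscale (\<zeta> ^ (\<chi> (m ! j) - 1)) (cbase \<chi> m)"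
  using M.T_Y[OF cidem_eigen] by (simp only: cbase_Y[OF \<chi>])

lemma lS_cbase:
  "Suc i < n \<Longrightarrow> m \<in> perms n \<Longrightarrow> lS d n i (cbase \<chi> m) \<in> fs.span (ctl_kernel d n \<union> cbase \<chi> ` perms n)"
  using M.S_Y_span[OF cidem_eigen] by (simp only: cbase_Y[OF \<chi>] cong: image_cong)

lemma cbase_reduce:
  "m \<in> perms n \<Longrightarrow> cbase \<chi> m \<in> fs.span (ctl_kernel d n \<union> cbase \<chi> ` {m \<in> perms n. \<not> has_triple \<chi> m})"
  using M.Y_reduce[OF cidem_eigen] by (simp only: cbase_Y[OF \<chi>] cong: image_cong)

end

definition span_gens :: "(fb_elt \<Rightarrow> kq) set" where
  "span_gens = ctl_kernel d n \<union> (\<Union>\<chi>\<in>colourings d n. cbase \<chi> ` perms n)"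

lemma span_gens_cases:
  assumes "x \<in> span_gens"
  obtains "x \<in> ctl_kernel d n" | \<chi> m where "\<chi> \<in> colourings d n" "m \<in> perms n" "x = cbase \<chi> m"
  using assms unfolding span_gens_def by blast

lemma span_gens_mono: "\<chi> \<in> colourings d n \<Longrightarrow> fs.span (ctl_kernel d n \<union> cbase \<chi> ` perms n) \<subseteq> fs.span span_gens"
  by (intro fs.span_mono) (auto simp: span_gens_def)

lemma span_gens_lS:
  assumes i: "Suc i < n" and x: "x \<in> fs.span span_gens" shows "lS d n i x \<in> fs.span span_gens"
  using x
proof (rule M.span_S)
  fix x assume "x \<in> span_gens"
  then show "lS d n i x \<in> fs.span span_gens"
  proof (cases rule: span_gens_cases)
    case 1
    then show ?thesis using M.S_J[OF i] by (intro fs.span_base) (auto simp: span_gens_def)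
  next
    case (2 \<chi> m)
    then show ?thesis using lS_cbase[OF 2(1) i 2(2)] span_gens_mono[OF 2(1)] by blast
  qed
qed

lemma span_gens_lt:
  assumes "\<And>x. x \<in> span_gens \<Longrightarrow> lt d n g x \<in> fs.span span_gens" "x \<in> fs.span span_gens"
  shows "lt d n g x \<in> fs.span span_gens"
  using assms(2)
proof (induction rule: fs.span_induct_alt)
  case base
  show ?case unfolding module_hom.zero[OF lt_linear] by (rule fs.span_zero)
next
  case (step c x y)
  show ?case unfolding lt_add lt_fscale
    by (rule fs.span_add[OF fs.span_scale[OF assms(1)[OF step.hyps]] step.IH])
qed

lemma kernel_span_gens: "x \<in> ctl_kernel d n \<Longrightarrow> x \<in> fs.span span_gens"
  by (intro fs.span_base) (simp add: span_gens_def)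

lemma cbase_span_gens: "\<chi> \<in> colourings d n \<Longrightarrow> m \<in> perms n \<Longrightarrow> cbase \<chi> m \<in> fs.span span_gens"
  by (intro fs.span_base) (auto simp: span_gens_def)

lemma span_gens_lT:
  assumes j: "j < n" and x: "x \<in> fs.span span_gens"
  shows "lT d n j x \<in> fs.span span_gens" "lt d n (inv\<^bsub>FB d n\<^esub> (FB_t d n (Suc j))) x \<in> fs.span span_gens"
proof -
  have g: "FB_t d n (Suc j) \<in> carrier (FB d n)" using j by (intro FB_t_closed[OF d \<zeta>]) auto
  show "lT d n j x \<in> fs.span span_gens" unfolding lT_def using _ x
  proof (rule span_gens_lt)
    fix x assume "x \<in> span_gens"
    then show "lt d n (FB_t d n (Suc j)) x \<in> fs.span span_gens"
    proof (cases rule: span_gens_cases)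
      case 1
      then show ?thesis by (intro kernel_span_gens lt_kernel[OF d \<zeta>] g)
    next
      case (2 \<chi> m)
      show ?thesis using lT_cbase[OF 2(1,2) j] unfolding 2(3) lT_def
        by (simp only: fs.span_scale cbase_span_gens[OF 2(1,2)])
    qed
  qed
  show "lt d n (inv\<^bsub>FB d n\<^esub> (FB_t d n (Suc j))) x \<in> fs.span span_gens" using _ x
  proof (rule span_gens_lt)
    fix x assume "x \<in> span_gens"
    then show "lt d n (inv\<^bsub>FB d n\<^esub> (FB_t d n (Suc j))) x \<in> fs.span span_gens"
    proof (cases rule: span_gens_cases)
      case 1
      then show ?thesis by (intro kernel_span_gens lt_kernel[OF d \<zeta>] g G.inv_closed)
    next
      case (2 \<chi> m)
      have "lt d n (inv\<^bsub>FB d n\<^esub> (FB_t d n (Suc j))) x = fscale (inverse (\<zeta> ^ (\<chi> (m ! j) - 1))) x"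
        using lT_cbase[OF 2(1,2) j] zeta_neq_0[OF d \<zeta>] unfolding 2(3) lT_def
        by (intro lt_inv_eigen[OF d \<zeta>] g) auto
      then show ?thesis unfolding 2(3) by (simp only: fs.span_scale cbase_span_gens[OF 2(1,2)])
    qed
  qed
qed

text \<open>Modulo the kernel the quadratic relation expresses the inverse of a braid generator
  through the generator and the identity. It applies because each \<open>cbase\<close> is a joint
  eigenvector of the framings.\<close>

lemma span_gens_lS_inv:
  assumes i: "Suc i < n" and x: "x \<in> fs.span span_gens"
  shows "lt d n (inv\<^bsub>FB d n\<^esub> (FB_s d n (Suc i))) x \<in> fs.span span_gens"
  using _ x
proof (rule span_gens_lt)
  let ?I = "lt d n (inv\<^bsub>FB d n\<^esub> (FB_s d n (Suc i)))"
  have g: "FB_s d n (Suc i) \<in> carrier (FB d n)" using i by (intro FB_s_closed[OF d \<zeta>]) auto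
  fix x assume "x \<in> span_gens"
  then show "?I x \<in> fs.span span_gens"
  proof (cases rule: span_gens_cases)
    case 1
    then show ?thesis by (intro kernel_span_gens lt_kernel[OF d \<zeta>] g G.inv_closed)
  next
    case (2 \<chi> m)
    have "m ! i \<in> set m" "m ! Suc i \<in> set m" using perms_length[OF 2(2)] i by auto
    then have lt: "m ! i < n" "m ! Suc i < n" using 2(2) by (auto simp: perms_def)
    let ?c = "if \<chi> (m ! i) = \<chi> (m ! Suc i) then fscale (q - inverse q) (lS d n i x) else 0"
    have "lS d n i (lS d n i x) - (?c + x) \<in> ctl_kernel d n"
      unfolding 2(3) using i lT_cbase[OF 2(1,2)] cidem_eigen(3)[OF 2(1)] lt
      by (intro M.quad cbase_closed[OF 2(1,2)]) auto
    then have "?I (lS d n i (lS d n i x) - (?c + x)) \<in> ctl_kernel d n"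
      by (rule lt_kernel[OF d \<zeta> G.inv_closed[OF g]])
    moreover have "?I (lS d n i (lS d n i x) - (?c + x)) = lS d n i x - (?I ?c + ?I x)"
      unfolding lt_diff lt_add unfolding lS_def[of d n i] by (simp only: lt_inv[OF d \<zeta> g])
    ultimately have k: "lS d n i x - (?I ?c + ?I x) \<in> fs.span span_gens" by (simp only: kernel_span_gens)
    have Ix: "?I (lS d n i x) = x" unfolding lS_def by (rule lt_inv(2)[OF d \<zeta> g])
    have xs: "x \<in> fs.span span_gens" using 2 cbase_span_gens by simp
    have c: "?I ?c \<in> fs.span span_gens"
      using xs by (simp add: lt_fscale Ix fs.span_scale module_hom.zero[OF lt_linear] fs.span_zero)
    have "?I x = lS d n i x - ?I ?c - (lS d n i x - (?I ?c + ?I x))" by simp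
    also have "\<dots> \<in> fs.span span_gens" by (intro fs.span_diff span_gens_lS i xs c k)
    finally show ?thesis .
  qed
qed

text \<open>The unit is a combination of the colour idempotents, which are the \<open>cbase\<close>
  of the identity permutation, and every letter of a word, inverse letters included, preserves the
  span.\<close>

lemma delta_span_gens:
  "w \<in> lists (fb_gens n \<times> UNIV) \<Longrightarrow> delta (FB_word d n w) \<in> fs.span span_gens"
proof (induction w)
  case Nil
  have "FB_word d n [] = \<one>\<^bsub>FB d n\<^esub>" by (simp add: FB_def presented_group_def)
  moreover have "(\<lambda>\<chi>. cidem d n \<zeta> \<chi> n) ` colourings d n \<subseteq> span_gens"
  proof (rule image_subsetI)
    fix \<chi> assume "\<chi> \<in> colourings d n"
    moreover have "cidem d n \<zeta> \<chi> n = cbase \<chi> [0..<n]" by (simp add: cbase_def tw_sorted)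
    moreover have "[0..<n] \<in> perms n" by (simp add: perms_def)
    ultimately show "cidem d n \<zeta> \<chi> n \<in> span_gens" by (auto simp: span_gens_def)
  qed
  ultimately show ?case using subsetD[OF fs.span_mono one_span_cidem[OF order.refl]] by (simp only:)
next
  case (Cons l w)
  then have w: "w \<in> lists (fb_gens n \<times> UNIV)" "[l] \<in> lists (fb_gens n \<times> UNIV)" by auto
  have IH: "delta (FB_word d n w) \<in> fs.span span_gens" using Cons w by simp
  have "delta (FB_word d n (l # w)) = lt d n (FB_word d n [l]) (delta (FB_word d n w))"
    using w by (simp add: lt_delta[OF d \<zeta>] FB_word_closed[OF d \<zeta>])
      (simp add: FB_def presented_group_mult[OF fb_rels_lists])
  also have "\<dots> \<in> fs.span span_gens"
  proof -
    obtain x e where l: "l = (x, e)" by (cases l)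
    have x: "x \<in> fb_gens n" using w l by auto
    have c: "FB_word d n [(x, True)] \<in> carrier (FB d n)" "FB_word d n [(x, False)] \<in> carrier (FB d n)"
      using x by (auto intro!: FB_word_closed[OF d \<zeta>])
    have "FB_word d n [(x, False)] \<otimes>\<^bsub>FB d n\<^esub> FB_word d n [(x, True)] = FB_word d n ([(x, False)] @ [(x, True)])"
      unfolding FB_def using x by (intro presented_group_mult[OF fb_rels_lists]) auto
    also have "\<dots> = FB_word d n []"
      using pres_cong.cancel[OF x, of "fb_rels d n" False] by (intro pres_class_eqI[OF fb_rels_lists]) simp
    also have "\<dots> = \<one>\<^bsub>FB d n\<^esub>" by (simp add: FB_def presented_group_def)
    finally have inv: "inv\<^bsub>FB d n\<^esub> FB_word d n [(x, True)] = FB_word d n [(x, False)]"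
      using c by (intro G.inv_equality)
    from x consider i where "x = GenS (Suc i)" "Suc i < n" | j where "x = GenT (Suc j)" "j < n"
    proof -
      assume S: "\<And>i. x = GenS (Suc i) \<Longrightarrow> Suc i < n \<Longrightarrow> thesis" and T: "\<And>j. x = GenT (Suc j) \<Longrightarrow> j < n \<Longrightarrow> thesis"
      from x consider i where "x = GenS i" "1 \<le> i" "i < n" | j where "x = GenT j" "1 \<le> j" "j \<le> n"
        by (auto simp: fb_gens_def)
      then show thesis
      proof cases
        case (1 i) then show ?thesis using S[of "i - 1"] by simp
      next
        case (2 j) then show ?thesis using T[of "j - 1"] by simp
      qed
    qed
    then show ?thesis
    proof cases
      case (1 i)
      show ?thesis
      proof (cases e)
        case True
        then show ?thesis using span_gens_lS[OF 1(2) IH] by (simp add: l 1(1) lS_def FB_s_def)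
      next
        case False
        then show ?thesis using span_gens_lS_inv[OF 1(2) IH] inv by (simp add: l 1(1) FB_s_def)
      qed
    next
      case (2 j)
      show ?thesis
      proof (cases e)
        case True
        then show ?thesis using span_gens_lT(1)[OF 2(2) IH] by (simp add: l 2(1) lT_def FB_t_def)
      next
        case False
        then show ?thesis using span_gens_lT(2)[OF 2(2) IH] inv by (simp add: l 2(1) FB_t_def)
      qed
    qed
  qed
  finally show ?case .
qed

lemma carrier_span_gens: "a \<in> carrier (kFB d n) \<Longrightarrow> a \<in> fs.span span_gens"
proof -
  assume a: "a \<in> carrier (kFB d n)"
  then have fin: "finite {g. a g \<noteq> 0}" and sub: "\<And>g. a g \<noteq> 0 \<Longrightarrow> g \<in> carrier (FB d n)"
    by (auto simp: kFB_def)
  have "a = (\<Sum>g | a g \<noteq> 0. fscale (a g) (delta g))"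
  proof
    fix z
    have "(\<Sum>g | a g \<noteq> 0. fscale (a g) (delta g)) z = (\<Sum>g | a g \<noteq> 0. if z = g then a g else 0)"
      unfolding fun_sum_apply by (intro sum.cong refl) (simp add: fscale_def delta_def)
    also have "\<dots> = a z" using fin by (simp add: sum.delta')
    finally show "a z = (\<Sum>g | a g \<noteq> 0. fscale (a g) (delta g)) z" by simp
  qed
  also have "\<dots> \<in> fs.span span_gens"
  proof (intro fs.span_sum fs.span_scale)
    fix g assume "g \<in> {g. a g \<noteq> 0}"
    then have "g \<in> carrier (FB d n)" using sub by blast
    then obtain w where "w \<in> lists (fb_gens n \<times> UNIV)" "g = FB_word d n w"
      unfolding FB_def presented_group_def by auto
    then show "delta g \<in> fs.span span_gens" using delta_span_gens by blast
  qed
  finally show ?thesis .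
qed

definition reduced_index :: "((nat \<Rightarrow> nat) \<times> nat list) set" where
  "reduced_index = Sigma (colourings d n) (\<lambda>\<chi>. {m \<in> perms n. \<not> has_triple \<chi> m})"

lemma finite_reduced_index: "finite reduced_index"
  unfolding reduced_index_def by (intro finite_SigmaI finite_colourings) (simp add: finite_perms)

text \<open>The span is put into the form of explicit coefficients over one finite index set,
  because injectivity is shown by proving each coefficient zero.\<close>

theorem reduced_spans:
  assumes "a \<in> carrier (kFB d n)"
  shows "\<exists>c. a - (\<Sum>(\<chi>, m)\<in>reduced_index. fscale (c (\<chi>, m)) (cbase \<chi> m)) \<in> ctl_kernel d n"
proof -
  let ?X = "ctl_kernel d n \<union> case_prod cbase ` reduced_index"
  have "span_gens \<subseteq> fs.span ?X"
  proof
    fix x assume "x \<in> span_gens"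
    then show "x \<in> fs.span ?X"
    proof (cases rule: span_gens_cases)
      case 1
      then show ?thesis by (intro fs.span_base) simp
    next
      case (2 \<chi> m)
      have "ctl_kernel d n \<union> cbase \<chi> ` {m \<in> perms n. \<not> has_triple \<chi> m} \<subseteq> ?X"
        using 2(1) by (force simp: reduced_index_def)
      then have "fs.span (ctl_kernel d n \<union> cbase \<chi> ` {m \<in> perms n. \<not> has_triple \<chi> m}) \<subseteq> fs.span ?X"
        by (rule fs.span_mono)
      then show ?thesis using cbase_reduce[OF 2(1,2)] unfolding 2(3) by (rule subsetD)
    qed
  qed
  then have "fs.span span_gens \<subseteq> fs.span ?X" by (rule fs.span_minimal[OF _ fs.subspace_span])
  then have "a \<in> fs.span ?X" using carrier_span_gens[OF assms] by blast
  then show ?thesis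
  proof (induction rule: fs.span_induct_alt)
    case base
    show ?case
      by (rule exI[of _ "\<lambda>_. 0"]) (simp only: fs.scale_zero_left case_prod_unfold sum.neutral_const diff_zero fs.subspace_0[OF kernel_subspace[OF d \<zeta>]])
  next
    case (step r x y)
    then obtain c where c: "y - (\<Sum>(\<chi>, m)\<in>reduced_index. fscale (c (\<chi>, m)) (cbase \<chi> m)) \<in> ctl_kernel d n" by blast
    from step.hyps consider "x \<in> ctl_kernel d n" | g where "g \<in> reduced_index" "x = case_prod cbase g" by blast
    then show ?case
    proof cases
      case 1
      have "fscale r x + (y - (\<Sum>(\<chi>, m)\<in>reduced_index. fscale (c (\<chi>, m)) (cbase \<chi> m))) \<in> ctl_kernel d n"
        by (intro fs.subspace_add fs.subspace_scale kernel_subspace[OF d \<zeta>] 1 c)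
      then show ?thesis by (intro exI[of _ c]) (simp only: add_diff_eq)
    next
      case (2 g)
      let ?c = "\<lambda>h. c h + (if h = g then r else 0)"
      have "(\<Sum>h\<in>reduced_index. fscale (?c h) (case_prod cbase h))
          = (\<Sum>h\<in>reduced_index. fscale (c h) (case_prod cbase h)) + (\<Sum>h\<in>reduced_index. if h = g then fscale r (case_prod cbase h) else 0)"
        by (simp only: fs.scale_left_distrib sum.distrib if_distrib[of "\<lambda>c. fscale c _"] fs.scale_zero_left)
      also have "(\<Sum>h\<in>reduced_index. if h = g then fscale r (case_prod cbase h) else 0) = fscale r x"
        using 2 finite_reduced_index by (subst sum.delta) simp_all
      finally have "fscale r x + y - (\<Sum>h\<in>reduced_index. fscale (?c h) (case_prod cbase h))
          = y - (\<Sum>h\<in>reduced_index. fscale (c h) (case_prod cbase h))"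
        by (simp only: add.commute[of _ "fscale r x"] add_diff_cancel_left)
      then show ?thesis using c by (intro exI[of _ ?c]) (simp only: case_prod_unfold prod.collapse)
    qed
  qed
qed

end

subsection \<open>The representation on tensor space\<close>

lemma asc_sg_0: "asc sg k r (\<lambda>l. 0) = (\<lambda>l. 0)"
  by (induction r arbitrary: k) (simp_all add: linop_0[OF linop_sg])

lemma tw_sg_0: "tw sg k m (\<lambda>l. 0) = (\<lambda>l. 0)"
  by (induction m arbitrary: k) (simp_all add: asc_sg_0)

context
  fixes d n :: nat and N :: "nat \<Rightarrow> nat" and \<zeta> :: kq
  assumes d: "d \<ge> 1" and \<zeta>: "primitive_root_of_unity d \<zeta>"
begin

interpretation G: group "FB d n" by (rule group_FB[OF d \<zeta>])
interpretation A: kalg "kFB d n" by (rule kalg_kFB[OF d \<zeta>])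
interpretation M: ctl_module fscale n "lS d n" "lT d n" "carrier (kFB d n)" "ctl_kernel d n" d \<zeta>
  by (rule ctl_module_kFB[OF d \<zeta>])

lemma PhiFB_T_space: "a \<in> carrier (kFB d n) \<Longrightarrow> x \<in> T_space d N n \<Longrightarrow> PhiFB d n N \<zeta> a x \<in> T_space d N n"
  by (rule hom_T_End_closed[OF PhiFB_alg_hom[OF d \<zeta>]])

lemma PhiFB_lt:
  assumes g: "g \<in> carrier (FB d n)" and a: "a \<in> carrier (kFB d n)" and x: "x \<in> T_space d N n"
  shows "PhiFB d n N \<zeta> (lt d n g a) x = fb_rep \<zeta> g (PhiFB d n N \<zeta> a x)"
  unfolding delta_mult[OF d \<zeta> g a, symmetric] hom_T_End_mult[OF PhiFB_alg_hom[OF d \<zeta>] delta_kFB[OF d \<zeta> g] a x]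
  by (rule PhiFB_delta[OF d \<zeta> PhiFB_T_space[OF a x]])

lemma PhiFB_lS:
  assumes "Suc k < n" "a \<in> carrier (kFB d n)" "x \<in> T_space d N n"
  shows "PhiFB d n N \<zeta> (lS d n k a) x = sg k (PhiFB d n N \<zeta> a x)"
proof -
  have g: "Suc k \<in> {1..<n}" using assms(1) by simp
  show ?thesis
    unfolding lS_def PhiFB_lt[OF FB_s_closed[OF d \<zeta> g] assms(2,3)]
    using fb_rep_s[OF d \<zeta> g PhiFB_T_space[OF assms(2,3)]] by simp
qed

lemma PhiFB_lT:
  assumes "k < n" "a \<in> carrier (kFB d n)" "x \<in> T_space d N n"
  shows "PhiFB d n N \<zeta> (lT d n k a) x = ta \<zeta> k (PhiFB d n N \<zeta> a x)"
proof -
  have g: "Suc k \<in> {1..n}" using assms(1) by simp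
  show ?thesis
    unfolding lT_def PhiFB_lt[OF FB_t_closed[OF d \<zeta> g] assms(2,3)]
    using fb_rep_t[OF d \<zeta> g PhiFB_T_space[OF assms(2,3)]] by simp
qed

lemma PhiFB_asc:
  "k + r < n \<Longrightarrow> a \<in> carrier (kFB d n) \<Longrightarrow> x \<in> T_space d N n \<Longrightarrow>
    PhiFB d n N \<zeta> (asc (lS d n) k r a) x = asc sg k r (PhiFB d n N \<zeta> a x)"
proof (induction r arbitrary: k)
  case (Suc r)
  then show ?case using M.asc_closed[of "Suc k" r a] by (simp add: PhiFB_lS)
qed simp

lemma PhiFB_tw:
  "k + length m \<le> n \<Longrightarrow> a \<in> carrier (kFB d n) \<Longrightarrow> x \<in> T_space d N n \<Longrightarrow>
    PhiFB d n N \<zeta> (tw (lS d n) k m a) x = tw sg k m (PhiFB d n N \<zeta> a x)"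
proof (induction m arbitrary: k a)
  case (Cons b m)
  have r: "k + below b m < n" using below_le_length[of b m] Cons.prems by simp
  show ?case using Cons.prems Cons.IH[of "Suc k" "asc (lS d n) k (below b m) a"] r
    by (simp add: PhiFB_asc M.asc_closed)
qed simp

lemma word_lS_closed:
  "w \<in> lists {k. Suc k < n} \<Longrightarrow> a \<in> carrier (kFB d n) \<Longrightarrow> word_op (lS d n) w a \<in> carrier (kFB d n)"
  by (induction w) (auto simp: lS_closed[OF d \<zeta>])

lemma PhiFB_word:
  "w \<in> lists {k. Suc k < n} \<Longrightarrow> a \<in> carrier (kFB d n) \<Longrightarrow> x \<in> T_space d N n \<Longrightarrow>
    PhiFB d n N \<zeta> (word_op (lS d n) w a) x = word_op sg w (PhiFB d n N \<zeta> a x)"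
  by (induction w) (auto simp: PhiFB_lS word_lS_closed)

lemma PhiFB_add:
  "a \<in> carrier (kFB d n) \<Longrightarrow> b \<in> carrier (kFB d n) \<Longrightarrow> x \<in> T_space d N n \<Longrightarrow>
    PhiFB d n N \<zeta> (a + b) x l = PhiFB d n N \<zeta> a x l + PhiFB d n N \<zeta> b x l"
  unfolding kFB_add[where d = d and n = n, symmetric] by (rule hom_T_End_add[OF PhiFB_alg_hom[OF d \<zeta>]])

lemma PhiFB_fscale:
  "a \<in> carrier (kFB d n) \<Longrightarrow> x \<in> T_space d N n \<Longrightarrow>
    PhiFB d n N \<zeta> (fscale c a) x l = c * PhiFB d n N \<zeta> a x l"
  unfolding kFB_smult[where d = d and n = n, symmetric] by (rule hom_T_End_smult[OF PhiFB_alg_hom[OF d \<zeta>]])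

lemma PhiFB_0: "x \<in> T_space d N n \<Longrightarrow> PhiFB d n N \<zeta> 0 x l = 0"
  using PhiFB_fscale[OF fs.subspace_0[OF carrier_subspace[OF d \<zeta>]], of x 0 l] by (simp only: fs.scale_zero_left mult_zero_left)

lemma PhiFB_diff:
  assumes "a \<in> carrier (kFB d n)" "b \<in> carrier (kFB d n)" "x \<in> T_space d N n"
  shows "PhiFB d n N \<zeta> (a - b) x l = PhiFB d n N \<zeta> a x l - PhiFB d n N \<zeta> b x l"
  unfolding kFB_minus[OF d \<zeta> assms(1,2), symmetric]
  by (rule hom_T_End_minus[OF A.kalg_axioms PhiFB_alg_hom[OF d \<zeta>] assms])

lemma PhiFB_sum:
  assumes x: "x \<in> T_space d N n"
  shows "(\<And>i. i \<in> I \<Longrightarrow> Z i \<in> carrier (kFB d n)) \<Longrightarrow>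
    PhiFB d n N \<zeta> (\<Sum>i\<in>I. fscale (c i) (Z i)) x l = (\<Sum>i\<in>I. c i * PhiFB d n N \<zeta> (Z i) x l)"
proof (induction I rule: infinite_finite_induct)
  case (insert i I)
  have "(\<Sum>i\<in>I. fscale (c i) (Z i)) \<in> carrier (kFB d n)" "fscale (c i) (Z i) \<in> carrier (kFB d n)"
    using insert.prems by (auto intro!: fs.subspace_sum fs.subspace_scale carrier_subspace[OF d \<zeta>])
  then show ?case
    unfolding sum.insert[OF insert.hyps] using insert.IH insert.prems x by (simp only: PhiFB_add PhiFB_fscale insertI1 insertI2)
qed (simp_all only: sum.infinite sum.empty PhiFB_0[OF x] not_False_eq_True)

lemma PhiFB_cproj:
  assumes j: "j < n" and a: "a \<in> carrier (kFB d n)" and x: "x \<in> T_space d N n"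
    and l: "l \<in> T_basis d N n" and c: "c \<in> {1..d}"
  shows "PhiFB d n N \<zeta> (cproj d n \<zeta> j c a) x l = (if fst (l ! j) = c then PhiFB d n N \<zeta> a x l else 0)"
proof -
  have p: "PhiFB d n N \<zeta> ((lT d n j ^^ t) a) x l = (\<zeta> ^ (fst (l ! j) - 1)) ^ t * PhiFB d n N \<zeta> a x l" for t
  proof (induction t)
    case (Suc t)
    then show ?case using PhiFB_lT[OF j funpow_closed[OF d \<zeta> j a] x, of t] by (simp add: ta_def)
  qed simp
  have f: "fst (l ! j) \<in> {1..d}" using T_basis_nth[OF l j] by simp
  have "PhiFB d n N \<zeta> (cproj d n \<zeta> j c a) x l = 1 / of_nat d *
      (\<Sum>t\<in>{1..d}. inverse (\<zeta> ^ (c - 1)) ^ t * PhiFB d n N \<zeta> ((lT d n j ^^ t) a) x l)"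
    unfolding cproj_def
    by (subst PhiFB_fscale, intro fs.subspace_sum fs.subspace_scale carrier_subspace[OF d \<zeta>] funpow_closed[OF d \<zeta> j a], rule x)
      (simp only: PhiFB_sum[OF x funpow_closed[OF d \<zeta> j a]])
  also have "\<dots> = (1 / of_nat d * (\<Sum>t\<in>{1..d}. (\<zeta> ^ (fst (l ! j) - 1) * inverse (\<zeta> ^ (c - 1))) ^ t)) * PhiFB d n N \<zeta> a x l"
    unfolding p by (simp add: sum_distrib_left sum_distrib_right power_mult_distrib mult_ac)
  also have "1 / of_nat d * (\<Sum>t\<in>{1..d}. (\<zeta> ^ (fst (l ! j) - 1) * inverse (\<zeta> ^ (c - 1))) ^ t)
      = (if fst (l ! j) - 1 = c - 1 then 1 else 0)"
    using f c by (intro root_average[OF \<zeta> d]) auto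
  also have "fst (l ! j) - 1 = c - 1 \<longleftrightarrow> fst (l ! j) = c" using f c by auto
  finally show ?thesis by simp
qed

lemma PhiFB_cidem_apply:
  assumes x: "x \<in> T_space d N n" and l: "l \<in> T_basis d N n" and \<chi>: "\<And>i. i < n \<Longrightarrow> \<chi> i \<in> {1..d}"
  shows "j \<le> n \<Longrightarrow> PhiFB d n N \<zeta> (cidem d n \<zeta> \<chi> j) x l = (if \<forall>i<j. fst (l ! i) = \<chi> i then x l else 0)"
proof (induction j)
  case 0
  have "PhiFB d n N \<zeta> (delta \<one>\<^bsub>FB d n\<^esub>) x = x"
    using hom_T_End_one[OF PhiFB_alg_hom[OF d \<zeta>] x] by (simp add: kFB_def)
  then show ?case by simp
next
  case (Suc j)
  then have j: "j < n" "j \<le> n" by auto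
  show ?case
    using PhiFB_cproj[OF j(1) cidem_closed[where \<chi> = \<chi>, OF d \<zeta> j(2)] x l \<chi>[OF j(1)]] Suc.IH[OF j(2)]
    by (auto simp: less_Suc_eq)
qed

lemma PhiFB_cidem:
  assumes x: "x \<in> T_space d N n" and \<chi>: "\<And>i. i < n \<Longrightarrow> \<chi> i \<in> {1..d}"
  shows "PhiFB d n N \<zeta> (cidem d n \<zeta> \<chi> n) x = (\<lambda>l. if map fst l = map \<chi> [0..<n] then x l else 0)"
proof (rule T_space_eqI)
  show "PhiFB d n N \<zeta> (cidem d n \<zeta> \<chi> n) x \<in> T_space d N n" by (intro PhiFB_T_space cidem_closed[OF d \<zeta>] x order.refl)
  show "(\<lambda>l. if map fst l = map \<chi> [0..<n] then x l else 0) \<in> T_space d N n" using x by (simp add: T_space_def)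
  fix l assume l: "l \<in> T_basis d N n"
  have "(\<forall>i<n. fst (l ! i) = \<chi> i) \<longleftrightarrow> map fst l = map \<chi> [0..<n]"
    using T_basis_length[OF l] by (auto simp: list_eq_iff_nth_eq)
  then show "PhiFB d n N \<zeta> (cidem d n \<zeta> \<chi> n) x l = (if map fst l = map \<chi> [0..<n] then x l else 0)"
    using PhiFB_cidem_apply[where \<chi> = \<chi>, OF x l \<chi> order.refl] by simp
qed

lemma PhiFB_cidem_delta:
  assumes t: "t \<in> T_basis d N n" and \<chi>: "\<And>i. i < n \<Longrightarrow> \<chi> i \<in> {1..d}"
  shows "PhiFB d n N \<zeta> (cidem d n \<zeta> \<chi> n) (delta t) = (if map fst t = map \<chi> [0..<n] then delta t else (\<lambda>l. 0))"
proof -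
  have e: "PhiFB d n N \<zeta> (cidem d n \<zeta> \<chi> n) (delta t) = (\<lambda>l. if map fst l = map \<chi> [0..<n] then delta t l else 0)"
    by (rule PhiFB_cidem[OF delta_T_space[OF t] \<chi>])
  show ?thesis unfolding e by (auto simp: delta_def fun_eq_iff)
qed

context
  assumes N1: "N 1 = 2"
begin

lemma PhiFB_kernel:
  assumes a: "a \<in> ctl_kernel d n" and x: "x \<in> T_space d N n"
  shows "PhiFB d n N \<zeta> a x l = 0"
proof -
  have "0 \<in> ctl_kernel d n" by (rule fs.subspace_0[OF kernel_subspace[OF d \<zeta>]])
  then have "CTL_map d n a = CTL_map d n 0" "a \<in> carrier (kFB d n)" "0 \<in> carrier (kFB d n)"
    using a by (simp_all only: ctl_kernel_def mem_Collect_eq)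
  then have "PhiFB d n N \<zeta> a = PhiFB d n N \<zeta> 0"
    by (simp only: Phi_CTL_map[where N = N, OF d \<zeta> N1, symmetric])
  then show ?thesis by (simp only: PhiFB_0[OF x])
qed

text \<open>Testing on basis tensors with colour pattern \<open>\<chi>\<close> isolates the
  coefficients belonging to \<open>\<chi>\<close>, since the other colour idempotents kill these
  tensors. For a fixed colouring \<open>tw_sg_independent\<close> applies.\<close>

theorem PhiFB_injective:
  assumes N: "\<And>b. 2 \<le> b \<Longrightarrow> b \<le> d \<Longrightarrow> n \<le> N b" and a: "a \<in> carrier (kFB d n)"
    and 0: "\<And>x l. x \<in> T_space d N n \<Longrightarrow> PhiFB d n N \<zeta> a x l = 0"
  shows "a \<in> ctl_kernel d n"
proof -
  obtain c where c: "a - (\<Sum>(\<chi>, m)\<in>reduced_index d n. fscale (c (\<chi>, m)) (cbase d n \<zeta> \<chi> m)) \<in> ctl_kernel d n"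
    using reduced_spans[OF d \<zeta> a] by blast
  let ?Z = "\<lambda>g. cbase d n \<zeta> (fst g) (snd g)"
  let ?s = "\<Sum>g\<in>reduced_index d n. fscale (c g) (?Z g)"
  have k: "a - ?s \<in> ctl_kernel d n" using c by (simp only: case_prod_unfold prod.collapse)
  have Zc: "?Z g \<in> carrier (kFB d n)" if "g \<in> reduced_index d n" for g
    using that by (intro cbase_closed[OF d \<zeta>]) (auto simp: reduced_index_def[OF d \<zeta>])
  have sc: "?s \<in> carrier (kFB d n)" by (intro fs.subspace_sum fs.subspace_scale carrier_subspace[OF d \<zeta>] Zc)
  have c0: "c (\<chi>, m) = 0" if g: "(\<chi>, m) \<in> reduced_index d n" for \<chi> m
  proof (rule tw_sg_independent[where N = N and \<chi> = \<chi> and c = "\<lambda>m. c (\<chi>, m)"])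
    show "N 1 = 2" by (rule N1)
    show "n \<le> N b" if "2 \<le> b" "b \<le> d" for b using that by (rule N)
    have \<chi>: "\<chi> \<in> colourings d n" using g by (auto simp: reduced_index_def[OF d \<zeta>])
    show "\<chi> p \<in> {1..d}" for p using \<chi> d by (cases "p < n") (auto simp: colourings_def)
    show "{m \<in> perms n. \<not> has_triple \<chi> m} \<subseteq> perms n" by blast
    show "\<not> has_triple \<chi> m" if "m \<in> {m \<in> perms n. \<not> has_triple \<chi> m}" for m using that by blast
    show "m \<in> {m \<in> perms n. \<not> has_triple \<chi> m}" using g by (auto simp: reduced_index_def[OF d \<zeta>])
    fix y l assume y: "y \<in> T_basis d N n" "map fst y = map \<chi> [0..<n]"
    have ev: "PhiFB d n N \<zeta> (?Z g) (delta y) l = (if fst g = \<chi> then tw sg 0 (snd g) (delta y) l else 0)"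
      if g: "g \<in> reduced_index d n" for g
    proof -
      have \<chi>': "fst g \<in> colourings d n" "snd g \<in> perms n" using g by (auto simp: reduced_index_def[OF d \<zeta>])
      have iff: "map fst y = map (fst g) [0..<n] \<longleftrightarrow> fst g = \<chi>"
      proof
        assume "map fst y = map (fst g) [0..<n]"
        then have "map (fst g) [0..<n] = map \<chi> [0..<n]" using y(2) by simp
        then have "fst g p = \<chi> p" if "p < n" for p using that by simp
        moreover have "fst g p = \<chi> p" if "\<not> p < n" for p using \<chi> \<chi>'(1) that by (simp add: colourings_def)
        ultimately show "fst g = \<chi>" by blast
      qed (use y in simp)
      have "PhiFB d n N \<zeta> (?Z g) (delta y) = tw sg 0 (snd g) (PhiFB d n N \<zeta> (cidem d n \<zeta> (fst g) n) (delta y))"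
        unfolding cbase_def[OF d \<zeta>] using \<chi>'(2)
        by (intro PhiFB_tw cidem_closed[OF d \<zeta>] delta_T_space y(1)) (simp_all add: perms_length)
      also have "PhiFB d n N \<zeta> (cidem d n \<zeta> (fst g) n) (delta y)
          = (if map fst y = map (fst g) [0..<n] then delta y else (\<lambda>l. 0))"
        using \<chi>'(1) by (intro PhiFB_cidem_delta y(1)) (simp add: colourings_def)
      finally show ?thesis unfolding iff by (simp add: tw_sg_0)
    qed
    have "0 = PhiFB d n N \<zeta> a (delta y) l - PhiFB d n N \<zeta> (a - ?s) (delta y) l"
      using 0[OF delta_T_space[OF y(1)]] PhiFB_kernel[OF k delta_T_space[OF y(1)]] by simp
    also have "\<dots> = PhiFB d n N \<zeta> ?s (delta y) l"
      unfolding PhiFB_diff[OF a sc delta_T_space[OF y(1)]] by simp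
    also have "\<dots> = (\<Sum>g\<in>reduced_index d n. c g * PhiFB d n N \<zeta> (?Z g) (delta y) l)"
      by (rule PhiFB_sum[OF delta_T_space[OF y(1)] Zc])
    also have "\<dots> = (\<Sum>g\<in>reduced_index d n. c g * (if fst g = \<chi> then tw sg 0 (snd g) (delta y) l else 0))"
      by (intro sum.cong refl) (simp only: ev)
    also have "\<dots> = (\<Sum>g\<in>Pair \<chi> ` {m \<in> perms n. \<not> has_triple \<chi> m}. c g * (if fst g = \<chi> then tw sg 0 (snd g) (delta y) l else 0))"
      using \<chi> by (intro sum.mono_neutral_right finite_reduced_index[OF d \<zeta>]) (auto simp: reduced_index_def[OF d \<zeta>])
    also have "\<dots> = (\<Sum>m\<in>{m \<in> perms n. \<not> has_triple \<chi> m}. c (\<chi>, m) * tw sg 0 m (delta y) l)"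
      by (subst sum.reindex) (auto intro: inj_onI)
    finally show "(\<Sum>m\<in>{m \<in> perms n. \<not> has_triple \<chi> m}. c (\<chi>, m) * tw sg 0 m (delta y) l) = 0" by simp
  qed
  have "?s = 0"
  proof (rule sum.neutral, rule ballI)
    fix g assume "g \<in> reduced_index d n"
    then have "c g = 0" using c0[of "fst g" "snd g"] by simp
    then show "fscale (c g) (?Z g) = 0" by (simp only: fs.scale_zero_left)
  qed
  with k show ?thesis by (simp only: diff_zero)
qed

text \<open>\<open>commutant_formula\<close> provides one combination of braid words for each colour
  pattern. Multiplying each on the right by the idempotent of its pattern glues them into a single
  element.\<close>

theorem PhiFB_surjective:
  assumes f: "f \<in> carrier (End_Uq d N n)"
  shows "\<exists>a\<in>carrier (kFB d n). PhiFB d n N \<zeta> a = f"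
proof -
  define P where "P = map fst ` T_basis d N n"
  have "\<exists>W c. finite W \<and> W \<subseteq> lists {k. Suc k < n} \<and>
      (\<forall>t\<in>T_basis d N n. map fst t = p \<longrightarrow> f (delta t) = (\<lambda>l. \<Sum>w\<in>W. c w * word_op sg w (delta t) l))"
    if "p \<in> P" for p
  proof -
    from that obtain t0 where t0: "t0 \<in> T_basis d N n" "p = map fst t0" by (auto simp: P_def)
    \<comment> \<open>The index at place \<open>k\<close> exceeds the small rank, stays within the
      rank enlarged by \<open>n\<close> because \<open>k < n\<close>, and differs from place to
      place within a colour.\<close>
    define v where "v = map (\<lambda>k. (p ! k, N (p ! k) + k + 1)) [0..<n]"
    have lp: "length p = n" using t0 by (simp add: T_basis_length)
    have pk: "p ! k \<in> {1..d}" if "k < n" for k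
      using T_basis_nth[OF t0(1) that] that T_basis_length[OF t0(1)] by (simp add: t0(2))
    have "v \<in> T_basis d (\<lambda>b. N b + n) n"
      using pk by (auto simp: v_def T_basis_def V_basis_def)
    moreover have "distinct v"
      by (auto simp: v_def distinct_map intro!: inj_onI)
    moreover have "N b < j" if "(b, j) \<in> set v" for b j using that by (auto simp: v_def)
    moreover have "map fst v = p" using lp by (simp add: v_def comp_def map_nth flip: lp)
    ultimately show ?thesis using commutant_formula[OF f, of v] by simp
  qed
  then have "\<forall>p\<in>P. \<exists>W c. finite W \<and> W \<subseteq> lists {k. Suc k < n} \<and>
      (\<forall>t\<in>T_basis d N n. map fst t = p \<longrightarrow> f (delta t) = (\<lambda>l. \<Sum>w\<in>W. c w * word_op sg w (delta t) l))"
    by (rule ballI)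
  from bchoice[OF this] obtain W where "\<forall>p\<in>P. \<exists>c. finite (W p) \<and> W p \<subseteq> lists {k. Suc k < n} \<and>
      (\<forall>t\<in>T_basis d N n. map fst t = p \<longrightarrow> f (delta t) = (\<lambda>l. \<Sum>w\<in>W p. c w * word_op sg w (delta t) l))" ..
  from bchoice[OF this] obtain c where Wc: "\<forall>p\<in>P. finite (W p) \<and> W p \<subseteq> lists {k. Suc k < n} \<and>
      (\<forall>t\<in>T_basis d N n. map fst t = p \<longrightarrow> f (delta t) = (\<lambda>l. \<Sum>w\<in>W p. c p w * word_op sg w (delta t) l))" ..
  define I where "I = Sigma P W"
  define Z where "Z i = word_op (lS d n) (snd i) (cidem d n \<zeta> (\<lambda>k. fst i ! k) n)" for i
  define a where "a = (\<Sum>i\<in>I. fscale (c (fst i) (snd i)) (Z i))"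
  have finP: "finite P" unfolding P_def using finite_T_basis by blast
  have IW: "fst i \<in> P" "snd i \<in> lists {k. Suc k < n}" if "i \<in> I" for i
  proof -
    have "fst i \<in> P" "snd i \<in> W (fst i)" using that by (auto simp: I_def)
    then show "fst i \<in> P" "snd i \<in> lists {k. Suc k < n}" using Wc by blast+
  qed
  have Zc: "Z i \<in> carrier (kFB d n)" if "i \<in> I" for i
    unfolding Z_def by (intro word_lS_closed cidem_closed[OF d \<zeta>] IW(2) that order.refl)
  have ac: "a \<in> carrier (kFB d n)"
    unfolding a_def by (intro fs.subspace_sum fs.subspace_scale carrier_subspace[OF d \<zeta>] Zc)
  have basis: "PhiFB d n N \<zeta> a (delta t) = f (delta t)" if t: "t \<in> T_basis d N n" for t
  proof
    fix l
    let ?p = "map fst t"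
    have pP: "?p \<in> P" using t by (simp add: P_def)
    have ev: "PhiFB d n N \<zeta> (Z i) (delta t) l = (if fst i = ?p then word_op sg (snd i) (delta t) l else 0)"
      if i: "i \<in> I" for i
    proof -
      note iP = IW[OF i]
      then obtain t0 where t0: "t0 \<in> T_basis d N n" "fst i = map fst t0" by (auto simp: P_def)
      have li: "length (fst i) = n" using t0 by (simp add: T_basis_length)
      have eq: "map (\<lambda>k. fst i ! k) [0..<n] = fst i" using li by (simp add: map_nth flip: li)
      have "PhiFB d n N \<zeta> (Z i) (delta t) = word_op sg (snd i) (PhiFB d n N \<zeta> (cidem d n \<zeta> (\<lambda>k. fst i ! k) n) (delta t))"
        unfolding Z_def by (intro PhiFB_word iP(2) cidem_closed[OF d \<zeta>] delta_T_space t order.refl)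
      also have "PhiFB d n N \<zeta> (cidem d n \<zeta> (\<lambda>k. fst i ! k) n) (delta t)
          = (if map fst t = map (\<lambda>k. fst i ! k) [0..<n] then delta t else (\<lambda>l. 0))"
      proof (rule PhiFB_cidem_delta[OF t])
        fix k assume "k < n"
        then show "fst i ! k \<in> {1..d}" using T_basis_nth[OF t0(1)] T_basis_length[OF t0(1)] by (simp add: t0(2))
      qed
      finally show ?thesis unfolding eq by (auto simp: linop_0[OF linop_word_op[OF linop_sg]])
    qed
    have "PhiFB d n N \<zeta> a (delta t) l = (\<Sum>i\<in>I. c (fst i) (snd i) * PhiFB d n N \<zeta> (Z i) (delta t) l)"
      unfolding a_def by (rule PhiFB_sum[OF delta_T_space[OF t] Zc])
    also have "\<dots> = (\<Sum>i\<in>I. c (fst i) (snd i) * (if fst i = ?p then word_op sg (snd i) (delta t) l else 0))"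
      by (intro sum.cong refl) (simp only: ev)
    also have "\<dots> = (\<Sum>i\<in>Pair ?p ` W ?p. c (fst i) (snd i) * (if fst i = ?p then word_op sg (snd i) (delta t) l else 0))"
      using pP finP Wc by (intro sum.mono_neutral_right) (auto simp: I_def)
    also have "\<dots> = (\<Sum>w\<in>W ?p. c ?p w * word_op sg w (delta t) l)"
      by (subst sum.reindex) (auto intro: inj_onI)
    also have "\<dots> = f (delta t) l" using Wc pP t by simp
    finally show "PhiFB d n N \<zeta> a (delta t) l = f (delta t) l" .
  qed
  have fT: "f \<in> carrier (T_End d N n)" using f unfolding End_Uq_carrier_iff by blast
  have aT: "PhiFB d n N \<zeta> a \<in> carrier (T_End d N n)" by (rule alg_homD(3)[OF PhiFB_alg_hom[OF d \<zeta>] ac])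
  have "PhiFB d n N \<zeta> a = f"
  proof (rule extensionalityI[of _ "T_space d N n"])
    show "PhiFB d n N \<zeta> a \<in> extensional (T_space d N n)" "f \<in> extensional (T_space d N n)"
      using aT fT by (auto simp: PiE_def)
    fix x assume x: "x \<in> T_space d N n"
    have e: "h x = (\<lambda>l. \<Sum>m\<in>T_basis d N n. x m * h (delta m) l)" if "h \<in> carrier (T_End d N n)" for h
      using T_End_apply_sum[OF that, of "T_basis d N n" delta x] delta_T_space
      unfolding T_space_expand[OF x, symmetric] by blast
    show "PhiFB d n N \<zeta> a x = f x"
      unfolding e[OF aT] e[OF fT] by (intro ext sum.cong refl) (simp only: basis)
  qed
  then show ?thesis using ac by blast
qed

end
end

subsection \<open>The antisymmetriser of a single colour\<close>

text \<open>On tensors of one colour the quadratic relation holds without a case distinction, so the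
  braid operators form a genuine Hecke algebra action.\<close>

definition mono_tens :: "nat \<Rightarrow> nat \<Rightarrow> tensor set" where
  "mono_tens b n = {x. \<forall>l. x l \<noteq> 0 \<longrightarrow> length l = n \<and> (\<forall>e\<in>set l. fst e = b)}"

lemma sg_support: "(\<And>l'. mset l' = mset l \<Longrightarrow> x l' = 0) \<Longrightarrow> sg k x l = 0"
  by (induction k x l rule: sg.induct) (auto simp: add_mset_commute)

lemma sg_mono_tens: "x \<in> mono_tens b n \<Longrightarrow> sg k x \<in> mono_tens b n"
proof -
  assume x: "x \<in> mono_tens b n"
  have "length l = n \<and> (\<forall>e\<in>set l. fst e = b)" if "sg k x l \<noteq> 0" for l
  proof -
    from that obtain l' where "mset l' = mset l" "x l' \<noteq> 0" using sg_support by blast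
    moreover from this have "length l' = n \<and> (\<forall>e\<in>set l'. fst e = b)" using x unfolding mono_tens_def by blast
    ultimately show ?thesis by (metis mset_eq_length mset_eq_setD)
  qed
  then show ?thesis by (simp add: mono_tens_def)
qed

lemma mono_tens_tens: "x \<in> mono_tens b n \<Longrightarrow> x \<in> tens n"
  by (auto simp: mono_tens_def tens_def)

interpretation sgm: braid_op n sg "mono_tens b n" for n b
  by (unfold_locales; (rule sg_mono_tens, assumption | erule (1) sgb.S_far, erule mono_tens_tens
      | erule sgb.S_braid, erule mono_tens_tens))

lemma sg_quadratic_mono:
  assumes "x \<in> mono_tens b n" "Suc k < n"
  shows "sg k (sg k x) l = x l + (q - inverse q) * sg k x l"
proof (cases "length l = n \<and> (\<forall>e\<in>set l. fst e = b)")
  case True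
  then have "fst (l ! k) = b" "fst (l ! Suc k) = b" using assms(2) by auto
  then show ?thesis using sg_quadratic[of k l x] True assms(2) by simp
next
  case False
  have z: "y l = 0" if "y \<in> mono_tens b n" for y
    using that False unfolding mono_tens_def by blast
  show ?thesis
    using z[OF assms(1)] z[OF sg_mono_tens[OF assms(1)]] z[OF sg_mono_tens[OF sg_mono_tens[OF assms(1)]]] by simp
qed

text \<open>With the constant colouring \<open>cinv\<close> is the ordinary length, so this is the
  unnormalised \<open>q\<close>-antisymmetriser of the Hecke algebra.\<close>

definition q_antisym :: "nat \<Rightarrow> tensor \<Rightarrow> tensor" where
  "q_antisym n x = (\<lambda>l. \<Sum>m\<in>perms n. (- inverse q) ^ cinv (\<lambda>_. 0) m * tw sg 0 m x l)"

lemma q_antisym_mono: "x \<in> mono_tens b n \<Longrightarrow> q_antisym n x \<in> mono_tens b n"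
proof -
  assume x: "x \<in> mono_tens b n"
  have "length l = n \<and> (\<forall>e\<in>set l. fst e = b)" if "q_antisym n x l \<noteq> 0" for l
  proof -
    have "\<exists>m\<in>perms n. tw sg 0 m x l \<noteq> 0"
    proof (rule ccontr)
      assume "\<not> ?thesis"
      then have "q_antisym n x l = 0" unfolding q_antisym_def by (intro sum.neutral) auto
      with that show False by simp
    qed
    then obtain m where m: "m \<in> perms n" "tw sg 0 m x l \<noteq> 0" by blast
    have "tw sg 0 m x \<in> mono_tens b n" by (intro sgm.tw_closed x) (simp add: perms_length[OF m(1)])
    then have "\<forall>l. tw sg 0 m x l \<noteq> 0 \<longrightarrow> length l = n \<and> (\<forall>e\<in>set l. fst e = b)"
      by (simp only: mono_tens_def mem_Collect_eq)
    then show ?thesis using m(2) by blast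
  qed
  then show ?thesis by (simp add: mono_tens_def)
qed

text \<open>Each \<open>m\<close> that ascends at \<open>k\<close> is paired with its exchange, so
  that a factor \<open>1 + c S\<close> with \<open>c = - inverse q\<close> splits off. The quadratic
  relation gives \<open>S (1 + c S) = c (1 + c S)\<close>, because
  \<open>c ^ 2 = 1 + c (q - inverse q)\<close>.\<close>

lemma sg_q_antisym:
  assumes x: "x \<in> mono_tens b n" and k: "Suc k < n"
  shows "sg k (q_antisym n x) l = - inverse q * q_antisym n x l"
proof -
  let ?c = "- inverse q"
  let ?sw = "\<lambda>m :: nat list. m[k := m ! Suc k, Suc k := m ! k]"
  let ?u = "\<lambda>m. tw sg 0 m x"
  define P where "P = {m \<in> perms n. m ! k < m ! Suc k}"
  define w where "w m = ?c ^ cinv (\<lambda>_. 0) m" for m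
  have dec: "\<exists>p a b s. m = p @ a # b # s \<and> length p = k \<and> ?sw m = p @ b # a # s" if "m \<in> perms n" for m
  proof -
    have "Suc k < length m" using perms_length[OF that] k by simp
    then obtain p a b s where "m = p @ a # b # s" "length p = k" by (rule adjacent_split)
    then show ?thesis by (intro exI[of _ p] exI[of _ a] exI[of _ b] exI[of _ s]) (simp add: nth_append list_update_append)
  qed
  have P: "?sw m \<in> perms n \<and> ?sw m \<notin> P \<and> w (?sw m) = ?c * w m \<and> ?u (?sw m) = sg k (?u m)" if m: "m \<in> P" for m
  proof -
    from m have mp: "m \<in> perms n" "m ! k < m ! Suc k" by (auto simp: P_def)
    obtain p a b' s where e: "m = p @ a # b' # s" "length p = k" "?sw m = p @ b' # a # s" using dec[OF mp(1)] by blast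
    have ab: "a < b'" using mp(2) e(2) by (auto simp: e(1) nth_append)
    have "?u (?sw m) = sg k (?u m)"
      using sgm.S_tw[OF ab, of 0 p s n x b] x perms_length[OF mp(1)] unfolding e(3) by (simp add: e(1,2))
    moreover have "p @ b' # a # s \<in> perms n" using mp(1) perms_swap e(1) by blast
    moreover have "p @ b' # a # s \<notin> P" using ab e(2) by (auto simp: P_def nth_append)
    moreover have "w (p @ b' # a # s) = ?c * w m"
      unfolding w_def e(1) cinv_swap[OF ab] by simp
    ultimately show ?thesis unfolding e(3) by simp
  qed
  have un: "perms n = P \<union> ?sw ` P"
  proof
    show "perms n \<subseteq> P \<union> ?sw ` P"
    proof
      fix m assume m: "m \<in> perms n"
      obtain p a b' s where e: "m = p @ a # b' # s" "length p = k" "?sw m = p @ b' # a # s" using dec[OF m] by blast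
      show "m \<in> P \<union> ?sw ` P"
      proof (cases "a < b'")
        case True
        then show ?thesis using m e by (auto simp: P_def nth_append)
      next
        case False
        then have "b' < a" using m by (auto simp: e(1) perms_def)
        moreover have "p @ b' # a # s \<in> perms n" using m perms_swap e(1) by blast
        ultimately have "p @ b' # a # s \<in> P" using e(2) by (auto simp: P_def nth_append)
        moreover have "m = ?sw (p @ b' # a # s)" using e(2) by (simp add: e(1) nth_append list_update_append)
        ultimately show ?thesis by blast
      qed
    qed
    show "P \<union> ?sw ` P \<subseteq> perms n" using P by (auto simp: P_def)
  qed
  have inj: "inj_on ?sw P"
  proof (rule inj_onI)
    fix m m' assume m: "m \<in> P" "m' \<in> P" "?sw m = ?sw m'"
    have inv: "?sw (?sw m) = m" if "m \<in> P" for m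
    proof -
      obtain p a b' s where e: "m = p @ a # b' # s" "length p = k" "?sw m = p @ b' # a # s"
        using dec[of m] \<open>m \<in> P\<close> by (auto simp: P_def)
      show ?thesis unfolding e(3) using e(2) by (simp add: e(1) nth_append list_update_append)
    qed
    show "m = m'" using inv[OF m(1)] inv[OF m(2)] m(3) by simp
  qed
  have finP: "finite P" unfolding P_def using finite_perms by simp
  have eq: "q_antisym n x = (\<lambda>l. \<Sum>m\<in>P. w m * (?u m l + ?c * sg k (?u m) l))"
  proof
    fix l
    have "q_antisym n x l = (\<Sum>m\<in>P. w m * ?u m l) + (\<Sum>m\<in>?sw ` P. w m * ?u m l)"
      unfolding q_antisym_def un w_def using finP P by (intro sum.union_disjoint) auto
    also have "(\<Sum>m\<in>?sw ` P. w m * ?u m l) = (\<Sum>m\<in>P. w (?sw m) * ?u (?sw m) l)"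
      by (subst sum.reindex[OF inj]) simp
    also have "\<dots> = (\<Sum>m\<in>P. w m * (?c * sg k (?u m) l))"
      using P by (intro sum.cong refl) (simp add: mult_ac)
    finally show "q_antisym n x l = (\<Sum>m\<in>P. w m * (?u m l + ?c * sg k (?u m) l))"
      unfolding distrib_left sum.distrib .
  qed
  have step: "sg k (\<lambda>l. ?u m l + ?c * sg k (?u m) l) l = ?c * (?u m l + ?c * sg k (?u m) l)" if "m \<in> P" for m
  proof -
    have "?u m \<in> mono_tens b n" using that x perms_length[of m n] by (intro sgm.tw_closed) (auto simp: P_def)
    then have "sg k (\<lambda>l. ?u m l + ?c * sg k (?u m) l) l = sg k (?u m) l + ?c * (?u m l + (q - inverse q) * sg k (?u m) l)"
      by (simp only: sg_add sg_scale sg_quadratic_mono[OF _ k])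
    also have "\<dots> = ?c * ?u m l + (1 + ?c * (q - inverse q)) * sg k (?u m) l" by (simp add: algebra_simps)
    also have "1 + ?c * (q - inverse q) = ?c * ?c" using q_neq_0 by (simp add: algebra_simps)
    finally show ?thesis by (simp add: algebra_simps)
  qed
  have "sg k (q_antisym n x) l = (\<Sum>m\<in>P. w m * sg k (\<lambda>l. ?u m l + ?c * sg k (?u m) l) l)"
    unfolding eq using fun_cong[OF linop_sum[OF linop_sg, of k w "\<lambda>m l. ?u m l + ?c * sg k (?u m) l" P]] .
  also have "\<dots> = (\<Sum>m\<in>P. w m * (?c * (?u m l + ?c * sg k (?u m) l)))"
    by (intro sum.cong refl) (simp only: step)
  also have "\<dots> = ?c * q_antisym n x l" unfolding eq sum_distrib_left by (intro sum.cong refl) (simp only: mult.left_commute)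
  finally show ?thesis .
qed

text \<open>At two equal neighbours \<open>sg\<close> multiplies by \<open>q\<close>, but the vector
  has eigenvalue \<open>- inverse q\<close>, so the value is zero. The eigenvalue equation then
  moves equal entries apart one step at a time: the diagonal term of \<open>sg\<close> sits at the
  tensor already known to vanish.\<close>

lemma antisym_repeated:
  assumes w: "\<And>k l. Suc k < n \<Longrightarrow> sg k w l = - inverse q * w l"
  shows "length (p @ x # u @ x # s) = n \<Longrightarrow> w (p @ x # u @ x # s) = 0"
proof (induction u arbitrary: p)
  case Nil
  have "sg (length p) w (p @ x # x # s) = - inverse q * w (p @ x # x # s)" using Nil by (intro w) simp
  then have "(q + inverse q) * w (p @ x # x # s) = 0" by (simp add: sg_append algebra_simps)
  then show ?case using q_add_inverse_neq_0 by simp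
next
  case (Cons z u)
  have "w ((p @ [z]) @ x # u @ x # s) = 0" using Cons.prems by (intro Cons.IH) simp
  then have 0: "w (p @ z # x # u @ x # s) = 0" by simp
  have "sg (length p) w (p @ z # x # u @ x # s) = - inverse q * w (p @ z # x # u @ x # s)"
    using Cons.prems by (intro w) simp
  then have s: "sg (length p) w (p @ z # x # u @ x # s) = 0" using 0 by simp
  show ?case
  proof (cases "z = x")
    case True
    then show ?thesis using 0 by simp
  next
    case False
    then show ?thesis using s 0 unfolding sg_append by (auto simp: prod_eq_iff split: if_splits)
  qed
qed

text \<open>Pigeonhole: fewer than \<open>n\<close> indices of colour \<open>b\<close> cannot fill
  \<open>n\<close> places without repetition.\<close>

theorem q_antisym_vanishes:
  assumes x: "x \<in> mono_tens b n" and N: "N b < n" and l: "l \<in> T_basis d N n"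
  shows "q_antisym n x l = 0"
proof (cases "\<forall>e\<in>set l. fst e = b")
  case True
  have "\<not> distinct l"
  proof
    assume "distinct l"
    then have "card (set l) = n" using l by (simp add: distinct_card T_basis_length)
    moreover have "set l \<subseteq> {b} \<times> {1..N b}" using l True by (force simp: T_basis_def V_basis_def)
    then have "card (set l) \<le> card ({b} \<times> {1..N b})" by (intro card_mono) auto
    ultimately show False using N by (simp add: card_cartesian_product)
  qed
  then obtain p e u s where "l = p @ [e] @ u @ [e] @ s" using not_distinct_decomp by blast
  then show ?thesis using antisym_repeated[of n "q_antisym n x" p e u s] sg_q_antisym[OF x] T_basis_length[OF l] by simp
next
  case False
  have "\<forall>l. q_antisym n x l \<noteq> 0 \<longrightarrow> length l = n \<and> (\<forall>e\<in>set l. fst e = b)"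
    using q_antisym_mono[OF x] by (simp only: mono_tens_def mem_Collect_eq)
  then show ?thesis using False by blast
qed

text \<open>\<open>CTL\<close> does not depend on the ranks of the colours above \<open>1\<close>.
  The antisymmetriser of colour \<open>b\<close> acts as zero for the rank \<open>N b\<close>, but
  it can be tested on another tensor space with larger ranks, where the permutation operators are
  independent.\<close>

theorem PhiFB_not_injective:
  assumes d: "d \<ge> 1" and \<zeta>: "primitive_root_of_unity d \<zeta>" and b: "b \<in> {2..d}" and N: "N b < n"
  shows "\<exists>a\<in>carrier (kFB d n) - ctl_kernel d n. \<forall>x\<in>T_space d N n. PhiFB d n N \<zeta> a x = (\<lambda>l. 0)"
proof -
  interpret M: ctl_module fscale n "lS d n" "lT d n" "carrier (kFB d n)" "ctl_kernel d n" d \<zeta>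
    by (rule ctl_module_kFB[OF d \<zeta>])
  let ?c = "- inverse q"
  let ?e = "cidem d n \<zeta> (\<lambda>_. b) n"
  define a where "a = (\<Sum>m\<in>perms n. fscale (?c ^ cinv (\<lambda>_. 0) m) (tw (lS d n) 0 m ?e))"
  have ec: "?e \<in> carrier (kFB d n)" by (rule cidem_closed[OF d \<zeta> order.refl])
  have twc: "tw (lS d n) 0 m ?e \<in> carrier (kFB d n)" if "m \<in> perms n" for m
    using that by (intro M.tw_closed ec) (simp add: perms_length)
  have ac: "a \<in> carrier (kFB d n)"
    unfolding a_def by (intro fs.subspace_sum fs.subspace_scale carrier_subspace[OF d \<zeta>] twc)
  have ev: "PhiFB d n N' \<zeta> a x = q_antisym n (\<lambda>l. if map fst l = map (\<lambda>_. b) [0..<n] then x l else 0)"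
    if x: "x \<in> T_space d N' n" for N' x
  proof
    fix l
    have "PhiFB d n N' \<zeta> a x l = (\<Sum>m\<in>perms n. ?c ^ cinv (\<lambda>_. 0) m * PhiFB d n N' \<zeta> (tw (lS d n) 0 m ?e) x l)"
      unfolding a_def by (rule PhiFB_sum[OF d \<zeta> x twc])
    also have "\<dots> = (\<Sum>m\<in>perms n. ?c ^ cinv (\<lambda>_. 0) m * tw sg 0 m (PhiFB d n N' \<zeta> ?e x) l)"
      using x ec by (intro sum.cong refl) (simp add: PhiFB_tw[OF d \<zeta>] perms_length)
    also have "PhiFB d n N' \<zeta> ?e x = (\<lambda>l. if map fst l = map (\<lambda>_. b) [0..<n] then x l else 0)"
      using b by (intro PhiFB_cidem[where \<chi> = "\<lambda>_. b", OF d \<zeta> x]) auto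
    finally show "PhiFB d n N' \<zeta> a x l = q_antisym n (\<lambda>l. if map fst l = map (\<lambda>_. b) [0..<n] then x l else 0) l"
      by (simp only: q_antisym_def)
  qed
  have zero: "PhiFB d n N \<zeta> a x = (\<lambda>l. 0)" if x: "x \<in> T_space d N n" for x
  proof (rule T_space_eqI[of _ d N n])
    show "PhiFB d n N \<zeta> a x \<in> T_space d N n" by (rule PhiFB_T_space[OF d \<zeta> ac x])
    fix l assume l: "l \<in> T_basis d N n"
    have "fst e = b \<and> length l = n" if "map fst l = map (\<lambda>_. b) [0..<n]" "e \<in> set l" for l :: "idx list" and e
    proof -
      have "fst e \<in> set (map fst l)" using that(2) by simp
      then have "fst e = b" unfolding that(1) by auto
      then show ?thesis using arg_cong[OF that(1), of length] by simp
    qed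
    moreover have "length l = n" if "map fst l = map (\<lambda>_. b) [0..<n]" for l :: "idx list"
      using arg_cong[OF that, of length] by simp
    ultimately have "(\<lambda>l. if map fst l = map (\<lambda>_. b) [0..<n] then x l else 0) \<in> mono_tens b n"
      unfolding mono_tens_def by auto
    from q_antisym_vanishes[OF this N l] show "PhiFB d n N \<zeta> a x l = 0" unfolding ev[OF x] .
  qed (rule T_space_0)
  have "a \<notin> ctl_kernel d n"
  proof
    assume k: "a \<in> ctl_kernel d n"
    \<comment> \<open>Rank \<open>2\<close> for colour \<open>1\<close> makes the kernel act as zero
      on this space; rank \<open>n\<close> for the others gives independence. As \<open>b\<close> is
      not \<open>1\<close>, no permutation has a decreasing triple of colour
      \<open>1\<close>.\<close>
    let ?N = "\<lambda>b :: nat. if b = 1 then 2 else n"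
    \<comment> \<open>The coefficient of the identity permutation; independence would force it to be
      zero although it is a power of a nonzero element.\<close>
    have "?c ^ cinv (\<lambda>_. 0) [0..<n] = 0"
    proof (rule tw_sg_independent[where N = ?N and \<chi> = "\<lambda>_. b" and c = "\<lambda>m. ?c ^ cinv (\<lambda>_. 0) m" and G = "perms n" and d = d])
      show "b \<in> {1..d}" for p :: nat using b by auto
      show "\<not> has_triple (\<lambda>_. b) m" for m using b by (auto simp: has_triple_def)
      show "[0..<n] \<in> perms n" by (simp add: perms_def)
      fix y l assume y: "y \<in> T_basis d ?N n" "map fst y = map (\<lambda>_. b) [0..<n]"
      have yT: "delta y \<in> T_space d ?N n" using y(1) by (rule delta_T_space)
      have "(\<lambda>l. if map fst l = map (\<lambda>_. b) [0..<n] then delta y l else 0) = delta y"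
        using y(2) by (auto simp: delta_def)
      then have "q_antisym n (delta y) l = PhiFB d n ?N \<zeta> a (delta y) l" by (simp only: ev[OF yT])
      also have "\<dots> = 0" by (rule PhiFB_kernel[OF d \<zeta> _ k yT]) simp
      finally show "(\<Sum>m\<in>perms n. ?c ^ cinv (\<lambda>_. 0) m * tw sg 0 m (delta y) l) = 0"
        by (simp only: q_antisym_def)
    qed auto
    then show False using q_neq_0 by simp
  qed
  with ac have "a \<in> carrier (kFB d n) - ctl_kernel d n" by (rule DiffI)
  moreover have "\<forall>x\<in>T_space d N n. PhiFB d n N \<zeta> a x = (\<lambda>l. 0)" by (intro ballI zero)
  ultimately show ?thesis by (intro bexI[of _ a])
qed

section \<open>Surjectivity of \<open>Phi\<close> and the criterion for an isomorphism\<close>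

theorem theorem5p6:
  fixes d n :: nat and N :: "nat \<Rightarrow> nat" and \<zeta> :: kq
  assumes "d \<ge> 1" and "n \<ge> 1"
    and "primitive_root_of_unity d \<zeta>"
    and "N 1 = 2" and "\<forall>b\<in>{2..d}. N b > 1"
  shows "\<exists>\<Phi> \<in> alg_hom (CTL d n) (End_Uq d N n).
           (\<forall>i\<in>{1..n}. \<Phi> (CTL_t d n i) = tau d N n \<zeta> i) \<and>
           (\<forall>i\<in>{1..<n}. \<Phi> (CTL_s d n i) = sigma d N n i) \<and>
           \<Phi> ` carrier (CTL d n) = carrier (End_Uq d N n) \<and>
           (\<Phi> \<in> alg_iso (CTL d n) (End_Uq d N n) \<longleftrightarrow> (\<forall>b\<in>{2..d}. n \<le> N b))"
proof -
  note d = assms(1) and \<zeta> = assms(3) and N1 = assms(4)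
  note h = Phi_alg_hom[where N = N and n = n, OF d \<zeta> N1]
  let ?\<Phi> = "Phi d n N \<zeta>"
  interpret Q: kalg "CTL d n" by (rule kalg_CTL[OF d \<zeta>])
  have surj: "?\<Phi> ` carrier (CTL d n) = carrier (End_Uq d N n)"
  proof
    show "?\<Phi> ` carrier (CTL d n) \<subseteq> carrier (End_Uq d N n)" using alg_homD(3)[OF h] by blast
    show "carrier (End_Uq d N n) \<subseteq> ?\<Phi> ` carrier (CTL d n)"
    proof
      fix f assume "f \<in> carrier (End_Uq d N n)"
      then obtain a where a: "a \<in> carrier (kFB d n)" "PhiFB d n N \<zeta> a = f"
        using PhiFB_surjective[where N = N, OF d \<zeta> N1] by blast
      then have "f = ?\<Phi> (CTL_map d n a)" by (simp only: Phi_CTL_map[where N = N, OF d \<zeta> N1])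
      then show "f \<in> ?\<Phi> ` carrier (CTL d n)" unfolding CTL_carrier[OF d \<zeta>] using a(1) by blast
    qed
  qed
  have inj: "inj_on ?\<Phi> (carrier (CTL d n))" if N: "\<forall>b\<in>{2..d}. n \<le> N b"
  proof (rule inj_onI)
    fix X Y assume X: "X \<in> carrier (CTL d n)" and Y: "Y \<in> carrier (CTL d n)" and e: "?\<Phi> X = ?\<Phi> Y"
    obtain a b where ab: "a \<in> carrier (kFB d n)" "X = CTL_map d n a" "b \<in> carrier (kFB d n)" "Y = CTL_map d n b"
      using X Y unfolding CTL_carrier[OF d \<zeta>] by blast
    have "PhiFB d n N \<zeta> a = PhiFB d n N \<zeta> b"
      using e unfolding ab(2,4) Phi_CTL_map[where N = N, OF d \<zeta> N1 ab(1)] Phi_CTL_map[where N = N, OF d \<zeta> N1 ab(3)] .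
    then have "PhiFB d n N \<zeta> (a - b) x l = 0" if "x \<in> T_space d N n" for x l
      by (simp only: PhiFB_diff[OF d \<zeta> ab(1,3) that] diff_self)
    moreover have c: "a - b \<in> carrier (kFB d n)" by (intro fs.subspace_diff carrier_subspace[OF d \<zeta>] ab)
    ultimately have "a - b \<in> ctl_kernel d n"
      using N by (intro PhiFB_injective[where N = N, OF d \<zeta> N1]) auto
    then have "CTL_map d n (a - b) = \<zero>\<^bsub>CTL d n\<^esub>" by (simp only: ctl_kernel_def mem_Collect_eq)
    moreover have "CTL_map d n ((a - b) + b) = CTL_map d n (a - b) \<oplus>\<^bsub>CTL d n\<^esub> CTL_map d n b"
      by (rule CTL_map_add[OF d \<zeta> c ab(3)])
    ultimately have "CTL_map d n a = \<zero>\<^bsub>CTL d n\<^esub> \<oplus>\<^bsub>CTL d n\<^esub> CTL_map d n b" by (simp only: diff_add_cancel)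
    then show "X = Y" using Y ab by (simp only: Q.l_zero)
  qed
  have not_inj: "\<not> inj_on ?\<Phi> (carrier (CTL d n))" if b: "b \<in> {2..d}" "N b < n" for b
  proof
    assume i: "inj_on ?\<Phi> (carrier (CTL d n))"
    obtain a where a: "a \<in> carrier (kFB d n)" "a \<notin> ctl_kernel d n" "\<forall>x\<in>T_space d N n. PhiFB d n N \<zeta> a x = (\<lambda>l. 0)"
      using PhiFB_not_injective[where N = N and b = b, OF d \<zeta> b] by blast
    have 0: "0 \<in> ctl_kernel d n" by (rule fs.subspace_0[OF kernel_subspace[OF d \<zeta>]])
    then have 0: "0 \<in> carrier (kFB d n)" "CTL_map d n 0 = \<zero>\<^bsub>CTL d n\<^esub>" by (simp_all only: ctl_kernel_def mem_Collect_eq)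
    have "PhiFB d n N \<zeta> a = PhiFB d n N \<zeta> 0"
    proof (rule extensionalityI[of _ "T_space d N n"])
      show "PhiFB d n N \<zeta> a \<in> extensional (T_space d N n)" "PhiFB d n N \<zeta> 0 \<in> extensional (T_space d N n)"
        using alg_homD(3)[OF PhiFB_alg_hom[OF d \<zeta>, of n N] a(1)] alg_homD(3)[OF PhiFB_alg_hom[OF d \<zeta>, of n N] 0(1)]
        by (simp_all add: PiE_def)
      fix x assume x: "x \<in> T_space d N n"
      show "PhiFB d n N \<zeta> a x = PhiFB d n N \<zeta> 0 x"
        by (rule ext) (simp only: a(3)[rule_format, OF x] PhiFB_0[OF d \<zeta> x])
    qed
    then have "?\<Phi> (CTL_map d n a) = ?\<Phi> (CTL_map d n 0)"
      by (simp only: Phi_CTL_map[where N = N, OF d \<zeta> N1] a(1) 0(1))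
    then have "CTL_map d n a = CTL_map d n 0"
      using i a(1) 0(1) unfolding CTL_carrier[OF d \<zeta>] by (meson imageI inj_onD)
    then show False using a(1,2) 0(2) by (simp only: ctl_kernel_def mem_Collect_eq simp_thms)
  qed
  show ?thesis
  proof (intro bexI[OF _ h] conjI ballI)
    show "?\<Phi> (CTL_t d n i) = tau d N n \<zeta> i" if "i \<in> {1..n}" for i using that by (rule Phi_t[where N = N, OF d \<zeta> N1])
    show "?\<Phi> (CTL_s d n i) = sigma d N n i" if "i \<in> {1..<n}" for i using that by (rule Phi_s[where N = N, OF d \<zeta> N1])
    show "?\<Phi> \<in> alg_iso (CTL d n) (End_Uq d N n) \<longleftrightarrow> (\<forall>b\<in>{2..d}. n \<le> N b)"
    proof -
      have "inj_on ?\<Phi> (carrier (CTL d n)) \<longleftrightarrow> (\<forall>b\<in>{2..d}. n \<le> N b)"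
        using inj not_inj not_le by blast
      then show ?thesis using h surj by (simp add: alg_iso_def bij_betw_def)
    qed
  qed (rule surj)
qed

end
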